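(* Let $\Omega\subset\mathbb{R}^N$ ($N\ge 2$) be a bounded domain whose boundary consists entirely of regular points for the Dirichlet Laplacian, and let $u$ be the solution of $$\partial_t u=\Delta u \ \text{in } \Omega\times(0,\infty),\qquad u=1 \ \text{on } \Omega\times\{0\},\qquad u=0 \ \text{on } \partial\Omega\times(0,\infty).$$ Suppose there exist a nonempty Lipschitz subdomain $\omega$ with $\overline{\omega}\subset\Omega$, sequences $(t_n)_n,(\tau_n)_n\subset(0,\infty)$ and $(a_n)_n,(b_n)_n\subset\mathbb{R}$ such that for all $n\in\mathbb{N}$ $$u(\tau_n)\equiv a_n \ \text{on } \partial\omega \ (\text{in the sense of traces}),\qquad \partial_\nu u(t_n)\equiv b_n \ \text{on } \partial\omega \ (\text{in the sense of weak conormal derivatives}),$$ and suppose that $(t_n)_n$ and $(\tau_n)_n$ have accumulation points $t^\star,\tau^\star\in(0,\infty]$ respectively (an accumulation point $\infty$ meaning the sequence is unbounded). Then $\omega$ and $\Omega$ are concentric balls.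
   Context: $u(t)$ denotes $x\mapsto u(x,t)$. Let $0<\lambda_1\le\lambda_2\le\dots\to\infty$ be the Dirichlet eigenvalues of $-\Delta$ on $\Omega$ (weak formulation in $H_0^1(\Omega)$, counted with multiplicity) with $L^2(\Omega)$-orthonormal eigenfunctions $\phi_k$; the solution is $u(t)=\sum_k(\int_\Omega\phi_k)e^{-\lambda_k t}\phi_k$, and for $t>0$, $u(t)\in H_0^1(\Omega)$ with $\Delta u(t)\in L^2(\Omega)$. The condition on $\partial\omega$ is imposed on the restriction $u(t_n)|_{\omega}$, with $\nu$ the exterior normal of $\omega$. Weak conormal derivative on a bounded Lipschitz domain $D$: for $\varphi\in H^1(D)$ with $\Delta\varphi\in L^2(D)$, $\partial_\nu\varphi\in H^{-1/2}(\partial D)$ is defined by $\langle\partial_\nu\varphi,\psi\rangle:=\int_D\Delta\varphi\,\tilde\psi+\int_D\nabla\varphi\cdot\nabla\tilde\psi$ for $\psi\in H^{1/2}(\partial D)$, with $\tilde\psi\in H^1(D)$ the harmonic extension of $\psi$; $\partial_\nu\varphi\equiv b$ means $\langle\partial_\nu\varphi,\psi\rangle=b\int_{\partial D}\psi$ for all $\psi$. A boundary point is regular for the Dirichlet Laplacian in the sense of Perron's method (Wiener regularity), so that Dirichlet solutions with continuous data are continuous up to it. *)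

theory Defs
  imports "HOL-Analysis.Analysis"
begin

fun iter_pd :: "('a::euclidean_space \<Rightarrow> real) \<Rightarrow> 'a list \<Rightarrow> 'a \<Rightarrow> real" where
  "iter_pd f [] = f"
| "iter_pd f (v # vs) = (\<lambda>x. frechet_derivative (iter_pd f vs) (at x) v)"

definition smooth_fun :: "('a::euclidean_space \<Rightarrow> real) \<Rightarrow> bool" where
  "smooth_fun f \<longleftrightarrow> (\<forall>vs x. iter_pd f vs differentiable (at x))"

definition tsupp :: "('a::euclidean_space \<Rightarrow> real) \<Rightarrow> 'a set" where
  "tsupp f = closure {x. f x \<noteq> 0}"

definition test_fun :: "'a::euclidean_space set \<Rightarrow> ('a \<Rightarrow> real) \<Rightarrow> bool" where
  "test_fun D f \<longleftrightarrow> smooth_fun f \<and> compact (tsupp f) \<and> tsupp f \<subseteq> D"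

definition grad_of :: "('a::euclidean_space \<Rightarrow> real) \<Rightarrow> 'a \<Rightarrow> 'a" where
  "grad_of f x = (\<Sum>i\<in>Basis. frechet_derivative f (at x) i *\<^sub>R i)"

definition lap_of :: "('a::euclidean_space \<Rightarrow> real) \<Rightarrow> 'a \<Rightarrow> real" where
  "lap_of f x = (\<Sum>i\<in>Basis. frechet_derivative (\<lambda>y. frechet_derivative f (at y) i) (at x) i)"

definition L2_on :: "'a::euclidean_space set \<Rightarrow> ('a \<Rightarrow> real) \<Rightarrow> bool" where
  "L2_on D f \<longleftrightarrow> f \<in> borel_measurable (lebesgue_on D) \<and>
     integrable (lebesgue_on D) (\<lambda>x. (f x)\<^sup>2)"

definition L2v_on :: "'a::euclidean_space set \<Rightarrow> ('a \<Rightarrow> 'a) \<Rightarrow> bool" where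
  "L2v_on D G \<longleftrightarrow> G \<in> borel_measurable (lebesgue_on D) \<and>
     integrable (lebesgue_on D) (\<lambda>x. (norm (G x))\<^sup>2)"

definition weak_grad :: "'a::euclidean_space set \<Rightarrow> ('a \<Rightarrow> real) \<Rightarrow> ('a \<Rightarrow> 'a) \<Rightarrow> bool" where
  "weak_grad D f G \<longleftrightarrow> (\<forall>\<phi>. test_fun D \<phi> \<longrightarrow> (\<forall>i\<in>Basis.
      (\<integral>x. f x * frechet_derivative \<phi> (at x) i \<partial>lebesgue_on D)
      = - (\<integral>x. (G x \<bullet> i) * \<phi> x \<partial>lebesgue_on D)))"

definition weak_lap :: "'a::euclidean_space set \<Rightarrow> ('a \<Rightarrow> real) \<Rightarrow> ('a \<Rightarrow> real) \<Rightarrow> bool" where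
  "weak_lap D f L \<longleftrightarrow> (\<forall>\<phi>. test_fun D \<phi> \<longrightarrow>
      (\<integral>x. f x * lap_of \<phi> x \<partial>lebesgue_on D) = (\<integral>x. L x * \<phi> x \<partial>lebesgue_on D))"

definition H1 :: "'a::euclidean_space set \<Rightarrow> ('a \<Rightarrow> real) \<Rightarrow> ('a \<Rightarrow> 'a) \<Rightarrow> bool" where
  "H1 D f G \<longleftrightarrow> L2_on D f \<and> L2v_on D G \<and> weak_grad D f G"

definition H01 :: "'a::euclidean_space set \<Rightarrow> ('a \<Rightarrow> real) \<Rightarrow> ('a \<Rightarrow> 'a) \<Rightarrow> bool" where
  "H01 D f G \<longleftrightarrow> H1 D f G \<and> (\<exists>\<psi>::nat \<Rightarrow> 'a \<Rightarrow> real. (\<forall>m. test_fun D (\<psi> m)) \<and>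
      (\<lambda>m. \<integral>x. (\<psi> m x - f x)\<^sup>2 + (norm (grad_of (\<psi> m) x - G x))\<^sup>2 \<partial>lebesgue_on D)
        \<longlonglongrightarrow> 0)"

definition dirichlet_eigenpair :: "'a::euclidean_space set \<Rightarrow> real \<Rightarrow> ('a \<Rightarrow> real) \<Rightarrow> bool" where
  "dirichlet_eigenpair D \<mu> \<phi> \<longleftrightarrow> (\<exists>G. H01 D \<phi> G \<and>
     (\<forall>v Gv. H01 D v Gv \<longrightarrow>
        (\<integral>x. G x \<bullet> Gv x \<partial>lebesgue_on D) = \<mu> * (\<integral>x. \<phi> x * v x \<partial>lebesgue_on D)))"

text \<open>lam: all Dirichlet eigenvalues in nondecreasing order, counted with multiplicity;
  phi: a corresponding complete L^2-orthonormal system of eigenfunctions\<close>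
definition dirichlet_eigenbasis ::
  "'a::euclidean_space set \<Rightarrow> (nat \<Rightarrow> real) \<Rightarrow> (nat \<Rightarrow> 'a \<Rightarrow> real) \<Rightarrow> bool" where
  "dirichlet_eigenbasis D lam phi \<longleftrightarrow> mono lam \<and>
     (\<forall>k. dirichlet_eigenpair D (lam k) (phi k)) \<and>
     (\<forall>j k. (\<integral>x. phi j x * phi k x \<partial>lebesgue_on D) = (if j = k then 1 else 0)) \<and>
     (\<forall>f. L2_on D f \<and> (\<forall>k. (\<integral>x. f x * phi k x \<partial>lebesgue_on D) = 0)
          \<longrightarrow> (AE x in lebesgue_on D. f x = 0))"

definition heat_solution ::
  "'a::euclidean_space set \<Rightarrow> (nat \<Rightarrow> real) \<Rightarrow> (nat \<Rightarrow> 'a \<Rightarrow> real) \<Rightarrow> (real \<Rightarrow> 'a \<Rightarrow> real) \<Rightarrow> bool" where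
  "heat_solution D lam phi U \<longleftrightarrow> (\<forall>t>0. L2_on D (U t) \<and>
     (\<lambda>n. \<integral>x. (U t x - (\<Sum>k<n. (\<integral>y. phi k y \<partial>lebesgue_on D) * exp (- lam k * t) * phi k x))\<^sup>2
            \<partial>lebesgue_on D) \<longlonglongrightarrow> 0)"

definition hausdorff_pre :: "real \<Rightarrow> real \<Rightarrow> 'a::euclidean_space set \<Rightarrow> ennreal" where
  "hausdorff_pre s \<delta> A = (INF C \<in> {C :: nat \<Rightarrow> 'a set. A \<subseteq> (\<Union>i. C i) \<and>
       (\<forall>i. bounded (C i) \<and> diameter (C i) \<le> \<delta>)}.
     (\<Sum>i. ennreal (pi powr (s / 2) / Gamma (s / 2 + 1) * (diameter (C i) / 2) powr s)))"

definition hausdorff_outer :: "real \<Rightarrow> 'a::euclidean_space set \<Rightarrow> ennreal" where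
  "hausdorff_outer s A = (SUP \<delta> \<in> {0<..}. hausdorff_pre s \<delta> A)"

definition surface_measure :: "'a::euclidean_space measure" where
  "surface_measure = measure_of UNIV (sets borel) (hausdorff_outer (real DIM('a) - 1))"

definition bdry_integral :: "'a::euclidean_space set \<Rightarrow> ('a \<Rightarrow> real) \<Rightarrow> real" where
  "bdry_integral D g = (\<integral>x. indicator (frontier D) x * g x \<partial>surface_measure)"

definition bounded_domain :: "'a::euclidean_space set \<Rightarrow> bool" where
  "bounded_domain D \<longleftrightarrow> open D \<and> connected D \<and> bounded D \<and> D \<noteq> {}"

text \<open>Bounded Lipschitz domain: near each boundary point, in suitable coordinates
  (unit direction e), D is the region below the graph of a Lipschitz function g.\<close>
definition lipschitz_domain :: "'a::euclidean_space set \<Rightarrow> bool" where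
  "lipschitz_domain D \<longleftrightarrow> bounded_domain D \<and>
    (\<forall>p\<in>frontier D. \<exists>e r h L (g :: 'a \<Rightarrow> real). norm e = 1 \<and> r > 0 \<and> h > 0 \<and>
       (\<forall>y z. y \<bullet> e = 0 \<and> z \<bullet> e = 0 \<longrightarrow> \<bar>g y - g z\<bar> \<le> L * norm (y - z)) \<and>
       g 0 = 0 \<and>
       (\<forall>y. y \<bullet> e = 0 \<and> norm y < r \<longrightarrow> \<bar>g y\<bar> < h) \<and>
       (\<forall>y s. y \<bullet> e = 0 \<and> norm y < r \<and> \<bar>s\<bar> < h \<longrightarrow>
          (p + y + s *\<^sub>R e \<in> D \<longleftrightarrow> s < g y)))"

definition superharmonic_on :: "'a::euclidean_space set \<Rightarrow> ('a \<Rightarrow> real) \<Rightarrow> bool" where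
  "superharmonic_on D v \<longleftrightarrow>
     (\<forall>x\<in>D. \<forall>e>0. \<exists>d>0. \<forall>y\<in>D \<inter> ball x d. v x - e < v y) \<and>
     (\<forall>x r. r > 0 \<and> cball x r \<subseteq> D \<longrightarrow>
        integrable (lebesgue_on (cball x r)) v \<and>
        (\<integral>y. v y \<partial>lebesgue_on (cball x r)) \<le> measure lebesgue (cball x r) * v x)"

definition perron_upper_class :: "'a::euclidean_space set \<Rightarrow> ('a \<Rightarrow> real) \<Rightarrow> ('a \<Rightarrow> real) set" where
  "perron_upper_class D f = {v. superharmonic_on D v \<and> bdd_below (v ` D) \<and>
      (\<forall>y\<in>frontier D. \<forall>e>0. \<exists>d>0. \<forall>x\<in>D \<inter> ball y d. f y - e \<le> v x)}"

definition perron_solution :: "'a::euclidean_space set \<Rightarrow> ('a \<Rightarrow> real) \<Rightarrow> 'a \<Rightarrow> real" where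
  "perron_solution D f x = Inf {v x | v. v \<in> perron_upper_class D f}"

definition regular_boundary_point :: "'a::euclidean_space set \<Rightarrow> 'a \<Rightarrow> bool" where
  "regular_boundary_point D x0 \<longleftrightarrow> x0 \<in> frontier D \<and>
     (\<forall>f. continuous_on (frontier D) f \<longrightarrow>
        (perron_solution D f \<longlongrightarrow> f x0) (at x0 within D))"

definition trace_const :: "'a::euclidean_space set \<Rightarrow> ('a \<Rightarrow> real) \<Rightarrow> real \<Rightarrow> bool" where
  "trace_const D f a \<longleftrightarrow> (\<exists>G. H1 D f G \<and> (\<exists>\<psi>::nat \<Rightarrow> 'a \<Rightarrow> real. (\<forall>m. test_fun UNIV (\<psi> m)) \<and>
      (\<lambda>m. \<integral>x. (\<psi> m x - f x)\<^sup>2 + (norm (grad_of (\<psi> m) x - G x))\<^sup>2 \<partial>lebesgue_on D)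
        \<longlonglongrightarrow> 0 \<and>
      (\<lambda>m. bdry_integral D (\<lambda>x. (\<psi> m x - a)\<^sup>2)) \<longlonglongrightarrow> 0))"

text \<open>weak conormal derivative of f (f in H^1(D), Laplacian in L^2(D)) is the constant b;
  tested against (traces of) C_c^infinity(R^N) functions, which are dense in H^{1/2}\<close>
definition conormal_const :: "'a::euclidean_space set \<Rightarrow> ('a \<Rightarrow> real) \<Rightarrow> real \<Rightarrow> bool" where
  "conormal_const D f b \<longleftrightarrow> (\<exists>G L. H1 D f G \<and> L2_on D L \<and> weak_lap D f L \<and>
      (\<forall>\<psi>. test_fun UNIV \<psi> \<longrightarrow>
         (\<integral>x. L x * \<psi> x + G x \<bullet> grad_of \<psi> x \<partial>lebesgue_on D) = b * bdry_integral D \<psi>))"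

end

(* Expanding in eigenfunctions turns each overdetermined condition, tested against a fixed
function, into the vanishing of a Dirichlet series at infinitely many times.  These times
accumulate or are unbounded, so the series vanishes identically, and integrating over all times
transfers the condition to the torsion function v, the solution of - Laplace v = 1 in H^1_0(Omega).
The conormal condition is used first: it makes the surface measure of the boundary of omega finite
and nonzero and the weak normal derivative of v constant there; with this, the trace condition
makes v constant on that boundary.  Thus v solves Serrin's overdetermined problem on omega, but
its Neumann datum is known only weakly.  Blowing up at two boundary points and comparing the
Hausdorff measures of the rescaled boundary pieces by a reflection shows that |grad v| is constant
on the boundary.  The P-function together with Pohozaev's identity then gives Hess v = - Id / N,
so omega is a ball and v is a quadratic polynomial q on it.  By unique continuation v = q on
Omega.  If q did not vanish at a regular boundary point p of Omega, then q minus an H^1_0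
approximation, divided by q, would be close to 1 near p and of small energy; a Caccioppoli
estimate then forces the Perron solution with data min(1, |y - p| / r) to be 1, against
regularity.  Hence the boundary of Omega lies on a sphere about the centre of omega. *)

theory Submission
  imports Defs "HOL-Complex_Analysis.Complex_Analysis" "HOL-Real_Asymp.Real_Asymp"
begin

text \<open>Two defaults shape the argument. \<open>measure_of\<close> yields the zero measure when
  its set function is not countably additive, and a Bochner integral is 0 when its integrand is not
  integrable. The conormal identity for a cutoff equal to 1 on \<open>closure \<omega>\<close> has
  minus the volume of \<open>\<omega>\<close> on its left side, so the boundary integral on its
  right cannot be 0; this rules out both defaults. Only then does the trace condition say something,
  hence the order. The unknown constants \<open>a n\<close> and \<open>b n\<close> drop out by
  testing with functions of zero boundary mean. On the merely Lipschitz boundary, normal derivatives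
  are read off from Taylor's formula for \<open>W\<close>, surface area enters through coverings and
  expanding maps, and cutoffs that are functions of \<open>W\<close> do the work of the divergence
  theorem. Perron regularity and membership in H^1_0 have no common definition. They can be compared
  because the torsion function has become a polynomial q: near a boundary point where q is nonzero,
  division by q is smooth.\<close>

(* Unqualified, these names denote the Henstock-Kurzweil versions. *)
lemmas integral_mono = Bochner_Integration.integral_mono
  and integral_cong = Bochner_Integration.integral_cong
  and integral_add = Bochner_Integration.integral_add
  and integral_diff = Bochner_Integration.integral_diff
  and integral_sum = Bochner_Integration.integral_sum
  and integrable_add = Bochner_Integration.integrable_add
  and integrable_diff = Bochner_Integration.integrable_diff
  and integrable_sum = Bochner_Integration.integrable_sum
  and integrable_bound = Bochner_Integration.integrable_bound
  and integral_nonneg = Bochner_Integration.integral_nonneg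
  and integral_mult_right_zero = Bochner_Integration.integral_mult_right_zero

section \<open>Partial derivatives and smooth functions\<close>

text \<open>The direction is the first argument so that \<open>pd v\<close> is an operator on
  functions that can be iterated, as in \<open>pd v ^^ k\<close>.\<close>

definition pd :: "'a::euclidean_space => ('a => real) => 'a => real" where
 "pd v f x = frechet_derivative f (at x) v"

lemma pd_has_derivative:
 assumes "f differentiable (at x)"
 shows "(f has_derivative (%v. pd v f x)) (at x)" using assms unfolding pd_def frechet_derivative_works by simp

lemma pd_eqI: "(f has_derivative D) (at x) ==> pd v f x = D v"
 unfolding pd_def using frechet_derivative_at by fastforce

lemma grad_of_pd: "grad_of f x = (\<Sum>i\<in>Basis. pd i f x *\<^sub>R i)" unfolding grad_of_def pd_def ..

lemma lap_of_pd: "lap_of f x = (\<Sum>i\<in>Basis. pd i (pd i f) x)" unfolding lap_of_def pd_def ..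

text \<open>The choice made by \<open>frechet_derivative\<close> depends only on the set of
  derivatives at the point, which is determined by the germ; equality therefore holds even where no
  derivative exists.\<close>

lemma pd_cong:
 assumes "open S" "x \<in> S" "!!y. y \<in> S ==> f y = g y"
 shows "pd v f x = pd v g x"
proof -
 have *: "(f has_derivative D) (at x) = (g has_derivative D) (at x)" for D
  using has_derivative_transform_within_open[of f D x UNIV S g]
   has_derivative_transform_within_open[of g D x UNIV S f] assms by auto
 show ?thesis unfolding pd_def frechet_derivative_def * ..
qed

text \<open>Differentiability refers to the full filter \<open>at x\<close>, so \<open>S\<close>
  only lists the points at which it is claimed. The property therefore passes to unions
  (\<open>Cn_Un\<close>, \<open>Cn_pointwise\<close>), which is how functions smooth on two
  overlapping open sets are glued.\<close>

primrec Cn :: "nat => 'a set => ('a::euclidean_space => real) => bool" where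
 "Cn 0 S f \<longleftrightarrow> True"
| "Cn (Suc n) S f \<longleftrightarrow> (\<forall>x\<in>S. f differentiable (at x)) \<and> (\<forall>v. Cn n S (pd v f))"

definition smooth_on :: "'a set => ('a::euclidean_space => real) => bool" where
 "smooth_on S f \<longleftrightarrow> (\<forall>n. Cn n S f)"

lemma Cn_cong:
 assumes "open S" "!!y. y \<in> S ==> f y = g y" "Cn n S f"
 shows "Cn n S g" using assms(2,3)
proof (induction n arbitrary: f g)
 case (Suc n)
 have "g differentiable (at x)" if "x \<in> S" for x
 proof -
  have "f differentiable (at x)" using Suc.prems(2) that by simp
  then obtain D where "(f has_derivative D) (at x)" unfolding differentiable_def by blast
  then have "(g has_derivative D) (at x)"
   using has_derivative_transform_within_open[of f D x UNIV S g] Suc.prems(1) that assms(1) by auto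
  then show ?thesis unfolding differentiable_def by blast
 qed
 moreover have "Cn n S (pd v g)" for v
 proof (rule Suc.IH)
  show "pd v f y = pd v g y" if "y \<in> S" for y by (rule pd_cong[OF assms(1) that]) (rule Suc.prems(1))
  show "Cn n S (pd v f)" using Suc.prems(2) by simp
 qed
 ultimately show ?case by simp
qed simp

lemma Cn_Suc_D: "Cn (Suc n) S f ==> Cn n S f" by (induction n arbitrary: f) auto

lemma Cn_mono: "Cn n S f ==> T \<subseteq> S ==> Cn n T f" by (induction n arbitrary: f) auto

lemma smooth_on_cong:
 "open S ==> (!!y. y \<in> S ==> f y = g y) ==> smooth_on S f ==> smooth_on S g"
 unfolding smooth_on_def using Cn_cong by blast

lemma smooth_on_mono: "smooth_on S f ==> T \<subseteq> S ==> smooth_on T f"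
 unfolding smooth_on_def using Cn_mono by blast

lemma Cn_Un: "Cn n S f ==> Cn n T f ==> Cn n (S \<union> T) f" by (induction n arbitrary: f) auto

lemma smooth_on_Un: "smooth_on S f ==> smooth_on T f ==> smooth_on (S \<union> T) f"
 unfolding smooth_on_def using Cn_Un by blast

lemma smooth_on_differentiable: "smooth_on S f ==> x \<in> S ==> f differentiable (at x)"
 unfolding smooth_on_def by (metis Cn.simps(2))

lemma smooth_on_pd: "smooth_on S f ==> smooth_on S (pd v f)" unfolding smooth_on_def by (metis Cn.simps(2))

lemma smooth_on_derivative:
 "smooth_on S f ==> x \<in> S ==> (f has_derivative (%v. pd v f x)) (at x)"
 by (simp add: pd_has_derivative smooth_on_differentiable)

lemma smooth_on_continuous: "smooth_on S f ==> continuous_on S f"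
 by (meson continuous_at_imp_continuous_on differentiable_imp_continuous_within smooth_on_differentiable)

lemma smooth_fun_iff: "smooth_fun f \<longleftrightarrow> smooth_on UNIV f"
proof
 have pdi: "iter_pd f (v # vs) = pd v (iter_pd f vs)" for f v and vs :: "'a list" by (auto simp: pd_def)
 assume "smooth_fun f"
 then have *: "iter_pd f vs differentiable (at x)" for vs x unfolding smooth_fun_def by blast
 have "Cn n UNIV (iter_pd f vs)" for n vs
 proof (induction n arbitrary: vs)
  case (Suc n)
  then show ?case using * Suc.IH[of "_ # vs"] by (simp add: pdi del: iter_pd.simps(2))
 qed simp
 from this[of _ "[]"] show "smooth_on UNIV f" unfolding smooth_on_def by simp
next
 have pdi: "iter_pd f (v # vs) = pd v (iter_pd f vs)" for f v and vs :: "'a list" by (auto simp: pd_def)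
 assume *: "smooth_on UNIV f"
 have "smooth_on UNIV (iter_pd f vs)" for vs
 proof (induction vs)
  case (Cons v vs)
  then show ?case using smooth_on_pd by (simp add: pdi del: iter_pd.simps(2))
 qed (use * in simp)
 then show "smooth_fun f" unfolding smooth_fun_def using smooth_on_differentiable by blast
qed

lemma pd_const [simp]: "pd v (%x. c) = (%x. 0)" by (rule ext, rule pd_eqI) simp

lemma pd_inner [simp]: "pd v (%x. x \<bullet> e) = (%x. v \<bullet> e)"
 by (rule ext, rule pd_eqI) (auto intro!: derivative_eq_intros)

lemma pd_add:
 "f differentiable (at x) ==> g differentiable (at x) ==> pd v (%x. f x + g x) x = pd v f x + pd v g x"
 by (rule pd_eqI) (auto intro!: derivative_eq_intros pd_has_derivative)

lemma pd_diff:
 "f differentiable (at x) ==> g differentiable (at x) ==> pd v (%x. f x - g x) x = pd v f x - pd v g x"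
 by (rule pd_eqI) (auto intro!: derivative_eq_intros pd_has_derivative)

lemma pd_mult:
 "f differentiable (at x) ==> g differentiable (at x) ==>
  pd v (%x. f x * g x) x = f x * pd v g x + pd v f x * g x"
 by (rule pd_eqI) (auto intro!: derivative_eq_intros pd_has_derivative simp: algebra_simps)

lemma pd_cmult:
 "f differentiable (at x) ==> pd v (%x. c * f x) x = c * pd v f x"
 by (rule pd_eqI) (auto intro!: derivative_eq_intros pd_has_derivative simp: algebra_simps)

lemma pd_sum:
 "(!!i. i \<in> I ==> f i differentiable (at x)) ==> pd v (%x. \<Sum>i\<in>I. f i x) x = (\<Sum>i\<in>I. pd v (f i) x)"
 by (rule pd_eqI) (auto intro!: derivative_eq_intros pd_has_derivative)

lemma pd_comp:
 assumes "f differentiable (at x)" "(g has_real_derivative d) (at (f x))"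
 shows "pd v (%x. g (f x)) x = d * pd v f x"
proof (rule pd_eqI)
 have "((g \<circ> f) has_derivative ((%y. y * d) \<circ> (%v. pd v f x))) (at x)"
  by (rule diff_chain_at) (use assms pd_has_derivative in \<open>auto simp: has_field_derivative_def mult_commute_abs\<close>)
 then show "((%x. g (f x)) has_derivative (%v. d * pd v f x)) (at x)" by (simp add: o_def mult.commute)
qed

lemma pd_affine:
 assumes "f differentiable (at (p + r *\<^sub>R x))"
 shows "pd v (%x. f (p + r *\<^sub>R x)) x = r * pd v f (p + r *\<^sub>R x)"
proof (rule pd_eqI)
 have "((f \<circ> (%x. p + r *\<^sub>R x)) has_derivative ((%v. pd v f (p + r *\<^sub>R x)) \<circ> (%v. r *\<^sub>R v))) (at x)"
  by (rule diff_chain_at) (use assms in \<open>auto intro!: derivative_eq_intros pd_has_derivative\<close>)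
 moreover have "pd (r *\<^sub>R v) f y = r * pd v f y" if "f differentiable (at y)" for v y
  using linear_cmul[OF has_derivative_linear[OF pd_has_derivative[OF that]]] by simp
 ultimately show "((%x. f (p + r *\<^sub>R x)) has_derivative (%v. r * pd v f (p + r *\<^sub>R x))) (at x)"
  using assms by (simp add: o_def)
qed

lemma pd_linear: "f differentiable (at x) ==> linear (%v. pd v f x)"
 using has_derivative_linear[OF pd_has_derivative] .

lemma pd_scaleR: "f differentiable (at x) ==> pd (c *\<^sub>R v) f x = c * pd v f x"
 using linear_cmul[OF pd_linear] by simp

lemma pd_grad: "f differentiable (at x) ==> pd v f x = grad_of f x \<bullet> v"
proof -
 assume d: "f differentiable (at x)"
 have "pd v f x = pd (\<Sum>i\<in>Basis. (v \<bullet> i) *\<^sub>R i) f x" by (simp add: euclidean_representation)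
 also have "... = (\<Sum>i\<in>Basis. (v \<bullet> i) * pd i f x)"
  using linear_sum[OF pd_linear[OF d], of "%i. (v \<bullet> i) *\<^sub>R i" Basis] by (simp add: pd_scaleR[OF d])
 finally show ?thesis unfolding grad_of_pd by (simp add: inner_sum_left inner_sum_right mult.commute inner_commute)
qed

lemma grad_of_Basis: "i \<in> Basis ==> grad_of f x \<bullet> i = pd i f x"
 unfolding grad_of_pd by (simp add: inner_sum_left inner_Basis if_distrib sum.delta cong: if_cong)

lemma Cn_const [simp]: "Cn n S (%x. c)" by (induction n arbitrary: c) auto

lemma smooth_on_const [simp]: "smooth_on S (%x. c)" by (simp add: smooth_on_def)

lemma smooth_on_inner [simp]: "smooth_on S (%x. x \<bullet> e)" unfolding smooth_on_def
proof
 fix n show "Cn n S (%x. x \<bullet> e)" by (cases n) (auto intro!: differentiableI derivative_eq_intros)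
qed

lemma Cn_add: "open S ==> Cn n S f ==> Cn n S g ==> Cn n S (%x. f x + g x)"
proof (induction n arbitrary: f g)
 case (Suc n)
 have "Cn n S (pd v (%x. f x + g x))" for v
  by (rule Cn_cong[where f = "%x. pd v f x + pd v g x"]) (use Suc in \<open>auto simp: pd_add\<close>)
 then show ?case using Suc.prems by auto
qed simp

lemma Cn_mult: "open S ==> Cn n S f ==> Cn n S g ==> Cn n S (%x. f x * g x)"
proof (induction n arbitrary: f g)
 case (Suc n)
 have *: "Cn n S f" "Cn n S g" using Suc.prems Cn_Suc_D by blast+
 have "Cn n S (pd v (%x. f x * g x))" for v
 proof (rule Cn_cong[where f = "%x. f x * pd v g x + pd v f x * g x" and g = "pd v (%x. f x * g x)"])
  show "Cn n S (%x. f x * pd v g x + pd v f x * g x)" using Suc.prems * by (intro Cn_add Suc.IH) auto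
 qed (use Suc.prems in \<open>auto simp: pd_mult\<close>)
 then show ?case using Suc.prems by auto
qed simp

lemma Cn_inverse: "open S ==> Cn n S f ==> (!!x. x \<in> S ==> f x ~= 0) ==> Cn n S (%x. inverse (f x))"
proof (induction n arbitrary: f)
 case (Suc n)
 have "Cn n S f" using Suc.prems Cn_Suc_D by blast
 then have i: "Cn n S (%x. inverse (f x))" using Suc by blast
 have "Cn n S (pd v (%x. inverse (f x)))" for v
 proof (rule Cn_cong[where f = "%x. (-1) * (pd v f x * (inverse (f x) * inverse (f x)))"])
  show "Cn n S (%x. (-1) * (pd v f x * (inverse (f x) * inverse (f x))))"
   using Suc.prems i by (intro Cn_mult Cn_const) auto
 next
  fix y assume y: "y \<in> S"
  have "((%y. inverse y) has_real_derivative - (inverse (f y) * 1 * inverse (f y))) (at (f y))"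
   using Suc.prems(3)[OF y] by (auto intro!: derivative_eq_intros simp: power2_eq_square)
  from pd_comp[where f = f and x = y and g = inverse, OF _ this, of v] show "- 1 * (pd v f y * (inverse (f y) * inverse (f y))) = pd v (%x. inverse (f x)) y"
   using Suc.prems y by simp
 qed (use Suc.prems in simp)
 then show ?case using Suc.prems by (auto intro!: derivative_intros)
qed simp

text \<open>Differentiating \<open>gd k (f x)\<close> brings in \<open>gd (Suc k)\<close>, so the
  outer function is supplied together with all its derivatives and the induction generalises
  \<open>k\<close>.\<close>

lemma Cn_comp:
 assumes "open S" "Cn n S f" "!!x. x \<in> S ==> f x \<in> I"
  and "!!k y. y \<in> I ==> (gd k has_real_derivative gd (Suc k) y) (at y)"
 shows "Cn n S (%x. gd k (f x))" using assms(2)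
proof (induction n arbitrary: k)
 case (Suc n)
 have n: "Cn n S f" using Suc.prems Cn_Suc_D by blast
 have "Cn n S (pd v (%x. gd k (f x)))" for v
 proof (rule Cn_cong[where f = "%x. gd (Suc k) (f x) * pd v f x"])
  fix y assume y: "y \<in> S"
  show "gd (Suc k) (f y) * pd v f y = pd v (%x. gd k (f x)) y"
   by (rule pd_comp[symmetric]) (use Suc.prems y assms in auto)
 qed (use Suc n assms in \<open>auto intro!: Cn_mult\<close>)
 moreover have "(%x. gd k (f x)) differentiable (at x)" if "x \<in> S" for x
 proof -
  have "gd k differentiable (at (f x))"
   using assms(4)[OF assms(3)[OF that]] by (meson differentiableI has_field_derivative_imp_has_derivative)
  then show ?thesis using differentiable_chain_at[of f x "gd k"] Suc.prems that by (simp add: o_def)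
 qed
 ultimately show ?case by simp
qed simp

lemma smooth_on_comp:
 assumes "open S" "smooth_on S f" "!!x. x \<in> S ==> f x \<in> I"
  and "!!k y. y \<in> I ==> (gd k has_real_derivative gd (Suc k) y) (at y)"
 shows "smooth_on S (%x. gd k (f x))" unfolding smooth_on_def
proof
 fix n show "Cn n S (%x. gd k (f x))"
  by (rule Cn_comp[OF assms(1), where I = I]) (use assms(2-4) in \<open>auto simp: smooth_on_def\<close>)
qed

lemma smooth_on_add: "open S ==> smooth_on S f ==> smooth_on S g ==> smooth_on S (%x. f x + g x)"
 and smooth_on_mult: "open S ==> smooth_on S f ==> smooth_on S g ==> smooth_on S (%x. f x * g x)"
 and smooth_on_inverse: "open S ==> smooth_on S f ==> (!!x. x \<in> S ==> f x ~= 0) ==> smooth_on S (%x. inverse (f x))"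
 by (simp_all add: smooth_on_def Cn_add Cn_mult Cn_inverse)

lemma smooth_on_minus: "open S ==> smooth_on S f ==> smooth_on S (%x. - f x)"
 using smooth_on_mult[of S "%x. -1" f] by simp

lemma smooth_on_diff: "open S ==> smooth_on S f ==> smooth_on S g ==> smooth_on S (%x. f x - g x)"
 using smooth_on_add[of S f "%x. - g x"] smooth_on_minus[of S g] by simp

lemma smooth_on_sum:
 "open S ==> (!!i. i \<in> I ==> smooth_on S (f i)) ==> smooth_on S (%x. \<Sum>i\<in>I. f i x)"
proof (induction I rule: infinite_finite_induct)
 case (insert i I)
 have "smooth_on S (%x. f i x + (\<Sum>i\<in>I. f i x))" by (rule smooth_on_add) (use insert in auto)
 then show ?case using insert.hyps by simp
qed simp_all

lemma smooth_on_power: "open S ==> smooth_on S f ==> smooth_on S (%x. f x ^ n)"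
proof (induction n)
 case (Suc n)
 have "smooth_on S (%x. f x * f x ^ n)" by (rule smooth_on_mult) (use Suc in auto)
 then show ?case by simp
qed simp

lemmas smooth_intros = smooth_on_const smooth_on_inner smooth_on_add smooth_on_mult smooth_on_minus
 smooth_on_diff smooth_on_sum smooth_on_power

lemma smooth_on_norm_sq: "smooth_on S (%x::'a::euclidean_space. (norm (x - p))^2)"
proof -
 have eq: "(%x. \<Sum>i\<in>Basis. (x \<bullet> i - p \<bullet> i)^2) = (%x. (norm (x - p))^2)"
 proof
  fix x show "(\<Sum>i\<in>Basis. (x \<bullet> i - p \<bullet> i)^2) = (norm (x - p))^2"
   unfolding power2_norm_eq_inner euclidean_inner[of "x - p" "x - p"] by (simp only: inner_diff_left power2_eq_square)
 qed
 have "smooth_on UNIV (%x. \<Sum>i\<in>Basis. (x \<bullet> i - p \<bullet> i)^2)"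
  by (intro smooth_intros open_UNIV)
 then show ?thesis unfolding eq using smooth_on_mono by blast
qed

lemma Cn_affine:
 assumes "Cn n UNIV f" shows "Cn n UNIV (%x. f (p + r *\<^sub>R x))" using assms
proof (induction n arbitrary: f)
 case (Suc n)
 have "Cn n UNIV (pd v (%x. f (p + r *\<^sub>R x)))" for v
 proof (rule Cn_cong[where f = "%x. r * pd v f (p + r *\<^sub>R x)"])
  show "Cn n UNIV (%x. r * pd v f (p + r *\<^sub>R x))" using Suc by (intro Cn_mult) auto
  show "r * pd v f (p + r *\<^sub>R y) = pd v (%x. f (p + r *\<^sub>R x)) y" for y
   using Suc.prems by (intro pd_affine[symmetric]) auto
 qed simp
 moreover have "(%x. f (p + r *\<^sub>R x)) differentiable (at x)" for x
 proof -
  have "(%x. p + r *\<^sub>R x) differentiable (at x)" by (auto intro!: derivative_intros)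
  moreover have "f differentiable (at (p + r *\<^sub>R x))" using Suc.prems by auto
  ultimately show ?thesis using differentiable_chain_at[of "%x. p + r *\<^sub>R x" x f] by (simp add: o_def)
 qed
 ultimately show ?case by auto
qed simp

lemma smooth_on_affine:
 "smooth_on UNIV f ==> smooth_on UNIV (%x. f (p + r *\<^sub>R x))"
 unfolding smooth_on_def using Cn_affine by blast

section \<open>Test functions\<close>

text \<open>With \<open>p = 1\<close> this is the standard flat function exp(-1/s). Polynomial
  prefactors in 1/s are included because the class is then closed under differentiation.\<close>

definition flat :: "real poly => real => real" where
 "flat p s = (if s <= 0 then 0 else poly p (1 / s) * exp (- (1 / s)))"

lemma poly_exp_decay:
 fixes p :: "real poly"
 shows "((%x. x ^ k * poly p x * exp (- x)) \<longlongrightarrow> 0) at_top"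
proof (induction p arbitrary: k)
 case 0
 then show ?case by simp
next
 case (pCons a q)
 have "((%x. a * (x ^ k / exp x) + x ^ Suc k * poly q x * exp (- x)) \<longlongrightarrow> a * 0 + 0) at_top"
  by (intro tendsto_add tendsto_mult_left tendsto_power_div_exp_0 pCons.IH)
 moreover have "(%x. a * (x ^ k / exp x) + x ^ Suc k * poly q x * exp (- x))
   = (%x. x ^ k * poly (pCons a q) x * exp (- x))" by (rule ext) (simp add: exp_minus field_simps)
 ultimately show ?case by simp
qed

lemma flat_tendsto_0: "(flat p \<longlongrightarrow> 0) (at 0)"
proof -
 have "((%x. x ^ 0 * poly p x * exp (- x)) \<longlongrightarrow> 0) at_top" by (rule poly_exp_decay)
 then have "((%s. poly p (inverse s) * exp (- inverse s)) \<longlongrightarrow> 0) (at_right 0)"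
  using filterlim_compose[OF _ filterlim_inverse_at_top_right] by fastforce
 then have r: "(flat p \<longlongrightarrow> 0) (at_right 0)" by (rule tendsto_cong[THEN iffD1, rotated])
   (auto simp: flat_def eventually_at_filter inverse_eq_divide)
 have l: "(flat p \<longlongrightarrow> 0) (at_left 0)" by (rule tendsto_cong[THEN iffD1, OF _ tendsto_const])
   (auto simp: flat_def eventually_at_filter)
 show ?thesis using l r by (rule filterlim_split_at_real)
qed

text \<open>In the variable x = 1/s, differentiation in s is -x^2 d/dx, which sends p(x) exp(-x) to
  x^2 (p - p')(x) exp(-x).\<close>

lemma flat_deriv:
 "(flat p has_real_derivative flat ([:0, 0, 1:] * (p - pderiv p)) s) (at s)"
proof (cases s "0 :: real" rule: linorder_cases)
 case less
 have "((%s. 0) has_real_derivative 0) (at s)" by simp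
 then have "(flat p has_real_derivative 0) (at s)" by (rule has_field_derivative_transform_within_open[where S = "{..<0}"])
   (use less in \<open>auto simp: flat_def\<close>)
 then show ?thesis using less by (simp add: flat_def)
next
 case greater
 have "((%s. poly p (1 / s) * exp (- (1 / s))) has_real_derivative
   flat ([:0, 0, 1:] * (p - pderiv p)) s) (at s)" using greater
  by (auto intro!: derivative_eq_intros DERIV_chain2[OF poly_DERIV]
    simp: flat_def field_simps power2_eq_square)
 then show ?thesis by (rule has_field_derivative_transform_within_open[where S = "{0<..}"])
   (use greater in \<open>auto simp: flat_def\<close>)
next
 case equal
 \<comment> \<open>At 0 the difference quotient is itself a flat function, with \<open>p\<close>
   multiplied by the variable 1/s, so its limit is already known.\<close>
 have "((%y. (flat p y - flat p 0) / (y - 0)) \<longlongrightarrow> 0) (at 0)"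
 proof (rule tendsto_cong[THEN iffD1, OF _ flat_tendsto_0[of "[:0, 1:] * p"]])
  show "\<forall>\<^sub>F y in at 0. flat ([:0, 1:] * p) y = (flat p y - flat p 0) / (y - 0)"
   by (auto simp: flat_def eventually_at_filter)
 qed
 then show ?thesis unfolding equal has_field_derivative_iff by (simp add: flat_def)
qed

lemma smooth_on_real_derivs:
 assumes "!!k y. (gd k has_real_derivative gd (Suc k) y) (at y)"
 shows "smooth_on UNIV (gd k :: real => real)"
 by (rule smooth_on_comp[where I = UNIV and f = "%x. x" and gd = gd])
  (use assms smooth_on_inner[of UNIV "1::real"] in auto)

lemma smooth_flat: "smooth_on UNIV (flat p)"
proof -
 define gd where "gd k = flat (((%p. [:0, 0, 1:] * (p - pderiv p)) ^^ k) p)" for k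
 have "smooth_on UNIV (gd 0)" by (rule smooth_on_real_derivs) (simp only: gd_def funpow.simps o_def flat_deriv)
 then show ?thesis by (simp add: gd_def)
qed

lemma smooth_on_has_real_derivative:
 "smooth_on UNIV (h :: real => real) ==> (h has_real_derivative pd 1 h y) (at y)"
proof -
 assume h: "smooth_on UNIV h"
 have "(%v. pd v h y) = (*) (pd 1 h y)"
 proof
  fix v show "pd v h y = pd 1 h y * v" using pd_scaleR[OF smooth_on_differentiable[OF h UNIV_I], of v 1 y] by simp
 qed
 then show ?thesis using smooth_on_derivative[OF h UNIV_I, of y] by (simp add: has_field_derivative_def)
qed

lemma smooth_on_compose:
 assumes "open S" "smooth_on UNIV (h :: real => real)" "smooth_on S f"
 shows "smooth_on S (%x. h (f x))"
proof -
 define gd where "gd k = (pd 1 ^^ k) h" for k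
 have s: "smooth_on UNIV (gd k)" for k unfolding gd_def by (induction k) (use assms smooth_on_pd in auto)
 have "smooth_on S (%x. gd 0 (f x))"
 proof (rule smooth_on_comp[where I = UNIV and gd = gd and k = 0 and f = f])
  fix k and y :: real
  show "(gd k has_real_derivative gd (Suc k) y) (at y)" using smooth_on_has_real_derivative[OF s, of k y] by (simp add: gd_def)
 qed (use assms in auto)
 then show ?thesis by (simp add: gd_def)
qed

lemma flat_nonneg: "0 <= flat 1 s" and flat_pos_iff: "0 < flat 1 s \<longleftrightarrow> 0 < s"
 and flat_eq_0: "s <= 0 ==> flat p s = 0" by (auto simp: flat_def)

definition smoothstep :: "real => real" where
 "smoothstep s = flat 1 s * inverse (flat 1 s + flat 1 (1 - s))"

lemma smoothstep_denom: "flat 1 s + flat 1 (1 - s) > 0"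
 using flat_nonneg[of s] flat_nonneg[of "1 - s"] flat_pos_iff[of s] flat_pos_iff[of "1 - s"] by (cases "s > 0") auto

lemma smooth_smoothstep: "smooth_on UNIV smoothstep"
proof -
 have 1: "smooth_on UNIV (%s::real. flat 1 (1 - s \<bullet> 1))"
  by (rule smooth_on_compose[OF open_UNIV smooth_flat]) (intro smooth_intros open_UNIV)
 have "smooth_on UNIV (%s. flat 1 s * inverse (flat 1 s + flat 1 (1 - s \<bullet> 1)))"
 proof (intro smooth_on_mult smooth_flat smooth_on_inverse smooth_on_add 1 open_UNIV)
  show "flat 1 x + flat 1 (1 - x \<bullet> 1) ~= 0" for x :: real using smoothstep_denom[of x] by simp
 qed
 then show ?thesis by (simp add: smoothstep_def[abs_def])
qed

lemma smoothstep_le_0: "s <= 0 ==> smoothstep s = 0" by (simp add: smoothstep_def flat_eq_0)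

lemma smoothstep_ge_1: "1 <= s ==> smoothstep s = 1"
 using smoothstep_denom[of s] by (simp add: smoothstep_def flat_eq_0[of "1 - s"])

lemma smoothstep_bounds: "0 <= smoothstep s" "smoothstep s <= 1"
 using smoothstep_denom[of s] flat_nonneg[of s] flat_nonneg[of "1 - s"] by (auto simp: smoothstep_def field_simps)

section \<open>Compactly supported smooth functions and their integrals\<close>

lemma test_fun_iff: "test_fun D f \<longleftrightarrow> smooth_on UNIV f \<and> compact (tsupp f) \<and> tsupp f \<subseteq> D"
 by (simp add: test_fun_def smooth_fun_iff)

lemma test_smooth: "test_fun D f ==> smooth_on UNIV f" by (simp add: test_fun_iff)

lemma test_mono: "test_fun D f ==> D \<subseteq> E ==> test_fun E f" by (auto simp: test_fun_iff)

lemma not_in_tsupp: "x \<notin> tsupp f ==> f x = 0"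
 unfolding tsupp_def using closure_subset[of "{x. f x ~= 0}"] by blast

lemma closed_tsupp [simp]: "closed (tsupp f)" by (simp add: tsupp_def)

lemma test_zero_outside: "test_fun D f ==> x \<notin> D ==> f x = 0"
 using not_in_tsupp[of x f] unfolding test_fun_iff by blast

lemma test_funI:
 assumes "smooth_on UNIV f" "compact K" "K \<subseteq> D" "!!x. x \<notin> K ==> f x = 0"
 shows "test_fun D f"
proof -
 have "tsupp f \<subseteq> K" unfolding tsupp_def by (rule closure_minimal) (use assms compact_imp_closed in auto)
 moreover then have "compact (tsupp f)" using assms(2) by (metis closed_closure compact_Int_closed inf.absorb_iff2 tsupp_def)
 ultimately show ?thesis using assms by (auto simp: test_fun_iff)
qed

lemma test_fun_mult: "test_fun D f ==> smooth_on UNIV g ==> test_fun D (%x. g x * f x)"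
 by (rule test_funI[where K = "tsupp f"]) (auto simp: test_fun_iff not_in_tsupp[of _ f] smooth_on_mult)

lemma test_fun_pd: "test_fun D f ==> test_fun D (pd v f)"
proof (rule test_funI[where K = "tsupp f"])
 assume t: "test_fun D f"
 show "pd v f x = 0" if "x \<notin> tsupp f" for x
 proof -
  have "pd v f x = pd v (%x. 0) x" by (rule pd_cong[where S = "- tsupp f"]) (use that not_in_tsupp[of _ f] in auto)
  then show ?thesis by simp
 qed
qed (auto simp: test_fun_iff smooth_on_pd)

lemma test_fun_add: "test_fun D f ==> test_fun D g ==> test_fun D (%x. f x + g x)"
 by (rule test_funI[where K = "tsupp f \<union> tsupp g"])
  (auto simp: test_fun_iff not_in_tsupp[of _ f] not_in_tsupp[of _ g] smooth_on_add)

lemma test_fun_cmult: "test_fun D f ==> test_fun D (%x. c * f x)"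
 using test_fun_mult[of D f "%x. c"] by simp

lemma test_fun_diff: "test_fun D f ==> test_fun D g ==> test_fun D (%x. f x - g x)"
 using test_fun_add[of D f "%x. (-1) * g x"] test_fun_cmult[of D g "-1"] by simp

lemma test_fun_zero: "test_fun D (%x. 0)" by (rule test_funI[where K = "{}"]) auto

lemma test_fun_sum: "(!!i. i \<in> I ==> test_fun D (f i)) ==> test_fun D (%x. \<Sum>i\<in>I. f i x)"
proof (induction I rule: infinite_finite_induct)
 case (insert i I)
 have "test_fun D (%x. f i x + (\<Sum>i\<in>I. f i x))" by (rule test_fun_add) (use insert in auto)
 then show ?case using insert.hyps by simp
qed (simp_all add: test_fun_zero)

lemma test_fun_lap: "test_fun D f ==> test_fun D (lap_of f)"
 unfolding lap_of_pd[abs_def] by (intro test_fun_sum test_fun_pd)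

lemma test_continuous: "test_fun D f ==> continuous_on UNIV f" by (rule smooth_on_continuous[OF test_smooth])

lemma test_bounded:
 assumes "test_fun D f" shows "\<exists>K. K >= 0 \<and> (\<forall>x. \<bar>f x\<bar> <= K)"
proof -
 have "compact (f ` tsupp f)" using assms test_continuous[OF assms]
  by (intro compact_continuous_image) (auto simp: test_fun_iff intro: continuous_on_subset)
 then obtain K where K: "!!y. y \<in> f ` tsupp f ==> norm y <= K"
  using compact_imp_bounded bounded_iff by metis
 have "\<bar>f x\<bar> <= max K 0" for x using K[of "f x"] not_in_tsupp[of x f] by (cases "x \<in> tsupp f") auto
 then show ?thesis by (intro exI[of _ "max K 0"]) auto
qed

lemma pd_bound:
 fixes K :: real
 assumes "f differentiable (at x)" "!!i. i \<in> Basis ==> \<bar>pd i f x\<bar> <= K"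
 shows "\<bar>pd v f x\<bar> <= DIM('a) * K * norm (v::'a::euclidean_space)"
proof -
 have "\<bar>pd v f x\<bar> = \<bar>\<Sum>i\<in>Basis. pd i f x * (i \<bullet> v)\<bar>"
  unfolding pd_grad[OF assms(1), of v] grad_of_pd by (simp add: inner_sum_left)
 also have "... <= (\<Sum>i\<in>(Basis::'a set). K * norm v)"
 proof (rule order_trans[OF sum_abs sum_mono])
  fix i :: 'a assume i: "i \<in> Basis"
  show "\<bar>pd i f x * (i \<bullet> v)\<bar> <= K * norm v"
   unfolding abs_mult by (rule mult_mono) (use assms(2)[OF i] Basis_le_norm[OF i, of v] in \<open>auto simp: inner_commute\<close>)
 qed
 finally show ?thesis by simp
qed

lemma test_Lipschitz:
 assumes "test_fun D f"
 shows "\<exists>K\<ge>0. (\<forall>x v. \<bar>pd v f x\<bar> <= K * norm v) \<and> (\<forall>x y. \<bar>f x - f y\<bar> <= K * norm (x - y))"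
proof -
 have "\<forall>i. \<exists>K\<ge>0. \<forall>x. \<bar>pd i f x\<bar> <= K" using test_bounded[OF test_fun_pd[OF assms]] by blast
 then obtain K where K: "!!i. K i >= 0" "!!i x. \<bar>pd i f x\<bar> <= K i" by metis
 define C where "C = (\<Sum>i\<in>Basis. K i)"
 have Ki: "K i <= C" if "i \<in> Basis" for i unfolding C_def by (rule member_le_sum) (use K that in auto)
 have C0: "C >= 0" unfolding C_def using K by (auto intro: sum_nonneg)
 have C: "C >= 0" "!!i x. i \<in> Basis ==> \<bar>pd i f x\<bar> <= C"
  using C0 order_trans[OF K(2) Ki] by auto
 have d: "f differentiable (at x)" for x using smooth_on_differentiable[OF test_smooth[OF assms]] by blast
 have 1: "\<bar>pd v f x\<bar> <= DIM('a) * C * norm v" for x v by (rule pd_bound[OF d C(2)])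
 have "norm (f x - f y) <= DIM('a) * C * norm (x - y)" for x y
 proof (rule differentiable_bound[where S = UNIV])
  show "(f has_derivative (%v. pd v f x)) (at x within UNIV)" for x using pd_has_derivative[OF d] by simp
  show "onorm (%v. pd v f x) <= DIM('a) * C" for x by (rule onorm_le) (use 1 in auto)
 qed auto
 then show ?thesis using 1 C by (intro exI[of _ "DIM('a) * C"]) auto
qed

lemma test_Taylor:
 assumes "test_fun D f"
 shows "\<exists>K\<ge>0. \<forall>x k. \<bar>f (x + k) - f x - pd k f x\<bar> <= K * (norm k)^2"
proof -
 have "\<forall>i. \<exists>K\<ge>0. \<forall>x y. \<bar>pd i f x - pd i f y\<bar> <= K * norm (x - y)"
  using test_Lipschitz[OF test_fun_pd[OF assms]] by blast
 then obtain K where K: "!!i. K i >= 0" "!!i x y. \<bar>pd i f x - pd i f y\<bar> <= K i * norm (x - y)" by metis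
 define C where "C = (\<Sum>i\<in>Basis. K i)"
 have Ki: "K i <= C" if "i \<in> Basis" for i unfolding C_def by (rule member_le_sum) (use K that in auto)
 have C0: "C >= 0" unfolding C_def using K by (auto intro: sum_nonneg)
 have C: "\<bar>pd i f x - pd i f y\<bar> <= C * norm (x - y)" if "i \<in> Basis" for i x y
  using K(2)[of i x y] mult_right_mono[OF Ki[OF that], of "norm (x - y)"] by simp
 have d: "f differentiable (at x)" for x using smooth_on_differentiable[OF test_smooth[OF assms]] by blast
 have dd: "((%y. f y - pd y f x) has_derivative (%v. pd v f y - pd v f x)) (at y)" for x y
  using pd_has_derivative[OF d, of y]
   bounded_linear.has_derivative[OF has_derivative_bounded_linear[OF pd_has_derivative[OF d[of x]]]
    has_derivative_ident] by (rule has_derivative_diff)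
 have "\<bar>f (x + k) - f x - pd k f x\<bar> <= DIM('a) * C * (norm k)^2" for x k
 proof -
  \<comment> \<open>Here \<open>pd y f x\<close>, with varying direction \<open>y\<close>, is the
    linear part. The mean value inequality is applied to \<open>f\<close> minus this linear function
    on the ball of radius \<open>norm k\<close>, where its derivative is at most a constant times
    \<open>norm k\<close>.\<close>
  have "norm ((f (x + k) - pd (x + k) f x) - (f x - pd x f x)) <= DIM('a) * (C * norm k) * norm (x + k - x)"
  proof (rule differentiable_bound[where S = "cball x (norm k)"])
   fix y assume y: "y \<in> cball x (norm k)"
   show "((%y. f y - pd y f x) has_derivative (%v. pd v f y - pd v f x)) (at y within cball x (norm k))"
    using dd has_derivative_at_withinI by blast
   show "onorm (%v. pd v f y - pd v f x) <= DIM('a) * (C * norm k)"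
   proof (rule onorm_le)
    fix v
    have "pd v (%y. f y - pd y f x) y = pd v f y - pd v f x" for v using pd_eqI[OF dd] .
    moreover have "\<bar>pd v (%y. f y - pd y f x) y\<bar> <= DIM('a) * (C * norm k) * norm v"
    proof (rule pd_bound[of "%y. f y - pd y f x" y "C * norm k" v])
     show "\<bar>pd i (%y. f y - pd y f x) y\<bar> <= C * norm k" if "i \<in> Basis" for i
      unfolding pd_eqI[OF dd] using C[OF that, of y x] mult_left_mono[OF _ C0, of "norm (y - x)" "norm k"] y
      by (simp add: dist_norm norm_minus_commute)
    qed (use dd in \<open>auto simp: differentiable_def\<close>)
    ultimately show "norm (pd v f y - pd v f x) <= DIM('a) * (C * norm k) * norm v" by simp
   qed
  qed (auto simp: dist_norm)
  moreover have "pd (x + k) f x = pd x f x + pd k f x" using linear_add[OF pd_linear[OF d]] .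
  ultimately show ?thesis by (simp add: power2_eq_square algebra_simps)
 qed
 then show ?thesis using C0 by (intro exI[of _ "DIM('a) * C"]) auto
qed

lemma borel_measurable_test: "test_fun D f ==> f \<in> borel_measurable borel"
 using borel_measurable_continuous_onI[OF test_continuous] .

lemma integrable_bounded_support:
 fixes f :: "'a::euclidean_space => real"
 assumes "f \<in> borel_measurable borel" "bounded S" "!!x. x \<notin> S ==> f x = 0" "!!x. \<bar>f x\<bar> <= K"
 shows "integrable lborel f"
proof -
 obtain r where r: "S \<subseteq> ball 0 r" using bounded_subset_ballD[OF assms(2)] by blast
 show ?thesis
 proof (rule integrableI_bounded_set[where A = "cball 0 r" and B = K])
  show "emeasure lborel (cball (0::'a) r) < \<infinity>" using emeasure_lborel_cball_finite[of "0::'a" r] by (simp add: top.not_eq_extremum)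
  show "AE x in lborel. x \<in> cball 0 r --> norm (f x) <= K" using assms(4) by simp
  have "f x = 0" if "x \<notin> cball 0 r" for x using that r assms(3)[of x] by (force simp: subset_iff)
  then show "AE x in lborel. x \<notin> cball 0 r --> f x = 0" by blast
 qed (use assms(1) in auto)
qed

lemma test_integrable:
 assumes "test_fun D f" shows "integrable lborel f"
proof -
 obtain K where "!!x. \<bar>f x\<bar> <= K" using test_bounded[OF assms] by blast
 then show ?thesis using integrable_bounded_support[OF borel_measurable_test[OF assms], of "tsupp f"] assms
  by (auto simp: test_fun_iff not_in_tsupp[of _ f] compact_imp_bounded)
qed

lemma lborel_integral_shift:
 fixes f :: "'a::euclidean_space => real"
 shows "(LBINT x. f (c + x)) = (LBINT x. f x)"
proof (cases "f \<in> borel_measurable borel")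
 case True
 then show ?thesis by (subst (2) lborel_distr_plus[of c, symmetric]) (simp add: integral_distr)
next
 case False
 \<comment> \<open>A non-measurable integrand leaves both integrals at their default 0.\<close>
 have "(%x. f (c + x)) \<notin> borel_measurable borel"
 proof
  assume "(%x. f (c + x)) \<in> borel_measurable borel"
  then have "(%x. f (c + x)) \<circ> (%x. - c + x) \<in> borel_measurable borel" by (intro measurable_comp) auto
  then show False using False by (simp add: o_def)
 qed
 then have "\<not> integrable lborel f" "\<not> integrable lborel (%x. f (c + x))"
  using False borel_measurable_integrable[of lborel f] borel_measurable_integrable[of lborel "%x. f (c + x)"] by auto
 then show ?thesis by (simp add: not_integrable_integral_eq)
qed

lemma integrable_shift:
 fixes f :: "'a::euclidean_space => real"
 assumes "integrable lborel f" shows "integrable lborel (%x. f (c + x))"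
 using integrable_distr[of "(+) c" lborel borel f] assms by (simp add: lborel_distr_plus)

text \<open>The open set \<open>W\<close> records that the cutoff is 1 on a whole neighbourhood of
  \<open>K\<close>, so that its derivatives vanish on \<open>K\<close> and products with it keep
  local identities.\<close>

lemma exists_cutoff:
 fixes K :: "'a::euclidean_space set"
 assumes "compact K" "open S" "K \<subseteq> S"
 shows "\<exists>et W. test_fun S et \<and> open W \<and> K \<subseteq> W \<and> (\<forall>x\<in>W. et x = 1) \<and> (\<forall>x. 0 <= et x \<and> et x <= 1)"
proof -
 have "\<forall>p\<in>K. \<exists>r>0. cball p r \<subseteq> S" using assms open_contains_cball by blast
 then obtain r where r: "!!p. p \<in> K ==> r p > 0 \<and> cball p (r p) \<subseteq> S" by metis
 obtain F where F: "F \<subseteq> K" "finite F" "K \<subseteq> (\<Union>p\<in>F. ball p (r p))"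
 proof (rule compactE_image[OF assms(1), of K "%p. ball p (r p)"])
  show "K \<subseteq> (\<Union>p\<in>K. ball p (r p))" using r by force
 qed (use that in auto)
 define b where "b p x = flat 1 (1 - (norm (x - p))^2 * inverse ((r p)^2))" for p x :: 'a
 have sb: "smooth_on UNIV (b p)" for p unfolding b_def
  by (rule smooth_on_compose[OF open_UNIV smooth_flat]) (intro smooth_intros smooth_on_norm_sq open_UNIV)
 have bpos: "b p x > 0" if "p \<in> F" "x \<in> ball p (r p)" for p x
 proof -
  have "(norm (x - p))^2 < (r p)^2"
   using that by (intro power_strict_mono) (auto simp: dist_norm norm_minus_commute)
  then show ?thesis unfolding b_def flat_pos_iff using r[of p] that F by (auto simp: field_simps)
 qed
 have b0: "b p x = 0" if "p \<in> F" "x \<notin> cball p (r p)" for p x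
 proof -
  have "r p > 0" using r that F by auto
  moreover have "(norm (x - p))^2 >= (r p)^2"
   using that \<open>r p > 0\<close> by (intro power_mono) (auto simp: dist_norm norm_minus_commute)
  ultimately show ?thesis unfolding b_def by (intro flat_eq_0) (auto simp: field_simps)
 qed
 have bnn: "b p x >= 0" for p x unfolding b_def by (rule flat_nonneg)
 define s where "s x = (\<Sum>p\<in>F. b p x)" for x
 have ss: "smooth_on UNIV s" unfolding s_def by (intro smooth_on_sum sb open_UNIV)
 then have cs: "continuous_on UNIV s" by (rule smooth_on_continuous)
 have spos: "s x > 0" if "x \<in> K" for x
 proof -
  obtain p where "p \<in> F" "x \<in> ball p (r p)" using F(3) \<open>x \<in> K\<close> by blast
  then show ?thesis unfolding s_def using bpos bnn F by (intro sum_pos2) auto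
 qed
 obtain c where c: "c > 0" "!!x. x \<in> K ==> s x >= c"
 proof (cases "K = {}")
  case True
  then show ?thesis using that[of 1] by auto
 next
  case False
  obtain x0 where "x0 \<in> K" "\<forall>y\<in>K. s x0 <= s y"
   using continuous_attains_inf[OF assms(1) False] cs continuous_on_subset by blast
  then show ?thesis using that[of "s x0"] spos by auto
 qed
 \<comment> \<open>The factor 2 / c makes the argument of \<open>smoothstep\<close> exceed 1 on the
   open set where \<open>s\<close> is above c / 2; this set contains \<open>K\<close> because
   \<open>s\<close> is at least \<open>c\<close> there.\<close>
 define et where "et x = smoothstep (2 / c * s x)" for x
 have "smooth_on UNIV et" unfolding et_def
  by (rule smooth_on_compose[OF open_UNIV smooth_smoothstep]) (intro smooth_intros ss open_UNIV)
 moreover have "et x = 0" if "x \<notin> (\<Union>p\<in>F. cball p (r p))" for x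
  using that b0 by (auto simp: et_def s_def smoothstep_le_0)
 moreover have "compact (\<Union>p\<in>F. cball p (r p))" using F by (intro compact_UN) auto
 ultimately have t: "test_fun S et" using r F by (intro test_funI[where K = "\<Union>p\<in>F. cball p (r p)"]) auto
 show ?thesis
 proof (intro exI conjI)
  show "open {x. s x > c / 2}" using cs by (intro open_Collect_less) (auto intro: continuous_intros)
  show "K \<subseteq> {x. s x > c / 2}" using c by force
  show "\<forall>x\<in>{x. s x > c / 2}. et x = 1" using c by (auto simp: et_def field_simps intro!: smoothstep_ge_1)
  show "test_fun S et" by (rule t)
  show "\<forall>x. 0 <= et x \<and> et x <= 1" using smoothstep_bounds by (simp add: et_def)
 qed
qed

section \<open>Square integrable functions\<close>

text \<open>One notion for scalar and vector fields, so that expansions in eigenfunctions and in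
  their gradients share the same lemmas.\<close>

definition sqi :: "'a measure => ('a => 'b::euclidean_space) => bool" where
 "sqi M f \<longleftrightarrow> f \<in> borel_measurable M \<and> integrable M (%x. (norm (f x))^2)"

lemma L2_on_sqi: "L2_on D f \<longleftrightarrow> sqi (lebesgue_on D) f" by (simp add: L2_on_def sqi_def)

lemma L2v_on_sqi: "L2v_on D f \<longleftrightarrow> sqi (lebesgue_on D) f" by (simp add: L2v_on_def sqi_def)

lemma sqi_meas [measurable_dest]: "sqi M f ==> f \<in> borel_measurable M" by (simp add: sqi_def)

lemma sqi_sq: "sqi M f ==> integrable M (%x. (norm (f x))^2)" by (simp add: sqi_def)

lemma sqi_inner:
 assumes "sqi M f" "sqi M g"
 shows "integrable M (%x. f x \<bullet> g x)"
proof (rule integrable_bound)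
 show "integrable M (%x. (norm (f x))^2 + (norm (g x))^2)"
  using assms by (intro integrable_add sqi_sq)
 show "(%x. f x \<bullet> g x) \<in> borel_measurable M" using assms sqi_meas by (intro borel_measurable_inner) auto
 have "\<bar>f x \<bullet> g x\<bar> <= (norm (f x))^2 + (norm (g x))^2" for x
 proof -
  have "\<bar>f x \<bullet> g x\<bar> <= norm (f x) * norm (g x)" by (rule Cauchy_Schwarz_ineq2)
  moreover have "2 * (norm (f x) * norm (g x)) <= (norm (f x))^2 + (norm (g x))^2"
   using sum_squares_bound[of "norm (f x)" "norm (g x)"] by simp
  moreover have "0 <= norm (f x) * norm (g x)" by simp
  ultimately show ?thesis by linarith
 qed
 then show "AE x in M. norm (f x \<bullet> g x) <= norm ((norm (f x))^2 + (norm (g x))^2)" by simp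
qed

lemma sqi_mult:
 fixes f g :: "'a => real"
 shows "sqi M f ==> sqi M g ==> integrable M (%x. f x * g x)"
 using sqi_inner[of M f g] by simp

lemma norm_add_sq_le: "(norm (a + b))^2 <= 2 * (norm a)^2 + 2 * (norm (b::'b::real_inner))^2"
proof -
 have "(norm (a + b))^2 <= (norm a + norm b)^2" by (intro power_mono norm_triangle_ineq) auto
 also have "... <= 2 * (norm a)^2 + 2 * (norm b)^2"
  using sum_squares_bound[of "norm a" "norm b"] by (simp add: power2_sum)
 finally show ?thesis .
qed

lemma sqi_bound:
 assumes "f \<in> borel_measurable M" "integrable M g" "!!x. x \<in> space M ==> (norm (f x))^2 <= g x"
 shows "sqi M f" unfolding sqi_def
proof
 show "integrable M (%x. (norm (f x))^2)" by (rule integrable_bound[OF assms(2)])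
   (use assms(1) in measurable, use assms(3) in force)
qed (rule assms)

lemma sqi_add: "sqi M f ==> sqi M g ==> sqi M (%x. f x + g x)"
 by (rule sqi_bound[where g = "%x. 2 * (norm (f x))^2 + 2 * (norm (g x))^2"])
  (auto simp: sqi_def norm_add_sq_le intro!: borel_measurable_add)

lemma sqi_scaleR: "sqi M f ==> sqi M (%x. c *\<^sub>R f x)"
 by (rule sqi_bound[where g = "%x. c^2 * (norm (f x))^2"])
  (auto simp: sqi_def power_mult_distrib intro!: borel_measurable_scaleR)

lemma sqi_cmult: "sqi M f ==> sqi M (%x. c * f x :: real)" using sqi_scaleR[of M f c] by simp

lemma sqi_diff: "sqi M f ==> sqi M g ==> sqi M (%x. f x - g x)"
 using sqi_add[of M f "%x. (-1) *\<^sub>R g x"] sqi_scaleR[of M g "-1"] by simp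

lemma sqi_zero: "sqi M (%x. 0)" by (simp add: sqi_def)

lemma sqi_sum: "(!!i. i \<in> I ==> sqi M (f i)) ==> sqi M (%x. \<Sum>i\<in>I. f i x)"
proof (induction I rule: infinite_finite_induct)
 case (insert i I)
 have "sqi M (%x. f i x + (\<Sum>i\<in>I. f i x))" by (rule sqi_add) (use insert in auto)
 then show ?case using insert.hyps by simp
qed (simp_all add: sqi_zero)

lemma sqi_bounded_mult:
 assumes "sqi M f" "g \<in> borel_measurable M" "!!x. x \<in> space M ==> \<bar>g x\<bar> <= K"
 shows "sqi M (%x. g x *\<^sub>R f x)"
proof (rule sqi_bound[where g = "%x. K^2 * (norm (f x))^2"])
 show "(norm (g x *\<^sub>R f x))^2 <= K^2 * (norm (f x))^2" if "x \<in> space M" for x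
  using power_mono[OF assms(3)[OF that], of 2] by (simp add: power_mult_distrib mult_right_mono)
qed (use assms in \<open>auto simp: sqi_def intro!: borel_measurable_scaleR\<close>)

lemma sqi_const: "finite_measure M ==> sqi M (%x. c)" by (simp add: sqi_def finite_measure.integrable_const)

lemma sqi_bounded:
 fixes f :: "'a => 'b::euclidean_space"
 assumes "finite_measure M" "f \<in> borel_measurable M" "!!x. x \<in> space M ==> norm (f x) <= K"
 shows "sqi M f" by (rule sqi_bound[where g = "%x. K^2"])
  (use assms in \<open>auto intro: finite_measure.integrable_const power_mono\<close>)

lemma sqi_integrable:
 fixes f :: "'a => real"
 shows "finite_measure M ==> sqi M f ==> integrable M f"
 using sqi_mult[OF _ sqi_const, of M f 1] by simp

lemma sq_expand:
 fixes f g :: "'a => 'b::euclidean_space"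
 assumes "sqi M f" "sqi M g"
 shows "(LINT x|M. (norm (f x - t *\<^sub>R g x))^2) =
  (LINT x|M. (norm (f x))^2) - 2 * t * (LINT x|M. f x \<bullet> g x) + t^2 * (LINT x|M. (norm (g x))^2)"
proof -
 have "(LINT x|M. (norm (f x - t *\<^sub>R g x))^2)
   = (LINT x|M. (norm (f x))^2 - 2 * t * (f x \<bullet> g x) + t^2 * (norm (g x))^2)"
  by (rule integral_cong[OF refl], simp only: power2_norm_eq_inner)
   (simp add: inner_diff inner_commute power2_eq_square algebra_simps)
 then show ?thesis using sqi_sq[OF assms(1)] sqi_sq[OF assms(2)] sqi_inner[OF assms] by simp
qed

lemma Cauchy_Schwarz_integral:
 fixes f g :: "'a => 'b::euclidean_space"
 assumes "sqi M f" "sqi M g"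
 shows "(LINT x|M. f x \<bullet> g x)^2 <= (LINT x|M. (norm (f x))^2) * (LINT x|M. (norm (g x))^2)"
proof -
 define a b c where "a = (LINT x|M. (norm (f x))^2)" "b = (LINT x|M. (norm (g x))^2)" "c = (LINT x|M. f x \<bullet> g x)"
 have b: "b >= 0" unfolding a_b_c_def by simp
 have nn: "0 <= a - 2 * t * c + t^2 * b" for t
 proof -
  have "0 <= (LINT x|M. (norm (f x - t *\<^sub>R g x))^2)" by simp
  then show ?thesis unfolding sq_expand[OF assms, of t] a_b_c_def .
 qed
 have "c^2 <= a * b"
 proof (cases "b = 0")
  case True
  have "c = 0"
  proof (rule ccontr)
   assume "c ~= 0"
   then show False using nn[of "(a + 1) / (2 * c)"] True by (simp add: field_simps)
  qed
  then show ?thesis using True by simp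
 next
  case False
  then show ?thesis using nn[of "c / b"] b by (simp add: field_simps power2_eq_square)
 qed
 then show ?thesis unfolding a_b_c_def .
qed

lemma integral_inner_tendsto:
 fixes g :: "'a => 'b::euclidean_space"
 assumes "!!n. sqi M (f n)" "sqi M F" "sqi M g" "(%n. \<integral>x. (norm (f n x - F x))^2 \<partial>M) \<longlonglongrightarrow> 0"
 shows "(%n. \<integral>x. f n x \<bullet> g x \<partial>M) \<longlonglongrightarrow> (LINT x|M. F x \<bullet> g x)"
proof -
 define B where "B = (LINT x|M. (norm (g x))^2)"
 have 1: "(LINT x|M. f n x \<bullet> g x) - (LINT x|M. F x \<bullet> g x) = (LINT x|M. (f n x - F x) \<bullet> g x)" for n
  using sqi_inner[OF assms(1,3)] sqi_inner[OF assms(2,3)] by (simp add: inner_diff_left)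
 have 2: "\<bar>\<integral>x. (f n x - F x) \<bullet> g x \<partial>M\<bar> <= sqrt ((LINT x|M. (norm (f n x - F x))^2) * B)" for n
  using real_sqrt_le_mono[OF Cauchy_Schwarz_integral[OF sqi_diff[OF assms(1)[of n] assms(2)] assms(3)]] unfolding B_def by simp
 have "(%n. sqrt ((LINT x|M. (norm (f n x - F x))^2) * B)) \<longlonglongrightarrow> 0"
  using tendsto_real_sqrt[OF tendsto_mult_left_zero[OF assms(4), of B]] by simp
 then have "(%n. (LINT x|M. f n x \<bullet> g x) - (LINT x|M. F x \<bullet> g x)) \<longlonglongrightarrow> 0"
  unfolding 1 by (rule Lim_null_comparison[rotated]) (simp add: 2)
 then show ?thesis by (rule LIM_zero_cancel)
qed

text \<open>On a finite measure space an L^2 Cauchy sequence is L^1 Cauchy, hence Cauchy almost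
  everywhere along a subsequence; Fatou's lemma then turns the pointwise limit into the L^2 limit of
  the whole sequence.\<close>

lemma Riesz_Fischer:
 fixes f :: "nat => 'a => 'b::euclidean_space"
 assumes fin: "finite_measure M" and sq: "!!n. sqi M (f n)"
  and Cauchy: "!!e. e > 0 ==> \<exists>N. \<forall>m\<ge>N. \<forall>n\<ge>N. (LINT x|M. (norm (f m x - f n x))^2) < e"
 shows "\<exists>F. sqi M F \<and> (%n. \<integral>x. (norm (f n x - F x))^2 \<partial>M) \<longlonglongrightarrow> 0"
proof -
 have [measurable]: "f n \<in> borel_measurable M" for n using sq sqi_meas by blast
 have nn: "(\<integral>\<^sup>+x. ennreal ((norm (f m x - f n x))^2) \<partial>M) = ennreal (LINT x|M. (norm (f m x - f n x))^2)" for m n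
  using sqi_sq[OF sqi_diff[OF sq sq]] by (intro nn_integral_eq_integral) auto
 define mu where "mu = measure M (space M)"
 have mu: "mu >= 0" by (simp add: mu_def)
 have sn: "sqi M (%x. norm (f m x - f n x))" for m n using sqi_diff[OF sq[of m] sq[of n]] by (simp add: sqi_def)
 have int: "integrable M (f n)" for n
 proof (rule integrable_norm_cancel)
  show "integrable M (%x. norm (f n x))" by (rule sqi_integrable[OF fin]) (use sq[of n] in \<open>simp add: sqi_def\<close>)
 qed simp
 have L1: "\<exists>N. \<forall>m\<ge>N. \<forall>n\<ge>N. (LINT x|M. norm (f m x - f n x)) < e" if e: "e > 0" for e
 proof -
  have "e^2 / (mu + 1) > 0" using e mu by simp
  then obtain N where N: "!!m n. m >= N ==> n >= N ==> (LINT x|M. (norm (f m x - f n x))^2) < e^2 / (mu + 1)"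
   using Cauchy by blast
  have "(LINT x|M. norm (f m x - f n x)) < e" if "m >= N" "n >= N" for m n
  proof (rule power2_less_imp_less)
   have "(LINT x|M. norm (f m x - f n x))^2 <= (LINT x|M. (norm (f m x - f n x))^2) * mu"
    using Cauchy_Schwarz_integral[OF sn sqi_const[OF fin, of 1], of m n] by (simp add: mu_def)
   also have "... <= e^2 / (mu + 1) * mu" using N[OF that] mu by (intro mult_right_mono) auto
   also have "... < e^2" using e mu by (simp add: field_simps)
   finally show "(LINT x|M. norm (f m x - f n x))^2 < e^2" .
  qed (use e in simp)
  then show ?thesis by blast
 qed
 obtain r where r: "strict_mono r" "AE x in M. Cauchy (%k. f (r k) x)" by (rule cauchy_L1_AE_cauchy_subseq[OF int L1])
 define F where "F x = lim (%k. f (r k) x)" for x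
 have [measurable]: "F \<in> borel_measurable M" unfolding F_def by (rule borel_measurable_lim_metric) simp
 have lim: "AE x in M. (%k. f (r k) x) \<longlonglongrightarrow> F x"
  using r(2) unfolding F_def by eventually_elim (simp add: Cauchy_convergent_iff convergent_LIMSEQ_iff)
 have Fatou: "(\<integral>\<^sup>+x. ennreal ((norm (f n x - F x))^2) \<partial>M) <= ennreal e"
  if e: "!!m. m >= K ==> (LINT x|M. (norm (f n x - f m x))^2) <= e" for n K e
 proof -
  have "(\<integral>\<^sup>+x. ennreal ((norm (f n x - F x))^2) \<partial>M) = (\<integral>\<^sup>+x. liminf (%k. ennreal ((norm (f n x - f (r k) x))^2)) \<partial>M)"
  proof (rule nn_integral_cong_AE, use lim in eventually_elim)
   fix x assume "(%k. f (r k) x) \<longlonglongrightarrow> F x"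
   then have "(%k. ennreal ((norm (f n x - f (r k) x))^2)) \<longlonglongrightarrow> ennreal ((norm (f n x - F x))^2)"
    by (intro tendsto_intros)
   then show "ennreal ((norm (f n x - F x))^2) = liminf (%k. ennreal ((norm (f n x - f (r k) x))^2))"
    using lim_imp_Liminf[OF trivial_limit_sequentially] by metis
  qed
  also have "... <= liminf (%k. \<integral>\<^sup>+x. ennreal ((norm (f n x - f (r k) x))^2) \<partial>M)"
   by (rule nn_integral_liminf) measurable
  also have "... <= ennreal e"
  proof (rule Liminf_le)
   show "\<forall>\<^sub>F k in sequentially. (\<integral>\<^sup>+x. ennreal ((norm (f n x - f (r k) x))^2) \<partial>M) <= ennreal e"
    unfolding nn eventually_sequentially
   proof (intro exI allI impI ennreal_leI e)
    show "K <= r k" if "K <= k" for k using seq_suble[OF r(1), of k] that by simp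
   qed
  qed simp
  finally show ?thesis .
 qed
 have sF: "sqi M F"
 proof -
  obtain N where N: "!!m n. m >= N ==> n >= N ==> (LINT x|M. (norm (f m x - f n x))^2) < 1"
   using Cauchy[of 1] by auto
  have "(\<integral>\<^sup>+x. ennreal ((norm (f N x - F x))^2) \<partial>M) <= ennreal 1"
   by (rule Fatou[of N]) (use N in \<open>auto intro: less_imp_le\<close>)
  then have "integrable M (%x. (norm (f N x - F x))^2)"
   by (intro integrableI_bounded) (auto simp: less_le_trans[of _ "ennreal 1"] le_less_trans)
  then have "sqi M (%x. f N x - F x)" by (simp add: sqi_def)
  from sqi_diff[OF sq[of N] this] show ?thesis by simp
 qed
 have "(%n. \<integral>x. (norm (f n x - F x))^2 \<partial>M) \<longlonglongrightarrow> 0"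
 proof (rule LIMSEQ_I)
  fix e :: real assume e: "e > 0"
  then obtain N where N: "!!m n. m >= N ==> n >= N ==> (LINT x|M. (norm (f m x - f n x))^2) < e / 2"
   using Cauchy[of "e / 2"] by auto
  have "norm ((LINT x|M. (norm (f n x - F x))^2) - 0) < e" if "n >= N" for n
  proof -
   have "(\<integral>\<^sup>+x. ennreal ((norm (f n x - F x))^2) \<partial>M) <= ennreal (e / 2)"
    by (rule Fatou[of N]) (use N that in \<open>auto intro: less_imp_le\<close>)
   then have "ennreal (LINT x|M. (norm (f n x - F x))^2) <= ennreal (e / 2)"
    using sqi_sq[OF sqi_diff[OF sq sF]] by (subst nn_integral_eq_integral[symmetric]) auto
   then show ?thesis using e by simp
  qed
  then show "\<exists>N. \<forall>n\<ge>N. norm ((LINT x|M. (norm (f n x - F x))^2) - 0) < e" by blast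
 qed
 then show ?thesis using sF by blast
qed

text \<open>Cutoffs that equal 1 on \<open>K\<close> and live in shrinking neighbourhoods of
  \<open>K\<close> converge pointwise to the indicator of \<open>K\<close>; dominated convergence
  does the rest.\<close>

lemma fundamental_lemma_compact:
 fixes f :: "'a::euclidean_space => real"
 assumes "open D" "integrable (lebesgue_on D) f" "compact K" "K \<subseteq> D"
  and "!!ph. test_fun D ph ==> (LINT x|lebesgue_on D. f x * ph x) = 0"
 shows "(LINT x|lebesgue_on D. f x * indicator K x) = 0"
proof (cases "K = {}")
 case False
 define S where "S n = {x. infdist x K < 1 / Suc n} \<inter> D" for n
 have "\<exists>et. test_fun (S n) et \<and> (\<forall>x\<in>K. et x = 1) \<and> (\<forall>x. 0 <= et x \<and> et x <= 1)" for n
 proof -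
  have "open (S n)" unfolding S_def by (intro open_Int assms open_Collect_less continuous_intros)
  moreover have "K \<subseteq> S n" using assms(4) by (auto simp: S_def infdist_zero)
  ultimately show ?thesis using exists_cutoff[OF assms(3), of "S n"] by blast
 qed
 then obtain et where et: "!!n. test_fun (S n) (et n)" "!!n x. x \<in> K ==> et n x = 1"
  "!!n x. 0 <= et n x \<and> et n x <= 1" by metis
 have "(%n. \<integral>x. f x * et n x \<partial>lebesgue_on D) \<longlonglongrightarrow> (LINT x|lebesgue_on D. f x * indicator K x)"
 proof (rule integral_dominated_convergence[where w = "%x. \<bar>f x\<bar>"])
  have [measurable]: "f \<in> borel_measurable (lebesgue_on D)" using assms(2) by simp
  have "et n \<in> borel_measurable (lebesgue_on D)" for n
   using borel_measurable_test[OF et(1)] by (simp add: measurable_completion measurable_restrict_space1)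
  then show "(%x. f x * et n x) \<in> borel_measurable (lebesgue_on D)" for n by measurable
  have "K \<in> sets lebesgue" using assms(3) by (simp add: lmeasurable_compact fmeasurableD)
  then have "(%x. indicator K x) \<in> borel_measurable (lebesgue_on D)" by (simp add: measurable_restrict_space1)
  then show "(%x. f x * indicator K x) \<in> borel_measurable (lebesgue_on D)" by measurable
  show "integrable (lebesgue_on D) (%x. \<bar>f x\<bar>)" using assms(2) by simp
  show "AE x in lebesgue_on D. norm (f x * et n x) <= \<bar>f x\<bar>" for n
   using et(3) by (intro AE_I2) (simp add: abs_mult mult_left_le)
  have "(%n. et n x) \<longlonglongrightarrow> indicator K x" for x
  proof (cases "x \<in> K")
   case False
   then have "infdist x K > 0"
    using assms(3) \<open>K ~= {}\<close> by (metis compact_imp_closed in_closed_iff_infdist_zero infdist_nonneg less_eq_real_def)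
   then obtain N where "1 / Suc N < infdist x K" using nat_approx_posE by metis
   then have "et n x = 0" if "n >= N" for n
   proof -
    have "1 / Suc n <= 1 / Suc N" using that by (simp add: frac_le)
    then have "x \<notin> S n" using \<open>1 / Suc N < infdist x K\<close> unfolding S_def by auto
    then show ?thesis using test_zero_outside[OF et(1)] by blast
   qed
   then have "\<forall>\<^sub>F n in sequentially. et n x = 0" by (auto simp: eventually_sequentially)
   then show ?thesis using False by (simp add: tendsto_eventually)
  qed (simp add: et)
  then show "AE x in lebesgue_on D. (%n. f x * et n x) \<longlonglongrightarrow> f x * indicator K x"
   by (intro AE_I2 tendsto_mult_left)
 qed
 moreover have "(LINT x|lebesgue_on D. f x * et n x) = 0" for n
  by (intro assms(5) test_mono[OF et(1)]) (auto simp: S_def)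
 ultimately have "(%n. 0) \<longlonglongrightarrow> (LINT x|lebesgue_on D. f x * indicator K x)" by simp
 from LIMSEQ_unique[OF this tendsto_const] show ?thesis .
qed simp

text \<open>A compact subset of the positivity set over which \<open>f\<close> integrates to 0 is
  null; inner regularity passes this on to the whole positivity set.\<close>

lemma fundamental_lemma_half:
 fixes f :: "'a::euclidean_space => real"
 assumes "open D" "bounded D" "integrable (lebesgue_on D) f"
  and "!!ph. test_fun D ph ==> (LINT x|lebesgue_on D. f x * ph x) = 0"
 shows "AE x in lebesgue_on D. f x <= 0"
proof -
 have D: "D \<in> sets lebesgue" using assms(1) by simp
 define E where "E = {x \<in> D. f x > 0}"
 have "{x \<in> space (lebesgue_on D). f x > 0} \<in> sets (lebesgue_on D)" using assms(3) by measurable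
 then have E: "E \<in> sets lebesgue" using D by (simp add: E_def sets_restrict_space_iff)
 have "emeasure lebesgue E <= ennreal e" if "e > 0" for e
 proof -
  obtain T where T: "closed T" "T \<subseteq> E" "E - T \<in> lmeasurable" "emeasure lebesgue (E - T) < ennreal e"
   using sets_lebesgue_inner_closed[OF E \<open>e > 0\<close>] by blast
  have cT: "compact T" using T assms(2) bounded_subset unfolding E_def compact_eq_bounded_closed by blast
  have sT: "T \<in> sets lebesgue" using T(1) by simp
  have TD: "T \<subseteq> D" using T(2) by (auto simp: E_def)
  have i0: "(LINT x|lebesgue_on D. f x * indicator T x) = 0" by (rule fundamental_lemma_compact[OF assms(1,3) cT TD assms(4)])
  have "(%x. indicator T x :: real) \<in> borel_measurable (lebesgue_on D)"
   using sT by (simp add: measurable_restrict_space1)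
  then have "integrable (lebesgue_on D) (%x. f x * indicator T x)"
   using assms(3) by (intro integrable_bound[OF assms(3)])
    (auto simp: abs_mult indicator_def intro!: borel_measurable_times)
  moreover have "0 <= f x * indicator T x" for x using T(2) by (auto simp: E_def indicator_def)
  ultimately have "AE x in lebesgue_on D. f x * indicator T x = 0"
   using i0 integral_nonneg_eq_0_iff_AE[of "lebesgue_on D" "%x. f x * indicator T x"] by auto
  then have "AE x in lebesgue_on D. x \<notin> T" by eventually_elim (use T(2) in \<open>auto simp: E_def indicator_def\<close>)
  then have "AE x in lebesgue. x \<notin> T" using TD D by (auto simp: AE_restrict_space_iff)
  then have "emeasure lebesgue T = 0" using sT by (subst AE_iff_null_sets[OF sT, THEN iffD2, THEN null_setsD1]) (auto)
  then show ?thesis using T(4) emeasure_subadditive[of T lebesgue "E - T"] sT T(2,3)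
   by (metis (no_types) Un_Diff_cancel Un_absorb1 add_0 fmeasurableD less_imp_le order_trans)
 qed
 then have "emeasure lebesgue E = 0" by (metis ennreal_le_epsilon add_0 le_zero_eq)
 then have "AE x in lebesgue. x \<notin> E" using E by (simp add: AE_iff_null_sets[symmetric] null_setsI)
 then show ?thesis using D unfolding E_def by (simp add: AE_restrict_space_iff not_less)
qed

lemma fundamental_lemma:
 fixes f :: "'a::euclidean_space => real"
 assumes "open D" "bounded D" "integrable (lebesgue_on D) f"
  and "!!ph. test_fun D ph ==> (LINT x|lebesgue_on D. f x * ph x) = 0"
 shows "AE x in lebesgue_on D. f x = 0"
proof -
 have "AE x in lebesgue_on D. - f x <= 0" by (rule fundamental_lemma_half) (use assms in auto)
 moreover have "AE x in lebesgue_on D. f x <= 0" by (rule fundamental_lemma_half) (use assms in auto)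
 ultimately show ?thesis by eventually_elim simp
qed

lemma lebesgue_on_integral_lborel:
 fixes F :: "'a::euclidean_space => real"
 assumes "open D" "F \<in> borel_measurable borel" "!!x. x \<notin> D ==> F x = 0"
 shows "(LINT x|lebesgue_on D. F x) = (LBINT x. F x)"
proof -
 have "(LINT x|lebesgue_on D. F x) = (LINT x|lebesgue. indicator D x *\<^sub>R F x)"
  using assms(1) by (intro integral_restrict_space) simp
 also have "(%x. indicator D x *\<^sub>R F x) = F" using assms(3) by (auto simp: indicator_def fun_eq_iff)
 finally show ?thesis using assms(2) by (simp add: integral_completion)
qed

section \<open>Dirichlet series\<close>

lemma xexp_le: "x * exp (- x * c) <= 1 / c" if "c > 0" for x c :: real
proof -
 have "x * c <= exp (x * c)" using exp_ge_add_one_self[of "x * c"] by linarith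
 then have "x * c * exp (- x * c) <= 1" by (simp add: exp_minus field_simps)
 then show ?thesis using that by (simp add: field_simps)
qed

context
 fixes lam e :: "nat => real"
 assumes lam: "mono lam" "lam 0 > 0" and e: "summable (%k. \<bar>e k\<bar>)"
begin

lemma lam_pos: "lam k > 0" using lam monoD[OF lam(1), of 0 k] by simp

lemma e_sub_summable: "summable (%k. if P k then e k else 0)"
 by (rule summable_rabs_cancel, rule summable_comparison_test'[OF e, of 0]) auto

lemma finite_lam_less: "finite {k. lam k < lam j}"
 by (rule finite_subset[of _ "{..<j}"]) (use monoD[OF lam(1), of j] in \<open>auto simp: not_less[symmetric]\<close>)

text \<open>A weight depending only on \<open>lam k\<close> is constant on each group of equal
  exponents and factors out of the group sum. Group sums are written as series since nothing assumed
  on \<open>lam\<close> bounds the size of a group.\<close>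

lemma group_sum_zero:
 assumes "!!i. lam i < lam j ==> (\<Sum>k. if lam k = lam i then e k else 0) = 0"
 shows "(\<Sum>k | lam k < lam j. F (lam k) * e k) = 0"
proof -
 define A where "A = {k. lam k < lam j}"
 have fA: "finite A" unfolding A_def by (rule finite_lam_less)
 have "(\<Sum>k | k \<in> A \<and> lam k = nu. F (lam k) * e k) = 0" if "nu \<in> lam ` A" for nu
 proof -
  from that obtain i where i: "nu = lam i" "i \<in> A" by blast
  have "(\<Sum>k | k \<in> A \<and> lam k = nu. F (lam k) * e k) = F nu * (\<Sum>k | k \<in> A \<and> lam k = nu. if lam k = lam i then e k else 0)"
   unfolding sum_distrib_left i by (rule sum.cong) auto
  also have "(\<Sum>k | k \<in> A \<and> lam k = nu. if lam k = lam i then e k else 0) = (\<Sum>k. if lam k = lam i then e k else 0)"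
   by (rule suminf_finite[symmetric]) (use fA i in \<open>auto simp: A_def\<close>)
  finally show ?thesis using assms[of i] i by (simp add: A_def)
 qed
 then show ?thesis using sum.image_gen[OF fA, of "%k. F (lam k) * e k" lam] by (simp add: A_def)
qed

text \<open>Coefficients with equal exponents cannot be separated, so only group sums are shown to
  vanish. After multiplication by exp(mu t), smaller exponents cancel by induction, the group of mu
  contributes the constant \<open>mu * E\<close>, and larger exponents decay for large
  \<open>t\<close> because of a gap above mu.\<close>

lemma dirichlet_group_zero:
 assumes z: "!!t. t \<in> S ==> (%k. e k * lam k * exp (- lam k * t)) sums 0"
  and unb: "!!B. \<exists>t\<in>S. t > B"
 shows "(\<Sum>k. if lam k = lam j then e k else 0) = 0"
proof (induction j rule: less_induct)
 case (less j)
 define mu where "mu = lam j"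
 have mu: "mu > 0" unfolding mu_def by (rule lam_pos)
 have low: "(\<Sum>k | lam k < mu. F (lam k) * e k) = 0" for F
  unfolding mu_def by (rule group_sum_zero, rule less.IH) (use monoD[OF lam(1), of j] in \<open>auto simp: not_less[symmetric]\<close>)
 define E where "E = (\<Sum>k. if lam k = mu then e k else 0)"
 \<comment> \<open>The gap comes from monotonicity: the least index beyond the group carries the
   smallest larger exponent. Without such an index any positive \<open>g\<close> serves.\<close>
 obtain g where g: "g > 0" "!!k. lam k > mu ==> lam k - mu >= g"
 proof (cases "\<exists>k. lam k > mu")
  case True
  define i where "i = (LEAST k. lam k > mu)"
  have i: "lam i > mu" unfolding i_def using True by (rule LeastI_ex)
  have "lam k >= lam i" if "lam k > mu" for k
   using monoD[OF lam(1), of i k] Least_le[of "%k. lam k > mu" k] that unfolding i_def by simp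
  then show ?thesis using that[of "lam i - mu"] i by auto
 qed (use that[of 1] in auto)
 define A where "A = (\<Sum>k. \<bar>e k\<bar>)"
 have main: "\<bar>mu * E\<bar> <= (1 + mu / g) * exp (- g * (t - 1)) * A" if t: "t \<in> S" "t > 1" for t
 proof -
  define h where "h k = e k * lam k * exp (- (lam k - mu) * t)" for k
  have "(%k. exp (mu * t) * (e k * lam k * exp (- lam k * t))) sums (exp (mu * t) * 0)" by (intro sums_mult z t)
  moreover have "exp (mu * t) * (e k * lam k * exp (- lam k * t)) = h k" for k
  proof -
   have "exp (- (lam k - mu) * t) = exp (mu * t) * exp (- lam k * t)"
    unfolding exp_add[symmetric] by (simp add: algebra_simps)
   then show ?thesis by (simp add: h_def)
  qed
  ultimately have hs: "h sums 0" by simp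
  define h1 h2 h3 where "h1 k = (if lam k < mu then h k else 0)"
   "h2 k = mu * (if lam k = mu then e k else 0)" "h3 k = (if lam k > mu then h k else 0)" for k
  have "h1 sums (\<Sum>k | lam k < mu. h k)"
   unfolding h1_h2_h3_def(1) using sums_If_finite[OF finite_lam_less[of j, folded mu_def], of h] by simp
  also have "(\<Sum>k | lam k < mu. h k) = 0"
   using low[of "%v. v * exp (- (v - mu) * t)"] by (simp add: h_def mult_ac)
  finally have s1: "h1 sums 0" .
  have s2: "h2 sums (mu * E)" unfolding h1_h2_h3_def(2) E_def by (intro sums_mult summable_sums e_sub_summable)
  have "(%k. h k - h1 k - h2 k) sums (0 - 0 - mu * E)" by (intro sums_diff hs s1 s2)
  moreover have "h k - h1 k - h2 k = h3 k" for k by (auto simp: h1_h2_h3_def h_def)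
  ultimately have s3: "h3 sums (- mu * E)" by simp
  \<comment> \<open>One unit of time is spent on absorbing the factor \<open>x\<close> via x exp(-x)
    <= 1; the remaining time t - 1 gives the decay.\<close>
  have b3: "norm (h3 k) <= (1 + mu / g) * exp (- g * (t - 1)) * \<bar>e k\<bar>" for k
  proof (cases "lam k > mu")
   case True
   define x where "x = lam k - mu"
   have x: "x >= g" using g(2)[OF True] by (simp add: x_def)
   have "lam k <= (1 + mu / g) * x"
    using x g(1) mu mult_left_mono[OF x, of "mu / g"] by (simp add: x_def algebra_simps)
   then have "lam k * exp (- x * t) <= (1 + mu / g) * x * exp (- x * t)" by simp
   also have "... = (1 + mu / g) * (x * exp (- x * 1) * exp (- x * (t - 1)))"
    by (simp add: mult_exp_exp algebra_simps flip: exp_add)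
   also have "... <= (1 + mu / g) * (1 * exp (- g * (t - 1)))"
   proof (intro mult_left_mono mult_mono)
    show "x * exp (- x * 1) <= 1" using xexp_le[of 1 x] by simp
    show "exp (- x * (t - 1)) <= exp (- g * (t - 1))" using x t(2) by (simp add: mult_right_mono)
   qed (use g mu in auto)
   finally have "lam k * exp (- x * t) <= (1 + mu / g) * exp (- g * (t - 1))" by simp
   then have "\<bar>e k\<bar> * (lam k * exp (- x * t)) <= \<bar>e k\<bar> * ((1 + mu / g) * exp (- g * (t - 1)))"
    by (intro mult_left_mono) auto
   then show ?thesis using True lam_pos[of k] by (simp add: h1_h2_h3_def h_def x_def abs_mult mult_ac)
  qed (use g mu in \<open>auto simp: h1_h2_h3_def\<close>)
  have "\<bar>mu * E\<bar> = norm (\<Sum>k. h3 k)" using s3 by (simp add: sums_iff)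
  also have "... <= (\<Sum>k. (1 + mu / g) * exp (- g * (t - 1)) * \<bar>e k\<bar>)"
   by (rule norm_suminf_le[OF b3 summable_mult[OF e]])
  also have "... = (1 + mu / g) * exp (- g * (t - 1)) * A" unfolding A_def by (rule suminf_mult[OF e])
  finally show ?thesis .
 qed
 have "mu * E = 0"
 proof (rule ccontr)
  assume ne: "mu * E ~= 0"
  have "((%t. (1 + mu / g) * exp (- g * (t - 1)) * A) \<longlongrightarrow> 0) at_top"
  proof -
   have "filterlim (%t. - g + g * t) at_top at_top"
    using g(1) by (intro filterlim_tendsto_add_at_top[OF tendsto_const] filterlim_tendsto_pos_mult_at_top[OF tendsto_const _ filterlim_ident])
   then have "filterlim (%t. - (- g + g * t)) at_bot at_top" by (simp only: filterlim_uminus_at_bot minus_minus)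
   then have "((%t. exp (- (- g + g * t))) \<longlongrightarrow> 0) at_top" by (rule filterlim_compose[OF exp_at_bot])
   then have "((%t. exp (- g * (t - 1))) \<longlongrightarrow> 0) at_top" by (simp add: algebra_simps)
   then show ?thesis by (auto intro!: tendsto_mult_left_zero tendsto_mult_right_zero)
  qed
  then have "\<forall>\<^sub>F t in at_top. (1 + mu / g) * exp (- g * (t - 1)) * A < \<bar>mu * E\<bar>"
   by (rule order_tendstoD) (use ne in simp)
  then obtain B where B: "!!t. t >= B ==> (1 + mu / g) * exp (- g * (t - 1)) * A < \<bar>mu * E\<bar>"
   unfolding eventually_at_top_linorder by blast
  obtain t where "t \<in> S" "t > max B 1" using unb by blast
  then show False using main[of t] B[of t] by simp
 qed
 then show ?case using mu unfolding E_def mu_def by simp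
qed

text \<open>The sum over exponents at most \<open>lam j\<close> vanishes group by group, and what is
  left is dominated by a tail of the absolutely convergent series.\<close>

lemma dirichlet_zero_unbounded:
 assumes z: "!!t. t \<in> S ==> (%k. e k * lam k * exp (- lam k * t)) sums 0"
  and unb: "!!B. \<exists>t\<in>S. t > B"
 shows "(\<Sum>k. e k) = 0"
proof -
 note gz = dirichlet_group_zero[OF z unb]
 have E0: "(\<Sum>k. if lam k <= lam j then e k else 0) = 0" for j
 proof -
  have "(%k. if lam k < lam j then e k else 0) sums 0"
   using sums_If_finite[OF finite_lam_less, of j e] group_sum_zero[of j "%_. 1"] gz by simp
  then have "(%k. (if lam k < lam j then e k else 0) + (if lam k = lam j then e k else 0)) sums (0 + 0)"
   by (rule sums_add) (use summable_sums[OF e_sub_summable, of "%k. lam k = lam j"] gz[of j] in simp)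
  moreover have "(if lam k < lam j then e k else 0) + (if lam k = lam j then e k else 0) = (if lam k <= lam j then e k else 0)" for k
   by auto
  ultimately show ?thesis by (simp add: sums_iff)
 qed
 have "\<bar>\<Sum>k. e k\<bar> <= (\<Sum>k. \<bar>e (k + Suc j)\<bar>)" for j
 proof -
  have s2: "summable (%k. if lam k <= lam j then 0 else e k)"
   by (rule summable_rabs_cancel, rule summable_comparison_test'[OF e, of 0]) auto
  have "(\<Sum>k. e k) = (\<Sum>k. (if lam k <= lam j then e k else 0) + (if lam k <= lam j then 0 else e k))"
   by (rule suminf_cong) auto
  also have "... = (\<Sum>k. if lam k <= lam j then 0 else e k)"
   using suminf_add[OF e_sub_summable s2, of "%k. lam k <= lam j"] E0 by simp
  also have "... = (\<Sum>k. if lam (k + Suc j) <= lam j then 0 else e (k + Suc j))"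
   by (subst suminf_split_initial_segment[OF s2, of "Suc j"]) (use monoD[OF lam(1)] in \<open>auto intro!: sum.neutral\<close>)
  finally have "\<bar>\<Sum>k. e k\<bar> = norm (\<Sum>k. if lam (k + Suc j) <= lam j then 0 else e (k + Suc j))" by simp
  also have "... <= (\<Sum>k. \<bar>e (k + Suc j)\<bar>)"
   by (rule norm_suminf_le) (use summable_ignore_initial_segment[OF e, of "Suc j"] in auto)
  finally show ?thesis .
 qed
 moreover have "(%j. \<Sum>k. \<bar>e (k + Suc j)\<bar>) \<longlonglongrightarrow> 0"
  using LIMSEQ_Suc[OF suminf_exist_split2[OF e]] by simp
 ultimately have "\<bar>\<Sum>k. e k\<bar> <= 0" using LIMSEQ_le_const by blast
 then show ?thesis by simp
qed

text \<open>The bound lam exp(-lam c) <= 1/c gives locally uniform convergence in the right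
  half-plane of complex times, so the sum is holomorphic there and the identity theorem
  applies.\<close>

lemma dirichlet_zero_limpt:
 assumes tp: "!!n::nat. t n > 0" and z: "!!n. (%k. e k * lam k * exp (- lam k * t n)) sums 0"
  and ts: "ts > 0" "ts islimpt range t" and x: "x > 0"
 shows "(%k. e k * lam k * exp (- lam k * x)) sums 0"
proof -
 define T where "T k z = complex_of_real (e k * lam k) * exp (- (of_real (lam k) * z))" for k z
 define f where "f z = (\<Sum>k. T k z)" for z
 define H where "H = {z::complex. Re z > 0}"
 have Tb: "norm (T k z) <= \<bar>e k\<bar> * (1 / de)" if "Re z >= de" "de > 0" for k z de
 proof -
  have "norm (T k z) = \<bar>e k\<bar> * (lam k * exp (- lam k * Re z))"
   using lam_pos[of k] by (simp add: T_def norm_mult abs_mult)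
  also have "lam k * exp (- lam k * Re z) <= 1 / Re z" using that by (intro xexp_le) auto
  also have "... <= 1 / de" using that by (simp add: frac_le)
  finally show ?thesis by (simp add: mult_left_mono)
 qed
 have sumT: "summable (%k. T k z)" if "z \<in> H" for z
  by (rule summable_comparison_test'[OF summable_mult2[OF e, of "1 / Re z"], of 0])
   (use Tb[of "Re z" z] that in \<open>auto simp: H_def\<close>)
 have oH: "open H" unfolding H_def by (rule open_halfspace_Re_gt)
 have cH: "connected H" unfolding H_def by (intro convex_connected convex_halfspace_Re_gt)
 have hol: "f holomorphic_on H"
 proof (rule holomorphic_uniform_sequence[OF oH])
  show "(%z. \<Sum>k<n. T k z) holomorphic_on H" for n unfolding T_def by (intro holomorphic_intros)
  fix z assume "z \<in> H"
  define de where "de = Re z / 2"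
  have d: "de > 0" using \<open>z \<in> H\<close> by (simp add: de_def H_def)
  have R: "Re w >= de" if "w \<in> cball z de" for w
   using that abs_Re_le_cmod[of "z - w"] unfolding de_def by (auto simp: dist_norm)
  have "cball z de \<subseteq> H" using R d unfolding H_def by force
  moreover have "uniform_limit (cball z de) (%n z. \<Sum>k<n. T k z) f sequentially"
   unfolding f_def by (rule Weierstrass_m_test[OF _ summable_mult2[OF e, of "1 / de"]]) (use Tb R d in auto)
  ultimately show "\<exists>d>0. cball z d \<subseteq> H \<and> uniform_limit (cball z d) (%n z. \<Sum>k<n. T k z) f sequentially"
   using d by blast
 qed
 have Tr: "T k (of_real y) = of_real (e k * lam k * exp (- lam k * y))" for k y
  by (simp only: T_def of_real_mult[symmetric] of_real_minus[symmetric] exp_of_real mult_minus_left)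
 have fz: "f w = 0" if "w \<in> H" for w
 proof (rule analytic_continuation[OF hol oH cH, of "complex_of_real ` range t" "of_real ts"])
  show "complex_of_real ` range t \<subseteq> H" using tp by (auto simp: H_def)
  show "complex_of_real ts \<in> H" using ts by (simp add: H_def)
  show "complex_of_real ts islimpt complex_of_real ` range t" unfolding islimpt_approachable
  proof (intro allI impI)
   fix ep :: real assume "ep > 0"
   then obtain x' where "x' \<in> range t" "x' ~= ts" "dist x' ts < ep"
    using ts(2) unfolding islimpt_approachable by blast
   then show "\<exists>x'\<in>complex_of_real ` range t. x' ~= complex_of_real ts \<and> dist x' (complex_of_real ts) < ep"
    by (intro bexI[of _ "complex_of_real x'"]) (auto simp: dist_of_real)
  qed
  show "f z = 0" if zt: "z \<in> complex_of_real ` range t" for z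
  proof -
   obtain n where n: "z = of_real (t n)" using zt by blast
   have "(%k. T k z) sums of_real 0" unfolding n Tr by (intro sums_of_real assms(2))
   then show ?thesis unfolding f_def by (simp add: sums_iff)
  qed
 qed (use that in auto)
 have "(%k. T k (of_real x)) sums 0"
  using sumT[of "of_real x"] fz[of "of_real x"] x unfolding f_def by (simp add: H_def sums_iff)
 then have "(%k. complex_of_real (e k * lam k * exp (- lam k * x))) sums of_real 0" unfolding Tr by simp
 then show ?thesis by (simp only: sums_of_real_iff)
qed

text \<open>The terms are \<open>e k * lam k * exp (- lam k * t)\<close> because their integral over
  all times is \<open>e k\<close>: a condition at the given times becomes one for the time integral
  of the heat flow, which is the torsion function. A finite accumulation point is first continued to
  all positive times, and these are unbounded.\<close>

theorem dirichlet_series_zero: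
 assumes tp: "!!n::nat. t n > 0" and z: "!!n. (%k. e k * lam k * exp (- lam k * t n)) sums 0"
  and acc: "(\<exists>ts>0. ts islimpt range t) \<or> \<not> bdd_above (range t)"
 shows "(\<Sum>k. e k) = 0" using acc
proof
 assume "\<exists>ts>0. ts islimpt range t"
 then obtain ts where ts: "ts > 0" "ts islimpt range t" by blast
 show ?thesis
 proof (rule dirichlet_zero_unbounded[where S = "{0<..}"])
  show "(%k. e k * lam k * exp (- lam k * x)) sums 0" if "x \<in> {0<..}" for x
   using dirichlet_zero_limpt[OF tp z ts] that by simp
  show "\<exists>t\<in>{0<..}. t > B" for B :: real by (rule bexI[of _ "max B 0 + 1"]) auto
 qed
next
 assume "\<not> bdd_above (range t)"
 then show ?thesis
  by (intro dirichlet_zero_unbounded[where S = "range t"]) (use z in \<open>auto simp: bdd_above_def not_le\<close>)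
qed

end

section \<open>Radial mollifiers\<close>

definition conv :: "('a::euclidean_space => real) => ('a => real) => 'a => real" where
 "conv h ro x = (LBINT y. h y * ro (x - y))"

lemma integrable_mult_bounded:
 fixes h g :: "'a => real"
 assumes "integrable M h" "g \<in> borel_measurable M" "!!x. \<bar>g x\<bar> <= K"
 shows "integrable M (%x. h x * g x)"
proof (rule integrable_bound)
 show "integrable M (%x. K * \<bar>h x\<bar>)" using assms(1) by simp
 show "(%x. h x * g x) \<in> borel_measurable M" using assms by measurable
 have "K >= 0" using assms(3) abs_ge_zero order_trans by blast
 then show "AE x in M. norm (h x * g x) <= norm (K * \<bar>h x\<bar>)"
  by (intro AE_I2) (simp add: abs_mult mult.commute mult_right_mono assms(3))
qed

lemma integral_mult_bound:
 fixes h g :: "'a => real"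
 assumes "integrable M h" "integrable M (%x. h x * g x)" "!!x. h x ~= 0 ==> \<bar>g x\<bar> <= c"
 shows "\<bar>LINT x|M. h x * g x\<bar> <= (LINT x|M. \<bar>h x\<bar>) * c"
proof -
 have "\<bar>h x * g x\<bar> <= \<bar>h x\<bar> * c" for x
  using assms(3)[of x] by (cases "h x = 0") (auto simp: abs_mult intro: mult_left_mono)
 then have "(LINT x|M. \<bar>h x * g x\<bar>) <= (LINT x|M. \<bar>h x\<bar> * c)"
  by (intro integral_mono) (use assms in auto)
 from order_trans[OF integral_abs_bound this] show ?thesis by simp
qed

lemma lborel_integral_affine:
 fixes f :: "'a::euclidean_space => real"
 assumes f: "f \<in> borel_measurable borel" and r: "r > 0"
 shows "(LBINT x. f x) = r ^ DIM('a) * (LBINT z. f (p + r *\<^sub>R z))"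
proof -
 have "(LBINT x. f x) = (\<integral>x. f x \<partial>density (distr lborel borel (%x. p + r *\<^sub>R x)) (%_. ennreal (\<bar>r\<bar> ^ DIM('a))))"
  using lborel_affine[of r p] r by simp
 also have "... = (\<integral>x. (\<bar>r\<bar> ^ DIM('a)) * f x \<partial>distr lborel borel (%x. p + r *\<^sub>R x))"
  using f by (subst integral_real_density) auto
 also have "... = (LBINT x. (\<bar>r\<bar> ^ DIM('a)) * f (p + r *\<^sub>R x))" using f by (subst integral_distr) auto
 finally show ?thesis using r by simp
qed

lemma borel_reflect:
 fixes ro :: "'a::euclidean_space => real"
 assumes "ro \<in> borel_measurable borel" shows "(%y. ro (x - y)) \<in> borel_measurable borel"
 by (rule measurable_compose[OF _ assms]) simp

lemma conv_integrable:
 assumes "integrable lborel h" "test_fun D ro"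
 shows "integrable lborel (%y. h y * ro (x - y))"
proof -
 obtain K where "!!x. \<bar>ro x\<bar> <= K" using test_bounded[OF assms(2)] by blast
 then show ?thesis using borel_reflect[OF borel_measurable_test[OF assms(2)]]
  by (intro integrable_mult_bounded[OF assms(1)]) auto
qed

lemma has_derivative_quadratic:
 fixes F :: "'a::euclidean_space => real"
 assumes "linear D" "d > 0" "!!k. norm k < d ==> \<bar>F (x + k) - F x - D k\<bar> <= C * (norm k)^2"
 shows "(F has_derivative D) (at x)" unfolding has_derivative_at
proof
 show "bounded_linear D" using assms(1) linear_conv_bounded_linear by blast
 show "(%k. norm (F (x + k) - F x - D k) / norm k) \<midarrow>0\<rightarrow> 0"
 proof (rule Lim_null_comparison)
  show "\<forall>\<^sub>F k in at 0. norm (norm (F (x + k) - F x - D k) / norm k) <= C * norm k" unfolding eventually_at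
  proof (intro exI[of _ d] conjI assms(2) ballI impI)
   fix k :: 'a assume "k ~= 0 \<and> dist k 0 < d"
   then show "norm (norm (F (x + k) - F x - D k) / norm k) <= C * norm k"
    using assms(3)[of k] by (simp add: field_simps power2_eq_square)
  qed
  show "((%k. C * norm k) \<longlongrightarrow> 0) (at (0::'a))" by (auto intro!: tendsto_eq_intros)
 qed
qed

text \<open>The quadratic Taylor remainder of the kernel is uniform, so it can be integrated against
  any integrable \<open>h\<close>.\<close>

lemma conv_has_derivative:
 assumes h: "integrable lborel h" and t: "test_fun D ro"
 shows "(conv h ro has_derivative (%v. conv h (pd v ro) x)) (at x)"
proof -
 obtain K where K: "!!x k. \<bar>ro (x + k) - ro x - pd k ro x\<bar> <= K * (norm k)^2"
  using test_Taylor[OF t] by blast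
 have d: "ro differentiable (at x)" for x using smooth_on_differentiable[OF test_smooth[OF t]] by blast
 note i = conv_integrable[OF h t] conv_integrable[OF h test_fun_pd[OF t]]
 show ?thesis
 proof (rule has_derivative_quadratic[where d = 1])
  show "linear (%v. conv h (pd v ro) x)"
  proof
   show "conv h (pd (u + v) ro) x = conv h (pd u ro) x + conv h (pd v ro) x" for u v
    unfolding conv_def linear_add[OF pd_linear[OF d]] distrib_left using i(2) by simp
   show "conv h (pd (c *\<^sub>R v) ro) x = c *\<^sub>R conv h (pd v ro) x" for c v
    unfolding conv_def pd_scaleR[OF d] by (simp add: mult.left_commute)
  qed
  fix k
  have "conv h ro (x + k) - conv h ro x - conv h (pd k ro) x = (LBINT y. h y * (ro (x + k - y) - ro (x - y) - pd k ro (x - y)))"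
   unfolding conv_def right_diff_distrib using i by simp
  also have "\<bar>...\<bar> <= (LBINT y. \<bar>h y\<bar>) * (K * (norm k)^2)"
  proof (rule integral_mult_bound[OF h])
   show "integrable lborel (%y. h y * (ro (x + k - y) - ro (x - y) - pd k ro (x - y)))"
    unfolding right_diff_distrib using i by simp
   show "\<bar>ro (x + k - y) - ro (x - y) - pd k ro (x - y)\<bar> <= K * (norm k)^2" for y
    using K[of "x - y" k] by (simp add: algebra_simps)
  qed
  finally show "\<bar>conv h ro (x + k) - conv h ro x - conv h (pd k ro) x\<bar> <= (LBINT y. \<bar>h y\<bar>) * K * (norm k)^2" by (simp add: mult.assoc)
 qed simp
qed

lemma pd_conv: "integrable lborel h ==> test_fun D ro ==> pd v (conv h ro) = conv h (pd v ro)"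
 by (rule ext, rule pd_eqI[OF conv_has_derivative])

lemma smooth_conv: "integrable lborel h ==> test_fun D ro ==> smooth_on UNIV (conv h ro)"
 unfolding smooth_on_def
proof
 fix n assume h: "integrable lborel h" and "test_fun D ro"
 then show "Cn n UNIV (conv h ro)"
 proof (induction n arbitrary: ro)
  case (Suc n)
  then show ?case using conv_has_derivative[OF h Suc.prems(2)] Suc.IH[OF h test_fun_pd[OF Suc.prems(2)]]
   by (auto simp: pd_conv[OF h Suc.prems(2)] differentiable_def)
 qed simp
qed

lemma lborel_reflect: "distr lborel borel (%x. c - x) = (lborel :: 'a::euclidean_space measure)"
proof -
 have "lborel = density (distr lborel borel (%x::'a. c + (-1) *\<^sub>R x)) (%_. ennreal (\<bar>-1\<bar> ^ DIM('a)))"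
  by (rule lborel_affine) simp
 then show ?thesis by (simp add: density_1)
qed

text \<open>Near the origin, the convolution of \<open>f\<close> with the indicator of a large ball
  is constant, equal to the integral of \<open>f\<close>. Its derivative, which is the same
  convolution for \<open>pd v f\<close>, therefore vanishes.\<close>

lemma integral_pd_zero:
 fixes f :: "'a::euclidean_space => real"
 assumes "test_fun D f" shows "(LBINT x. pd v f x) = 0"
proof -
 obtain r where r: "tsupp f \<subseteq> ball 0 r"
  using assms bounded_subset_ballD compact_imp_bounded unfolding test_fun_iff by metis
 define h :: "'a => real" where "h = indicator (ball 0 (r + 1))"
 have h: "integrable lborel h" unfolding h_def
  using emeasure_lborel_ball_finite[of "0::'a" "r + 1"] by (intro integrable_real_indicator) auto
 have c: "conv h g x = (LBINT y. g y)" if g: "test_fun (tsupp f) g" and x: "norm x < 1" for g x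
 proof -
  have hg: "h y * g (x - y) = g (x - y)" for y
  proof (cases "x - y \<in> tsupp f")
   case True
   then have "norm (x - y) < r" using r by auto
   then have "norm y < r + 1" using norm_triangle_ineq4[of x "x - y"] x by simp
   then show ?thesis by (simp add: h_def)
  qed (use test_zero_outside[OF g] in simp)
  show ?thesis unfolding conv_def hg
   using integral_distr[of "%y. x - y" lborel borel g] borel_measurable_test[OF g] by (simp add: lborel_reflect)
 qed
 have t: "test_fun (tsupp f) f" using assms by (simp add: test_fun_iff)
 have "(LBINT x. pd v f x) = pd v (conv h f) 0" using c[OF test_fun_pd[OF t], of 0] by (simp add: pd_conv[OF h t])
 also have "... = pd v (%_. LBINT x. f x) (0::'a)" by (rule pd_cong[of "ball 0 1"]) (auto intro: c[OF t])
 finally show ?thesis by simp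
qed

lemma integration_by_parts:
 assumes "test_fun D g" "smooth_on UNIV f"
 shows "(LBINT x. f x * pd v g x) = - (LBINT x. pd v f x * g x)"
proof -
 have d: "f differentiable (at x)" "g differentiable (at x)" for x using smooth_on_differentiable assms test_smooth by blast+
 have "(LBINT x. pd v (%x. f x * g x) x) = 0" by (rule integral_pd_zero[OF test_fun_mult[OF assms]])
 moreover have "(%x. pd v (%x. f x * g x) x) = (%x. f x * pd v g x + pd v f x * g x)"
  using pd_mult[OF d] by simp
 moreover have "integrable lborel (%x. f x * pd v g x)"
  using test_integrable[OF test_fun_mult[OF test_fun_pd[OF assms(1)] assms(2)]] .
 moreover have "integrable lborel (%x. pd v f x * g x)"
  using test_integrable[OF test_fun_mult[OF assms(1) smooth_on_pd[OF assms(2)]]] .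
 ultimately show ?thesis by simp
qed

lemma lap_conv:
 assumes "integrable lborel h" "test_fun D ro"
 shows "lap_of (conv h ro) x = conv h (lap_of ro) x"
proof -
 have "lap_of (conv h ro) x = (\<Sum>i\<in>Basis. conv h (pd i (pd i ro)) x)"
  unfolding lap_of_pd pd_conv[OF assms] pd_conv[OF assms(1) test_fun_pd[OF assms(2)]] ..
 also have "... = conv h (lap_of ro) x" unfolding conv_def lap_of_pd sum_distrib_left
  by (rule integral_sum[symmetric]) (intro conv_integrable[OF assms(1) test_fun_pd[OF test_fun_pd[OF assms(2)]]])
 finally show ?thesis .
qed

lemma test_reflect:
 assumes "test_fun UNIV ro" "!!z. z \<notin> K ==> ro z = 0" "compact K" "(%z. x - z) ` K \<subseteq> D"
 shows "test_fun D (%y. ro (x - y))"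
proof (rule test_funI[where K = "(%z. x - z) ` K"])
 show "smooth_on UNIV (%y. ro (x - y))" using smooth_on_affine[OF test_smooth[OF assms(1)], of x "-1"] by simp
 show "compact ((%z. x - z) ` K)" by (intro compact_continuous_image continuous_intros assms)
 show "ro (x - y) = 0" if "y \<notin> (%z. x - z) ` K" for y
 proof (rule assms(2))
  show "x - y \<notin> K" using that by (metis (no_types, lifting) diff_diff_eq2 add_diff_cancel_left' image_eqI)
 qed
qed (rule assms)

lemma lap_reflect:
 assumes "test_fun UNIV ro" shows "lap_of (%y. ro (x - y)) y = lap_of ro (x - y)"
proof -
 have p1: "pd i (%y. f (x - y)) y = - pd i f (x - y)" if "test_fun UNIV f" for f y i
  using pd_affine[of f x "-1" y i] smooth_on_differentiable[OF test_smooth[OF that]] by simp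
 have t: "test_fun UNIV (pd i ro)" for i by (rule test_fun_pd[OF assms])
 have "pd i (pd i (%y. ro (x - y))) y = pd i (pd i ro) (x - y)" for i
 proof -
  have "pd i (%y. ro (x - y)) = (%y. - 1 * pd i ro (x - y))" using p1[OF assms] by auto
  moreover have "(%y. pd i ro (x - y)) differentiable (at y)"
   using smooth_on_differentiable[OF smooth_on_affine[OF test_smooth[OF t[of i]], of x "-1"] UNIV_I, of y] by simp
  ultimately have "pd i (pd i (%y. ro (x - y))) y = - 1 * pd i (%y. pd i ro (x - y)) y"
   by (simp only: pd_cmult)
  then show ?thesis using p1[OF t[of i], of i y] by simp
 qed
 then show ?thesis unfolding lap_of_pd by simp
qed

text \<open>\<open>sg\<close> is the inverse square of the support radius. In this parametrisation
  derivatives in \<open>z\<close> and in \<open>sg\<close> stay in the family up to polynomial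
  factors in \<open>z\<close>, since both only differentiate the profile
  \<open>flat p\<close>.\<close>

definition radk :: "real poly => real => 'a::euclidean_space => real" where
 "radk p sg z = flat p (1 - sg * (norm z)^2)"

definition flatD :: "real poly => real poly" where
 "flatD p = [:0, 0, 1:] * (p - pderiv p)"

lemma flat_deriv': "(flat p has_real_derivative flat (flatD p) s) (at s)" unfolding flatD_def by (rule flat_deriv)

lemma smooth_radk: "smooth_on UNIV (radk p sg)"
proof -
 have "smooth_on UNIV (%z::'a. flat p (1 - sg * (norm (z - 0))^2))"
  by (rule smooth_on_compose[OF open_UNIV smooth_flat]) (intro smooth_intros smooth_on_norm_sq open_UNIV)
 then show ?thesis by (simp add: radk_def[abs_def])
qed

lemma radk_zero: "sg > 0 ==> z \<notin> cball 0 (1 / sqrt sg) ==> radk p sg z = 0"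
proof -
 assume s: "sg > 0" and "z \<notin> cball 0 (1 / sqrt sg)"
 then have "1 / sqrt sg <= norm z" by simp
 then have "(1 / sqrt sg)^2 <= (norm z)^2" by (rule power_mono) (use s in auto)
 then have "1 <= sg * (norm z)^2" using s by (simp add: power_divide field_simps)
 then show ?thesis unfolding radk_def by (intro flat_eq_0) simp
qed

lemma test_radk: "sg > 0 ==> test_fun UNIV (radk p sg)"
 by (rule test_funI[where K = "cball 0 (1 / sqrt sg)"]) (auto simp: smooth_radk intro: radk_zero)

lemma pd_radk: "pd v (radk p sg) z = - 2 * sg * (z \<bullet> v) * radk (flatD p) sg z"
proof (rule pd_eqI)
 have "((%z. 1 - sg * (norm z)^2) has_derivative (%v. - 2 * sg * (z \<bullet> v))) (at z)"
  unfolding power2_norm_eq_inner by (auto intro!: derivative_eq_intros simp: inner_commute algebra_simps)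
 moreover have "(flat p has_derivative (*) (flat (flatD p) (1 - sg * (norm z)^2))) (at (1 - sg * (norm z)^2))"
  using flat_deriv' has_field_derivative_def by blast
 ultimately have "((flat p \<circ> (%z. 1 - sg * (norm z)^2)) has_derivative
  ((*) (flat (flatD p) (1 - sg * (norm z)^2)) \<circ> (%v. - 2 * sg * (z \<bullet> v)))) (at z)"
  by (rule diff_chain_at)
 then show "(radk p sg has_derivative (%v. - 2 * sg * (z \<bullet> v) * radk (flatD p) sg z)) (at z)"
  by (simp add: o_def radk_def[abs_def] mult_ac)
qed

lemma lap_radk:
 fixes z :: "'a::euclidean_space"
 shows "lap_of (radk p sg) z = - 2 * sg * (DIM('a) * radk (flatD p) sg z
  - 2 * sg * (norm z)^2 * radk (flatD (flatD p)) sg z)"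
proof -
 let ?q = "flatD p"
 have "pd i (pd i (radk p sg)) z = - 2 * sg * (radk ?q sg z - 2 * sg * (z \<bullet> i)^2 * radk (flatD ?q) sg z)"
  if i: "i \<in> Basis" for i :: 'a
 proof -
  have e: "pd i (radk p sg) = (%z. (- 2 * sg * (z \<bullet> i)) * radk ?q sg z)"
   by (rule ext) (simp add: pd_radk)
  have d1: "(%z. - 2 * sg * (z \<bullet> i)) differentiable (at z)" by (auto intro!: derivative_intros)
  have d2: "radk ?q sg differentiable (at z)" using smooth_on_differentiable[OF smooth_radk] by blast
  have "pd i (%z. - 2 * sg * (z \<bullet> i)) z = - 2 * sg"
   using i by (intro trans[OF pd_cmult]) (auto intro!: derivative_intros simp: inner_Basis)
  then show ?thesis unfolding e pd_mult[OF d1 d2] pd_radk by (simp add: power2_eq_square algebra_simps)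
 qed
 then have "lap_of (radk p sg) z
  = (\<Sum>i\<in>Basis. - 2 * sg * (radk ?q sg z - 2 * sg * (z \<bullet> i)^2 * radk (flatD ?q) sg z))"
  unfolding lap_of_pd by (intro sum.cong) auto
 also have "... = - 2 * sg * (DIM('a) * radk ?q sg z - 2 * sg * (\<Sum>i\<in>Basis. (z \<bullet> i)^2) * radk (flatD ?q) sg z)"
  by (simp add: right_diff_distrib sum_subtractf sum_distrib_left sum_distrib_right mult_ac sum_negf)
 also have "(\<Sum>i\<in>Basis. (z \<bullet> i)^2) = (norm z)^2"
  unfolding power2_norm_eq_inner euclidean_inner[of z z] by (simp add: power2_eq_square)
 finally show ?thesis .
qed

lemma flat_Taylor:
 "\<exists>C\<ge>0. \<forall>a b. a <= 1 --> b <= 1 --> \<bar>flat p b - flat p a - (b - a) * flat (flatD p) a\<bar> <= C * (b - a)^2"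
proof -
 \<comment> \<open>The cutoff makes the Taylor bound for test functions on the line applicable; it
   is 1 for \<open>t\<close> at most 2 and 0 from 3 on, while the arguments that occur are at most
   1.\<close>
 define m where "m t = smoothstep (3 - t) * flat p t" for t
 have "smooth_on UNIV (%t::real. smoothstep (3 - t \<bullet> 1))"
  by (rule smooth_on_compose[OF open_UNIV smooth_smoothstep]) (intro smooth_intros open_UNIV)
 then have sm: "smooth_on UNIV m" unfolding m_def by (intro smooth_on_mult smooth_flat open_UNIV) simp
 have tm: "test_fun UNIV m" by (rule test_funI[where K = "{0..3}"])
   (use sm in \<open>auto simp: m_def flat_eq_0 smoothstep_le_0 not_le\<close>)
 have meq: "m t = flat p t" if "t <= 2" for t using that by (simp add: m_def smoothstep_ge_1)
 obtain C where C: "C >= 0" "!!x k. \<bar>m (x + k) - m x - pd k m x\<bar> <= C * (norm k)^2"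
  using test_Taylor[OF tm] by blast
 have "\<bar>flat p b - flat p a - (b - a) * flat (flatD p) a\<bar> <= C * (b - a)^2" if "a <= 1" "b <= 1" for a b
 proof -
  have "pd (b - a) m a = pd (b - a) (flat p) a" by (rule pd_cong[where S = "{..<2}"]) (use meq that in auto)
  also have "... = flat (flatD p) a * (b - a)" by (rule pd_eqI) (use flat_deriv' has_field_derivative_def in blast)
  finally show ?thesis using C(2)[of a "b - a"] meq that by (simp add: mult.commute)
 qed
 then show "\<exists>C\<ge>0. \<forall>a b. a <= 1 --> b <= 1 --> \<bar>flat p b - flat p a - (b - a) * flat (flatD p) a\<bar> <= C * (b - a)^2"
  using C(1) by blast
qed

text \<open>The derivative profile of exp(-1/s); its polynomial is X^2, so it is nonnegative. With
  it the Laplacian of \<open>radk 1\<close> involves only \<open>radk prof\<close> and the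
  derivative of \<open>radk prof\<close> in the scale.\<close>

abbreviation prof :: "real poly" where "prof \<equiv> flatD 1"

lemma radk_conv_deriv:
 fixes h :: "'a::euclidean_space => real"
 assumes h: "integrable lborel h" "bounded S" "!!y. y \<notin> S ==> h y = 0" and s: "sg > 0"
 shows "((%sg. conv h (radk p sg) x) has_real_derivative
  - conv h (%z. (norm z)^2 * radk (flatD p) sg z) x) (at sg)"
proof -
 obtain C where C: "C >= 0" "!!a b. a <= 1 ==> b <= 1 ==> \<bar>flat p b - flat p a - (b - a) * flat (flatD p) a\<bar> <= C * (b - a)^2"
  using flat_Taylor by blast
 obtain r where r: "S \<subseteq> ball x r" using bounded_subset_ballD[OF h(2)] by blast
 have sN: "smooth_on UNIV (%z::'a. (norm z)^2)" using smooth_on_norm_sq[of UNIV 0] by simp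
 have tN: "test_fun UNIV (%z::'a. (norm z)^2 * radk q ta z)" if "ta > 0" for ta q
  by (rule test_fun_mult[OF test_radk[OF that] sN])
 note i = conv_integrable[OF h(1) test_radk] conv_integrable[OF h(1) tN]
 define D where "D = - conv h (%z. (norm z)^2 * radk (flatD p) sg z) x"
 define B where "B = (LBINT y. \<bar>h y\<bar>) * (C * r ^ 4)"
 have bd: "\<bar>conv h (radk p (sg + k)) x - conv h (radk p sg) x - D * k\<bar> <= B * (norm k)^2" if "norm k < sg" for k
 proof -
  have k: "sg + k > 0" using that by simp
  define g where "g y = radk p (sg + k) (x - y) - radk p sg (x - y) + k * ((norm (x - y))^2 * radk (flatD p) sg (x - y))" for y
  note i = i(1)[OF k, of p x] i(1)[OF s, of p x] i(2)[OF s, of x "flatD p"]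
  have g: "h y * g y = h y * radk p (sg + k) (x - y) - h y * radk p sg (x - y)
    + k * (h y * ((norm (x - y))^2 * radk (flatD p) sg (x - y)))" for y by (simp add: g_def algebra_simps)
  have "conv h (radk p (sg + k)) x - conv h (radk p sg) x - D * k = (LBINT y. h y * g y)"
   unfolding D_def conv_def g using i by (simp add: mult.commute)
  also have "\<bar>...\<bar> <= (LBINT y. \<bar>h y\<bar>) * (C * r ^ 4 * k^2)"
  proof (rule integral_mult_bound[OF h(1)])
   show "integrable lborel (%y. h y * g y)" unfolding g using i by simp
   fix y assume "h y ~= 0"
   then have "y \<in> S" using h(3) by blast
   define s where "s = (norm (x - y))^2"
   have s: "0 <= s" "s^2 <= r ^ 4"
   proof -
    have "norm (x - y) <= r" using \<open>y \<in> S\<close> r by (auto simp: dist_norm)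
    then show "s^2 <= r ^ 4" unfolding s_def power_mult[symmetric] by (simp add: power_mono)
   qed (simp add: s_def)
   have "\<bar>flat p (1 - (sg + k) * s) - flat p (1 - sg * s) - ((1 - (sg + k) * s) - (1 - sg * s)) * flat (flatD p) (1 - sg * s)\<bar>
    <= C * ((1 - (sg + k) * s) - (1 - sg * s))^2"
    by (rule C(2)) (use s k \<open>sg > 0\<close> in auto)
   also have "((1 - (sg + k) * s) - (1 - sg * s)) = - (k * s)" by (simp add: algebra_simps)
   also have "C * (- (k * s))^2 <= C * r ^ 4 * k^2"
    using mult_left_mono[OF s(2), of "C * k^2"] C(1) by (simp add: power_mult_distrib mult_ac)
   finally show "\<bar>g y\<bar> <= C * r ^ 4 * k^2" by (simp add: g_def radk_def algebra_simps flip: s_def)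
  qed
  finally show ?thesis by (simp add: B_def)
 qed
 show ?thesis unfolding has_field_derivative_def D_def[symmetric]
  by (rule has_derivative_quadratic[OF _ s bd]) (auto intro!: linearI simp: algebra_simps)
qed

definition weakly_harmonic :: "'a::euclidean_space set => ('a => real) => bool" where
 "weakly_harmonic D h \<longleftrightarrow> (\<forall>ph. test_fun D ph --> (LBINT x. h x * lap_of ph x) = 0)"

lemma weakly_harmonic_conv:
 assumes "weakly_harmonic D h" "test_fun UNIV ro" "!!z. z \<notin> cball 0 R ==> ro z = 0" "cball x R \<subseteq> D"
 shows "conv h (lap_of ro) x = 0"
proof -
 have "test_fun D (%y. ro (x - y))" by (rule test_reflect[OF assms(2), where K = "cball 0 R"])
   (use assms(3,4) in \<open>auto simp: dist_norm intro!: subsetD[OF assms(4)]\<close>)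
 then have "(LBINT y. h y * lap_of (%y. ro (x - y)) y) = 0" using assms(1) by (simp add: weakly_harmonic_def)
 then show ?thesis by (simp add: conv_def lap_reflect[OF assms(2)])
qed

text \<open>The Laplacian of the radial primitive of the kernel is its scaling derivative, so the
 normalised averages of a weakly harmonic function do not depend on the scale.\<close>

lemma radial_average_const:
 fixes h :: "'a::euclidean_space => real"
 assumes h: "integrable lborel h" "bounded S" "!!y. y \<notin> S ==> h y = 0" "weakly_harmonic D h"
  and s: "0 < sg" "sg <= ta" "cball x (1 / sqrt sg) \<subseteq> D"
 shows "sg powr (DIM('a) / 2) * conv h (radk prof sg) x = ta powr (DIM('a) / 2) * conv h (radk prof ta) x"
proof -
 define J where "J sg = conv h (radk prof sg) x" for sg
 define J' where "J' sg = - conv h (%z. (norm z)^2 * radk (flatD prof) sg z) x" for sg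
 have sN: "smooth_on UNIV (%z::'a. (norm z)^2)" using smooth_on_norm_sq[of UNIV 0] by simp
 \<comment> \<open>The equation n J + 2 ka J' = 0 says that ka^(n/2) J(ka) has zero derivative. It
   is weak harmonicity tested with \<open>radk 1 ka\<close>, since the convolution of
   \<open>h\<close> with the Laplacian of that kernel is -2 ka times the left side.\<close>
 have ode: "DIM('a) * J ka + 2 * ka * J' ka = 0" if k: "ka >= sg" for ka
 proof -
  have kp: "ka > 0" using k s by simp
  have "1 / sqrt ka <= 1 / sqrt sg" using k s by (intro divide_left_mono) auto
  then have "cball x (1 / sqrt ka) \<subseteq> D" using s(3) by (auto simp: subset_iff)
  then have "conv h (lap_of (radk 1 ka)) x = 0"
   by (intro weakly_harmonic_conv[OF h(4) test_radk[OF kp]]) (use radk_zero[OF kp] in auto)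
  moreover have "conv h (lap_of (radk 1 ka)) x = - 2 * ka * (DIM('a) * J ka + 2 * ka * J' ka)"
  proof -
   have i1: "integrable lborel (%y. h y * radk prof ka (x - y))"
    by (rule conv_integrable[OF h(1) test_radk[OF kp]])
   have i2: "integrable lborel (%y. h y * ((norm (x - y))^2 * radk (flatD prof) ka (x - y)))"
    by (rule conv_integrable[OF h(1) test_fun_mult[OF test_radk[OF kp] sN]])
   have "conv h (lap_of (radk 1 ka)) x = (LBINT y. - 2 * ka * DIM('a) * (h y * radk prof ka (x - y))
     + 4 * ka^2 * (h y * ((norm (x - y))^2 * radk (flatD prof) ka (x - y))))"
    unfolding conv_def lap_radk
    by (rule integral_cong[OF refl]) (simp add: algebra_simps power2_eq_square)
   also have "... = - 2 * ka * DIM('a) * J ka - 4 * ka^2 * J' ka"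
    using i1 i2 unfolding J_def J'_def conv_def by simp
   finally show ?thesis by (simp add: algebra_simps power2_eq_square)
  qed
  ultimately show ?thesis using kp by simp
 qed
 have "\<exists>c. \<forall>ka\<in>{sg..ta}. ka powr (DIM('a) / 2) * J ka = c"
 proof (rule has_field_derivative_zero_constant)
  show "((%ka. ka powr (DIM('a) / 2) * J ka) has_real_derivative 0) (at ka within {sg..ta})" if "ka \<in> {sg..ta}" for ka
  proof -
   have kp: "ka > 0" using that s by simp
   have dJ: "(J has_real_derivative J' ka) (at ka)" unfolding J_def J'_def by (rule radk_conv_deriv[OF h(1-3) kp])
   have dP: "((%ka. ka powr (DIM('a) / 2)) has_real_derivative DIM('a) / 2 * ka powr (DIM('a) / 2 - 1)) (at ka)"
    by (rule has_real_derivative_powr[OF kp])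
   have "DIM('a) / 2 * ka powr (DIM('a) / 2 - 1) * J ka + J' ka * ka powr (DIM('a) / 2)
    = ka powr (DIM('a) / 2 - 1) / 2 * (DIM('a) * J ka + 2 * ka * J' ka)"
   proof -
    have "ka powr (DIM('a) / 2) = ka powr (DIM('a) / 2 - 1) * ka" using kp by (simp add: powr_diff)
    then show ?thesis by (simp add: algebra_simps)
   qed
   also have "... = 0" using ode[of ka] that by simp
   finally show ?thesis using DERIV_mult[OF dP dJ] has_field_derivative_at_within by force
  qed
 qed auto
 then show ?thesis unfolding J_def using s by auto
qed

lemma radk_nonneg: "radk prof sg z >= 0" by (simp add: radk_def flat_def flatD_def)

definition kmass :: "'a::euclidean_space itself => real" where
 "kmass _ = (\<integral>z. radk prof 1 z \<partial>(lborel::'a measure))"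

lemma kmass_pos: "kmass TYPE('a::euclidean_space) > 0"
proof -
 have i: "integrable lborel (radk prof 1 :: 'a => real)" by (rule test_integrable[OF test_radk]) simp
 have "kmass TYPE('a) ~= 0"
 proof
  assume "kmass TYPE('a) = 0"
  then have "AE z in lborel. radk prof 1 (z::'a) = 0" using i by (simp add: kmass_def integral_nonneg_eq_0_iff_AE radk_nonneg)
  moreover have "radk prof 1 z ~= 0" if "z \<in> ball (0::'a) 1" for z
  proof -
   have "(norm z)^2 < 1^2" by (rule power_strict_mono) (use that in auto)
   then show ?thesis by (simp add: radk_def flat_def flatD_def)
  qed
  ultimately have "AE z in lborel. z \<notin> ball (0::'a) 1" by (auto elim: eventually_mono)
  then have "emeasure lborel (ball (0::'a) 1) = 0" by (subst AE_iff_measurable[symmetric]) auto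
  then show False using content_ball_pos[of 1 "0::'a"] by (simp add: measure_def)
 qed
 moreover have "kmass TYPE('a) >= 0" unfolding kmass_def by (intro integral_nonneg radk_nonneg)
 ultimately show ?thesis by simp
qed

lemma kmass_scale:
 fixes sg :: real
 assumes s: "sg > 0"
 shows "sg powr (DIM('a) / 2) * (\<integral>z. radk prof sg z \<partial>(lborel::'a::euclidean_space measure)) = kmass TYPE('a)"
proof -
 have "radk prof 1 (0 + sqrt sg *\<^sub>R z) = radk prof sg z" for z :: 'a
  using s by (simp add: radk_def power_mult_distrib)
 moreover have "sqrt sg ^ DIM('a) = sg powr (DIM('a) / 2)"
  using s by (simp add: powr_half_sqrt[symmetric] powr_powr powr_realpow[symmetric])
 ultimately show ?thesis
  using lborel_integral_affine[OF borel_measurable_test[OF test_radk[of 1 prof, where 'a = 'a]], of "sqrt sg" 0] s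
  by (simp add: kmass_def)
qed

definition moll :: "real => 'a::euclidean_space => real" where
 "moll sg z = sg powr (DIM('a) / 2) / kmass TYPE('a) * radk prof sg z"

lemma test_moll: "sg > 0 ==> test_fun UNIV (moll sg :: 'a::euclidean_space => real)"
 unfolding moll_def by (intro test_fun_cmult test_radk)

lemma moll_zero: "sg > 0 ==> z \<notin> cball 0 (1 / sqrt sg) ==> moll sg z = 0"
 using radk_zero[of sg z prof] by (simp add: moll_def)

lemma moll_nonneg: "moll sg z >= 0"
 unfolding moll_def using kmass_pos[where 'a = 'a] by (intro mult_nonneg_nonneg radk_nonneg) auto

lemma moll_mass: "sg > 0 ==> (\<integral>z. moll sg z \<partial>(lborel::'a::euclidean_space measure)) = 1"
 unfolding moll_def using kmass_scale[of sg, where 'a = 'a] kmass_pos[where 'a = 'a] by simp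

lemma moll_even: "moll sg (x - y) = moll sg (y - x)" by (simp add: moll_def radk_def norm_minus_commute)

lemma conv_moll:
 "conv h (moll sg) x = sg powr (DIM('a) / 2) * conv h (radk prof sg) (x::'a::euclidean_space) / kmass TYPE('a)"
 unfolding conv_def moll_def by (simp add: mult.left_commute flip: integral_mult_right_zero)

section \<open>Bounded Borel functions with bounded support\<close>

lemma continuous_bounded:
 fixes f :: "'a::euclidean_space => real"
 assumes "continuous_on UNIV f" "bounded S"
 shows "\<exists>K\<ge>0. \<forall>x\<in>S. \<bar>f x\<bar> <= K"
proof -
 have "bounded (f ` closure S)"
  by (rule compact_imp_bounded[OF compact_continuous_image[OF continuous_on_subset[OF assms(1) subset_UNIV]]])
   (use assms(2) in \<open>simp add: compact_closure\<close>)
 then obtain K where "\<forall>y\<in>f ` closure S. \<bar>y\<bar> <= K" unfolding bounded_iff by auto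
 then have "\<forall>x\<in>S. \<bar>f x\<bar> <= \<bar>K\<bar>" using closure_subset[of S] by force
 then show ?thesis by (intro exI[of _ "\<bar>K\<bar>"]) simp
qed

text \<open>A class closed under sums, products and translations, all of whose members are
  integrable; it settles integrability in the difference-quotient computations at the
  boundary.\<close>

definition bbs :: "('a::euclidean_space => real) => bool" where
 "bbs f \<longleftrightarrow> f \<in> borel_measurable borel \<and> (\<exists>K\<ge>0. \<forall>x. \<bar>f x\<bar> <= K) \<and> bounded {x. f x ~= 0}"

lemma bbsI:
 assumes "f \<in> borel_measurable borel" "!!x. \<bar>f x\<bar> <= K" "bounded S" "!!x. x \<notin> S ==> f x = 0"
 shows "bbs f"
proof -
 have "{x. f x ~= 0} \<subseteq> S" using assms(4) by blast
 then show ?thesis unfolding bbs_def using assms bounded_subset by (metis abs_ge_zero order_trans)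
qed

lemma bbs_borel: "bbs f ==> f \<in> borel_measurable borel" by (simp add: bbs_def)

lemma bbs_integrable: "bbs f ==> integrable lborel f"
 unfolding bbs_def using integrable_bounded_support[of f "{x. f x ~= 0}"] by blast

lemma bbs_test: "test_fun D f ==> bbs f"
 by (metis bbsI borel_measurable_test test_bounded test_fun_iff compact_imp_bounded not_in_tsupp)

lemma bbs_mult_bounded:
 assumes "bbs f" "g \<in> borel_measurable borel" "!!x. f x ~= 0 ==> \<bar>g x\<bar> <= K"
 shows "bbs (%x. f x * g x)"
proof -
 obtain B where B: "!!x. \<bar>f x\<bar> <= B" using assms(1) by (auto simp: bbs_def)
 show ?thesis
 proof (rule bbsI[where S = "{x. f x ~= 0}" and K = "B * \<bar>K\<bar>"])
  show "\<bar>f x * g x\<bar> <= B * \<bar>K\<bar>" for x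
   using B[of x] assms(3)[of x] unfolding abs_mult by (cases "f x = 0") (auto intro!: mult_mono)
 qed (use assms in \<open>auto simp: bbs_def\<close>)
qed

lemma bbs_mult: "bbs f ==> bbs g ==> bbs (%x. f x * g x)"
 using bbs_mult_bounded[of f g] by (auto simp: bbs_def)

lemma bbs_mult_continuous: "bbs f ==> continuous_on UNIV g ==> bbs (%x. f x * g x)"
 using bbs_mult_bounded[of f g] continuous_bounded[of g "{x. f x ~= 0}"] borel_measurable_continuous_onI[of g]
 by (auto simp: bbs_def)

lemma bbs_cmult: "bbs f ==> bbs (%x. c * f x)"
 using bbs_mult_continuous[of f "%x. c"] by (simp add: mult.commute)

lemma bbs_add:
 assumes "bbs f" "bbs g" shows "bbs (%x. f x + g x)"
proof -
 obtain A B where "!!x. \<bar>f x\<bar> <= A" "!!x. \<bar>g x\<bar> <= B" using assms by (auto simp: bbs_def)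
 then have "\<bar>f x + g x\<bar> <= A + B" for x by (meson abs_triangle_ineq add_mono order_trans)
 then show ?thesis
  by (rule bbsI[where S = "{x. f x ~= 0} \<union> {x. g x ~= 0}", rotated]) (use assms in \<open>auto simp: bbs_def\<close>)
qed

lemma bbs_diff: "bbs f ==> bbs g ==> bbs (%x. f x - g x)"
 using bbs_add[of f "%x. - 1 * g x"] bbs_cmult[of g "- 1"] by simp

lemma bbs_power2: "bbs f ==> bbs (%x. (f x)^2)" unfolding power2_eq_square by (rule bbs_mult)

lemma bbs_shift:
 assumes "bbs f" shows "bbs (%x. f (c + x))"
proof -
 obtain A where A: "!!x. \<bar>f x\<bar> <= A" using assms by (auto simp: bbs_def)
 show ?thesis
 proof (rule bbsI[where S = "(%x. - c + x) ` {x. f x ~= 0}", OF _ A])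
  show "(%x. f (c + x)) \<in> borel_measurable borel" using bbs_borel[OF assms] by simp
  show "bounded ((%x. - c + x) ` {x. f x ~= 0})" using assms by (intro bounded_translation) (simp add: bbs_def)
  show "f (c + x) = 0" if "x \<notin> (%x. - c + x) ` {x. f x ~= 0}" for x
   using that image_eqI[of x "%x. - c + x" "c + x" "{x. f x ~= 0}"] by auto
 qed
qed

lemma bbs_indicator: "S \<in> sets borel ==> bounded S ==> bbs (indicator S)"
 by (rule bbsI[where K = 1]) (auto simp: indicator_def)

lemma bbs_sum: "(!!i. i \<in> I ==> bbs (f i)) ==> bbs (%x. \<Sum>i\<in>I. f i x)"
proof (induction I rule: infinite_finite_induct)
 case (insert i I)
 then show ?case using bbs_add[of "f i" "%x. \<Sum>i\<in>I. f i x"] by simp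
qed (auto simp: bbs_def)

lemmas bbs_intros = bbs_cmult bbs_mult bbs_add bbs_diff bbs_power2 bbs_shift bbs_sum

lemma integral_swap_kernel:
 fixes f g :: "'a::euclidean_space => real"
 assumes f: "integrable lborel f" and g: "integrable lborel g"
  and k: "case_prod k \<in> borel_measurable (borel \<Otimes>\<^sub>M borel)" "!!x y. \<bar>k x y\<bar> <= K"
 shows "integrable lborel (%x. f x * (LBINT y. g y * k x y))"
  "(LBINT x. f x * (LBINT y. g y * k x y)) = (LBINT y. g y * (LBINT x. f x * k x y))"
proof -
 have [measurable]: "f \<in> borel_measurable borel" "g \<in> borel_measurable borel" using f g by auto
 have [measurable]: "case_prod k \<in> borel_measurable (lborel \<Otimes>\<^sub>M lborel)" using k(1) by simp
 define F where "F x y = f x * (g y * k x y)" for x y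
 have Fm: "case_prod F \<in> borel_measurable (lborel \<Otimes>\<^sub>M lborel)" unfolding F_def by measurable
 have iF: "integrable lborel (F x)" for x
  unfolding F_def using k by (intro integrable_mult_right integrable_mult_bounded[OF g, of _ K]) auto
 have "integrable (lborel \<Otimes>\<^sub>M lborel) (case_prod F)"
 proof (rule lborel_pair.Fubini_integrable[OF Fm])
  have b: "(LBINT y. norm (F x y)) <= K * (LBINT y. \<bar>g y\<bar>) * \<bar>f x\<bar>" for x
  proof -
   have "(LBINT y. norm (F x y)) <= (LBINT y. K * \<bar>f x\<bar> * \<bar>g y\<bar>)"
   proof (rule integral_mono[OF integrable_norm[OF iF]])
    show "norm (F x y) <= K * \<bar>f x\<bar> * \<bar>g y\<bar>" for y
     using mult_left_mono[OF k(2)[of x y], of "\<bar>f x\<bar> * \<bar>g y\<bar>"] by (simp add: F_def abs_mult mult_ac)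
   qed (use g in simp)
   then show ?thesis using g by (simp add: mult_ac)
  qed
  show "integrable lborel (%x. \<integral>y. norm (case_prod F (x, y)) \<partial>lborel)"
  proof (rule integrable_bound)
   show "integrable lborel (%x. K * (LBINT y. \<bar>g y\<bar>) * \<bar>f x\<bar>)" using f by simp
   show "AE x in lborel. norm (LBINT y. norm (case_prod F (x, y))) <= norm (K * (LBINT y. \<bar>g y\<bar>) * \<bar>f x\<bar>)"
    using b by (auto intro: order_trans[OF _ abs_ge_self])
  qed (use Fm in measurable)
 qed (use iF in simp)
 note i = this
 show "integrable lborel (%x. f x * (LBINT y. g y * k x y))" using lborel_pair.integrable_fst'[OF i] by (simp add: F_def)
 have "(LBINT y. (LBINT x. g y * (f x * k x y))) = (LBINT x. (LBINT y. F x y))"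
  using lborel_pair.Fubini_integral[OF i] by (simp add: F_def mult.left_commute)
 then show "(LBINT x. f x * (LBINT y. g y * k x y)) = (LBINT y. g y * (LBINT x. f x * k x y))" by (simp add: F_def)
qed

lemma lebesgue_on_borel:
 fixes F :: "'a::euclidean_space => real"
 assumes S: "S \<in> sets borel" and F: "F \<in> borel_measurable borel"
 shows "integrable (lebesgue_on S) F \<longleftrightarrow> integrable lborel (%x. indicator S x * F x)"
  "(LINT x|lebesgue_on S. F x) = (LBINT x. indicator S x * F x)"
proof -
 have "(%x. indicator S x * F x) \<in> borel_measurable lborel" using S F by simp
 then show "integrable (lebesgue_on S) F \<longleftrightarrow> integrable lborel (%x. indicator S x * F x)"
  "(LINT x|lebesgue_on S. F x) = (LBINT x. indicator S x * F x)"
  using S by (simp_all add: integrable_restrict_space integral_restrict_space integrable_completion integral_completion)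
qed

lemma bbs_continuous_on:
 "S \<in> sets borel ==> bounded S ==> continuous_on UNIV f ==> bbs (%x. indicator S x * f x)"
 by (rule bbs_mult_continuous[OF bbs_indicator])

section \<open>Weyl's lemma\<close>

lemma Cn_pointwise: "Cn n S f \<longleftrightarrow> (\<forall>x\<in>S. Cn n {x} f)" by (induction n arbitrary: f) auto

lemma smooth_on_local:
 assumes "!!x. x \<in> S ==> \<exists>T. x \<in> T \<and> smooth_on T f"
 shows "smooth_on S f" unfolding smooth_on_def
proof
 fix n
 have "Cn n {x} f" if "x \<in> S" for x using assms[OF that] Cn_mono[of n _ f "{x}"] unfolding smooth_on_def by blast
 then show "Cn n S f" using Cn_pointwise[of n S f] by blast
qed

lemma lap_cong:
 assumes "open S" "x \<in> S" "!!y. y \<in> S ==> f y = g y"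
 shows "lap_of f x = lap_of g x"
proof -
 have "pd i (pd i f) x = pd i (pd i g) x" for i by (rule pd_cong[OF assms(1,2)]) (rule pd_cong[OF assms(1) _ assms(3)])
 then show ?thesis unfolding lap_of_pd by simp
qed

lemma lap_diff:
 assumes S: "open S" "x \<in> S" and f: "smooth_on S f" and g: "smooth_on S g"
 shows "lap_of (%x. f x - g x) x = lap_of f x - lap_of g x"
proof -
 note sd = smooth_on_differentiable
 have "pd i (pd i (%x. f x - g x)) x = pd i (%y. pd i f y - pd i g y) x" for i
  by (rule pd_cong[OF S], rule pd_diff) (erule sd[OF f], erule sd[OF g])
 then have "pd i (pd i (%x. f x - g x)) x = pd i (pd i f) x - pd i (pd i g) x" for i
  by (rule trans) (rule pd_diff[OF sd[OF smooth_on_pd[OF f] S(2)] sd[OF smooth_on_pd[OF g] S(2)]])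
 then show ?thesis unfolding lap_of_pd by (simp add: sum_subtractf)
qed

text \<open>The product is smooth on \<open>D\<close> and vanishes on the open complement of the
  support of the cutoff, and these two open sets cover the space. The values of \<open>W\<close>
  outside \<open>D\<close> may be arbitrary.\<close>

lemma test_mult_local:
 assumes t: "test_fun D et" and D: "open D" and W: "smooth_on D W"
 shows "test_fun D (%x. W x * et x)"
proof (rule test_funI[where K = "tsupp et"])
 have "smooth_on D (%x. W x * et x)" by (intro smooth_on_mult D W smooth_on_mono[OF test_smooth[OF t]]) auto
 moreover have "smooth_on (- tsupp et) (%x. W x * et x)"
  by (rule smooth_on_cong[of _ "%x. 0"]) (use not_in_tsupp[of _ et] in auto)
 ultimately have "smooth_on (D \<union> - tsupp et) (%x. W x * et x)" by (rule smooth_on_Un)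
 moreover have "D \<union> - tsupp et = UNIV" using t by (auto simp: test_fun_iff)
 ultimately show "smooth_on UNIV (%x. W x * et x)" by simp
qed (use t not_in_tsupp[of _ et] in \<open>auto simp: test_fun_iff\<close>)

lemma AE_eq_continuous:
 fixes f g :: "'a::euclidean_space => real"
 assumes "open B" "continuous_on B f" "continuous_on B g" "AE x in lborel. x \<in> B --> f x = g x" "x \<in> B"
 shows "f x = g x"
proof (rule ccontr)
 assume ne: "f x ~= g x"
 have "continuous_on B (%x. f x - g x)" by (intro continuous_intros assms)
 then have "open (B \<inter> (%x. f x - g x) -` (- {0}))" by (rule continuous_open_preimage[OF _ assms(1)]) auto
 moreover have "x \<in> B \<inter> (%x. f x - g x) -` (- {0})" using ne assms(5) by simp
 ultimately obtain e where e: "e > 0" "ball x e \<subseteq> B \<inter> (%x. f x - g x) -` (- {0})"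
  unfolding open_contains_ball by blast
 have "AE y in lborel. y \<notin> ball x e" using assms(4) by eventually_elim (use e in auto)
 then have "emeasure lborel (ball x e) = 0" by (subst AE_iff_measurable[symmetric]) auto
 then show False using content_ball_pos[OF e(1), of x] by (simp add: measure_def)
qed

lemma integrable_lebesgue_on_lborel:
 fixes f :: "'a::euclidean_space => real"
 assumes "open D" "integrable lborel F" "!!x. x \<in> D ==> F x = f x"
 shows "integrable (lebesgue_on D) f"
proof -
 have "integrable lborel (%x. F x * indicator D x)"
 proof (rule integrable_mult_bounded[OF assms(2)])
  show "(%x. indicator D x) \<in> borel_measurable lborel" using assms(1) by simp
  show "\<bar>indicator D x :: real\<bar> <= 1" for x by (simp add: indicator_def)
 qed
 then have "integrable lebesgue (%x. F x * indicator D x)" by (subst integrable_completion) auto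
 moreover have "(%x. F x * indicator D x) = (%x. indicator D x *\<^sub>R f x)"
  using assms(3) by (auto simp: indicator_def fun_eq_iff)
 ultimately show ?thesis using assms(1) by (subst integrable_restrict_space) auto
qed

lemma AE_lebesgue_on_lborel:
 assumes "open D" shows "(AE x in lebesgue_on D. P x) \<longleftrightarrow> (AE x in lborel. x \<in> D --> P x)"
 using assms by (simp add: AE_restrict_space_iff AE_completion_iff)

lemma moll_approx:
 fixes ph :: "'a::euclidean_space => real"
 assumes t: "test_fun D ph" and s: "sg > 0" and K: "!!x y. \<bar>ph x - ph y\<bar> <= K * norm (x - y)" "K >= 0"
 shows "\<bar>conv ph (moll sg) y - ph y\<bar> <= K / sqrt sg"
proof -
 have tm: "test_fun UNIV (moll sg :: 'a => real)" by (rule test_moll[OF s])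
 have mass: "(LBINT z. moll sg (y - z)) = 1"
  unfolding moll_even[of sg y] using lborel_integral_shift[of "moll sg" "- y"] moll_mass[OF s, where 'a = 'a] by simp
 have im: "integrable lborel (%z. moll sg (y - z))"
  unfolding moll_even[of sg y] using integrable_shift[OF test_integrable[OF tm], of "- y"] by simp
 have i: "integrable lborel (%z. ph z * moll sg (y - z))" by (rule conv_integrable[OF test_integrable[OF t] tm])
 have "conv ph (moll sg) y - ph y = (LBINT z. moll sg (y - z) * (ph z - ph y))"
  using i im mass by (simp add: conv_def left_diff_distrib mult.commute[of "moll sg _"])
 also have "\<bar>...\<bar> <= (LBINT z. \<bar>moll sg (y - z)\<bar>) * (K / sqrt sg)"
 proof (rule integral_mult_bound[OF im])
  show "integrable lborel (%z. moll sg (y - z) * (ph z - ph y))"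
   using i im by (simp add: left_diff_distrib mult.commute[of "moll sg _"])
  fix z assume "moll sg (y - z) ~= 0"
  then have "norm (y - z) <= 1 / sqrt sg" using moll_zero[OF s, of "y - z"] by force
  then show "\<bar>ph z - ph y\<bar> <= K / sqrt sg"
   using K(1)[of z y] mult_left_mono[OF _ K(2), of "norm (y - z)" "1 / sqrt sg"] by (simp add: norm_minus_commute)
 qed
 finally show ?thesis using mass by (simp add: abs_of_nonneg[OF moll_nonneg])
qed

lemma conv_swap:
 fixes h ph ro :: "'a::euclidean_space => real"
 assumes h: "integrable lborel h" and p: "integrable lborel ph" and r: "test_fun UNIV ro"
  and ev: "!!x y. ro (x - y) = ro (y - x)"
 shows "(LBINT x. conv h ro x * ph x) = (LBINT y. h y * conv ph ro y)"
proof -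
 obtain K where K: "!!x. \<bar>ro x\<bar> <= K" using test_bounded[OF r] by blast
 have [measurable]: "ro \<in> borel_measurable borel" by (rule borel_measurable_test[OF r])
 have "conv ph ro y = (LBINT x. ph x * ro (x - y))" for y by (simp only: conv_def ev[of y])
 moreover have "(LBINT x. conv h ro x * ph x) = (LBINT x. ph x * (LBINT y. h y * ro (x - y)))" by (simp add: conv_def mult.commute)
 moreover have "... = (LBINT y. h y * (LBINT x. ph x * ro (x - y)))" by (rule integral_swap_kernel(2)[OF p h _ K]) measurable
 ultimately show ?thesis by simp
qed

text \<open>Averages at all admissible scales agree, so they define one function \<open>V\<close>;
  near a given point a single scale serves, whence smoothness and harmonicity. The formula for
  \<open>V\<close> by averages is part of the conclusion because the gradient estimate rests on
  it.\<close>

theorem Weyl: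
 fixes h :: "'a::euclidean_space => real"
 assumes D: "open D" "bounded D" and h: "integrable lborel h" "bounded S" "!!y. y \<notin> S ==> h y = 0" "weakly_harmonic D h"
 obtains V where "smooth_on D V" "!!x. x \<in> D ==> lap_of V x = 0" "AE x in lborel. x \<in> D --> V x = h x"
  "!!x sg. sg > 0 ==> cball x (1 / sqrt sg) \<subseteq> D ==> V x = conv h (moll sg) x"
proof -
 define s where "s x = (SOME sg. sg > 0 \<and> cball x (1 / sqrt sg) \<subseteq> D)" for x
 define V where "V x = conv h (moll (s x)) x" for x
 have sqr: "1 / sqrt (1 / e^2) = e" if "e > 0" for e :: real using that by (simp add: real_sqrt_divide)
 have sx: "s x > 0 \<and> cball x (1 / sqrt (s x)) \<subseteq> D" if "sg > 0" "cball x (1 / sqrt sg) \<subseteq> D" for x sg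
  unfolding s_def by (rule someI[of _ sg]) (use that in auto)
 have cc: "conv h (moll sg) x = conv h (moll ta) x"
  if "sg > 0" "sg <= ta" "cball x (1 / sqrt sg) \<subseteq> D" for x sg ta
  unfolding conv_moll using radial_average_const[OF h that] by simp
 have Veq: "V x = conv h (moll sg) x" if "sg > 0" "cball x (1 / sqrt sg) \<subseteq> D" for x sg
 proof (cases "sg <= s x")
  case True
  show ?thesis unfolding V_def by (rule cc[OF that(1) True that(2), symmetric])
 next
  case False
  then show ?thesis unfolding V_def using sx[OF that] by (intro cc) auto
 qed
 have local: "\<exists>e>0. ball x e \<subseteq> D \<and> (\<forall>y\<in>ball x e. cball y e \<subseteq> D \<and> V y = conv h (moll (1 / e^2)) y)" if x: "x \<in> D" for x
 proof -
  obtain r where r: "r > 0" "cball x r \<subseteq> D" using D(1) x open_contains_cball by blast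
  define e where "e = r / 2"
  have e: "e > 0" using r by (simp add: e_def)
  have c: "cball y e \<subseteq> D" if "y \<in> ball x e" for y
  proof
   fix z assume "z \<in> cball y e"
   then have "dist x z <= r" using dist_triangle[of x z y] that by (simp add: e_def)
   then show "z \<in> D" using r(2) by auto
  qed
  have "V y = conv h (moll (1 / e^2)) y" if "y \<in> ball x e" for y by (rule Veq) (use e c[OF that] sqr[OF e] in auto)
  moreover have "ball x e \<subseteq> D" using r(2) e by (auto simp: e_def)
  ultimately show ?thesis using e c by blast
 qed
 have sV: "smooth_on D V"
 proof (rule smooth_on_local)
  fix x assume "x \<in> D"
  then obtain e where e: "e > 0" "ball x e \<subseteq> D" "!!y. y \<in> ball x e ==> V y = conv h (moll (1 / e^2)) y"
   using local by blast
  have "smooth_on (ball x e) (conv h (moll (1 / e^2)))"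
   by (rule smooth_on_mono[OF smooth_conv[OF h(1) test_moll]]) (use e in auto)
  then have "smooth_on (ball x e) V" by (rule smooth_on_cong[rotated 2]) (use e(3) in auto)
  then show "\<exists>T. x \<in> T \<and> smooth_on T V" using e(1) by (intro exI[of _ "ball x e"]) auto
 qed
 have lV: "lap_of V x = 0" if x: "x \<in> D" for x
 proof -
  obtain e where e0: "e > 0" "\<forall>y\<in>ball x e. cball y e \<subseteq> D \<and> V y = conv h (moll (1 / e^2)) y"
   using local[OF x] by blast
  have e: "e > 0" "cball x e \<subseteq> D" "!!y. y \<in> ball x e ==> V y = conv h (moll (1 / e^2)) y"
   using e0(1) bspec[OF e0(2), of x] bspec[OF e0(2)] by auto
  have e2: "1 / e^2 > 0" using e by simp
  have "lap_of V x = lap_of (conv h (moll (1 / e^2))) x" by (rule lap_cong[of "ball x e"]) (use e in auto)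
  also have "... = conv h (lap_of (moll (1 / e^2))) x" by (rule lap_conv[OF h(1) test_moll[OF e2]])
  also have "... = 0" by (rule weakly_harmonic_conv[OF h(4) test_moll[OF e2] _ e(2)])
    (use moll_zero[OF e2] sqr[OF e(1)] in auto)
  finally show ?thesis .
 qed
 \<comment> \<open>On \<open>Dn n\<close> all scales beyond a fixed one are admissible at once, so
   the mollification parameter can be sent to infinity there.\<close>
 define Dn where "Dn n = {x. infdist x (- D) > 1 / real (Suc n)}" for n
 have nD: "- D ~= {}" using D(2) not_bounded_UNIV by (metis Compl_empty_eq double_compl)
 have cD: "closed (- D)" using D(1) by (simp add: closed_Compl)
 have oDn: "open (Dn n)" for n unfolding Dn_def by (intro open_Collect_less continuous_intros)
 have cDn: "cball x (1 / real (Suc n)) \<subseteq> D" if "x \<in> Dn n" for n x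
 proof
  fix y assume y: "y \<in> cball x (1 / real (Suc n))"
  show "y \<in> D"
  proof (rule ccontr)
   assume "y \<notin> D"
   then have "infdist x (- D) <= dist x y" by (intro infdist_le) auto
   then show False using y that by (auto simp: Dn_def)
  qed
 qed
 have DnD: "Dn n \<subseteq> D" for n
 proof
  fix x assume "x \<in> Dn n"
  then have "cball x (1 / real (Suc n)) \<subseteq> D" by (rule cDn)
  moreover have "x \<in> cball x (1 / real (Suc n))" by simp
  ultimately show "x \<in> D" by blast
 qed
 have DUn: "\<exists>n. x \<in> Dn n" if "x \<in> D" for x
 proof -
  have "infdist x (- D) ~= 0" using in_closed_iff_infdist_zero[OF cD nD, of x] that by simp
  then have "infdist x (- D) > 0" using infdist_nonneg[of x "- D"] by linarith
  then show ?thesis unfolding Dn_def using nat_approx_posE by blast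
 qed
 have AEn: "AE x in lborel. x \<in> Dn n --> V x = h x" for n
 proof -
  define sg where "sg = (real (Suc n))^2"
  have s: "sg > 0" "1 / sqrt sg = 1 / real (Suc n)" by (auto simp: sg_def)
  have VD: "V x = conv h (moll ta) x" if "x \<in> Dn n" "ta >= sg" for x ta
  proof -
   have "cball x (1 / sqrt sg) \<subseteq> D" using cDn[OF that(1)] s by simp
   then show ?thesis using Veq[of sg x] cc[of sg ta x] s that by simp
  qed
  have cm: "continuous_on UNIV (conv h (moll sg))"
   by (rule smooth_on_continuous[OF smooth_conv[OF h(1) test_moll[OF s(1)]]])
  have bD: "bounded (Dn n)" using bounded_subset[OF D(2) DnD] .
  define F where "F x = indicator (Dn n) x * conv h (moll sg) x - h x" for x
  have iF: "integrable lborel F" unfolding F_def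
   by (intro integrable_diff h bbs_integrable[OF bbs_continuous_on[OF _ bD cm]] borel_open oDn)
  have "AE x in lebesgue_on (Dn n). F x = 0"
  proof (rule fundamental_lemma[OF oDn bD])
   show "integrable (lebesgue_on (Dn n)) F" by (rule integrable_lebesgue_on_lborel[OF oDn iF]) simp
   fix ph assume t: "test_fun (Dn n) ph"
   obtain L where L: "L >= 0" "!!x y. \<bar>ph x - ph y\<bar> <= L * norm (x - y)" using test_Lipschitz[OF t] by blast
   have ip: "integrable lborel ph" by (rule test_integrable[OF t])
   define A where "A = (LBINT x. conv h (moll sg) x * ph x)"
   define B where "B = (LBINT x. h x * ph x)"
   have hp: "integrable lborel (%x. h x * ph x)"
    using test_bounded[OF t] borel_measurable_test[OF t] by (auto intro: integrable_mult_bounded[OF h(1)])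
   \<comment> \<open>\<open>A\<close> does not depend on \<open>ta\<close>, because \<open>V\<close>
     is the average at each of these scales. Moving the even mollifier onto the smooth test function
     shows that \<open>A\<close> is as close to \<open>B\<close> as desired.\<close>
   have close: "\<bar>A - B\<bar> <= L / sqrt ta * (LBINT y. \<bar>h y\<bar>)" if t2: "ta >= sg" for ta
   proof -
    have tp: "ta > 0" using t2 s by simp
    have "A = (LBINT x. conv h (moll ta) x * ph x)" unfolding A_def
    proof (rule integral_cong[OF refl])
     fix x show "conv h (moll sg) x * ph x = conv h (moll ta) x * ph x"
      using VD[of x sg] VD[of x ta] t2 test_zero_outside[OF t, of x] by (cases "x \<in> Dn n") auto
    qed
    also have "... = (LBINT y. h y * conv ph (moll ta) y)"
     by (rule conv_swap[OF h(1) ip test_moll[OF tp] moll_even])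
    finally have A: "A = (LBINT y. h y * conv ph (moll ta) y)" .
    have ma: "\<bar>conv ph (moll ta) y - ph y\<bar> <= L / sqrt ta" for y by (rule moll_approx[OF t tp L(2,1)])
    have mm: "(%y. conv ph (moll ta) y - ph y) \<in> borel_measurable lborel"
     using borel_measurable_continuous_onI[OF smooth_on_continuous[OF smooth_conv[OF ip test_moll[OF tp]]]]
      borel_measurable_test[OF t] by (intro borel_measurable_diff) auto
    have id: "integrable lborel (%y. h y * (conv ph (moll ta) y - ph y))"
     by (rule integrable_mult_bounded[OF h(1) mm ma])
    have "integrable lborel (%y. h y * conv ph (moll ta) y)"
     using integrable_add[OF id hp] by (simp add: right_diff_distrib)
    then have "A - B = (LBINT y. h y * (conv ph (moll ta) y - ph y))"
     unfolding A B_def using hp by (simp add: right_diff_distrib)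
    then show ?thesis using integral_mult_bound[OF h(1) id ma] by (simp add: mult.commute)
   qed
   have "\<bar>A - B\<bar> <= 0"
   proof (rule tendsto_lowerbound)
    show "((%ta. L / sqrt ta * (LBINT y. \<bar>h y\<bar>)) \<longlongrightarrow> 0) at_top"
     by (intro tendsto_mult_left_zero real_tendsto_divide_at_top[OF tendsto_const] sqrt_at_top)
    show "\<forall>\<^sub>F ta in at_top. \<bar>A - B\<bar> <= L / sqrt ta * (LBINT y. \<bar>h y\<bar>)"
     using eventually_ge_at_top[of sg] by eventually_elim (rule close)
   qed simp
   then have "A = B" by simp
   have cp: "integrable lborel (%x. conv h (moll sg) x * ph x)"
    by (rule test_integrable[OF test_fun_mult[OF t smooth_conv[OF h(1) test_moll[OF s(1)]]]])
   have "(LINT x|lebesgue_on (Dn n). F x * ph x) = (LBINT x. F x * ph x)" by (rule lebesgue_on_integral_lborel[OF oDn])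
     (use iF borel_measurable_test[OF t] test_zero_outside[OF t] in auto)
   also have "... = (LBINT x. conv h (moll sg) x * ph x - h x * ph x)"
   proof (rule integral_cong[OF refl])
    fix x show "F x * ph x = conv h (moll sg) x * ph x - h x * ph x"
     using test_zero_outside[OF t, of x] by (cases "x \<in> Dn n") (auto simp: F_def left_diff_distrib)
   qed
   also have "... = A - B" unfolding A_def B_def using cp hp by simp
   finally show "(LINT x|lebesgue_on (Dn n). F x * ph x) = 0" using \<open>A = B\<close> by simp
  qed
  then have "AE x in lborel. x \<in> Dn n --> F x = 0" using AE_lebesgue_on_lborel[OF oDn, of "%x. F x = 0" n] by simp
  then show ?thesis by eventually_elim (use VD[of _ sg] in \<open>auto simp: F_def\<close>)
 qed
 have "AE x in lborel. \<forall>n. x \<in> Dn n --> V x = h x" by (subst AE_all_countable) (blast intro: AEn)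
 then have "AE x in lborel. x \<in> D --> V x = h x" by eventually_elim (use DUn in blast)
 then show ?thesis using that sV lV Veq by blast
qed

section \<open>Interior gradient estimates\<close>

lemma lap_weak:
 assumes t: "test_fun D ph" and sf: "smooth_on UNIV f"
 shows "(LBINT x. f x * lap_of ph x) = (LBINT x. lap_of f x * ph x)"
proof -
 have "(LBINT x. f x * pd i (pd i ph) x) = (LBINT x. pd i (pd i f) x * ph x)" for i
  using integration_by_parts[OF test_fun_pd[OF t] sf, of i] integration_by_parts[OF t smooth_on_pd[OF sf], of i i] by simp
 moreover have "integrable lborel (%x. f x * pd i (pd i ph) x)" for i
  using test_integrable[OF test_fun_mult[OF test_fun_pd[OF test_fun_pd[OF t]] sf]] .
 moreover have "integrable lborel (%x. pd i (pd i f) x * ph x)" for i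
  using test_integrable[OF test_fun_mult[OF t smooth_on_pd[OF smooth_on_pd[OF sf]]]] .
 ultimately show ?thesis unfolding lap_of_pd sum_distrib_left sum_distrib_right by (simp add: integral_sum)
qed

text \<open>An L^1 bound for the gradient of the unit mollifier, written with \<open>0 - u\<close>
  so that the lemmas on reflected test functions apply. Dilation contributes the factor
  \<open>sqrt sg\<close>.\<close>

definition grad_const :: "'a::euclidean_space itself => real" where
 "grad_const _ = (LBINT u. \<Sum>i\<in>Basis. \<bar>pd i (moll 1) (0 - u :: 'a)\<bar>)"

lemma test_reflect_UNIV: "test_fun UNIV f ==> test_fun UNIV (%y. f (x - y))"
 by (rule test_reflect[where K = "tsupp f"]) (auto simp: test_fun_iff not_in_tsupp[of _ f])

lemma grad_const:
 shows "grad_const TYPE('a::euclidean_space) >= 0"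
  and "sg > 0 ==> (LBINT y. \<bar>pd v (moll sg) (x - y :: 'a)\<bar>) <= grad_const TYPE('a) * sqrt sg * norm v"
proof -
 show "grad_const TYPE('a) >= 0" unfolding grad_const_def by (intro integral_nonneg sum_nonneg) simp
 assume s: "sg > 0"
 define N where "N = sqrt sg ^ DIM('a)"
 have N: "N > 0" "sg powr (DIM('a) / 2) = N"
  using s by (simp_all add: N_def powr_half_sqrt[symmetric] powr_powr powr_realpow[symmetric])
 define f where "f w u = \<bar>pd w (moll 1) (0 - u :: 'a)\<bar>" for w u
 have d: "moll 1 differentiable (at z)" for z :: 'a by (rule smooth_on_differentiable[OF test_smooth[OF test_moll]]) auto
 have dd: "(%z. moll 1 (0 + sqrt sg *\<^sub>R z)) differentiable (at z)" for z :: 'a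
  by (rule smooth_on_differentiable[OF smooth_on_affine[OF test_smooth[OF test_moll]]]) auto
 have t: "test_fun UNIV (%u. pd w (moll 1) (0 - u :: 'a))" for w by (intro test_reflect_UNIV test_fun_pd test_moll) simp
 have fi: "integrable lborel (f w)" "f w \<in> borel_measurable borel" for w
  using test_integrable[OF t[of w]] borel_measurable_test[OF t[of w]] by (simp_all add: f_def[abs_def])
 have "moll sg = (%z. N * moll 1 (0 + sqrt sg *\<^sub>R z :: 'a))"
  using s by (simp add: moll_def radk_def power_mult_distrib N fun_eq_iff)
 then have "pd v (moll sg) z = N * (sqrt sg * pd v (moll 1) (0 + sqrt sg *\<^sub>R z))" for z :: 'a
  by (simp only: pd_cmult[OF dd] pd_affine[OF d])
 then have "\<bar>pd v (moll sg) (x - y)\<bar> = sqrt sg * (N * f v (- (sqrt sg *\<^sub>R x) + sqrt sg *\<^sub>R y))" for y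
  using s N by (simp add: f_def abs_mult scaleR_diff_right mult_ac)
 then have "(LBINT y. \<bar>pd v (moll sg) (x - y)\<bar>) = sqrt sg * (LBINT u. f v u)"
  using lborel_integral_affine[OF fi(2)[of v], of "sqrt sg" "- (sqrt sg *\<^sub>R x)"] s by (simp flip: N_def)
 also have "(LBINT u. f v u) <= (LBINT u. norm v * (\<Sum>i\<in>Basis. f i u))"
 proof (rule integral_mono[OF fi(1)])
  show "integrable lborel (%u. norm v * (\<Sum>i\<in>Basis. f i u))" using fi(1) by simp
  fix u
  have "f v u <= norm (grad_of (moll 1) (0 - u)) * norm v" unfolding f_def pd_grad[OF d, of v] by (rule Cauchy_Schwarz_ineq2)
  also have "... <= (\<Sum>i\<in>Basis. f i u) * norm v"
   unfolding grad_of_pd f_def by (intro mult_right_mono sum_norm_le) auto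
  finally show "f v u <= norm v * (\<Sum>i\<in>Basis. f i u)" by (simp add: mult.commute)
 qed
 finally show "(LBINT y. \<bar>pd v (moll sg) (x - y)\<bar>) <= grad_const TYPE('a) * sqrt sg * norm v"
  using s by (simp add: grad_const_def f_def mult_ac)
qed

text \<open>Cutting \<open>W\<close> off by the indicator of a ball gives a function on the whole
  space of the kind that \<open>Weyl\<close> expects. The integration by parts is carried out with a
  test function that agrees with \<open>W\<close> on the ball.\<close>

lemma weakly_harmonic_smooth:
 fixes W :: "'a::euclidean_space => real"
 assumes D: "open D" and W: "smooth_on D W" "!!y. y \<in> D ==> lap_of W y = 0" and c: "cball x0 R \<subseteq> D"
 shows "weakly_harmonic (ball x0 R) (%y. indicator (ball x0 R) y * W y)"
  and "(%y. indicator (ball x0 R) y * W y) \<in> borel_measurable borel"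
proof -
 obtain et U where e: "test_fun D et" "open U" "cball x0 R \<subseteq> U" "!!x. x \<in> U ==> et x = 1"
  using exists_cutoff[OF compact_cball D c] by metis
 define W' where "W' y = W y * et y" for y
 have tW: "test_fun D W'" unfolding W'_def by (rule test_mult_local[OF e(1) D W(1)])
 have W'W: "W' y = W y" if "y \<in> ball x0 R" for y using that e(3) e(4)[of y] by (auto simp: W'_def subset_iff)
 have eq: "(%y. indicator (ball x0 R) y * W y) = (%y. indicator (ball x0 R) y * W' y)"
  using W'W by (auto simp: indicator_def fun_eq_iff)
 have "(%y. indicator (ball x0 R) y * W' y) \<in> borel_measurable borel"
  by (intro borel_measurable_times borel_measurable_indicator borel_measurable_test[OF tW]) auto
 then show "(%y. indicator (ball x0 R) y * W y) \<in> borel_measurable borel" by (simp only: eq)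
 show "weakly_harmonic (ball x0 R) (%y. indicator (ball x0 R) y * W y)" unfolding weakly_harmonic_def
 proof (intro allI impI)
  fix ph assume t: "test_fun (ball x0 R) ph"
  have "(LBINT x. indicator (ball x0 R) x * W x * lap_of ph x) = (LBINT x. W' x * lap_of ph x)"
  proof (rule integral_cong[OF refl])
   fix x show "indicator (ball x0 R) x * W x * lap_of ph x = W' x * lap_of ph x"
    using W'W[of x] test_zero_outside[OF test_fun_lap[OF t], of x] by (cases "x \<in> ball x0 R") auto
  qed
  also have "... = (LBINT x. lap_of W' x * ph x)" by (rule lap_weak[OF t test_smooth[OF tW]])
  also have "... = (\<integral>x. 0 \<partial>(lborel::'a measure))"
  proof (rule integral_cong[OF refl])
   fix x show "lap_of W' x * ph x = 0"
   proof (cases "x \<in> ball x0 R")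
    case True
    have "lap_of W' x = lap_of W x" by (rule lap_cong[of "ball x0 R"]) (use True W'W in auto)
    then show ?thesis using W(2)[of x] True c by (auto simp: subset_iff)
   qed (use test_zero_outside[OF t] in simp)
  qed
  finally show "(LBINT x. indicator (ball x0 R) x * W x * lap_of ph x) = 0" by simp
 qed
qed

text \<open>By Weyl's lemma on the ball, \<open>W\<close> is its own average with radius R / 2 at
  points within R / 2 of the centre, so the derivative can be put on the mollifier.\<close>

lemma harmonic_gradient_estimate:
 fixes W :: "'a::euclidean_space => real"
 assumes D: "open D" and W: "smooth_on D W" "!!y. y \<in> D ==> lap_of W y = 0"
  and R: "R > 0" "cball x0 R \<subseteq> D" and M: "!!y. y \<in> ball x0 R ==> \<bar>W y\<bar> <= M"
 shows "\<bar>pd v W x0\<bar> <= 2 * grad_const TYPE('a) * M / R * norm v"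
proof -
 define B where "B = ball x0 R"
 define h where "h y = indicator B y * W y" for y
 have wh: "weakly_harmonic B h" "h \<in> borel_measurable borel" unfolding h_def B_def
  by (rule weakly_harmonic_smooth(1)[OF D W R(2)], simp, rule weakly_harmonic_smooth(2)[OF D W R(2)], simp)
 have M0: "M >= 0" using M[of x0] R by (auto intro: order_trans[OF abs_ge_zero])
 have hM: "\<bar>h y\<bar> <= M" for y using M[of y] M0 by (auto simp: h_def B_def indicator_def)
 have ih: "integrable lborel h"
  by (rule integrable_bounded_support[OF wh(2), of B]) (use hM in \<open>auto simp: h_def B_def\<close>)
 obtain V where V: "smooth_on B V" "AE x in lborel. x \<in> B --> V x = h x"
  "!!x sg. sg > 0 ==> cball x (1 / sqrt sg) \<subseteq> B ==> V x = conv h (moll sg) x"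
  by (rule Weyl[of B h B]) (use ih wh in \<open>auto simp: B_def h_def\<close>)
 have sW: "smooth_on B W" by (rule smooth_on_mono[OF W(1)]) (use R(2) in \<open>auto simp: B_def\<close>)
 have VW: "V x = W x" if "x \<in> B" for x
 proof (rule AE_eq_continuous[OF _ smooth_on_continuous[OF V(1)] smooth_on_continuous[OF sW] _ that])
  show "AE x in lborel. x \<in> B --> V x = W x" using V(2) by eventually_elim (simp add: h_def)
 qed (simp add: B_def)
 define sg where "sg = (2 / R)^2"
 have s: "sg > 0" "sqrt sg = 2 / R" using R by (auto simp: sg_def)
 have loc: "W y = conv h (moll sg) y" if "y \<in> ball x0 (R / 2)" for y
 proof -
  have "cball y (R / 2) \<subseteq> B"
  proof
   fix z assume "z \<in> cball y (R / 2)"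
   then show "z \<in> B" using that dist_triangle[of x0 z y] by (simp add: B_def)
  qed
  then have "V y = conv h (moll sg) y" using s by (intro V(3)) auto
  moreover have "y \<in> B" using that R by (auto simp: B_def)
  ultimately show ?thesis using VW by simp
 qed
 have "pd v W x0 = pd v (conv h (moll sg)) x0" by (rule pd_cong[of "ball x0 (R / 2)"]) (use loc R in auto)
 also have "... = conv h (pd v (moll sg)) x0" by (simp add: pd_conv[OF ih test_moll[OF s(1)]])
 finally have "pd v W x0 = (LBINT y. pd v (moll sg) (x0 - y) * h y)" by (simp add: conv_def mult.commute)
 moreover have "\<bar>...\<bar> <= (LBINT y. \<bar>pd v (moll sg) (x0 - y)\<bar>) * M"
  using conv_integrable[OF ih test_fun_pd[OF test_moll[OF s(1)]], of v x0]
  by (intro integral_mult_bound test_integrable[OF test_reflect_UNIV[OF test_fun_pd[OF test_moll[OF s(1)]]]] hM) (simp add: mult.commute)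
 ultimately have "\<bar>pd v W x0\<bar> <= M * (LBINT y. \<bar>pd v (moll sg) (x0 - y)\<bar>)" by (simp add: mult.commute)
 also have "... <= M * (grad_const TYPE('a) * sqrt sg * norm v)"
  using mult_left_mono[OF grad_const(2)[OF s(1), of v x0] M0] by simp
 also have "... = 2 * grad_const TYPE('a) * M / R * norm v" unfolding s(2) by simp
 finally show ?thesis .
qed

section \<open>Unique continuation for harmonic functions\<close>

lemma smooth_on_pd_iter: "smooth_on D W ==> smooth_on D ((pd v ^^ k) W)" by (induction k) (auto simp: smooth_on_pd)

lemma pd_iter_zero:
 assumes "open B" "!!y. y \<in> B ==> W y = 0" "x \<in> B"
 shows "(pd v ^^ k) W x = 0" using assms(3)
proof (induction k arbitrary: x)
 case (Suc k)
 have "pd v ((pd v ^^ k) W) x = pd v (%x. 0) x" by (rule pd_cong[OF assms(1) Suc.prems]) (rule Suc.IH)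
 then show ?case by simp
qed (use assms in simp)

lemma pd_line:
 assumes "f differentiable (at (p + s *\<^sub>R v))"
 shows "((%s. f (p + s *\<^sub>R v)) has_real_derivative pd v f (p + s *\<^sub>R v)) (at s)"
proof -
 have "((f \<circ> (%s. p + s *\<^sub>R v)) has_derivative ((%u. pd u f (p + s *\<^sub>R v)) \<circ> (%t. t *\<^sub>R v))) (at s)"
  by (rule diff_chain_at) (use pd_has_derivative[OF assms] in \<open>auto intro!: derivative_eq_intros\<close>)
 then show ?thesis unfolding pd_scaleR[OF assms] by (simp add: o_def pd_scaleR[OF assms] has_field_derivative_def mult_commute_abs)
qed

text \<open>Schwarz's theorem on mixed derivatives; it lets directional derivatives commute with the
  Laplacian.\<close>

lemma smooth_second_difference:
 fixes f :: "'a::euclidean_space => real"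
 assumes "smooth_on D f" "open D" "x \<in> D"
 shows "pd u (pd v f) x = pd v (pd u f) x"
proof -
 obtain r where r: "r > 0" "ball x r \<subseteq> D" using assms(2,3) open_contains_ball by blast
 define c where "c = norm u + norm v + 1"
 have c: "c > 0" by (simp add: c_def add_nonneg_pos)
 text \<open>Mixed second differences, evaluated by the mean value theorem in either order.\<close>
 have key: "\<exists>y\<in>ball x (h * c). f (x + h *\<^sub>R a + h *\<^sub>R b) - f (x + h *\<^sub>R a) - f (x + h *\<^sub>R b) + f x = h * h * pd b (pd a f) y"
  if h: "h > 0" "h * c <= r" and ab: "norm a + norm b < c" for h a b
 proof -
  have inD: "x + s *\<^sub>R a + s' *\<^sub>R b \<in> ball x (h * c)" if "0 <= s" "s <= h" "0 <= s'" "s' <= h" for s s'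
  proof -
   have "norm (s *\<^sub>R a + s' *\<^sub>R b) <= s * norm a + s' * norm b"
    using norm_triangle_ineq[of "s *\<^sub>R a" "s' *\<^sub>R b"] that by simp
   also have "... <= h * (norm a + norm b)" unfolding distrib_left using that by (intro add_mono mult_right_mono) auto
   also have "... < h * c" using ab h by simp
   finally have "norm (s *\<^sub>R a + s' *\<^sub>R b) < h * c" .
   moreover have "x - (x + s *\<^sub>R a + s' *\<^sub>R b) = - (s *\<^sub>R a + s' *\<^sub>R b)" by simp
   ultimately show ?thesis by (simp only: mem_ball dist_norm norm_minus_cancel)
  qed
  have inD': "x + s *\<^sub>R a + s' *\<^sub>R b \<in> D" if "0 <= s" "s <= h" "0 <= s'" "s' <= h" for s s'
   using inD[OF that] r(2) h(2) by (auto simp: subset_iff)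
  note line = pd_line[OF smooth_on_differentiable[OF assms(1)]] pd_line[OF smooth_on_differentiable[OF smooth_on_pd[OF assms(1)]]]
  define F where "F s = f (x + h *\<^sub>R b + s *\<^sub>R a) - f (x + s *\<^sub>R a)" for s
  have "\<exists>z. 0 < z \<and> z < h \<and> F h - F 0 = (h - 0) * (pd a f (x + h *\<^sub>R b + z *\<^sub>R a) - pd a f (x + z *\<^sub>R a))"
  proof (rule MVT2[OF h(1)])
   fix s assume s: "0 <= s" "s <= h"
   show "(F has_real_derivative pd a f (x + h *\<^sub>R b + s *\<^sub>R a) - pd a f (x + s *\<^sub>R a)) (at s)"
    unfolding F_def
    by (intro DERIV_diff line(1)) (use inD'[OF s, of h] inD'[OF s, of 0] h in \<open>auto simp: add_ac\<close>)
  qed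
  then obtain z where z: "0 < z" "z < h" "F h - F 0 = h * (pd a f (x + h *\<^sub>R b + z *\<^sub>R a) - pd a f (x + z *\<^sub>R a))" by auto
  have "\<exists>z'. 0 < z' \<and> z' < h \<and> pd a f (x + z *\<^sub>R a + h *\<^sub>R b) - pd a f (x + z *\<^sub>R a + 0 *\<^sub>R b) = (h - 0) * pd b (pd a f) (x + z *\<^sub>R a + z' *\<^sub>R b)"
  proof (rule MVT2[OF h(1)])
   fix s assume s: "0 <= s" "s <= h"
   show "((%s. pd a f (x + z *\<^sub>R a + s *\<^sub>R b)) has_real_derivative pd b (pd a f) (x + z *\<^sub>R a + s *\<^sub>R b)) (at s)"
    by (rule line(2)) (use inD'[of z s] z s in auto)
  qed
  then obtain z' where z': "0 < z'" "z' < h" "pd a f (x + z *\<^sub>R a + h *\<^sub>R b) - pd a f (x + z *\<^sub>R a) = h * pd b (pd a f) (x + z *\<^sub>R a + z' *\<^sub>R b)" by auto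
  have "F h - F 0 = f (x + h *\<^sub>R a + h *\<^sub>R b) - f (x + h *\<^sub>R a) - f (x + h *\<^sub>R b) + f x"
   by (simp add: F_def add_ac)
  moreover have "F h - F 0 = h * h * pd b (pd a f) (x + z *\<^sub>R a + z' *\<^sub>R b)" using z(3) z'(3) by (simp add: add_ac)
  moreover have "x + z *\<^sub>R a + z' *\<^sub>R b \<in> ball x (h * c)" using inD[of z z'] z z' by auto
  ultimately show ?thesis by metis
 qed
 have cont: "continuous (at x) (pd b (pd a f))" for a b
  using smooth_on_continuous[OF smooth_on_pd[OF smooth_on_pd[OF assms(1)]]] assms(2,3)
   continuous_on_eq_continuous_at by blast
 show ?thesis
 proof (rule ccontr)
  assume ne: "pd u (pd v f) x ~= pd v (pd u f) x"
  define e where "e = \<bar>pd u (pd v f) x - pd v (pd u f) x\<bar> / 2"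
  have e: "e > 0" using ne by (simp add: e_def)
  obtain d1 where d1: "d1 > 0" "!!y. dist y x < d1 ==> dist (pd u (pd v f) y) (pd u (pd v f) x) < e"
   using cont[of u v] e unfolding continuous_at_eps_delta by metis
  obtain d2 where d2: "d2 > 0" "!!y. dist y x < d2 ==> dist (pd v (pd u f) y) (pd v (pd u f) x) < e"
   using cont[of v u] e unfolding continuous_at_eps_delta by metis
  define h where "h = min r (min d1 d2) / c"
  have h: "h > 0" "h * c <= r" "h * c <= d1" "h * c <= d2" using c r d1 d2 by (auto simp: h_def)
  obtain y1 where y1: "y1 \<in> ball x (h * c)" "f (x + h *\<^sub>R v + h *\<^sub>R u) - f (x + h *\<^sub>R v) - f (x + h *\<^sub>R u) + f x = h * h * pd u (pd v f) y1"
   using key[OF h(1,2), of v u] by (auto simp: c_def)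
  obtain y2 where y2: "y2 \<in> ball x (h * c)" "f (x + h *\<^sub>R u + h *\<^sub>R v) - f (x + h *\<^sub>R u) - f (x + h *\<^sub>R v) + f x = h * h * pd v (pd u f) y2"
   using key[OF h(1,2), of u v] by (auto simp: c_def)
  have "h * h * pd u (pd v f) y1 = h * h * pd v (pd u f) y2" unfolding y1(2)[symmetric] y2(2)[symmetric] by (simp add: add_ac)
  then have "pd u (pd v f) y1 = pd v (pd u f) y2" using h by simp
  moreover have "dist (pd u (pd v f) y1) (pd u (pd v f) x) < e" using d1(2)[of y1] y1(1) h by (auto simp: dist_commute)
  moreover have "dist (pd v (pd u f) y2) (pd v (pd u f) x) < e" using d2(2)[of y2] y2(1) h by (auto simp: dist_commute)
  ultimately show False by (auto simp: e_def dist_real_def abs_if split: if_splits)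
 qed
qed

lemma lap_pd:
 assumes "smooth_on D W" "open D" "!!y. y \<in> D ==> lap_of W y = c" "x \<in> D"
 shows "lap_of (pd v W) x = 0"
proof -
 have sw: "smooth_on D (pd i (pd i W))" for i by (intro smooth_on_pd assms)
 have "pd i (pd i (pd v W)) x = pd v (pd i (pd i W)) x" for i
 proof -
  have "pd i (pd i (pd v W)) x = pd i (pd v (pd i W)) x"
   by (rule pd_cong[OF assms(2,4)]) (rule smooth_second_difference[OF assms(1,2)])
  also have "... = pd v (pd i (pd i W)) x" by (rule smooth_second_difference[OF smooth_on_pd[OF assms(1)] assms(2,4)])
  finally show ?thesis .
 qed
 then have "lap_of (pd v W) x = (\<Sum>i\<in>Basis. pd v (pd i (pd i W)) x)" by (simp add: lap_of_pd)
 also have "... = pd v (%y. \<Sum>i\<in>Basis. pd i (pd i W) y) x"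
  by (rule pd_sum[symmetric]) (use smooth_on_differentiable[OF sw assms(4)] in auto)
 also have "... = pd v (%y. c) x"
  by (rule pd_cong[OF assms(2,4)]) (use assms(3) in \<open>simp add: lap_of_pd\<close>)
 finally show ?thesis by simp
qed

lemma lap_pd_iter:
 assumes "smooth_on D W" "open D" "!!y. y \<in> D ==> lap_of W y = 0" "x \<in> D"
 shows "lap_of ((pd v ^^ k) W) x = 0" using assms(4)
proof (induction k arbitrary: x)
 case (Suc k)
 show ?case using lap_pd[OF smooth_on_pd_iter[OF assms(1)] assms(2) Suc.IH Suc.prems, of v] by simp
qed (use assms in simp)

text \<open>Each derivative costs a radius \<open>d\<close> in the gradient estimate, so
  \<open>k\<close> of them fit if the point stays \<open>k * d\<close> inside the ball.\<close>

lemma harmonic_iter_bound: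
 fixes W :: "'a::euclidean_space => real"
 assumes D: "open D" and W: "smooth_on D W" "!!y. y \<in> D ==> lap_of W y = 0"
  and R: "d > 0" "cball x0 R \<subseteq> D" and M: "!!y. y \<in> ball x0 R ==> \<bar>W y\<bar> <= M" and v: "norm v <= 1"
  and C: "C = 2 * grad_const TYPE('a)"
 shows "y \<in> ball x0 (R - k * d) ==> \<bar>(pd v ^^ k) W y\<bar> <= M * (C / d) ^ k"
proof (induction k arbitrary: y)
 case (Suc k)
 have C0: "C >= 0" using C grad_const(1)[where 'a = 'a] by simp
 have sub: "z \<in> ball x0 (R - k * d)" if "z \<in> cball y d" for z
  using that Suc.prems dist_triangle[of x0 z y] by (auto simp: algebra_simps)
 have "cball y d \<subseteq> D"
 proof
  fix z assume z: "z \<in> cball y d"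
  have "k * d >= 0" using R by simp
  then have "z \<in> cball x0 R" using sub[OF z] by auto
  then show "z \<in> D" using R by blast
 qed
 then have "\<bar>pd v ((pd v ^^ k) W) y\<bar> <= 2 * grad_const TYPE('a) * (M * (C / d) ^ k) / d * norm v"
  by (intro harmonic_gradient_estimate[OF D smooth_on_pd_iter[OF W(1)] lap_pd_iter[OF W(1) D W(2)] R(1)])
   (auto intro!: Suc.IH sub)
 also have "... <= 2 * grad_const TYPE('a) * (M * (C / d) ^ k) / d * 1"
 proof (intro mult_left_mono v)
  have "M >= 0"
  proof -
   have "y \<in> ball x0 (R - Suc k * d)" by (rule Suc.prems)
   moreover have "Suc k * d >= 0" using R by simp
   ultimately have "y \<in> ball x0 R" by auto
   then show ?thesis using M[of y] by auto
  qed
  then show "0 <= 2 * grad_const TYPE('a) * (M * (C / d) ^ k) / d" using grad_const(1)[where 'a = 'a] C0 R by simp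
 qed
 finally show ?case by (simp add: C mult_ac)
qed (use M in auto)

lemma power_div_fact_le: "real k ^ k / fact k <= exp (real k)"
proof -
 have "(\<Sum>n\<in>{k}. real k ^ n /\<^sub>R fact n) <= (\<Sum>n. real k ^ n /\<^sub>R fact n)"
  by (rule sum_le_suminf) (auto simp: summable_exp)
 then have "(\<Sum>n\<in>{k}. real k ^ n /\<^sub>R fact n) <= exp (real k)" by (simp add: exp_def)
 then show ?thesis by (simp add: divide_inverse mult.commute)
qed

text \<open>Quantitative analyticity: all derivatives at \<open>x0\<close> vanish, so only the
  Taylor remainder of order \<open>k\<close> counts, and it tends to 0 on a ball whose radius is a
  fixed fraction of \<open>R\<close>. That this fraction depends on the dimension alone is what
  makes the zero set relatively closed in the unique continuation argument.\<close>

lemma harmonic_zero_propagates: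
 fixes W :: "'a::euclidean_space => real"
 shows "\<exists>c>0. \<forall>D W x0 R. open D --> smooth_on D W --> (\<forall>y\<in>D. lap_of W y = 0) --> R > 0 --> cball x0 R \<subseteq> D
  --> (\<exists>e>0. \<forall>y\<in>ball x0 e. W y = 0) --> (\<forall>y\<in>ball (x0::'a) (c * R). W y = 0)"
proof -
 define C where "C = 2 * grad_const TYPE('a)"
 have C0: "C >= 0" unfolding C_def using grad_const(1)[where 'a = 'a] by simp
 \<comment> \<open>Chosen so that 2 C e h / R <= 1/2 for h < c R; this is the ratio of the geometric
   bound below.\<close>
 define c where "c = 1 / (4 * exp 1 * (C + 1))"
 have c: "c > 0" unfolding c_def using C0 by (intro divide_pos_pos mult_pos_pos) auto
 have c1: "c <= 1 / 4"
 proof -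
  have "1 <= exp (1::real) * (C + 1)" using C0 mult_mono[of 1 "exp (1::real)" 1 "C + 1"] by simp
  then show ?thesis unfolding c_def by (simp add: field_simps)
 qed
 have "W y = 0"
  if D: "open D" and W: "smooth_on D W" "\<forall>y\<in>D. lap_of W y = 0" and R: "R > 0" "cball x0 R \<subseteq> D"
   and z: "e > 0" "\<forall>y\<in>ball x0 e. W y = 0" and y: "y \<in> ball x0 (c * R)" for D W x0 R e and y :: 'a
 proof (cases "y = x0")
  case True
  then show ?thesis using z by simp
 next
  case False
  define h where "h = norm (y - x0)"
  define v where "v = (1 / h) *\<^sub>R (y - x0)"
  have h: "h > 0" "h < c * R" using False y by (auto simp: h_def dist_norm norm_minus_commute)
  have v: "norm v <= 1" "y = x0 + h *\<^sub>R v" using h by (auto simp: v_def h_def)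
  have "bounded (W ` cball x0 R)"
   by (intro compact_imp_bounded compact_continuous_image continuous_on_subset[OF smooth_on_continuous[OF W(1)] R(2)]) simp
  then obtain M where M: "!!y. y \<in> cball x0 R ==> \<bar>W y\<bar> <= M" unfolding bounded_iff real_norm_def by blast
  have M0: "M >= 0" using M[of x0] R by auto
  have bd: "\<bar>W y\<bar> <= M * (1 / 2) ^ k" if k: "k > 0" for k
  proof -
   \<comment> \<open>The \<open>k\<close> derivatives together use up half the radius; the resulting
     k^k is absorbed by k^k / k! <= e^k.\<close>
   define d where "d = R / (2 * k)"
   have d: "d > 0" "k * d = R / 2" using R k by (auto simp: d_def)
   define diff where "diff m t = (pd v ^^ m) W (x0 + t *\<^sub>R v)" for m t
   have inB: "x0 + t *\<^sub>R v \<in> ball x0 (R - k * d)" if "0 <= t" "t <= h" for t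
   proof -
    have "norm (t *\<^sub>R v) <= t * 1" using that v(1) mult_left_mono[OF v(1) that(1)] by simp
    also have "... < R / 2" using that h c1 R mult_right_mono[OF c1, of R] by linarith
    finally show ?thesis using d by (simp add: dist_norm)
   qed
   have "\<exists>t>0. t < h \<and> diff 0 h = (\<Sum>m<k. diff m 0 / fact m * h ^ m) + diff k t / fact k * h ^ k"
   proof (rule Maclaurin[OF h(1) k refl], intro allI impI)
    fix m t assume t: "m < k \<and> 0 <= t \<and> t <= h"
    have inD: "x0 + t *\<^sub>R v \<in> D" using inB[of t] t R d by (auto simp: subset_iff)
    have sm: "smooth_on D ((pd v ^^ m) W)" by (rule smooth_on_pd_iter[OF W(1)])
    show "(diff m has_real_derivative diff (Suc m) t) (at t)"
     unfolding diff_def[abs_def] using pd_line[OF smooth_on_differentiable[OF sm inD]] by simp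
   qed
   moreover have "diff m 0 = 0" for m unfolding diff_def by (rule pd_iter_zero[of "ball x0 e"]) (use z in auto)
   ultimately obtain t where t: "0 < t" "t < h" "diff 0 h = diff k t / fact k * h ^ k" by auto
   have "\<bar>diff k t\<bar> <= M * (C / d) ^ k"
    unfolding diff_def by (rule harmonic_iter_bound[OF D W(1) _ d(1) R(2) _ v(1) C_def]) (use W(2) M inB[of t] t in auto)
   then have "\<bar>W y\<bar> <= M * (C / d) ^ k / fact k * h ^ k"
    using t h v(2) by (simp add: diff_def abs_mult divide_right_mono mult_right_mono)
   also have "... = M * ((2 * C * h / R) ^ k * (real k ^ k / fact k))"
    using R k by (simp add: d_def power_mult_distrib power_divide field_simps)
   also have "... <= M * ((2 * C * h / R) ^ k * exp (real k))"
    using M0 C0 h R by (intro mult_left_mono power_div_fact_le) auto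
   also have "... = M * (2 * C * h / R * exp 1) ^ k"
   proof -
    have "exp (real k) = exp 1 ^ k" using exp_of_nat_mult[of k "1::real"] by simp
    then show ?thesis by (simp only: power_mult_distrib)
   qed
   also have "... <= M * (1 / 2) ^ k"
   proof (intro mult_left_mono power_mono M0)
    have "h / R <= c" using h R by (simp add: field_simps)
    then have "2 * C * exp 1 * (h / R) <= 2 * C * exp 1 * c" using C0 by (intro mult_left_mono) auto
    also have "... = ((2 * exp 1) * C) / ((2 * exp 1) * (2 * (C + 1)))"
     unfolding c_def by (simp only: mult_ac times_divide_eq_right mult_1_right)
    also have "... = C / (2 * (C + 1))" by (rule mult_divide_mult_cancel_left) simp
    also have "... <= 1 / 2" using C0 by (simp add: field_simps)
    finally show "2 * C * h / R * exp 1 <= 1 / 2" by (simp add: mult_ac)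
   qed (use C0 h R in auto)
   finally show ?thesis .
  qed
  have "\<bar>W y\<bar> <= 0"
  proof (rule LIMSEQ_le_const)
   show "(%k. M * (1 / 2) ^ k) \<longlonglongrightarrow> 0" by (intro tendsto_mult_right_zero LIMSEQ_realpow_zero) auto
   show "\<exists>N. \<forall>n\<ge>N. \<bar>W y\<bar> <= M * (1 / 2) ^ n" using bd by (intro exI[of _ 1]) auto
  qed
  then show ?thesis by simp
 qed
 then show ?thesis using c by blast
qed

theorem unique_continuation:
 fixes W :: "'a::euclidean_space => real"
 assumes D: "open D" "connected D" and W: "smooth_on D W" "!!y. y \<in> D ==> lap_of W y = 0"
  and w: "open w" "w ~= {}" "w \<subseteq> D" "!!y. y \<in> w ==> W y = 0" and x: "x \<in> D"
 shows "W x = 0"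
proof -
 obtain c where c0: "c > 0" and c1: "\<forall>D (W::'a => real) x0 R. open D --> smooth_on D W --> (\<forall>y\<in>D. lap_of W y = 0) --> R > 0 --> cball x0 R \<subseteq> D
  --> (\<exists>e>0. \<forall>y\<in>ball x0 e. W y = 0) --> (\<forall>y\<in>ball x0 (c * R). W y = 0)"
  using harmonic_zero_propagates[where 'a = 'a] by (elim exE conjE)
 have propag: "W y = 0" if "R > 0" "cball z R \<subseteq> D" "e > 0" "\<forall>y\<in>ball z e. W y = 0" "y \<in> ball z (c * R)" for z R e y
  using c1[rule_format, OF D(1) W(1), of R z y] W(2) that by blast
 define Z where "Z = interior {x \<in> D. W x = 0}"
 have oZ: "open Z" and ZD: "Z \<subseteq> D" unfolding Z_def using interior_subset by auto
 have wZ: "w \<subseteq> Z" unfolding Z_def by (rule interior_maximal) (use w in auto)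
 have "openin (top_of_set D) Z" using oZ ZD by (simp add: open_subset)
 moreover have "closedin (top_of_set D) Z" unfolding closedin_limpt
 proof (intro conjI allI impI ZD)
  fix x assume x: "x islimpt Z \<and> x \<in> D"
  then obtain R0 where "R0 > 0" "cball x R0 \<subseteq> D" using D(1) open_contains_cball by blast
  then have R: "R0 / 2 > 0" "cball x (2 * (R0 / 2)) \<subseteq> D" by auto
  define R where "R = R0 / 2"
  note R = R[folded R_def]
  \<comment> \<open>A point of \<open>Z\<close> within \<open>de\<close> of \<open>x\<close> still
    has a ball of radius \<open>R\<close> inside \<open>D\<close>, and \<open>x\<close> lies within
    the fraction \<open>c\<close> of that radius.\<close>
  define de where "de = min R (c * R)"
  have d: "de > 0" using R c0 by (simp add: de_def)
  then obtain z where z: "z \<in> Z" "dist z x < de" using x unfolding islimpt_approachable by blast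
  obtain e where e: "e > 0" "ball z e \<subseteq> Z" using oZ z open_contains_ball by blast
  have cz: "cball z R \<subseteq> D"
  proof
   fix y assume "y \<in> cball z R"
   then have "dist x y <= 2 * R" using z(2) dist_triangle[of x y z] by (auto simp: de_def dist_commute)
   then show "y \<in> D" using R by auto
  qed
  have "W y = 0" if "y \<in> ball z (c * R)" for y
  proof (rule propag[OF R(1) cz e(1) _ that])
   have "ball z e \<subseteq> {x \<in> D. W x = 0}" using e(2) interior_subset unfolding Z_def by (rule order_trans)
   then show "\<forall>y\<in>ball z e. W y = 0" by blast
  qed
  then have "ball z (c * R) \<inter> D \<subseteq> {x \<in> D. W x = 0}" by auto
  then have "ball z (c * R) \<inter> D \<subseteq> Z" unfolding Z_def by (rule interior_maximal) (use D in auto)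
  moreover have "x \<in> ball z (c * R) \<inter> D" using z(2) x by (simp add: de_def)
  ultimately show "x \<in> Z" by blast
 qed
 ultimately have "Z = {} \<or> Z = D" using D(2) unfolding connected_clopen by blast
 then have "Z = D" using wZ w(2) by auto
 then show ?thesis using x interior_subset unfolding Z_def by blast
qed

section \<open>Weak gradients\<close>

lemma measurable_lebesgue_onI:
 fixes f :: "'a::euclidean_space => 'b::euclidean_space"
 shows "f \<in> borel_measurable borel ==> f \<in> borel_measurable (lebesgue_on S)"
 by (simp add: measurable_completion measurable_restrict_space1)

lemma grad_of_borel:
 assumes "test_fun D ps" shows "grad_of ps \<in> borel_measurable borel" unfolding grad_of_pd[abs_def]
 by (intro borel_measurable_sum borel_measurable_scaleR borel_measurable_test[OF test_fun_pd[OF assms]]) simp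

lemma grad_of_bounded:
 assumes "test_fun D ps" shows "\<exists>K\<ge>0. \<forall>x. norm (grad_of ps x) <= K"
proof -
 have "\<forall>i. \<exists>K\<ge>0. \<forall>x. \<bar>pd i ps x\<bar> <= K" using test_bounded[OF test_fun_pd[OF assms]] by blast
 then obtain K where K: "!!i. K i >= 0" "!!i x. \<bar>pd i ps x\<bar> <= K i" by metis
 have "norm (grad_of ps x) <= (\<Sum>i\<in>Basis. K i)" for x unfolding grad_of_pd by (rule sum_norm_le) (use K in simp)
 moreover have "(\<Sum>i\<in>Basis. K i) >= 0" using K(1) by (intro sum_nonneg) auto
 ultimately show ?thesis by blast
qed

lemma grad_of_mult:
 assumes "f differentiable (at x)" "g differentiable (at x)"
 shows "grad_of (%x. f x * g x) x = f x *\<^sub>R grad_of g x + g x *\<^sub>R grad_of f x"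
 unfolding grad_of_pd pd_mult[OF assms] by (simp add: scaleR_sum_right sum.distrib[symmetric] algebra_simps)

lemma grad_of_add:
 assumes "f differentiable (at x)" "g differentiable (at x)"
 shows "grad_of (%x. f x + g x) x = grad_of f x + grad_of g x"
 unfolding grad_of_pd pd_add[OF assms] by (simp add: sum.distrib algebra_simps)

lemma grad_of_cmult:
 assumes "f differentiable (at x)"
 shows "grad_of (%x. c * f x) x = c *\<^sub>R grad_of f x"
 unfolding grad_of_pd pd_cmult[OF assms] by (simp add: scaleR_sum_right)

lemma test_differentiable: "test_fun D f ==> f differentiable (at x)"
 using smooth_on_differentiable[OF test_smooth] by blast

lemma finite_measure_lebesgue_on: "open D ==> bounded D ==> finite_measure (lebesgue_on D)"
 by (simp add: finite_measure_lebesgue_on lmeasurable_open)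

lemma test_sqi:
 assumes "open S" "bounded S" "test_fun D ps"
 shows "sqi (lebesgue_on S) ps" "sqi (lebesgue_on S) (grad_of ps)"
proof -
 obtain K where K: "!!x. \<bar>ps x\<bar> <= K" using test_bounded[OF assms(3)] by blast
 obtain L where L: "!!x. norm (grad_of ps x) <= L" using grad_of_bounded[OF assms(3)] by blast
 show "sqi (lebesgue_on S) ps"
  by (rule sqi_bounded[OF finite_measure_lebesgue_on[OF assms(1,2)] measurable_lebesgue_onI[OF borel_measurable_test[OF assms(3)]], of K])
   (simp add: K)
 show "sqi (lebesgue_on S) (grad_of ps)"
  by (rule sqi_bounded[OF finite_measure_lebesgue_on[OF assms(1,2)] measurable_lebesgue_onI[OF grad_of_borel[OF assms(3)]], of L])
   (rule L)
qed

lemma integral_split_sq: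
 assumes "sqi M f" "sqi M g"
 shows "(LINT x|M. (f x :: real)^2 + (norm (g x))^2) = (LINT x|M. (norm (f x))^2) + (LINT x|M. (norm (g x))^2)"
 using sqi_sq[OF assms(1)] sqi_sq[OF assms(2)] by simp

lemma tendsto_split_sq:
 fixes f :: "nat => 'a => real" and g :: "nat => 'a => 'b::euclidean_space"
 assumes "!!m. sqi M (f m)" "!!m. sqi M (g m)"
  and "(%m. \<integral>x. (f m x)^2 + (norm (g m x))^2 \<partial>M) \<longlonglongrightarrow> 0"
 shows "(%m. \<integral>x. (norm (f m x))^2 \<partial>M) \<longlonglongrightarrow> 0" "(%m. \<integral>x. (norm (g m x))^2 \<partial>M) \<longlonglongrightarrow> 0"
proof -
 have nn: "0 <= (LINT x|M. (norm (f m x))^2)" "0 <= (LINT x|M. (norm (g m x))^2)" for m by auto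
 have l: "(%m. (LINT x|M. (norm (f m x))^2) + (LINT x|M. (norm (g m x))^2)) \<longlonglongrightarrow> 0"
  using assms(3) unfolding integral_split_sq[OF assms(1,2)] .
 show "(%m. \<integral>x. (norm (f m x))^2 \<partial>M) \<longlonglongrightarrow> 0"
  by (rule tendsto_sandwich[OF _ _ tendsto_const l]) (use nn in auto)
 show "(%m. \<integral>x. (norm (g m x))^2 \<partial>M) \<longlonglongrightarrow> 0"
  by (rule tendsto_sandwich[OF _ _ tendsto_const l]) (use nn in auto)
qed

lemma L2_dist_triangle:
 fixes f :: "'a => 'b::euclidean_space"
 assumes "sqi M f" "sqi M g" "sqi M h"
 shows "(LINT x|M. (norm (f x - h x))^2) <= 2 * (LINT x|M. (norm (f x - g x))^2) + 2 * (LINT x|M. (norm (g x - h x))^2)"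
proof -
 have "(LINT x|M. (norm (f x - h x))^2) <= (LINT x|M. 2 * (norm (f x - g x))^2 + 2 * (norm (g x - h x))^2)"
 proof (rule integral_mono)
  show "(norm (f x - h x))^2 <= 2 * (norm (f x - g x))^2 + 2 * (norm (g x - h x))^2" for x
   using norm_add_sq_le[of "f x - g x" "g x - h x"] by simp
  show "integrable M (%x. (norm (f x - h x))^2)" by (rule sqi_sq[OF sqi_diff[OF assms(1,3)]])
  show "integrable M (%x. 2 * (norm (f x - g x))^2 + 2 * (norm (g x - h x))^2)"
   using sqi_sq[OF sqi_diff[OF assms(1,2)]] sqi_sq[OF sqi_diff[OF assms(2,3)]] by simp
 qed
 also have "... = 2 * (LINT x|M. (norm (f x - g x))^2) + 2 * (LINT x|M. (norm (g x - h x))^2)"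
  using sqi_sq[OF sqi_diff[OF assms(1,2)]] sqi_sq[OF sqi_diff[OF assms(2,3)]] by simp
 finally show ?thesis .
qed

lemma weak_gradD:
 assumes "weak_grad D f G" "test_fun D ph" "i \<in> Basis"
 shows "(LINT x|lebesgue_on D. f x * pd i ph x) = - (LINT x|lebesgue_on D. (G x \<bullet> i) * ph x)"
 using assms unfolding weak_grad_def pd_def by blast

lemma weak_gradI:
 assumes "!!ph i. test_fun D ph ==> i \<in> Basis ==>
  (LINT x|lebesgue_on D. f x * pd i ph x) = - (LINT x|lebesgue_on D. (G x \<bullet> i) * ph x)"
 shows "weak_grad D f G" using assms unfolding weak_grad_def pd_def by blast

lemma H01_D:
 assumes "H01 D f G"
 shows "sqi (lebesgue_on D) f" "sqi (lebesgue_on D) G" "weak_grad D f G"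
 using assms unfolding H01_def H1_def L2_on_sqi L2v_on_sqi by auto

lemma H01_approx:
 assumes D: "open D" "bounded D" and h: "H01 D f G" and e: "e > 0"
 shows "\<exists>ps. test_fun D ps \<and> (LINT x|lebesgue_on D. (norm (ps x - f x))^2) < e \<and>
  (LINT x|lebesgue_on D. (norm (grad_of ps x - G x))^2) < e"
proof -
 obtain ps where p: "!!m::nat. test_fun D (ps m)"
  "(%m. \<integral>x. (ps m x - f x)^2 + (norm (grad_of (ps m) x - G x))^2 \<partial>lebesgue_on D) \<longlonglongrightarrow> 0"
  using h unfolding H01_def by blast
 have s: "sqi (lebesgue_on D) (%x. ps m x - f x)" "sqi (lebesgue_on D) (%x. grad_of (ps m) x - G x)" for m
  using test_sqi[OF D p(1)] H01_D[OF h] by (auto intro: sqi_diff)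
 note l = tendsto_split_sq[OF s p(2)]
 have "\<forall>\<^sub>F m in sequentially. (LINT x|lebesgue_on D. (norm (ps m x - f x))^2) < e \<and>
  (LINT x|lebesgue_on D. (norm (grad_of (ps m) x - G x))^2) < e"
  using order_tendstoD(2)[OF l(1) e] order_tendstoD(2)[OF l(2) e] by eventually_elim simp
 then show ?thesis using p(1) eventually_happens'[OF sequentially_bot] by blast
qed

lemma smooth_weak_grad:
 assumes "open D" and f: "smooth_on UNIV f" shows "weak_grad D f (grad_of f)"
proof (rule weak_gradI)
 fix ph i assume t: "test_fun D ph" and i: "i \<in> (Basis :: 'a set)"
 have 1: "test_fun D (%x. f x * pd i ph x)" "test_fun D (%x. pd i f x * ph x)"
  using test_fun_mult[OF test_fun_pd[OF t] f] test_fun_mult[OF t smooth_on_pd[OF f]] by (simp_all add: mult.commute)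
 have "(LINT x|lebesgue_on D. h x) = (LBINT x. h x)" if "test_fun D h" for h
  by (rule lebesgue_on_integral_lborel[OF assms(1) borel_measurable_test[OF that] test_zero_outside[OF that]])
 note this[OF 1(1)] this[OF 1(2)]
 then show "(LINT x|lebesgue_on D. f x * pd i ph x) = - (LINT x|lebesgue_on D. (grad_of f x \<bullet> i) * ph x)"
  using integration_by_parts[OF t f] by (simp add: grad_of_Basis[OF i])
qed

lemma sqi_comp: "sqi M G ==> sqi M (%x. G x \<bullet> (i :: 'b::euclidean_space))"
proof (rule sqi_bound[where g = "%x. (norm i)^2 * (norm (G x))^2"])
 show "(norm (G x \<bullet> i))^2 <= (norm i)^2 * (norm (G x))^2" for x
  using power_mono[OF Cauchy_Schwarz_ineq2[of "G x" i], of 2] by (simp add: power_mult_distrib mult.commute)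
qed (auto simp: sqi_def intro!: borel_measurable_inner)

lemma weak_grad_limit:
 assumes D: "open D" "bounded D"
  and s: "!!n::nat. sqi (lebesgue_on D) (f n)" "!!n. sqi (lebesgue_on D) (G n)" "sqi (lebesgue_on D) F" "sqi (lebesgue_on D) Ga"
  and w: "!!n. weak_grad D (f n) (G n)"
  and l: "(%n. \<integral>x. (norm (f n x - F x))^2 \<partial>lebesgue_on D) \<longlonglongrightarrow> 0" "(%n. \<integral>x. (norm (G n x - Ga x))^2 \<partial>lebesgue_on D) \<longlonglongrightarrow> 0"
 shows "weak_grad D F Ga"
proof (rule weak_gradI)
 fix ph i assume t: "test_fun D ph" and i: "i \<in> (Basis :: 'a set)"
 have "(%n. \<integral>x. f n x \<bullet> pd i ph x \<partial>lebesgue_on D) \<longlonglongrightarrow> (LINT x|lebesgue_on D. F x \<bullet> pd i ph x)"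
  by (rule integral_inner_tendsto[OF s(1,3) test_sqi(1)[OF D test_fun_pd[OF t]] l(1)])
 moreover have "(%n. \<integral>x. G n x \<bullet> (ph x *\<^sub>R i) \<partial>lebesgue_on D) \<longlonglongrightarrow> (LINT x|lebesgue_on D. Ga x \<bullet> (ph x *\<^sub>R i))"
 proof (rule integral_inner_tendsto[OF s(2,4) _ l(2)])
  obtain K where "!!x. \<bar>ph x\<bar> <= K" using test_bounded[OF t] by blast
  then show "sqi (lebesgue_on D) (%x. ph x *\<^sub>R i)"
   by (intro sqi_bounded_mult[OF sqi_const[OF finite_measure_lebesgue_on[OF D]]]
    measurable_lebesgue_onI borel_measurable_test[OF t]) auto
 qed
 moreover have "(LINT x|lebesgue_on D. f n x \<bullet> pd i ph x) = - (LINT x|lebesgue_on D. G n x \<bullet> (ph x *\<^sub>R i))" for n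
  using weak_gradD[OF w t i] by (simp add: mult.commute)
 ultimately have "(%n. - (LINT x|lebesgue_on D. G n x \<bullet> (ph x *\<^sub>R i))) \<longlonglongrightarrow> (LINT x|lebesgue_on D. F x \<bullet> pd i ph x)"
  "(%n. - (LINT x|lebesgue_on D. G n x \<bullet> (ph x *\<^sub>R i))) \<longlonglongrightarrow> - (LINT x|lebesgue_on D. Ga x \<bullet> (ph x *\<^sub>R i))"
  by (simp_all only: tendsto_minus)
 then have "(LINT x|lebesgue_on D. F x \<bullet> pd i ph x) = - (LINT x|lebesgue_on D. Ga x \<bullet> (ph x *\<^sub>R i))"
  by (rule LIMSEQ_unique)
 then show "(LINT x|lebesgue_on D. F x * pd i ph x) = - (LINT x|lebesgue_on D. (Ga x \<bullet> i) * ph x)"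
  by (simp add: mult.commute)
qed

text \<open>The weak gradient is inherited from the approximants, so membership reduces to the
  simultaneous approximation of the function and the field.\<close>

lemma H01_I:
 assumes D: "open D" "bounded D" and s: "sqi (lebesgue_on D) f" "sqi (lebesgue_on D) G"
  and a: "!!e. e > 0 ==> \<exists>ps. test_fun D ps \<and> (LINT x|lebesgue_on D. (norm (ps x - f x))^2) < e \<and>
  (LINT x|lebesgue_on D. (norm (grad_of ps x - G x))^2) < e"
 shows "H01 D f G"
proof -
 have ex: "\<forall>n. \<exists>ps. test_fun D ps \<and> (LINT x|lebesgue_on D. (norm (ps x - f x))^2) < 1 / Suc n \<and>
  (LINT x|lebesgue_on D. (norm (grad_of ps x - G x))^2) < 1 / Suc n" by (rule allI, rule a) simp
 obtain ps where p0: "\<forall>n. test_fun D (ps n) \<and> (LINT x|lebesgue_on D. (norm (ps n x - f x))^2) < 1 / Suc n \<and>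
  (LINT x|lebesgue_on D. (norm (grad_of (ps n) x - G x))^2) < 1 / Suc n" using choice[OF ex] by (elim exE)
 have p: "test_fun D (ps n)" "(LINT x|lebesgue_on D. (norm (ps n x - f x))^2) < 1 / Suc n"
  "(LINT x|lebesgue_on D. (norm (grad_of (ps n) x - G x))^2) < 1 / Suc n" for n
  using p0[rule_format, of n] by simp_all
 have n0: "(%n. 1 / real (Suc n)) \<longlonglongrightarrow> 0" using LIMSEQ_inverse_real_of_nat by (simp add: inverse_eq_divide)
 have l: "F \<longlonglongrightarrow> 0" if "!!n. F n < 1 / real (Suc n)" "!!n. 0 <= F n" for F
  by (rule tendsto_sandwich[OF _ _ tendsto_const n0]) (simp_all add: that less_imp_le[OF that(1)] del: of_nat_Suc)
 note l1 = l[OF p(2)] and l2 = l[OF p(3)]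
 have wg: "weak_grad D f G"
  by (rule weak_grad_limit[OF D test_sqi[OF D p(1)] s smooth_weak_grad[OF D(1) test_smooth[OF p(1)]] l1 l2]) simp_all
 have "(%m. \<integral>x. (ps m x - f x)^2 + (norm (grad_of (ps m) x - G x))^2 \<partial>lebesgue_on D) \<longlonglongrightarrow> 0"
  unfolding integral_split_sq[OF sqi_diff[OF test_sqi(1)[OF D p(1)] s(1)] sqi_diff[OF test_sqi(2)[OF D p(1)] s(2)]]
  using tendsto_add[OF l1 l2] by simp
 then show ?thesis unfolding H01_def H1_def L2_on_sqi L2v_on_sqi using s wg p(1) by blast
qed

lemma H01_test: "open D ==> bounded D ==> test_fun D ps ==> H01 D ps (grad_of ps)"
 by (rule H01_I) (auto intro: test_sqi)

lemma H01_add: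
 assumes D: "open D" "bounded D" and h: "H01 D f G" "H01 D f' G'"
 shows "H01 D (%x. f x + f' x) (%x. G x + G' x)"
proof (rule H01_I[OF D])
 note s = H01_D(1,2)[OF h(1)] H01_D(1,2)[OF h(2)]
 show "sqi (lebesgue_on D) (%x. f x + f' x)" "sqi (lebesgue_on D) (%x. G x + G' x)" using s by (auto intro: sqi_add)
 fix e :: real assume "e > 0"
 then have e: "e / 4 > 0" by simp
 obtain ps where p: "test_fun D ps" "(LINT x|lebesgue_on D. (norm (ps x - f x))^2) < e / 4" "(LINT x|lebesgue_on D. (norm (grad_of ps x - G x))^2) < e / 4"
  using H01_approx[OF D h(1) e] by blast
 obtain ps' where p': "test_fun D ps'" "(LINT x|lebesgue_on D. (norm (ps' x - f' x))^2) < e / 4" "(LINT x|lebesgue_on D. (norm (grad_of ps' x - G' x))^2) < e / 4"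
  using H01_approx[OF D h(2) e] by blast
 note t = test_sqi[OF D p(1)] test_sqi[OF D p'(1)]
 have gen: "(LINT x|lebesgue_on D. (norm ((u x + u' x) - (w x + w' x)))^2) < e"
  if "sqi (lebesgue_on D) u" "sqi (lebesgue_on D) u'" "sqi (lebesgue_on D) w" "sqi (lebesgue_on D) w'"
   "(LINT x|lebesgue_on D. (norm (u x - w x))^2) < e / 4" "(LINT x|lebesgue_on D. (norm (u' x - w' x))^2) < e / 4"
  for u u' w w' :: "'a => 'c::euclidean_space"
  using L2_dist_triangle[OF sqi_add[OF that(1,2)] sqi_add[OF that(3,2)] sqi_add[OF that(3,4)]] that(5,6) by simp
 have g: "grad_of (%x. ps x + ps' x) x = grad_of ps x + grad_of ps' x" for x
  by (rule grad_of_add[OF test_differentiable[OF p(1)] test_differentiable[OF p'(1)]])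
 show "\<exists>ps. test_fun D ps \<and> (LINT x|lebesgue_on D. (norm (ps x - (f x + f' x)))^2) < e \<and>
  (LINT x|lebesgue_on D. (norm (grad_of ps x - (G x + G' x)))^2) < e"
  by (rule exI[of _ "%x. ps x + ps' x"], unfold g, intro conjI test_fun_add p p' gen t s)
qed

lemma H01_cmult:
 assumes D: "open D" "bounded D" and h: "H01 D f G"
 shows "H01 D (%x. c * f x) (%x. c *\<^sub>R G x)"
proof (rule H01_I[OF D])
 note s = H01_D(1,2)[OF h]
 show "sqi (lebesgue_on D) (%x. c * f x)" "sqi (lebesgue_on D) (%x. c *\<^sub>R G x)"
  using sqi_cmult[OF s(1)] sqi_scaleR[OF s(2)] by auto
 fix e :: real assume e0: "e > 0"
 define d where "d = e / (c^2 + 1)"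
 have c1: "c^2 + 1 > 0" by (simp add: add_nonneg_pos)
 have d: "d > 0" "c^2 * d < e"
 proof -
  show "d > 0" using e0 c1 by (simp add: d_def)
  then show "c^2 * d < e" using c1 using e0 by (simp add: d_def field_simps)
 qed
 obtain ps where p: "test_fun D ps" "(LINT x|lebesgue_on D. (norm (ps x - f x))^2) < d" "(LINT x|lebesgue_on D. (norm (grad_of ps x - G x))^2) < d"
  using H01_approx[OF D h d(1)] by blast
 have gen: "(LINT x|lebesgue_on D. (norm (c *\<^sub>R u x - c *\<^sub>R w x))^2) < e" if "(LINT x|lebesgue_on D. (norm (u x - w x))^2) < d"
  for u w :: "'a => 'c::euclidean_space"
 proof -
  have "(LINT x|lebesgue_on D. (norm (c *\<^sub>R u x - c *\<^sub>R w x))^2) = c^2 * (LINT x|lebesgue_on D. (norm (u x - w x))^2)"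
   by (simp add: power_mult_distrib flip: scaleR_diff_right)
  also have "... <= c^2 * d" using that by (intro mult_left_mono) auto
  finally show ?thesis using d by simp
 qed
 have g: "grad_of (%x. c * ps x) x = c *\<^sub>R grad_of ps x" for x
  by (rule grad_of_cmult[OF test_differentiable[OF p(1)]])
 show "\<exists>ps. test_fun D ps \<and> (LINT x|lebesgue_on D. (norm (ps x - c * f x))^2) < e \<and>
  (LINT x|lebesgue_on D. (norm (grad_of ps x - c *\<^sub>R G x))^2) < e"
  using gen[OF p(2)] gen[OF p(3)] test_fun_cmult[OF p(1), of c] by (intro exI[of _ "%x. c * ps x"]) (simp add: g)
qed

lemma H01_zero: "open D ==> bounded D ==> H01 D (%x. 0) (%x. 0)"
 using H01_test[OF _ _ test_fun_zero, of D] by (simp add: grad_of_pd[abs_def])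

lemma H01_sum:
 assumes D: "open D" "bounded D" and h: "!!k. k \<in> A ==> H01 D (f k) (G k)"
 shows "H01 D (%x. \<Sum>k\<in>A. a k * f k x) (%x. \<Sum>k\<in>A. a k *\<^sub>R G k x)" using h
proof (induction A rule: infinite_finite_induct)
 case (insert k A)
 have "H01 D (%x. a k * f k x + (\<Sum>k\<in>A. a k * f k x)) (%x. a k *\<^sub>R G k x + (\<Sum>k\<in>A. a k *\<^sub>R G k x))"
  by (rule H01_add[OF D H01_cmult[OF D]]) (use insert in auto)
 then show ?case using insert.hyps by simp
qed (simp_all add: H01_zero[OF D])

lemma H01_limit:
 assumes D: "open D" "bounded D" and h: "!!n::nat. H01 D (f n) (G n)" and s: "sqi (lebesgue_on D) F" "sqi (lebesgue_on D) Ga"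
  and l: "(%n. \<integral>x. (norm (f n x - F x))^2 \<partial>lebesgue_on D) \<longlonglongrightarrow> 0" "(%n. \<integral>x. (norm (G n x - Ga x))^2 \<partial>lebesgue_on D) \<longlonglongrightarrow> 0"
 shows "H01 D F Ga"
proof (rule H01_I[OF D s])
 fix e :: real assume "e > 0"
 then have e: "e / 4 > 0" by simp
 have "\<forall>\<^sub>F n in sequentially. (LINT x|lebesgue_on D. (norm (f n x - F x))^2) < e / 4 \<and> (LINT x|lebesgue_on D. (norm (G n x - Ga x))^2) < e / 4"
  using order_tendstoD(2)[OF l(1) e] order_tendstoD(2)[OF l(2) e] by eventually_elim simp
 then obtain n where n: "(LINT x|lebesgue_on D. (norm (f n x - F x))^2) < e / 4" "(LINT x|lebesgue_on D. (norm (G n x - Ga x))^2) < e / 4"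
  using eventually_happens'[OF sequentially_bot] by blast
 obtain ps where p: "test_fun D ps" "(LINT x|lebesgue_on D. (norm (ps x - f n x))^2) < e / 4" "(LINT x|lebesgue_on D. (norm (grad_of ps x - G n x))^2) < e / 4"
  using H01_approx[OF D h e] by blast
 show "\<exists>ps. test_fun D ps \<and> (LINT x|lebesgue_on D. (norm (ps x - F x))^2) < e \<and> (LINT x|lebesgue_on D. (norm (grad_of ps x - Ga x))^2) < e"
  using L2_dist_triangle[OF test_sqi(1)[OF D p(1)] H01_D(1)[OF h[of n]] s(1)]
   L2_dist_triangle[OF test_sqi(2)[OF D p(1)] H01_D(2)[OF h[of n]] s(2)] n p by (intro exI[of _ ps]) auto
qed

text \<open>Integrate the derivative of \<open>ps^2\<close> by parts against a coordinate function,
  which is at most \<open>R\<close> on \<open>D\<close>, and absorb half of the result by Young's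
  inequality.\<close>

lemma Poincare_test:
 fixes ps :: "'a::euclidean_space => real"
 assumes D: "open D" and R: "D \<subseteq> cball 0 R" and t: "test_fun D ps"
 shows "(LINT x|lebesgue_on D. (norm (ps x))^2) <= 4 * R^2 * (LINT x|lebesgue_on D. (norm (grad_of ps x))^2)"
proof -
 obtain i where i: "i \<in> (Basis :: 'a set)" using nonempty_Basis by blast
 have tp: "test_fun D (%x. ps x * ps x)" by (rule test_fun_mult[OF t test_smooth[OF t]])
 have d: "ps differentiable (at x)" for x by (rule test_differentiable[OF t])
 have s: "smooth_on UNIV (%x::'a. x \<bullet> i)" by simp
 have pp: "pd i (%x. ps x * ps x) x = 2 * ps x * pd i ps x" for x unfolding pd_mult[OF d d] by simp
 have "(LBINT x. (x \<bullet> i) * (2 * ps x * pd i ps x)) = - (LBINT x. (i \<bullet> i) * (ps x * ps x))"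
  using integration_by_parts[OF tp s, of i] unfolding pp pd_inner .
 then have e1: "(LBINT x. (ps x)^2) = - (LBINT x. (x \<bullet> i) * (2 * ps x * pd i ps x))"
  using i by (simp add: inner_Basis power2_eq_square)
 have i1: "integrable lborel (%x. (x \<bullet> i) * (2 * ps x * pd i ps x))"
  using test_integrable[OF test_fun_mult[OF test_fun_pd[OF tp, of i] s]] unfolding pp .
 have i2: "integrable lborel (%x. (ps x)^2)" using test_integrable[OF tp] by (simp add: power2_eq_square)
 have i3: "integrable lborel (%x. (pd i ps x)^2)"
  using test_integrable[OF test_fun_mult[OF test_fun_pd[OF t] test_smooth[OF test_fun_pd[OF t]]], of i i] by (simp add: power2_eq_square)
 have "- (LBINT x. (x \<bullet> i) * (2 * ps x * pd i ps x)) = (LBINT x. - ((x \<bullet> i) * (2 * ps x * pd i ps x)))" by simp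
 also have "... <= (LBINT x. (ps x)^2 / 2 + 2 * R^2 * (pd i ps x)^2)"
 proof (rule integral_mono)
  show "- ((x \<bullet> i) * (2 * ps x * pd i ps x)) <= (ps x)^2 / 2 + 2 * R^2 * (pd i ps x)^2" for x
  proof (cases "x \<in> D")
   case True
   have "\<bar>x \<bullet> i\<bar> <= R" using Basis_le_norm[OF i, of x] R True by auto
   then have "(x \<bullet> i)^2 <= R^2" by (metis abs_ge_zero power2_abs power_mono)
   then have "2 * (x \<bullet> i)^2 * (pd i ps x)^2 <= 2 * R^2 * (pd i ps x)^2" by (intro mult_right_mono) auto
   moreover have "0 <= (ps x / 2 + (x \<bullet> i) * pd i ps x)^2" by simp
   ultimately show ?thesis by (simp add: power2_eq_square algebra_simps)
  qed (use test_zero_outside[OF t] in simp)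
 qed (use i1 i2 i3 in auto)
 also have "... = (LBINT x. (ps x)^2) / 2 + 2 * R^2 * (LBINT x. (pd i ps x)^2)" using i2 i3 by simp
 finally have "(LBINT x. (ps x)^2) <= 4 * R^2 * (LBINT x. (pd i ps x)^2)" using e1 by simp
 moreover have "(LBINT x. (ps x)^2) = (LINT x|lebesgue_on D. (norm (ps x))^2)"
  using lebesgue_on_integral_lborel[OF D, of "%x. (ps x)^2"] borel_measurable_test[OF t] test_zero_outside[OF t] by simp
 moreover have "(LBINT x. (pd i ps x)^2) <= (LINT x|lebesgue_on D. (norm (grad_of ps x))^2)"
 proof -
  have "(LBINT x. (pd i ps x)^2) = (LINT x|lebesgue_on D. (pd i ps x)^2)"
   using lebesgue_on_integral_lborel[OF D, of "%x. (pd i ps x)^2"] borel_measurable_test[OF test_fun_pd[OF t]]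
    test_zero_outside[OF test_fun_pd[OF t]] by simp
  also have "... <= (LINT x|lebesgue_on D. (norm (grad_of ps x))^2)"
  proof (rule integral_mono)
   have bD: "bounded D" using R bounded_subset bounded_cball by blast
   show "integrable (lebesgue_on D) (%x. (norm (grad_of ps x))^2)" by (rule sqi_sq[OF test_sqi(2)[OF D bD t]])
   show "integrable (lebesgue_on D) (%x. (pd i ps x)^2)"
    using sqi_sq[OF test_sqi(1)[OF D bD test_fun_pd[OF t]], of i] by simp
   show "(pd i ps x)^2 <= (norm (grad_of ps x))^2" for x
    using power_mono[OF Basis_le_norm[OF i, of "grad_of ps x"], of 2] by (simp add: grad_of_Basis[OF i])
  qed
  finally show ?thesis .
 qed
 ultimately show ?thesis using mult_left_mono[of "\<integral>x. (pd i ps x)^2 \<partial>lborel" _ "4 * R^2"] by (smt (verit) zero_le_power2)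
qed

text \<open>It serves to show that the first eigenvalue is positive, so the constant is not
  optimised.\<close>

lemma Poincare:
 fixes f :: "'a::euclidean_space => real"
 assumes D: "open D" "bounded D"
 shows "\<exists>C>0. \<forall>f G. H01 D f G --> (LINT x|lebesgue_on D. (norm (f x))^2) <= C * (LINT x|lebesgue_on (D::'a set). (norm (G x))^2)"
proof -
 obtain R where R: "R > 0" "D \<subseteq> cball 0 R" using bounded_subset_ballD[OF D(2), of 0] ball_subset_cball by blast
 have "(LINT x|lebesgue_on D. (norm (f x))^2) <= 16 * R^2 * (LINT x|lebesgue_on D. (norm (G x))^2)" if h: "H01 D f G" for f G
 proof (rule field_le_epsilon)
  fix e :: real assume e: "e > 0"
  define d where "d = e / (2 + 16 * R^2)"
  have d: "d > 0" using e R by (simp add: d_def add_pos_nonneg)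
  obtain ps where p: "test_fun D ps" "(LINT x|lebesgue_on D. (norm (ps x - f x))^2) < d" "(LINT x|lebesgue_on D. (norm (grad_of ps x - G x))^2) < d"
   using H01_approx[OF D h d] by blast
  have 1: "(LINT x|lebesgue_on D. (norm (f x))^2) <= 2 * d + 2 * (LINT x|lebesgue_on D. (norm (ps x))^2)"
   using L2_dist_triangle[OF H01_D(1)[OF h] test_sqi(1)[OF D p(1)] sqi_zero] p(2) by (simp add: abs_minus_commute power2_commute)
  have 2: "(LINT x|lebesgue_on D. (norm (grad_of ps x))^2) <= 2 * d + 2 * (LINT x|lebesgue_on D. (norm (G x))^2)"
   using L2_dist_triangle[OF test_sqi(2)[OF D p(1)] H01_D(2)[OF h] sqi_zero] p(3) by simp
  have "(LINT x|lebesgue_on D. (norm (f x))^2) <= 2 * d + 2 * (4 * R^2 * (2 * d + 2 * (LINT x|lebesgue_on D. (norm (G x))^2)))"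
   using 1 order_trans[OF Poincare_test[OF D(1) R(2) p(1)] mult_left_mono[OF 2, of "4 * R^2"]] by simp
  also have "... = 16 * R^2 * (LINT x|lebesgue_on D. (norm (G x))^2) + d * (2 + 16 * R^2)" by (simp add: algebra_simps)
  also have "d * (2 + 16 * R^2) = e"
  proof -
   have "2 + 16 * R^2 ~= 0" using R by (smt (verit) zero_le_power2)
   then show ?thesis by (simp add: d_def)
  qed
  finally show "(LINT x|lebesgue_on D. (norm (f x))^2) <= 16 * R^2 * (LINT x|lebesgue_on D. (norm (G x))^2) + e" .
 qed
 then show ?thesis using R by (intro exI[of _ "16 * R^2"]) auto
qed

section \<open>Eigenfunction expansions\<close>

text \<open>Orthogonality with prescribed squared norms: \<open>phi\<close> satisfies it with norms
  1 and the gradients \<open>G\<close> with norms \<open>lam\<close>, so Bessel's inequality and the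
  convergence of series are proved once for both.\<close>

definition orth :: "'a measure => (nat => 'a => 'b::euclidean_space) => (nat => real) => bool" where
 "orth M e mu \<longleftrightarrow> (\<forall>k. sqi M (e k)) \<and> (\<forall>j k. (LINT x|M. e j x \<bullet> e k x) = (if j = k then mu k else 0))"

lemma orth_sqi: "orth M e mu ==> sqi M (e k)" by (simp add: orth_def)

lemma orth_sum_sqi: "orth M e mu ==> sqi M (%x. \<Sum>k\<in>A. a k *\<^sub>R e k x)"
 by (rule sqi_sum, rule sqi_scaleR, rule orth_sqi)

lemma orth_sum_inner:
 assumes "orth M e mu" "sqi M g"
 shows "(LINT x|M. (\<Sum>k\<in>A. a k *\<^sub>R e k x) \<bullet> g x) = (\<Sum>k\<in>A. a k * (LINT x|M. e k x \<bullet> g x))"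
proof -
 have "(LINT x|M. (\<Sum>k\<in>A. a k *\<^sub>R e k x) \<bullet> g x) = (LINT x|M. (\<Sum>k\<in>A. a k * (e k x \<bullet> g x)))"
  by (simp add: inner_sum_left)
 also have "... = (\<Sum>k\<in>A. (LINT x|M. a k * (e k x \<bullet> g x)))"
  by (rule integral_sum) (use sqi_inner[OF orth_sqi[OF assms(1)] assms(2)] in simp)
 finally show ?thesis by simp
qed

lemma orth_norm:
 assumes "orth M e mu" "finite A"
 shows "(LINT x|M. (norm (\<Sum>k\<in>A. a k *\<^sub>R e k x))^2) = (\<Sum>k\<in>A. (a k)^2 * mu k)"
proof -
 have "(LINT x|M. (norm (\<Sum>k\<in>A. a k *\<^sub>R e k x))^2) = (\<Sum>k\<in>A. a k * (LINT x|M. e k x \<bullet> (\<Sum>k\<in>A. a k *\<^sub>R e k x)))"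
  unfolding power2_norm_eq_inner by (rule orth_sum_inner[OF assms(1) orth_sum_sqi[OF assms(1)]])
 also have "... = (\<Sum>k\<in>A. (a k)^2 * mu k)"
 proof (rule sum.cong[OF refl])
  fix k assume k: "k \<in> A"
  have "(LINT x|M. e k x \<bullet> (\<Sum>k\<in>A. a k *\<^sub>R e k x)) = (LINT x|M. (\<Sum>j\<in>A. a j *\<^sub>R e j x) \<bullet> e k x)"
   by (simp add: inner_commute)
  also have "... = (\<Sum>j\<in>A. a j * (if j = k then mu k else 0))"
   unfolding orth_sum_inner[OF assms(1) orth_sqi[OF assms(1)]] using assms(1) by (simp add: orth_def)
  also have "... = a k * mu k" using k assms(2) by (simp add: if_distrib cong: if_cong)
  finally show "a k * (LINT x|M. e k x \<bullet> (\<Sum>k\<in>A. a k *\<^sub>R e k x)) = (a k)^2 * mu k"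
   by (simp add: power2_eq_square)
 qed
 finally show ?thesis .
qed

lemma Bessel:
 assumes o: "orth M e mu" and m: "!!k. mu k > 0" and g: "sqi M g"
 shows "summable (%k. (LINT x|M. e k x \<bullet> g x)^2 / mu k)"
proof (rule summableI_nonneg_bounded)
 fix n
 define b where "b k = (LINT x|M. e k x \<bullet> g x)" for k
 define S where "S x = (\<Sum>k<n. (b k / mu k) *\<^sub>R e k x)" for x
 have sS: "sqi M S" unfolding S_def by (rule orth_sum_sqi[OF o])
 have 1: "(LINT x|M. g x \<bullet> S x) = (\<Sum>k<n. (b k)^2 / mu k)"
  unfolding inner_commute[of "g _"] S_def orth_sum_inner[OF o g] by (rule sum.cong) (simp_all add: b_def power2_eq_square)
 have 2: "(LINT x|M. (norm (S x))^2) = (\<Sum>k<n. (b k)^2 / mu k)"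
  unfolding S_def orth_norm[OF o finite_lessThan]
  by (rule sum.cong) (use m in \<open>simp_all add: power2_eq_square less_imp_neq[symmetric]\<close>)
 have "0 <= (LINT x|M. (norm (g x - 1 *\<^sub>R S x))^2)" by simp
 then show "(\<Sum>k<n. (LINT x|M. e k x \<bullet> g x)^2 / mu k) <= (LINT x|M. (norm (g x))^2)"
  unfolding sq_expand[OF g sS] 1 2 b_def by simp
qed (use m in \<open>simp add: less_imp_le\<close>)

lemma orth_series:
 assumes fin: "finite_measure M" and o: "orth M e mu" and s: "summable (%k. (a k)^2 * mu k)"
 shows "\<exists>F. sqi M F \<and> (%n. \<integral>x. (norm ((\<Sum>k<n. a k *\<^sub>R e k x) - F x))^2 \<partial>M) \<longlonglongrightarrow> 0"
proof (rule Riesz_Fischer[OF fin orth_sum_sqi[OF o]])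
 fix ep :: real assume "ep > 0"
 then obtain N where N: "!!m n. m >= N ==> norm (\<Sum>k\<in>{m..<n}. (a k)^2 * mu k) < ep"
  using s unfolding summable_Cauchy by blast
 have d: "(LINT x|M. (norm ((\<Sum>k<n. a k *\<^sub>R e k x) - (\<Sum>k<m. a k *\<^sub>R e k x)))^2) < ep" if "m >= N" "m <= n" for m n
 proof -
  have "(\<Sum>k<n. a k *\<^sub>R e k x) - (\<Sum>k<m. a k *\<^sub>R e k x) = (\<Sum>k\<in>{m..<n}. a k *\<^sub>R e k x)" for x
   using sum_diff_nat_ivl[of 0 m n "%k. a k *\<^sub>R e k x"] that by (simp add: lessThan_atLeast0)
  then show ?thesis using orth_norm[OF o, of "{m..<n}" a] N[OF that(1), of n] by simp
 qed
 have "(LINT x|M. (norm ((\<Sum>k<m. a k *\<^sub>R e k x) - (\<Sum>k<n. a k *\<^sub>R e k x)))^2) < ep" if "m >= N" "n >= N" for m n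
  using d[of m n] d[of n m] that by (cases "m <= n") (auto simp: norm_minus_commute)
 then show "\<exists>N. \<forall>m\<ge>N. \<forall>n\<ge>N. (LINT x|M. (norm ((\<Sum>k<m. a k *\<^sub>R e k x) - (\<Sum>k<n. a k *\<^sub>R e k x)))^2) < ep"
  by blast
qed

lemma orth_series_inner:
 assumes o: "orth M e mu" and F: "sqi M F" "(%n. \<integral>x. (norm ((\<Sum>k<n. a k *\<^sub>R e k x) - F x))^2 \<partial>M) \<longlonglongrightarrow> 0"
  and g: "sqi M g"
 shows "(%k. a k * (LINT x|M. e k x \<bullet> g x)) sums (LINT x|M. F x \<bullet> g x)"
 using integral_inner_tendsto[OF orth_sum_sqi[OF o] F(1) g F(2)] unfolding orth_sum_inner[OF o g] sums_def .

section \<open>Restriction to subdomains and uniqueness of weak derivatives\<close>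

lemma lebesgue_on_subset_integral:
 fixes f :: "'a::euclidean_space => real"
 assumes "open w" "open D" "w \<subseteq> D"
 shows "(LINT x|lebesgue_on w. f x) = (LINT x|lebesgue_on D. indicator w x * f x)"
proof -
 have "(LINT x|lebesgue_on w. f x) = (LINT x|lebesgue. indicator w x *\<^sub>R f x)"
  using assms(1) by (intro integral_restrict_space) simp
 also have "... = (LINT x|lebesgue. indicator D x *\<^sub>R (indicator w x * f x))"
  by (rule integral_cong[OF refl]) (use assms(3) in \<open>auto simp: indicator_def\<close>)
 also have "... = (LINT x|lebesgue_on D. indicator w x * f x)"
  using assms(2) by (intro integral_restrict_space[symmetric]) simp
 finally show ?thesis .
qed

lemma sqi_subset:
 fixes f :: "'a::euclidean_space => 'b::euclidean_space"
 assumes "open w" "open D" "w \<subseteq> D" "sqi (lebesgue_on D) f"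
 shows "sqi (lebesgue_on w) f" "sqi (lebesgue_on D) (%x. indicator w x *\<^sub>R f x)"
proof -
 have wD: "w \<in> sets lebesgue" "D \<in> sets lebesgue" using assms by auto
 have m: "f \<in> borel_measurable (lebesgue_on w)"
  using sqi_meas[OF assms(4)] measurable_restrict_mono[of f lebesgue D borel w] assms(3) by blast
 have "integrable (lebesgue_on w) (%x. (norm (f x))^2)"
 proof -
  have "integrable lebesgue (%x. indicator D x *\<^sub>R (norm (f x))^2)"
   using sqi_sq[OF assms(4)] wD by (simp add: integrable_restrict_space)
  then have "integrable lebesgue (%x. (indicator D x *\<^sub>R (norm (f x))^2) * indicator w x)"
   by (rule integrable_mult_bounded[where K = 1]) (use wD in \<open>auto simp: indicator_def\<close>)
  moreover have "(%x. (indicator D x *\<^sub>R (norm (f x))^2) * indicator w x) = (%x. indicator w x *\<^sub>R (norm (f x))^2)"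
   using assms(3) by (auto simp: indicator_def fun_eq_iff)
  ultimately have "integrable lebesgue (%x. indicator w x *\<^sub>R (norm (f x))^2)" by simp
  then show ?thesis using wD by (simp add: integrable_restrict_space)
 qed
 then show "sqi (lebesgue_on w) f" using m by (simp add: sqi_def)
 show "sqi (lebesgue_on D) (%x. indicator w x *\<^sub>R f x)"
 proof (rule sqi_bounded_mult[OF assms(4), where K = 1])
  show "(indicator w :: 'a => real) \<in> borel_measurable (lebesgue_on D)"
   using assms(1) by (intro measurable_lebesgue_onI) simp
 qed (simp add: indicator_def)
qed

lemma sets_surface_measure: "sets (surface_measure :: 'a::euclidean_space measure) = sets borel"
 unfolding surface_measure_def using sets.sigma_sets_eq[of "borel :: 'a measure"] by simp

lemma weak_grad_subset:
 assumes "open w" "open D" "w \<subseteq> D" "weak_grad D v Ga"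
 shows "weak_grad w v Ga"
proof (rule weak_gradI)
 fix ph and i :: 'a assume t: "test_fun w ph" and i: "i \<in> Basis"
 have "indicator w x * (v x * pd i ph x) = v x * pd i ph x" "indicator w x * ((Ga x \<bullet> i) * ph x) = (Ga x \<bullet> i) * ph x" for x
  using test_zero_outside[OF t, of x] test_zero_outside[OF test_fun_pd[OF t], of x i] by (auto simp: indicator_def)
 then show "(LINT x|lebesgue_on w. v x * pd i ph x) = - (LINT x|lebesgue_on w. (Ga x \<bullet> i) * ph x)"
  unfolding lebesgue_on_subset_integral[OF assms(1-3)] by (simp only: weak_gradD[OF assms(4) test_mono[OF t assms(3)] i])
qed

lemma L2_zero:
 assumes D: "open D" "bounded D" and f: "sqi (lebesgue_on D) f" and g: "sqi (lebesgue_on D) (g :: 'a::euclidean_space => real)"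
  and eq: "!!ph. test_fun D ph ==> (LINT x|lebesgue_on D. f x * ph x) = (LINT x|lebesgue_on D. g x * ph x)"
 shows "AE x in lebesgue_on D. f x = g x"
proof -
 have "AE x in lebesgue_on D. f x - g x = 0"
 proof (rule fundamental_lemma[OF D])
  show "integrable (lebesgue_on D) (%x. f x - g x)" by (intro sqi_integrable finite_measure_lebesgue_on D sqi_diff f g)
  show "(LINT x|lebesgue_on D. (f x - g x) * ph x) = 0" if t: "test_fun D ph" for ph
   using eq[OF t] sqi_mult[OF f test_sqi(1)[OF D t]] sqi_mult[OF g test_sqi(1)[OF D t]] by (simp add: left_diff_distrib)
 qed
 then show ?thesis by (rule eventually_mono) simp
qed

lemma weak_grad_unique:
 assumes D: "open D" "bounded D" and s: "sqi (lebesgue_on D) G" "sqi (lebesgue_on D) Ga" and w: "weak_grad D v G" "weak_grad D v Ga"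
 shows "AE x in lebesgue_on D. G x = Ga x"
proof -
 have "AE x in lebesgue_on D. \<forall>i\<in>Basis. G x \<bullet> i = Ga x \<bullet> i"
 proof (rule AE_finite_allI[OF finite_Basis], rule L2_zero[OF D sqi_comp[OF s(1)] sqi_comp[OF s(2)]])
  fix i :: 'a and ph assume "i \<in> Basis" "test_fun D ph"
  then show "(LINT x|lebesgue_on D. (G x \<bullet> i) * ph x) = (LINT x|lebesgue_on D. (Ga x \<bullet> i) * ph x)"
   using weak_gradD[OF w(1), of ph i] weak_gradD[OF w(2), of ph i] by simp
 qed
 then show ?thesis by (rule eventually_mono) (simp add: euclidean_eq_iff[of "G _"])
qed

lemma weak_grad_lap:
 assumes D: "open D" "bounded D" and s: "sqi (lebesgue_on D) f" "sqi (lebesgue_on D) Ga" and w: "weak_grad D f Ga"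
  and t: "test_fun D ph"
 shows "(LINT x|lebesgue_on D. f x * lap_of ph x) = - (LINT x|lebesgue_on D. Ga x \<bullet> grad_of ph x)"
proof -
 have "(LINT x|lebesgue_on D. f x * lap_of ph x) = (\<Sum>i\<in>Basis. LINT x|lebesgue_on D. f x * pd i (pd i ph) x)"
  unfolding lap_of_pd sum_distrib_left
  by (rule integral_sum, rule sqi_mult[OF s(1) test_sqi(1)[OF D test_fun_pd[OF test_fun_pd[OF t]]]])
 also have "... = - (\<Sum>i\<in>Basis. LINT x|lebesgue_on D. (Ga x \<bullet> i) * pd i ph x)"
  unfolding sum_negf[symmetric] by (rule sum.cong[OF refl], rule weak_gradD[OF w test_fun_pd[OF t]])
 also have "(\<Sum>i\<in>Basis. LINT x|lebesgue_on D. (Ga x \<bullet> i) * pd i ph x) = (LINT x|lebesgue_on D. (\<Sum>i\<in>Basis. (Ga x \<bullet> i) * pd i ph x))"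
  by (rule integral_sum[symmetric], rule sqi_mult[OF sqi_comp[OF s(2)] test_sqi(1)[OF D test_fun_pd[OF t]]])
 also have "(%x. \<Sum>i\<in>Basis. (Ga x \<bullet> i) * pd i ph x) = (%x. Ga x \<bullet> grad_of ph x)"
  unfolding grad_of_pd by (simp add: inner_sum_right mult.commute)
 finally show ?thesis .
qed

lemma surface_bounded_integrable:
 fixes f :: "'a::euclidean_space => real"
 assumes "integrable surface_measure (indicator F :: 'a => real)" "f \<in> borel_measurable borel" "!!x. \<bar>f x\<bar> <= K"
 shows "integrable surface_measure (%x. indicator F x * f x)" by (rule integrable_mult_bounded[OF assms(1) _ assms(3)])
  (use assms(2) in \<open>simp only: measurable_cong_sets[OF sets_surface_measure refl]\<close>)

text \<open>\<open>G\<close> fixes one weak gradient for each eigenfunction, and \<open>weq\<close>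
  is the weak eigenvalue equation for that choice.\<close>

locale dirichlet_modes =
 fixes Om :: "'a::euclidean_space set" and lam :: "nat => real" and phi :: "nat => 'a => real" and G :: "nat => 'a => 'a"
 assumes D: "open Om" "bounded Om" and basis: "dirichlet_eigenbasis Om lam phi"
  and G: "!!k. H01 Om (phi k) (G k)"
  and weq: "!!k v Gv. H01 Om v Gv ==> (LINT x|lebesgue_on Om. G k x \<bullet> Gv x) = lam k * (LINT x|lebesgue_on Om. phi k x * v x)"
begin

abbreviation (input) "MM \<equiv> lebesgue_on Om"

lemma fin_M: "finite_measure MM" by (rule finite_measure_lebesgue_on[OF D])

lemma orth_phi: "orth MM phi (%_. 1)" using basis H01_D(1)[OF G] unfolding orth_def dirichlet_eigenbasis_def by simp

lemma orth_G: "orth MM G lam"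
proof -
 have "(LINT x|MM. G j x \<bullet> G k x) = (if j = k then lam k else 0)" for j k
  using weq[OF G[of k], of j] basis unfolding dirichlet_eigenbasis_def by simp
 then show ?thesis using H01_D(2)[OF G] unfolding orth_def by simp
qed

lemma lam_mono: "mono lam" using basis by (simp add: dirichlet_eigenbasis_def)

lemma lam0_pos: "lam 0 > 0"
proof -
 obtain C where C: "C > 0" "!!f G. H01 Om f G ==> (LINT x|MM. (norm (f x))^2) <= C * (LINT x|MM. (norm (G x))^2)"
  using Poincare[OF D] by blast
 have "(LINT x|MM. (norm (phi 0 x))^2) = 1" using orth_phi unfolding orth_def power2_norm_eq_inner by simp
 moreover have "(LINT x|MM. (norm (G 0 x))^2) = lam 0" using orth_G unfolding orth_def power2_norm_eq_inner by simp
 ultimately have "1 <= C * lam 0" using C(2)[OF G[of 0]] by simp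
 then show ?thesis using C(1) by (smt (verit) mult_nonneg_nonpos)
qed

lemma lam_gt0: "lam k > 0" and lam_ge: "lam 0 <= lam k" using lam0_pos monoD[OF lam_mono, of 0 k] by auto

definition coef :: "nat => real" where "coef k = (LINT x|MM. phi k x)"

lemma coef_sq: "summable (%k. (coef k)^2)"
 using Bessel[OF orth_phi _ sqi_const[OF fin_M, of 1]] by (simp add: coef_def)

lemma A_sq: "sqi MM g ==> summable (%k. (LINT x|MM. phi k x * g x)^2)"
 using Bessel[OF orth_phi, of g] by simp

lemma B_sq: "sqi MM g ==> summable (%k. (LINT x|MM. G k x \<bullet> g x)^2 / lam k)"
 by (rule Bessel[OF orth_G lam_gt0])

text \<open>The function expanded is the constant 1: the limit of its Fourier series has the same
  coefficients, so completeness identifies the two almost everywhere.\<close>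

lemma Parseval:
 assumes "sqi MM g" shows "(%k. coef k * (LINT x|MM. phi k x * g x)) sums (LINT x|MM. g x)"
proof -
 obtain F where F: "sqi MM F" "(%n. \<integral>x. (norm ((\<Sum>k<n. coef k *\<^sub>R phi k x) - F x))^2 \<partial>MM) \<longlonglongrightarrow> 0"
  using orth_series[OF fin_M orth_phi, of coef] coef_sq by auto
 note s = orth_series_inner[OF orth_phi F]
 have s1: "sqi MM (%x. 1::real)" by (rule sqi_const[OF fin_M])
 have "(LINT x|MM. (1 - F x) * phi j x) = 0" for j
 proof -
  have "(%k. coef k * (if k = j then 1 else 0)) sums (LINT x|MM. F x * phi j x)"
   using s[OF orth_sqi[OF orth_phi, of j]] orth_phi unfolding orth_def by simp
  moreover have "(%k. coef k * (if k = j then 1 else 0)) sums coef j"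
   using sums_single[of j coef] by (simp add: if_distrib cong: if_cong)
  ultimately have "(LINT x|MM. F x * phi j x) = coef j" using sums_unique2 by blast
  moreover have "integrable MM (%x. F x * phi j x)" by (rule sqi_mult[OF F(1) orth_sqi[OF orth_phi]])
  moreover have "integrable MM (phi j)" by (rule sqi_integrable[OF fin_M orth_sqi[OF orth_phi]])
  ultimately show ?thesis by (simp add: left_diff_distrib coef_def)
 qed
 then have "AE x in MM. 1 - F x = 0" using basis sqi_diff[OF s1 F(1)] unfolding dirichlet_eigenbasis_def L2_on_sqi by blast
 then have "(LINT x|MM. F x * g x) = (LINT x|MM. g x)" using sqi_meas[OF F(1)] sqi_meas[OF assms]
  by (intro integral_cong_AE borel_measurable_times) (auto elim!: eventually_mono)
 then show ?thesis using s[OF assms] by simp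
qed

lemma mode_series:
 assumes "summable (%k. (a k)^2)" "summable (%k. (a k)^2 * lam k)"
 shows "\<exists>F Ga. H01 Om F Ga \<and> (%n. \<integral>x. (norm ((\<Sum>k<n. a k *\<^sub>R phi k x) - F x))^2 \<partial>MM) \<longlonglongrightarrow> 0
  \<and> (%n. \<integral>x. (norm ((\<Sum>k<n. a k *\<^sub>R G k x) - Ga x))^2 \<partial>MM) \<longlonglongrightarrow> 0"
proof -
 obtain F where F: "sqi MM F" "(%n. \<integral>x. (norm ((\<Sum>k<n. a k *\<^sub>R phi k x) - F x))^2 \<partial>MM) \<longlonglongrightarrow> 0"
  using orth_series[OF fin_M orth_phi, of a] assms(1) by auto
 obtain Ga where Ga: "sqi MM Ga" "(%n. \<integral>x. (norm ((\<Sum>k<n. a k *\<^sub>R G k x) - Ga x))^2 \<partial>MM) \<longlonglongrightarrow> 0"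
  using orth_series[OF fin_M orth_G assms(2)] by auto
 have "H01 Om (%x. \<Sum>k<n. a k *\<^sub>R phi k x) (%x. \<Sum>k<n. a k *\<^sub>R G k x)" for n
  using H01_sum[OF D, of "{..<n}" phi G a] G by simp
 from H01_limit[OF D this F(1) Ga(1) F(2) Ga(2)] show ?thesis using F(2) Ga(2) by blast
qed

lemma phi_lap:
 assumes t: "test_fun Om ph"
 shows "(LINT x|MM. phi k x * lap_of ph x) = - lam k * (LINT x|MM. phi k x * ph x)"
 using weak_grad_lap[OF D H01_D[OF G] t] weq[OF H01_test[OF D t]] by simp

lemma lam_exp_bound: "t > 0 ==> lam k * exp (- lam k * t) <= 1 / t" by (rule xexp_le)

text \<open>These sums make the series for \<open>U t\<close>, for its gradient and for its
  Laplacian converge; the factors of \<open>lam k\<close> are paid for by the exponential at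
  positive time.\<close>

lemma coef_exp_sq:
 assumes t: "t > 0"
 shows "summable (%k. (coef k * exp (- lam k * t))^2)"
  and "summable (%k. (coef k * exp (- lam k * t))^2 * lam k)"
  and "summable (%k. (- coef k * lam k * exp (- lam k * t))^2)"
proof -
 have e1: "exp (- lam k * t) <= 1" for k using lam_gt0[of k] t by (simp add: mult_nonneg_nonneg less_imp_le)
 have "(exp (- lam k * t))^2 <= 1" for k using power_mono[OF e1[of k], of 2] by simp
 then have b1: "(coef k * exp (- lam k * t))^2 <= (coef k)^2" for k
  unfolding power_mult_distrib by (intro mult_left_le) auto
 show "summable (%k. (coef k * exp (- lam k * t))^2)"
  by (rule summable_comparison_test'[OF coef_sq, of 0]) (use b1 in simp)
 have b2: "(coef k * exp (- lam k * t))^2 * lam k <= (coef k)^2 * (1 / t)" for k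
 proof -
  have "(exp (- lam k * t))^2 * lam k <= 1 * (1 / t)"
  proof -
   have "(exp (- lam k * t))^2 * lam k = exp (- lam k * t) * (lam k * exp (- lam k * t))" by (simp add: power2_eq_square)
   also have "... <= 1 * (1 / t)" using e1 lam_exp_bound[OF t] lam_gt0[of k] by (intro mult_mono) auto
   finally show ?thesis .
  qed
  then show ?thesis unfolding power_mult_distrib mult.assoc by (intro mult_left_mono) auto
 qed
 show "summable (%k. (coef k * exp (- lam k * t))^2 * lam k)"
  by (rule summable_comparison_test'[OF summable_mult2[OF coef_sq, of "1 / t"], of 0])
   (use b2 lam_gt0 in \<open>simp add: abs_mult less_imp_le\<close>)
 have b3: "(- coef k * lam k * exp (- lam k * t))^2 <= (coef k)^2 * (1 / t)^2" for k
 proof -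
  have "(lam k * exp (- lam k * t))^2 <= (1 / t)^2"
   using lam_exp_bound[OF t] lam_gt0[of k] by (intro power_mono) auto
  then have "(coef k)^2 * (lam k * exp (- lam k * t))^2 <= (coef k)^2 * (1 / t)^2" by (intro mult_left_mono) auto
  then show ?thesis by (simp add: power_mult_distrib mult.assoc)
 qed
 show "summable (%k. (- coef k * lam k * exp (- lam k * t))^2)"
  by (rule summable_comparison_test'[OF summable_mult2[OF coef_sq, of "(1 / t)^2"], of 0]) (use b3 in simp)
qed

text \<open>Convergence is kept only in the weak form, as pairings with square-integrable functions;
  the Dirichlet series of the overdetermined conditions are exactly such pairings.\<close>

definition psums :: "(nat => real) => ('a => real) => bool" where
 "psums a F \<longleftrightarrow> sqi MM F \<and> (\<forall>g. sqi MM g --> (%k. a k * (LINT x|MM. phi k x * g x)) sums (LINT x|MM. F x * g x))"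

definition gsums :: "(nat => real) => ('a => 'a) => bool" where
 "gsums a F \<longleftrightarrow> sqi MM F \<and> (\<forall>g. sqi MM g --> (%k. a k * (LINT x|MM. G k x \<bullet> g x)) sums (LINT x|MM. F x \<bullet> g x))"

lemma psumsI: "sqi MM F ==> (%n. LINT x|MM. (norm ((\<Sum>k<n. a k *\<^sub>R phi k x) - F x))^2) \<longlonglongrightarrow> 0 ==> psums a F"
 unfolding psums_def using orth_series_inner[OF orth_phi] by auto

lemma gsumsI: "sqi MM F ==> (%n. LINT x|MM. (norm ((\<Sum>k<n. a k *\<^sub>R G k x) - F x))^2) \<longlonglongrightarrow> 0 ==> gsums a F"
 unfolding gsums_def using orth_series_inner[OF orth_G] by blast

lemma psumsD: "psums a F ==> sqi MM g ==> (%k. a k * (LINT x|MM. phi k x * g x)) sums (LINT x|MM. F x * g x)"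
 and gsumsD: "gsums a Ga ==> sqi MM h ==> (%k. a k * (LINT x|MM. G k x \<bullet> h x)) sums (LINT x|MM. Ga x \<bullet> h x)"
 by (simp_all add: psums_def gsums_def)

text \<open>Division by \<open>lam k\<close> inverts minus the Laplacian on the expansion of 1, and
  it is also the time integral of the heat modes.\<close>

definition torsion :: "('a => real) => ('a => 'a) => bool" where
 "torsion v Ga \<longleftrightarrow> H01 Om v Ga \<and> psums (%k. coef k / lam k) v \<and> gsums (%k. coef k / lam k) Ga \<and>
  (\<forall>ph. test_fun Om ph --> (LINT x|MM. Ga x \<bullet> grad_of ph x) = (LINT x|MM. ph x))"

lemma torsion_exists: "\<exists>v Ga. torsion v Ga"
proof -
 have b1: "(coef k / lam k)^2 <= (coef k)^2 * (1 / lam 0)^2" for k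
  unfolding power_divide using lam_ge[of k] lam0_pos by (simp add: power_divide frac_le power_mono)
 have b2: "(coef k / lam k)^2 * lam k <= (coef k)^2 * (1 / lam 0)" for k
  using lam_ge[of k] lam0_pos lam_gt0[of k] by (simp add: power_divide power2_eq_square frac_le)
 have s1: "summable (%k. (coef k / lam k)^2)"
  by (rule summable_comparison_test'[OF summable_mult2[OF coef_sq, of "(1 / lam 0)^2"], of 0]) (use b1 in simp)
 have s2: "summable (%k. (coef k / lam k)^2 * lam k)"
  by (rule summable_comparison_test'[OF summable_mult2[OF coef_sq, of "1 / lam 0"], of 0])
   (use b2 lam_gt0 in \<open>simp add: abs_mult less_imp_le\<close>)
 obtain v Ga where H: "H01 Om v Ga" "(%n. LINT x|MM. (norm ((\<Sum>k<n. (coef k / lam k) *\<^sub>R phi k x) - v x))^2) \<longlonglongrightarrow> 0"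
  "(%n. LINT x|MM. (norm ((\<Sum>k<n. (coef k / lam k) *\<^sub>R G k x) - Ga x))^2) \<longlonglongrightarrow> 0"
  using mode_series[OF s1 s2] by blast
 note v = H(1) psumsI[OF H01_D(1)[OF H(1)] H(2)] gsumsI[OF H01_D(2)[OF H(1)] H(3)]
 have "(LINT x|MM. Ga x \<bullet> grad_of ph x) = (LINT x|MM. ph x)" if t: "test_fun Om ph" for ph
 proof (rule sums_unique2[OF gsumsD[OF v(3) test_sqi(2)[OF D t]]])
  have "coef k / lam k * (LINT x|MM. G k x \<bullet> grad_of ph x) = coef k * (LINT x|MM. phi k x * ph x)" for k
   using weq[OF H01_test[OF D t], of k] lam_gt0[of k] by simp
  then show "(%k. coef k / lam k * (LINT x|MM. G k x \<bullet> grad_of ph x)) sums (LINT x|MM. ph x)"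
   using Parseval[OF test_sqi(1)[OF D t]] by simp
 qed
 then show ?thesis unfolding torsion_def using v by blast
qed

lemma summable_coef_A:
 assumes "summable (%k. (A k)^2)"
 shows "summable (%k. \<bar>coef k * A k\<bar>)" "summable (%k. \<bar>coef k / lam k * A k\<bar>)"
proof -
 have b: "\<bar>coef k * A k\<bar> <= (coef k)^2 + (A k)^2" for k
 proof -
  have "2 * (\<bar>coef k\<bar> * \<bar>A k\<bar>) <= (coef k)^2 + (A k)^2" using sum_squares_bound[of "\<bar>coef k\<bar>" "\<bar>A k\<bar>"] by simp
  moreover have "0 <= \<bar>coef k\<bar> * \<bar>A k\<bar>" by simp
  ultimately show ?thesis unfolding abs_mult by linarith
 qed
 show 1: "summable (%k. \<bar>coef k * A k\<bar>)"
  by (rule summable_comparison_test'[OF summable_add[OF coef_sq assms], of 0]) (use b in simp)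
 have "\<bar>coef k / lam k * A k\<bar> <= \<bar>coef k * A k\<bar> * (1 / lam 0)" for k
  using lam_ge[of k] lam0_pos lam_gt0[of k] by (simp add: abs_mult frac_le)
 then show "summable (%k. \<bar>coef k / lam k * A k\<bar>)"
  by (intro summable_comparison_test'[OF summable_mult2[OF 1, of "1 / lam 0"], of 0]) simp
qed

lemma summable_coef_B:
 assumes "summable (%k. (B k)^2 / lam k)"
 shows "summable (%k. \<bar>coef k / lam k * B k\<bar>)"
proof -
 have b: "\<bar>coef k / lam k * B k\<bar> <= (coef k)^2 * (1 / lam 0) + (B k)^2 / lam k" for k
 proof -
  have "2 * (\<bar>coef k\<bar> * \<bar>B k\<bar>) <= (coef k)^2 + (B k)^2" using sum_squares_bound[of "\<bar>coef k\<bar>" "\<bar>B k\<bar>"] by simp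
  moreover have "0 <= \<bar>coef k\<bar> * \<bar>B k\<bar>" by simp
  ultimately have "\<bar>coef k\<bar> * \<bar>B k\<bar> <= (coef k)^2 + (B k)^2" by linarith
  then have "\<bar>coef k\<bar> * \<bar>B k\<bar> / lam k <= ((coef k)^2 + (B k)^2) / lam k"
   using lam_gt0[of k] by (intro divide_right_mono) auto
  moreover have "(coef k)^2 / lam k <= (coef k)^2 * (1 / lam 0)"
   using lam_ge[of k] lam0_pos by (simp add: frac_le)
  ultimately show ?thesis using lam_gt0[of k] by (simp add: abs_mult add_divide_distrib)
 qed
 show ?thesis
  by (rule summable_comparison_test'[OF summable_add[OF summable_mult2[OF coef_sq, of "1 / lam 0"] assms], of 0]) (use b in simp)
qed

end

section \<open>Transfer of the boundary conditions from the heat flow to the torsion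
  function\<close>

locale heat_modes = dirichlet_modes +
 fixes w :: "'a set" and U :: "real => 'a => real" and v :: "'a => real" and Ga :: "'a => 'a"
 assumes w: "open w" "w \<subseteq> Om" and U: "heat_solution Om lam phi U" and tor: "torsion v Ga"
begin

lemma bw: "bounded w" using bounded_subset[OF D(2) w(2)] .

lemmas on_w = lebesgue_on_subset_integral[OF w(1) D(1) w(2)] and sub = sqi_subset[OF w(1) D(1) w(2)]

lemma v_Ga: "sqi MM v" "sqi MM Ga" "psums (%k. coef k / lam k) v" "gsums (%k. coef k / lam k) Ga"
 using tor H01_D unfolding torsion_def by blast+

lemma U_sqi: "t > 0 ==> sqi MM (U t)" using U unfolding heat_solution_def L2_on_sqi by blast

lemma U_series:
 assumes "t > 0"
 shows "(%n. LINT x|MM. (norm ((\<Sum>k<n. (coef k * exp (- lam k * t)) *\<^sub>R phi k x) - U t x))^2) \<longlonglongrightarrow> 0"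
 using U assms unfolding heat_solution_def coef_def by (simp add: power2_commute)

lemmas U_psums = psumsI[OF U_sqi U_series]

text \<open>The overdetermined conditions speak of some weak gradient on \<open>w\<close>;
  uniqueness identifies it almost everywhere with the gradient series on the whole domain.\<close>

lemma U_gradient:
 assumes t: "t > 0" and H: "H1 w (U t) G'"
 shows "\<exists>De. gsums (%k. coef k * exp (- lam k * t)) De \<and> (AE x in lebesgue_on w. G' x = De x)"
proof -
 obtain De where g: "sqi MM De" "(%n. LINT x|MM. (norm ((\<Sum>k<n. (coef k * exp (- lam k * t)) *\<^sub>R G k x) - De x))^2) \<longlonglongrightarrow> 0"
  using orth_series[OF fin_M orth_G coef_exp_sq(2)[OF t]] by auto
 have hn: "H01 Om (%x. \<Sum>k<n. (coef k * exp (- lam k * t)) *\<^sub>R phi k x) (%x. \<Sum>k<n. (coef k * exp (- lam k * t)) *\<^sub>R G k x)" for n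
  using H01_sum[OF D, of "{..<n}" phi G "%k. coef k * exp (- lam k * t)"] G by simp
 have "weak_grad Om (U t) De"
  by (rule weak_grad_limit[OF D H01_D(1)[OF hn] H01_D(2)[OF hn] U_sqi[OF t] g(1) H01_D(3)[OF hn] U_series[OF t] g(2)])
 then have "AE x in lebesgue_on w. G' x = De x"
  using H weak_grad_unique[OF w(1) bw _ sub(1)[OF g(1)] _ weak_grad_subset[OF w(1) D(1) w(2)]] unfolding H1_def L2v_on_sqi by blast
 then show ?thesis using gsumsI[OF g] by blast
qed

lemma U_laplacian:
 assumes t: "t > 0" and H: "weak_lap w (U t) L'" "L2_on w L'"
 shows "\<exists>L. psums (%k. - coef k * lam k * exp (- lam k * t)) L \<and> (AE x in lebesgue_on w. L' x = L x)"
proof -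
 obtain L where L0: "sqi MM L" "(%n. LINT x|MM. (norm ((\<Sum>k<n. (- coef k * lam k * exp (- lam k * t)) *\<^sub>R phi k x) - L x))^2) \<longlonglongrightarrow> 0"
  using orth_series[OF fin_M orth_phi, of "%k. - coef k * lam k * exp (- lam k * t)"] coef_exp_sq(3)[OF t] by auto
 note L = L0(1) psumsI[OF L0]
 have "AE x in lebesgue_on w. L' x = L x"
 proof (rule L2_zero[OF w(1) bw _ sub(1)[OF L(1)]])
  show "sqi (lebesgue_on w) L'" using H(2) by (simp add: L2_on_sqi)
  fix ph assume tp: "test_fun w ph"
  have tO: "test_fun Om ph" by (rule test_mono[OF tp w(2)])
  have z: "indicator w x * (U t x * lap_of ph x) = U t x * lap_of ph x" "indicator w x * (h x * ph x) = h x * ph x" for x and h :: "'a => real"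
   using test_zero_outside[OF tp, of x] test_zero_outside[OF test_fun_lap[OF tp], of x] by (auto simp: indicator_def)
  have "(LINT x|MM. U t x * lap_of ph x) = (LINT x|MM. L x * ph x)"
   using sums_unique2[OF psumsD[OF U_psums[OF t t] test_sqi(1)[OF D test_fun_lap[OF tO]]]]
    psumsD[OF L(2) test_sqi(1)[OF D tO]] unfolding phi_lap[OF tO] by (simp add: mult_ac)
  moreover have "(LINT x|lebesgue_on w. U t x * lap_of ph x) = (LINT x|lebesgue_on w. L' x * ph x)"
   using H(1) tp unfolding weak_lap_def by blast
  ultimately show "(LINT x|lebesgue_on w. L' x * ph x) = (LINT x|lebesgue_on w. L x * ph x)" unfolding on_w z by simp
 qed
 then show ?thesis using L(2) by blast
qed

lemma test_ind_sqi:
 assumes "test_fun UNIV ps"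
 shows "sqi MM (%x. indicator w x *\<^sub>R ps x)" "sqi MM (%x. indicator w x *\<^sub>R grad_of ps x)"
 by (rule sub(2)[OF test_sqi(1)[OF D assms]], rule sub(2)[OF test_sqi(2)[OF D assms]])

text \<open>For fixed \<open>ps\<close> the conormal identity at time \<open>t n\<close> is the
  value of one Dirichlet series. Requiring \<open>b n * bdry_integral w ps = 0\<close> removes the
  unknown constants, and it also admits a \<open>ps\<close> whose boundary integral is 0 merely by
  default.\<close>

lemma conormal_torsion:
 assumes tp: "!!n::nat. t n > 0" and acc: "(\<exists>ts>0. ts islimpt range t) \<or> \<not> bdd_above (range t)"
  and c: "!!n. conormal_const w (U (t n)) (b n)" and p: "test_fun UNIV ps" and z: "!!n. b n * bdry_integral w ps = 0"
 shows "(LINT x|lebesgue_on w. Ga x \<bullet> grad_of ps x - ps x) = 0"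
proof -
 define A B where "A k = (LINT x|MM. phi k x * (indicator w x *\<^sub>R ps x))"
  "B k = (LINT x|MM. G k x \<bullet> (indicator w x *\<^sub>R grad_of ps x))" for k
 note tw = test_sqi[OF w(1) bw p]
 have split: "(LINT x|lebesgue_on w. f x * ps x + F x \<bullet> grad_of ps x)
   = (LINT x|MM. f x * (indicator w x *\<^sub>R ps x)) + (LINT x|MM. F x \<bullet> (indicator w x *\<^sub>R grad_of ps x))"
  if "sqi MM f" "sqi MM F" for f F
  using integral_add[OF sqi_mult[OF sub(1)[OF that(1)] tw(1)] sqi_inner[OF sub(1)[OF that(2)] tw(2)]]
  unfolding on_w by (simp add: mult_ac)
 \<comment> \<open>\<open>- lam k * A k\<close> comes from the Laplacian and \<open>B k\<close> from
   the gradient; dividing by \<open>lam k\<close> gives the corresponding coefficients for the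
   torsion function, whose Laplacian is -1.\<close>
 define e where "e k = coef k / lam k * (- lam k * A k + B k)" for k
 have e: "e k = - (coef k * A k) + coef k / lam k * B k" for k using lam_gt0[of k] by (simp add: e_def algebra_simps)
 have "(%k. e k * lam k * exp (- lam k * t n)) sums 0" for n
 proof -
  obtain G' L' where c': "H1 w (U (t n)) G'" "L2_on w L'" "weak_lap w (U (t n)) L'"
   "(LINT x|lebesgue_on w. L' x * ps x + G' x \<bullet> grad_of ps x) = b n * bdry_integral w ps"
   using c[of n] p unfolding conormal_const_def by blast
  obtain De where g: "gsums (%k. coef k * exp (- lam k * t n)) De" "AE x in lebesgue_on w. G' x = De x"
   using U_gradient[OF tp c'(1)] by blast
  obtain L where l: "psums (%k. - coef k * lam k * exp (- lam k * t n)) L" "AE x in lebesgue_on w. L' x = L x"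
   using U_laplacian[OF tp c'(3,2)] by blast
  have s: "sqi MM L" "sqi MM De" using g(1) l(1) by (auto simp: psums_def gsums_def)
  have s': "sqi (lebesgue_on w) G'" "sqi (lebesgue_on w) L'" using c' unfolding H1_def L2v_on_sqi L2_on_sqi by auto
  have "(LINT x|lebesgue_on w. L' x * ps x + G' x \<bullet> grad_of ps x) = (LINT x|lebesgue_on w. L x * ps x + De x \<bullet> grad_of ps x)"
  proof (rule integral_cong_AE)
   show "AE x in lebesgue_on w. L' x * ps x + G' x \<bullet> grad_of ps x = L x * ps x + De x \<bullet> grad_of ps x"
    using g(2) l(2) by eventually_elim simp
  qed (use sqi_mult[OF s'(2) tw(1)] sqi_inner[OF s'(1) tw(2)] sqi_mult[OF sub(1)[OF s(1)] tw(1)] sqi_inner[OF sub(1)[OF s(2)] tw(2)] in auto)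
  then have X: "(LINT x|MM. L x * (indicator w x *\<^sub>R ps x)) + (LINT x|MM. De x \<bullet> (indicator w x *\<^sub>R grad_of ps x)) = 0"
   using c'(4) z split[OF s] by simp
  have "(%k. - coef k * lam k * exp (- lam k * t n) * A k + coef k * exp (- lam k * t n) * B k) sums 0" unfolding A_B_def
   by (rule sums_add[OF psumsD[OF l(1) test_ind_sqi(1)[OF p]] gsumsD[OF g(1) test_ind_sqi(2)[OF p]], unfolded X])
  moreover have "- coef k * lam k * exp (- lam k * t n) * A k + coef k * exp (- lam k * t n) * B k = e k * lam k * exp (- lam k * t n)" for k
   unfolding e_def using lam_gt0[of k] by (simp add: field_simps)
  ultimately show ?thesis by simp
 qed
 moreover have "summable (%k. \<bar>e k\<bar>)"
 proof (rule summable_comparison_test')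
  show "summable (%k. \<bar>coef k * A k\<bar> + \<bar>coef k / lam k * B k\<bar>)" unfolding A_B_def
   by (intro summable_add summable_coef_A(1) summable_coef_B A_sq B_sq test_ind_sqi p)
  show "norm \<bar>e k\<bar> <= \<bar>coef k * A k\<bar> + \<bar>coef k / lam k * B k\<bar>" for k
   unfolding e using abs_triangle_ineq[of "- (coef k * A k)" "coef k / lam k * B k"] by simp
 qed
 ultimately have "(\<Sum>k. e k) = 0" using dirichlet_series_zero[OF lam_mono lam0_pos, of e t] tp acc by blast
 moreover have "e sums (- (LINT x|MM. indicator w x *\<^sub>R ps x) + (LINT x|MM. Ga x \<bullet> (indicator w x *\<^sub>R grad_of ps x)))"
  unfolding e[abs_def] A_B_def by (intro sums_add sums_minus Parseval gsumsD[OF v_Ga(4)] test_ind_sqi p)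
 moreover have "(LINT x|lebesgue_on w. Ga x \<bullet> grad_of ps x - ps x) = (LINT x|lebesgue_on w. Ga x \<bullet> grad_of ps x) - (LINT x|lebesgue_on w. ps x)"
  by (intro integral_diff sqi_inner[OF sub(1)[OF v_Ga(2)] tw(2)]
   sqi_integrable[OF finite_measure_lebesgue_on[OF w(1) bw] tw(1)])
 ultimately show ?thesis unfolding on_w by (simp add: sums_iff)
qed

text \<open>Pair \<open>f\<close> with \<open>Ga x \<bullet> grad_of te x - te x\<close> and its
  gradient with \<open>te x *\<^sub>R Ga x\<close>. For smooth \<open>f\<close> this is the conormal
  expression of the product \<open>f * te\<close>, hence \<open>- ka\<close> times the boundary
  integral of that product. The functional is continuous in H^1, so it can be evaluated at
  \<open>U (t n)\<close> through the approximants of the trace condition, where it is a multiple of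
  the zero boundary mean of \<open>te\<close>. The claim is that it vanishes at \<open>v\<close>
  too.\<close>

lemma trace_torsion:
 fixes te :: "'a => real"
 assumes tp: "!!n::nat. t n > 0" and acc: "(\<exists>ts>0. ts islimpt range t) \<or> \<not> bdd_above (range t)"
  and tr: "!!n. trace_const w (U (t n)) (a n)" and p: "test_fun UNIV te" and z: "bdry_integral w te = 0"
  and fin: "integrable surface_measure (indicator (frontier w) :: 'a => real)"
  and con: "!!ps. test_fun UNIV ps ==> (LINT x|lebesgue_on w. Ga x \<bullet> grad_of ps x - ps x) = - ka * bdry_integral w ps"
 shows "(LINT x|lebesgue_on w. v x * (Ga x \<bullet> grad_of te x - te x) + Ga x \<bullet> (te x *\<^sub>R Ga x)) = 0"
proof -
 obtain K1 where K1: "!!x. \<bar>te x\<bar> <= K1" using test_bounded[OF p] by blast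
 obtain K2 where K2: "!!x. norm (grad_of te x) <= K2" using grad_of_bounded[OF p] by blast
 define al be where "al x = Ga x \<bullet> grad_of te x - te x" "be x = te x *\<^sub>R Ga x" for x
 have sb: "sqi MM be" unfolding al_be_def
  by (rule sqi_bounded_mult[OF v_Ga(2) measurable_lebesgue_onI[OF borel_measurable_test[OF p]] K1])
 have "sqi MM (%x. Ga x \<bullet> grad_of te x)"
 proof (rule sqi_bound[where g = "%x. K2^2 * (norm (Ga x))^2"])
  show "(%x. Ga x \<bullet> grad_of te x) \<in> borel_measurable MM"
   by (intro borel_measurable_inner sqi_meas[OF v_Ga(2)] measurable_lebesgue_onI[OF grad_of_borel[OF p]])
  show "(norm (Ga x \<bullet> grad_of te x))^2 <= K2^2 * (norm (Ga x))^2" for x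
   using power_mono[OF order_trans[OF Cauchy_Schwarz_ineq2 mult_left_mono[OF K2 norm_ge_zero]] abs_ge_zero, of "Ga x" x 2]
   by (simp add: power_mult_distrib mult.commute)
 qed (use sqi_sq[OF v_Ga(2)] in simp)
 then have sa: "sqi MM al" unfolding al_be_def by (rule sqi_diff[OF _ test_sqi(1)[OF D p]])
 note sw = sub(1)[OF sa] sub(1)[OF sb]
 define al' be' where "al' x = indicator w x *\<^sub>R al x" "be' x = indicator w x *\<^sub>R be x" for x
 have sw': "sqi MM al'" "sqi MM be'" unfolding al'_be'_def by (rule sub(2)[OF sa], rule sub(2)[OF sb])
 have split: "(LINT x|lebesgue_on w. f x * al x) + (LINT x|lebesgue_on w. F x \<bullet> be x) = (LINT x|MM. f x * al' x) + (LINT x|MM. F x \<bullet> be' x)" for f F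
  unfolding on_w al'_be'_def by (simp add: mult_ac)
 define e where "e k = coef k / lam k * ((LINT x|MM. phi k x * al' x) + (LINT x|MM. G k x \<bullet> be' x))" for k
 have "(%k. e k * lam k * exp (- lam k * t n)) sums 0" for n
 proof -
  obtain G' ps where tr': "H1 w (U (t n)) G'" "!!m::nat. test_fun UNIV (ps m)"
   "(%m. LINT x|lebesgue_on w. (ps m x - U (t n) x)^2 + (norm (grad_of (ps m) x - G' x))^2) \<longlonglongrightarrow> 0"
   "(%m. bdry_integral w (%x. (ps m x - a n)^2)) \<longlonglongrightarrow> 0"
   using tr[of n] unfolding trace_const_def by blast
  obtain De where g': "gsums (%k. coef k * exp (- lam k * t n)) De" "AE x in lebesgue_on w. G' x = De x"
   using U_gradient[OF tp tr'(1)] by blast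
  have sD: "sqi MM De" using g'(1) by (simp add: gsums_def)
  have sG': "sqi (lebesgue_on w) G'" using tr'(1) by (simp add: H1_def L2v_on_sqi)
  have sU: "sqi (lebesgue_on w) (U (t n))" by (rule sub(1)[OF U_sqi[OF tp]])
  note tm = test_sqi[OF w(1) bw tr'(2)]
  note lim = tendsto_split_sq[OF sqi_diff[OF tm(1) sU] sqi_diff[OF tm(2) sG'] tr'(3)]
  define I where "I m = (LINT x|lebesgue_on w. ps m x * al x) + (LINT x|lebesgue_on w. grad_of (ps m) x \<bullet> be x)" for m
  have I_eq: "I m = - ka * bdry_integral w (%x. ps m x * te x)" for m
  proof -
   have "ps m x * al x + grad_of (ps m) x \<bullet> be x = Ga x \<bullet> grad_of (%x. ps m x * te x) x - ps m x * te x" for x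
    unfolding al_be_def grad_of_mult[OF test_differentiable[OF tr'(2)] test_differentiable[OF p]]
    by (simp add: inner_add_right inner_commute algebra_simps)
   then show ?thesis unfolding I_def con[OF test_fun_mult[OF p test_smooth[OF tr'(2)]], symmetric]
    using sqi_mult[OF tm(1) sw(1)] sqi_inner[OF tm(2) sw(2)] by (simp flip: integral_add)
  qed
  have "I \<longlonglongrightarrow> (LINT x|lebesgue_on w. U (t n) x * al x) + (LINT x|lebesgue_on w. G' x \<bullet> be x)"
   unfolding I_def
   using tendsto_add[OF integral_inner_tendsto[OF tm(1) sU sw(1) lim(1)] integral_inner_tendsto[OF tm(2) sG' sw(2) lim(2)]] by simp
  moreover have "I \<longlonglongrightarrow> - ka * (a n * bdry_integral w te)" unfolding I_eq[abs_def]
  proof (rule tendsto_mult_left)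
   let ?S = "surface_measure :: 'a measure"
   define F where "F = frontier w"
   note iS = surface_bounded_integrable[OF fin[folded F_def]]
   have sS: "sqi ?S (%x. indicator F x * f x)" if f: "f \<in> borel_measurable borel" "!!x. \<bar>f x\<bar> <= K" for f :: "'a => real" and K
   proof -
    have "(f x)^2 <= K^2" for x using power_mono[OF f(2)[of x] abs_ge_zero, of 2] by simp
    then have "integrable ?S (%x. indicator F x * (f x)^2)" by (intro iS[where K = "K^2"]) (use f(1) in auto)
    moreover have "(%x. (norm (indicator F x * f x))^2) = (%x. indicator F x * (f x)^2)"
     by (auto simp: indicator_def)
    ultimately show ?thesis using iS[OF f] unfolding sqi_def by simp
   qed
   have s1: "sqi ?S (%x. indicator F x * (ps m x - a n))" for m
   proof -
    obtain K where "!!x. \<bar>ps m x\<bar> <= K" using test_bounded[OF tr'(2)] by blast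
    then have "\<bar>ps m x - a n\<bar> <= K + \<bar>a n\<bar>" for x
     using order_trans[OF abs_triangle_ineq4[of "ps m x" "a n"] add_right_mono] by blast
    then show ?thesis by (rule sS[rotated]) (use borel_measurable_test[OF tr'(2)] in simp)
   qed
   note cm = borel_measurable_test[OF p]
   have s2: "sqi ?S (%x. indicator F x * te x)" by (rule sS[OF cm K1])
   define c where "c = (LINT x|?S. (norm (indicator F x * te x))^2)"
   \<comment> \<open>Cauchy-Schwarz on the boundary, with finite surface measure, turns L^2
     convergence of the boundary values to \<open>a n\<close> into convergence of the integrals
     against \<open>te\<close>.\<close>
   have b: "(bdry_integral w (%x. ps m x * te x) - a n * bdry_integral w te)^2 <= bdry_integral w (%x. (ps m x - a n)^2) * c" for m
   proof -
    have "indicator F x * (ps m x * te x) = (indicator F x * (ps m x - a n)) * (indicator F x * te x) + a n * (indicator F x * te x)" for x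
     by (simp add: indicator_def algebra_simps)
    then have "bdry_integral w (%x. ps m x * te x) - a n * bdry_integral w te = (LINT x|?S. (indicator F x * (ps m x - a n)) \<bullet> (indicator F x * te x))"
     unfolding bdry_integral_def F_def[symmetric] using sqi_mult[OF s1 s2, of m] iS[OF cm K1] by simp
    moreover have "(%x. (norm (indicator F x * (ps m x - a n)))^2) = (%x. indicator F x * (ps m x - a n)^2)"
     by (auto simp: indicator_def)
    ultimately show ?thesis using Cauchy_Schwarz_integral[OF s1[of m] s2] by (simp add: bdry_integral_def F_def c_def)
   qed
   have "(%m. (bdry_integral w (%x. ps m x * te x) - a n * bdry_integral w te)^2) \<longlonglongrightarrow> 0"
    by (rule tendsto_sandwich[OF _ _ tendsto_const tendsto_mult_left_zero[OF tr'(4)]])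
     (rule always_eventually, simp, rule always_eventually, rule allI, rule b)
   then have "(%m. bdry_integral w (%x. ps m x * te x) - a n * bdry_integral w te) \<longlonglongrightarrow> 0"
    using tendsto_real_sqrt[of _ 0] by (fastforce simp: tendsto_rabs_zero_iff)
   then show "(%m. bdry_integral w (%x. ps m x * te x)) \<longlonglongrightarrow> a n * bdry_integral w te" by (rule LIM_zero_cancel)
  qed
  ultimately have "(LINT x|lebesgue_on w. U (t n) x * al x) + (LINT x|lebesgue_on w. G' x \<bullet> be x) = 0"
   using LIMSEQ_unique z by fastforce
  moreover have "(LINT x|lebesgue_on w. G' x \<bullet> be x) = (LINT x|lebesgue_on w. De x \<bullet> be x)"
   by (rule integral_cong_AE) (use g'(2) sqi_inner[OF sG' sw(2)] sqi_inner[OF sub(1)[OF sD] sw(2)] in auto)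
  ultimately have X: "(LINT x|MM. U (t n) x * al' x) + (LINT x|MM. De x \<bullet> be' x) = 0" using split[of "U (t n)" De] by simp
  have "(%k. coef k * exp (- lam k * t n) * (LINT x|MM. phi k x * al' x)
   + coef k * exp (- lam k * t n) * (LINT x|MM. G k x \<bullet> be' x)) sums 0"
   using sums_add[OF psumsD[OF U_psums[OF tp tp, of n] sw'(1)] gsumsD[OF g'(1) sw'(2)]] unfolding X .
  moreover have "coef k * exp (- lam k * t n) * A + coef k * exp (- lam k * t n) * B = (coef k / lam k * (A + B)) * lam k * exp (- lam k * t n)" for k A B
   using lam_gt0[of k] by (simp add: field_simps)
  ultimately show ?thesis by (simp add: e_def)
 qed
 moreover have "summable (%k. \<bar>e k\<bar>)"
 proof (rule summable_comparison_test')
  show "summable (%k. \<bar>coef k / lam k * (LINT x|MM. phi k x * al' x)\<bar> + \<bar>coef k / lam k * (LINT x|MM. G k x \<bullet> be' x)\<bar>)"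
   by (intro summable_add summable_coef_A(2) summable_coef_B A_sq B_sq sw')
  show "norm \<bar>e k\<bar> <= \<bar>coef k / lam k * (LINT x|MM. phi k x * al' x)\<bar> + \<bar>coef k / lam k * (LINT x|MM. G k x \<bullet> be' x)\<bar>" for k
   unfolding e_def distrib_left real_norm_def abs_idempotent by (rule abs_triangle_ineq)
 qed
 ultimately have "(\<Sum>k. e k) = 0" using dirichlet_series_zero[OF lam_mono lam0_pos, of e t] tp acc by blast
 moreover have "e sums ((LINT x|MM. v x * al' x) + (LINT x|MM. Ga x \<bullet> be' x))"
  unfolding e_def[abs_def] distrib_left by (intro sums_add psumsD[OF v_Ga(3)] gsumsD[OF v_Ga(4)] sw')
 ultimately have "(LINT x|lebesgue_on w. v x * al x) + (LINT x|lebesgue_on w. Ga x \<bullet> be x) = 0" unfolding split by (simp add: sums_iff)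
 then show ?thesis
  using sqi_mult[OF sub(1)[OF v_Ga(1)] sw(1)] sqi_inner[OF sub(1)[OF v_Ga(2)] sw(2)] by (simp add: al_be_def)
qed

end

section \<open>Hausdorff measure of Lipschitz boundaries\<close>

lemma hausdorff_pre_mono: "A \<subseteq> B ==> hausdorff_pre s de A <= hausdorff_pre s de B"
 unfolding hausdorff_pre_def by (rule INF_superset_mono) auto

lemma hausdorff_outer_mono: "A \<subseteq> B ==> hausdorff_outer s A <= hausdorff_outer s B"
 unfolding hausdorff_outer_def by (rule SUP_mono) (auto intro: hausdorff_pre_mono)

definition hconst :: "real => real" where "hconst s = pi powr (s / 2) / Gamma (s / 2 + 1)"

lemma hconst_pos: "s >= 0 ==> hconst s > 0" unfolding hconst_def by (intro divide_pos_pos Gamma_real_pos) auto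

text \<open>Preimages of the members of a cover of the image form a cover of \<open>A\<close> with
  diameters shrunk by 1 / c. This argument is purely metric, so \<open>f\<close> may come from
  pointwise choices.\<close>

lemma hausdorff_outer_expanding:
 fixes f :: "'a::euclidean_space => 'b::euclidean_space"
 assumes c: "c > 0" and f: "!!x y. x \<in> A ==> y \<in> A ==> c * dist x y <= dist (f x) (f y)" and s: "s >= 0"
 shows "ennreal (c powr s) * hausdorff_outer s A <= hausdorff_outer s (f ` A)"
proof -
 have pre: "ennreal (c powr s) * hausdorff_pre s de A <= hausdorff_outer s (f ` A)" if d: "de > 0" for de
 proof -
  have "ennreal (c powr s) * hausdorff_pre s de A <= hausdorff_pre s (c * de) (f ` A)"
   unfolding hausdorff_pre_def[of s "c * de"]
  proof (rule INF_greatest)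
   fix C :: "nat => 'b set"
   assume "C \<in> {C. f ` A \<subseteq> (\<Union>i. C i) \<and> (\<forall>i. bounded (C i) \<and> diameter (C i) <= c * de)}"
   then have C: "f ` A \<subseteq> (\<Union>i. C i)" "!!i. bounded (C i)" "!!i. diameter (C i) <= c * de" by auto
   define E where "E i = {x \<in> A. f x \<in> C i}" for i
   have dE: "dist x y <= diameter (C i) / c" if "x \<in> E i" "y \<in> E i" for x y i
   proof -
    have "c * dist x y <= dist (f x) (f y)" using f that by (simp add: E_def)
    also have "... <= diameter (C i)" using diameter_bounded_bound[OF C(2)] that by (simp add: E_def)
    finally show ?thesis using c by (simp add: field_simps)
   qed
   have bE: "bounded (E i)" for i unfolding bounded_def by (metis dE dist_commute)
   have diE: "diameter (E i) <= diameter (C i) / c" for i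
    by (rule diameter_le) (use dE diameter_ge_0[OF C(2)] c in \<open>auto simp: dist_norm\<close>)
   have "hausdorff_pre s de A <= (\<Sum>i. ennreal (hconst s * (diameter (E i) / 2) powr s))"
    unfolding hausdorff_pre_def hconst_def[symmetric]
   proof (rule INF_lower)
    have "diameter (E i) <= de" for i using diE[of i] divide_right_mono[OF C(3)[of i], of c] c by simp
    then show "E \<in> {C. A \<subseteq> (\<Union>i. C i) \<and> (\<forall>i. bounded (C i) \<and> diameter (C i) <= de)}"
     using C(1) bE by (auto simp: E_def)
   qed
   then have "ennreal (c powr s) * hausdorff_pre s de A <= ennreal (c powr s) * (\<Sum>i. ennreal (hconst s * (diameter (E i) / 2) powr s))"
    by (intro mult_left_mono) auto
   also have "... = (\<Sum>i. ennreal (c powr s) * ennreal (hconst s * (diameter (E i) / 2) powr s))" by simp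
   also have "... <= (\<Sum>i. ennreal (hconst s * (diameter (C i) / 2) powr s))"
   proof (rule suminf_le)
    fix i
    have "c powr s * (hconst s * (diameter (E i) / 2) powr s) = hconst s * (c * (diameter (E i) / 2)) powr s"
    proof -
     have "(c * (diameter (E i) / 2)) powr s = c powr s * (diameter (E i) / 2) powr s" by (rule powr_mult)
     then show ?thesis by (simp only: mult_ac)
    qed
    also have "... <= hconst s * (diameter (C i) / 2) powr s"
     using diE[of i] c s hconst_pos[OF s] diameter_ge_0[OF bE[of i]] by (intro mult_left_mono powr_mono2) (auto simp: field_simps)
    finally show "ennreal (c powr s) * ennreal (hconst s * (diameter (E i) / 2) powr s) <= ennreal (hconst s * (diameter (C i) / 2) powr s)"
     by (simp add: ennreal_mult'[symmetric] ennreal_leI)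
   qed auto
   finally show "ennreal (c powr s) * hausdorff_pre s de A <= (\<Sum>i. ennreal (pi powr (s / 2) / Gamma (s / 2 + 1) * (diameter (C i) / 2) powr s))"
    unfolding hconst_def .
  qed
  also have "... <= hausdorff_outer s (f ` A)" unfolding hausdorff_outer_def by (rule SUP_upper) (use c d in simp)
  finally show ?thesis .
 qed
 have "ennreal (c powr s) * hausdorff_outer s A = (SUP de\<in>{0<..}. ennreal (c powr s) * hausdorff_pre s de A)"
  unfolding hausdorff_outer_def by (rule SUP_mult_left_ennreal)
 also have "... <= hausdorff_outer s (f ` A)" by (rule SUP_least) (use pre in simp)
 finally show ?thesis .
qed

text \<open>\<open>measure_of\<close> falls back to the zero measure if its set function is not a
  measure; a single nonzero value therefore shows that the prescribed Hausdorff values are in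
  force.\<close>

lemma emeasure_surface:
 assumes "emeasure (surface_measure :: 'a::euclidean_space measure) Y ~= 0" "X \<in> sets borel"
 shows "emeasure (surface_measure :: 'a measure) X = hausdorff_outer (real DIM('a) - 1) X"
 using assms unfolding surface_measure_def emeasure_measure_of_conv
 using sets.sigma_sets_eq[of "borel :: 'a measure"] by (auto split: if_splits)

definition tube :: "'a::euclidean_space => real => 'a set => 'a set" where
 "tube e m C = {z + s *\<^sub>R e | z s. z \<in> C \<and> \<bar>s\<bar> <= m}"

text \<open>The tube over a set of diameter at most \<open>d\<close> is covered by about 2 m / d
  balls of radius \<open>2 * d\<close> strung along \<open>e\<close>. The positive bound
  \<open>d\<close> may exceed the diameter, which is what sets of diameter 0 require.\<close>

lemma tube_volume_aux:
 fixes C :: "'a::euclidean_space set"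
 assumes e: "norm e = 1" and C: "bounded C" "diameter C <= d" and d: "0 < d" "d <= ro" and m: "m >= 0"
 shows "\<exists>E. E \<in> sets borel \<and> tube e m C \<subseteq> E \<and>
  emeasure lborel E <= ennreal (unit_ball_vol (DIM('a)) * 2 ^ DIM('a) * (2 * m + ro) * d ^ (DIM('a) - 1))"
proof (cases "C = {}")
 case True
 then show ?thesis by (intro exI[of _ "{}"]) (auto simp: tube_def)
next
 case False
 then obtain z0 where z0: "z0 \<in> C" by blast
 define J where "J = nat \<lfloor>2 * m / d\<rfloor>"
 define E where "E = (\<Union>j\<in>{..J}. cball (z0 + (real j * d - m) *\<^sub>R e) (2 * d))"
 have "tube e m C \<subseteq> E"
 proof
  fix x assume "x \<in> tube e m C"
  then obtain z s where x: "x = z + s *\<^sub>R e" "z \<in> C" "\<bar>s\<bar> <= m" by (auto simp: tube_def)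
  define j where "j = nat \<lfloor>(s + m) / d\<rfloor>"
  have sm: "0 <= (s + m) / d" using x(3) d by auto
  have j: "real j <= (s + m) / d" "(s + m) / d < real j + 1" using sm unfolding j_def by linarith+
  have "(s + m) / d <= 2 * m / d" using x(3) d by (intro divide_right_mono) auto
  then have "j <= J" unfolding j_def J_def by (intro nat_mono floor_mono)
  have "\<bar>s - (real j * d - m)\<bar> <= d" using j d by (simp add: field_simps)
  then have "norm ((s - (real j * d - m)) *\<^sub>R e) <= d" using e by simp
  moreover have "norm (z - z0) <= d" using diameter_bounded_bound[OF C(1) x(2) z0] C(2) by (simp add: dist_norm)
  moreover have eq: "x - (z0 + (real j * d - m) *\<^sub>R e) = (z - z0) + (s - (real j * d - m)) *\<^sub>R e"
   by (simp add: x algebra_simps)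
  ultimately have "norm (x - (z0 + (real j * d - m) *\<^sub>R e)) <= 2 * d"
   unfolding eq using norm_triangle_ineq[of "z - z0" "(s - (real j * d - m)) *\<^sub>R e"] by linarith
  then show "x \<in> E" using \<open>j <= J\<close> unfolding E_def by (auto simp: dist_norm norm_minus_commute)
 qed
 moreover have "E \<in> sets borel" unfolding E_def by auto
 moreover have "emeasure lborel E <= ennreal (unit_ball_vol (DIM('a)) * 2 ^ DIM('a) * (2 * m + ro) * d ^ (DIM('a) - 1))"
 proof -
  define v where "v = unit_ball_vol (DIM('a)) * (2 * d) ^ DIM('a)"
  have v: "v >= 0" using d by (simp add: v_def)
  have "emeasure lborel E <= (\<Sum>j\<in>{..J}. emeasure lborel (cball (z0 + (real j * d - m) *\<^sub>R e) (2 * d)))"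
   unfolding E_def by (rule emeasure_subadditive_finite) auto
  also have "... = (\<Sum>j\<in>{..J}. ennreal v)" using d by (intro sum.cong) (auto simp: emeasure_cball v_def)
  also have "... = ennreal ((real J + 1) * v)" using v by (subst sum_ennreal) (auto simp: add.commute)
  also have "... <= ennreal (unit_ball_vol (DIM('a)) * 2 ^ DIM('a) * (2 * m + ro) * d ^ (DIM('a) - 1))"
  proof (rule ennreal_leI)
   have "0 <= 2 * m / d" using m d by simp
   then have "real J <= 2 * m / d" unfolding J_def by linarith
   then have "(real J + 1) * v <= (2 * m / d + 1) * v" using v by (intro mult_right_mono) auto
   also have "... = unit_ball_vol (DIM('a)) * 2 ^ DIM('a) * (2 * m + d) * d ^ (DIM('a) - 1)"
   proof -
    have "d ^ DIM('a) = d * d ^ (DIM('a) - 1)" by (metis DIM_positive Suc_pred' power_Suc)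
    then show ?thesis using d by (simp add: v_def power_mult_distrib field_simps)
   qed
   also have "... <= unit_ball_vol (DIM('a)) * 2 ^ DIM('a) * (2 * m + ro) * d ^ (DIM('a) - 1)"
    using d by (intro mult_left_mono mult_right_mono) auto
   finally show "(real J + 1) * v <= unit_ball_vol (DIM('a)) * 2 ^ DIM('a) * (2 * m + ro) * d ^ (DIM('a) - 1)" .
  qed
  finally show ?thesis .
 qed
 ultimately show ?thesis by blast
qed

lemma tube_volume:
 fixes C :: "'a::euclidean_space set"
 assumes N: "DIM('a) >= 2" and e: "norm e = 1" and C: "bounded C" "diameter C <= ro" and ro: "0 < ro" and m: "m >= 0"
 shows "\<exists>E. E \<in> sets borel \<and> tube e m C \<subseteq> E \<and>
  emeasure lborel E <= ennreal (unit_ball_vol (DIM('a)) * 2 ^ DIM('a) * (2 * m + ro) * diameter C ^ (DIM('a) - 1))"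
proof (cases "diameter C > 0")
 case True
 then show ?thesis using tube_volume_aux[OF e C(1) order_refl True C(2) m] by blast
next
 case False
 then have dC: "diameter C = 0" using diameter_ge_0[OF C(1)] by simp
 \<comment> \<open>A set of diameter 0 is given the artificial bounds ro / (n + 1); in dimension at
   least 2 the resulting volumes tend to 0.\<close>
 define k where "k = unit_ball_vol (DIM('a)) * 2 ^ DIM('a) * (2 * m + ro)"
 have "\<forall>n. \<exists>E. E \<in> sets borel \<and> tube e m C \<subseteq> E \<and> emeasure lborel E <= ennreal (k * (ro / Suc n) ^ (DIM('a) - 1))"
  unfolding k_def
  by (rule allI, rule tube_volume_aux[OF e C(1) _ _ _ m]) (use ro dC in \<open>auto simp: field_simps\<close>)
 then obtain E where E: "!!n. E n \<in> sets borel" "!!n. tube e m C \<subseteq> E n" "!!n. emeasure lborel (E n) <= ennreal (k * (ro / Suc n) ^ (DIM('a) - 1))"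
  by metis
 define I where "I = (\<Inter>n. E n)"
 have I: "I \<in> sets borel" "tube e m C \<subseteq> I" unfolding I_def using E by auto
 have le: "emeasure lborel I <= ennreal (k * (ro / Suc n) ^ (DIM('a) - 1))" for n
  by (rule order_trans[OF emeasure_mono E(3)]) (use E(1) in \<open>auto simp: I_def\<close>)
 have l0: "(%n. ro / Suc n) \<longlonglongrightarrow> 0"
  using tendsto_mult[OF tendsto_const LIMSEQ_inverse_real_of_nat, of ro] by (simp add: divide_inverse)
 have z: "k * 0 ^ (DIM('a) - 1) = 0" using N by simp
 have "(%n. k * (ro / Suc n) ^ (DIM('a) - 1)) \<longlonglongrightarrow> k * 0 ^ (DIM('a) - 1)"
  by (intro tendsto_mult tendsto_const tendsto_power l0)
 then have "(%n. ennreal (k * (ro / Suc n) ^ (DIM('a) - 1))) \<longlonglongrightarrow> ennreal 0"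
  unfolding z by (rule tendsto_ennrealI)
 then have "emeasure lborel I <= ennreal 0" by (rule LIMSEQ_le_const) (use le in blast)
 then have I0: "emeasure lborel I = 0" by simp
 show ?thesis using I I0 by (intro exI[of _ I]) auto
qed

section \<open>Charts of a Lipschitz boundary\<close>

definition lip_chart :: "'a::euclidean_space set => 'a => 'a => real => real => real => ('a => real) => bool" where
 "lip_chart D p e r h L g \<longleftrightarrow> norm e = 1 \<and> r > 0 \<and> h > 0 \<and> L >= 0 \<and>
   (\<forall>y z. y \<bullet> e = 0 \<and> z \<bullet> e = 0 --> \<bar>g y - g z\<bar> <= L * norm (y - z)) \<and>
   g 0 = 0 \<and>
   (\<forall>y. y \<bullet> e = 0 \<and> norm y < r --> \<bar>g y\<bar> < h) \<and>
   (\<forall>y s. y \<bullet> e = 0 \<and> norm y < r \<and> \<bar>s\<bar> < h -->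
     (p + y + s *\<^sub>R e \<in> D \<longleftrightarrow> s < g y))"

lemma lip_chart_exists:
 assumes "lipschitz_domain D" "p \<in> frontier D"
 shows "\<exists>e r h L g. lip_chart D p e r h L g"
proof -
 obtain e r h L and g :: "'a => real" where c: "norm e = 1" "r > 0" "h > 0"
   "\<forall>y z. y \<bullet> e = 0 \<and> z \<bullet> e = 0 --> \<bar>g y - g z\<bar> <= L * norm (y - z)" "g 0 = 0"
   "\<forall>y. y \<bullet> e = 0 \<and> norm y < r --> \<bar>g y\<bar> < h"
   "\<forall>y s. y \<bullet> e = 0 \<and> norm y < r \<and> \<bar>s\<bar> < h --> (p + y + s *\<^sub>R e \<in> D \<longleftrightarrow> s < g y)"
  using assms unfolding lipschitz_domain_def by blast
 have "\<forall>y z. y \<bullet> e = 0 \<and> z \<bullet> e = 0 --> \<bar>g y - g z\<bar> <= \<bar>L\<bar> * norm (y - z)"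
  using c(4) mult_right_mono[OF abs_ge_self[of L] norm_ge_zero] by (meson order_trans)
 then have "lip_chart D p e r h \<bar>L\<bar> g" unfolding lip_chart_def using c(1,2,3,5-7) by simp
 then show ?thesis by blast
qed

context
 fixes D :: "'a::euclidean_space set" and p e :: 'a and r h L :: real and g :: "'a => real"
 assumes chart: "lip_chart D p e r h L g" and oD: "open D"
begin

lemma chart_facts:
 "norm e = 1" "r > 0" "h > 0" "L >= 0" "g 0 = 0"
 "y \<bullet> e = 0 ==> z \<bullet> e = 0 ==> \<bar>g y - g z\<bar> <= L * norm (y - z)"
 "y \<bullet> e = 0 ==> norm y < r ==> \<bar>g y\<bar> < h"
 "y \<bullet> e = 0 ==> norm y < r ==> \<bar>s\<bar> < h ==> p + y + s *\<^sub>R e \<in> D \<longleftrightarrow> s < g y"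
 using chart unfolding lip_chart_def by blast+

lemma chart_g_bound: "y \<bullet> e = 0 ==> \<bar>g y\<bar> <= L * norm y"
 using chart_facts(6)[of y 0] chart_facts(5) by simp

lemma chart_decomp:
 fixes x :: 'a
 defines "t \<equiv> x \<bullet> e" and "y \<equiv> x - (x \<bullet> e) *\<^sub>R e"
 shows "x = y + t *\<^sub>R e" "y \<bullet> e = 0" "norm y <= norm x" "\<bar>t\<bar> <= norm x"
proof -
 have ee: "e \<bullet> e = 1" using chart_facts(1) by (simp add: norm_eq_1)
 show "x = y + t *\<^sub>R e" by (simp add: t_def y_def)
 show ye: "y \<bullet> e = 0" by (simp add: y_def inner_diff_left ee)
 show "\<bar>t\<bar> <= norm x" unfolding t_def using Cauchy_Schwarz_ineq2[of x e] chart_facts(1) by simp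
 have "(norm x)^2 = (norm y)^2 + t^2"
 proof -
  have "(norm x)^2 = (y + t *\<^sub>R e) \<bullet> (y + t *\<^sub>R e)" by (simp add: power2_norm_eq_inner t_def y_def)
  also have "... = y \<bullet> y + t * t" using ye by (simp add: inner_add inner_commute[of e y] ee)
  also have "... = (norm y)^2 + t^2" by (simp add: power2_norm_eq_inner power2_eq_square[of t])
  finally show ?thesis .
 qed
 then show "norm y <= norm x" by (intro power2_le_imp_le[of "norm y" "norm x"]) auto
qed

lemma chart_frontier:
 assumes y: "y \<bullet> e = 0" "norm y < r"
 shows "p + y + g y *\<^sub>R e \<in> frontier D"
proof -
 define x where "x = p + y + g y *\<^sub>R e"
 have gh: "\<bar>g y\<bar> < h" by (rule chart_facts(7)[OF y])
 have "x \<notin> D" unfolding x_def using chart_facts(8)[OF y gh] by simp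
 moreover have "x \<in> closure D" unfolding closure_approachable
 proof (intro allI impI)
  fix ep :: real assume "ep > 0"
  define s where "s = g y - min (ep / 2) ((g y + h) / 2)"
  have gp: "g y + h > 0" using gh by auto
  have s: "s < g y" "\<bar>s\<bar> < h" "g y - s <= ep / 2" "g y - s > 0" using gp gh \<open>ep > 0\<close> by (auto simp: s_def min_def)
  have "p + y + s *\<^sub>R e \<in> D" using chart_facts(8)[OF y s(2)] s(1) by simp
  moreover have "dist (p + y + s *\<^sub>R e) x < ep"
  proof -
   have "x - (p + y + s *\<^sub>R e) = (g y - s) *\<^sub>R e" by (simp add: x_def algebra_simps)
   then have "dist x (p + y + s *\<^sub>R e) = \<bar>g y - s\<bar>" unfolding dist_norm using chart_facts(1) by simp
   then show ?thesis using s \<open>ep > 0\<close> by (simp add: dist_commute)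
  qed
  ultimately show "\<exists>y\<in>D. dist y x < ep" by blast
 qed
 ultimately show ?thesis using oD unfolding x_def frontier_def by (simp add: interior_open)
qed

text \<open>Take the opening 1 / (2 (1 + L)) around the direction \<open>- e\<close>: the
  displacement along \<open>e\<close> and the variation of \<open>g\<close> together use up at most
  half of \<open>s\<close>, so the point stays below the graph.\<close>

lemma chart_cone:
 "\<exists>c>0. \<exists>s0>0. \<forall>s z. 0 < s --> s < s0 --> norm z <= c * s --> p - s *\<^sub>R e + z \<in> D"
proof -
 define c where "c = 1 / (2 * (1 + L))"
 have L: "L >= 0" by (rule chart_facts(4))
 have c: "c > 0" "c <= 1 / 2" "c * (1 + L) = 1 / 2" using L by (auto simp: c_def field_simps)
 define s0 where "s0 = min r (h / 2)"
 have s0: "s0 > 0" using chart_facts(2,3) by (simp add: s0_def)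
 have "p - s *\<^sub>R e + z \<in> D" if s: "0 < s" "s < s0" and z: "norm z <= c * s" for s z
 proof -
  define t y where "t = z \<bullet> e" "y = z - (z \<bullet> e) *\<^sub>R e"
  have d: "z = y + t *\<^sub>R e" "y \<bullet> e = 0" "norm y <= norm z" "\<bar>t\<bar> <= norm z"
   using chart_decomp[of z] by (auto simp: t_y_def)
  have cs: "c * s <= s / 2" using c s mult_right_mono[of c "1/2" s] by simp
  have sr: "s < r" "s < h / 2" using s(2) by (auto simp: s0_def)
  have yr: "norm y < r" using d(3) z cs s(1) sr by linarith
  have sh: "\<bar>t - s\<bar> < h" using d(4) z cs s(1) sr by linarith
  have "\<bar>g y\<bar> <= L * (c * s)" using chart_g_bound[OF d(2)] d(3) z L mult_left_mono[of "norm y" "c * s" L] by simp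
  moreover have "c * s + L * (c * s) = s / 2" using c(3)
  proof -
   have "c * s + L * (c * s) = (c * (1 + L)) * s" by (simp add: algebra_simps)
   then show ?thesis by (simp only: c(3))
  qed
  ultimately have "t - s < g y" using d(4) z s by linarith
  then have "p + y + (t - s) *\<^sub>R e \<in> D" using chart_facts(8)[OF d(2) yr sh] by simp
  moreover have "p + y + (t - s) *\<^sub>R e = p - s *\<^sub>R e + z" using d(1) by (simp add: algebra_simps)
  ultimately show ?thesis by simp
 qed
 then show ?thesis using c(1) s0 by blast
qed

text \<open>Thickening a cover of the boundary piece along \<open>e\<close> produces tubes that
  cover a whole ball, since every point of the ball lies on a short segment in direction
  \<open>e\<close> that meets the graph. Comparing volumes bounds the covering sums from
  below.\<close>

lemma chart_hausdorff_lower: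
 assumes N: "DIM('a) >= 2"
 shows "\<exists>c>0. \<exists>ro0>0. \<forall>ro. 0 < ro --> ro < ro0 -->
  ennreal (c * ro ^ (DIM('a) - 1)) <= hausdorff_outer (real DIM('a) - 1) (frontier D \<inter> ball p ro)"
proof -
 define n where "n = DIM('a) - 1"
 have n: "n > 0" "DIM('a) = Suc n" "real DIM('a) - 1 = real n" using N by (auto simp: n_def)
 have L: "L >= 0" by (rule chart_facts(4))
 define v where "v = unit_ball_vol (DIM('a))"
 have v: "v > 0" by (simp add: v_def)
 define K where "K = v * 2 ^ DIM('a) * (2 * (1 + L) + 1)"
 have K: "K > 0" unfolding K_def using v L by (intro mult_pos_pos) auto
 define k where "k = hconst (real n) / 2 ^ n * v / K"
 have hc: "hconst (real n) > 0" by (rule hconst_pos) simp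
 have k: "k > 0" unfolding k_def using v K hc by simp
 have main: "ennreal (k * ro ^ n) <= hausdorff_outer (real n) (frontier D \<inter> ball p ((2 + L) * ro))"
  if ro: "0 < ro" "ro < r" for ro
 proof -
  define A where "A = frontier D \<inter> ball p ((2 + L) * ro)"
  define m where "m = (1 + L) * ro"
  have m: "m >= 0" using L ro by (simp add: m_def)
  have "ennreal (k * ro ^ n) <= hausdorff_pre (real n) ro A" unfolding hausdorff_pre_def
  proof (rule INF_greatest)
   fix C :: "nat => 'a set"
   assume "C \<in> {C. A \<subseteq> (\<Union>i. C i) \<and> (\<forall>i. bounded (C i) \<and> diameter (C i) <= ro)}"
   then have C: "A \<subseteq> (\<Union>i. C i)" "!!i. bounded (C i)" "!!i. diameter (C i) <= ro" by auto
   have "\<forall>i. \<exists>E. E \<in> sets borel \<and> tube e m (C i) \<subseteq> E \<and>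
    emeasure lborel E <= ennreal (v * 2 ^ DIM('a) * (2 * m + ro) * diameter (C i) ^ n)"
    unfolding v_def n_def using tube_volume[OF N chart_facts(1) C(2,3) ro(1) m] by blast
   then obtain E where E: "!!i. E i \<in> sets borel" "!!i. tube e m (C i) \<subseteq> E i"
    "!!i. emeasure lborel (E i) <= ennreal (v * 2 ^ DIM('a) * (2 * m + ro) * diameter (C i) ^ n)" by metis
   have Krho: "v * 2 ^ DIM('a) * (2 * m + ro) = K * ro" by (simp add: K_def m_def algebra_simps)
   have sub: "ball p ro \<subseteq> (\<Union>i. E i)"
   proof
    fix x assume x: "x \<in> ball p ro"
    define t y where "t = (x - p) \<bullet> e" "y = (x - p) - ((x - p) \<bullet> e) *\<^sub>R e"
    have d: "x - p = y + t *\<^sub>R e" "y \<bullet> e = 0" "norm y <= norm (x - p)" "\<bar>t\<bar> <= norm (x - p)"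
     using chart_decomp[of "x - p"] by (auto simp: t_y_def)
    have nx: "norm (x - p) < ro" using x by (simp add: dist_norm norm_minus_commute)
    have yr: "norm y < r" using d(3) nx ro by simp
    define ga where "ga = p + y + g y *\<^sub>R e"
    have gF: "ga \<in> frontier D" unfolding ga_def by (rule chart_frontier[OF d(2) yr])
    have gb: "\<bar>g y\<bar> <= L * ro" using chart_g_bound[OF d(2)] d(3) nx L mult_left_mono[of "norm y" ro L] by simp
    have "norm (ga - p) <= norm y + \<bar>g y\<bar>"
     using norm_triangle_ineq[of y "g y *\<^sub>R e"] chart_facts(1) by (simp add: ga_def add.assoc)
    also have "... < (2 + L) * ro" using d(3) nx gb ro by (simp add: algebra_simps)
    finally have "ga \<in> A" using gF unfolding A_def by (simp add: dist_norm norm_minus_commute)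
    then obtain i where i: "ga \<in> C i" using C(1) by blast
    have "x = ga + (t - g y) *\<^sub>R e" using d(1) by (simp add: ga_def algebra_simps)
    moreover have "\<bar>t - g y\<bar> <= m" using d(4) nx gb by (simp add: m_def algebra_simps)
    ultimately have "x \<in> tube e m (C i)" using i unfolding tube_def by blast
    then show "x \<in> (\<Union>i. E i)" using E(2) by blast
   qed
   have "ennreal (v * ro ^ Suc n) = emeasure lborel (ball p ro)" using ro by (simp add: emeasure_ball v_def n(2))
   also have "... <= emeasure lborel (\<Union>i. E i)" by (rule emeasure_mono[OF sub]) (use E(1) in auto)
   also have "... <= (\<Sum>i. emeasure lborel (E i))" by (rule emeasure_subadditive_countably) (use E(1) in auto)
   also have "... <= (\<Sum>i. ennreal (K * ro) * ennreal (diameter (C i) ^ n))"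
   proof (rule suminf_le)
    show "emeasure lborel (E i) <= ennreal (K * ro) * ennreal (diameter (C i) ^ n)" for i
     using E(3)[of i] K ro unfolding Krho by (simp add: ennreal_mult'[symmetric] less_imp_le)
   qed auto
   also have "... = ennreal (K * ro) * (\<Sum>i. ennreal (diameter (C i) ^ n))" by simp
   finally have le: "ennreal (v * ro ^ Suc n) <= ennreal (K * ro) * (\<Sum>i. ennreal (diameter (C i) ^ n))" .
   have "ennreal (k * ro ^ n) = ennreal (hconst (real n) / 2 ^ n / (K * ro)) * ennreal (v * ro ^ Suc n)"
    using K ro hc v by (simp add: ennreal_mult'[symmetric] k_def field_simps)
   also have "... <= ennreal (hconst (real n) / 2 ^ n / (K * ro)) * (ennreal (K * ro) * (\<Sum>i. ennreal (diameter (C i) ^ n)))"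
    by (intro mult_left_mono le) simp
   also have "... = ennreal (hconst (real n) / 2 ^ n) * (\<Sum>i. ennreal (diameter (C i) ^ n))"
    unfolding mult.assoc[symmetric] using K ro hc by (simp add: ennreal_mult'[symmetric])
   also have "... = (\<Sum>i. ennreal (hconst (real n) / 2 ^ n) * ennreal (diameter (C i) ^ n))" by simp
   also have "... = (\<Sum>i. ennreal (pi powr (real n / 2) / Gamma (real n / 2 + 1) * (diameter (C i) / 2) powr real n))"
   proof (rule suminf_cong)
    fix i
    have d: "diameter (C i) >= 0" by (rule diameter_ge_0[OF C(2)])
    have "(diameter (C i) / 2) powr real n = (diameter (C i) / 2) ^ n"
     using d n(1) by (cases "diameter (C i) = 0") (auto simp: powr_realpow)
    then show "ennreal (hconst (real n) / 2 ^ n) * ennreal (diameter (C i) ^ n)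
     = ennreal (pi powr (real n / 2) / Gamma (real n / 2 + 1) * (diameter (C i) / 2) powr real n)"
     using hc d by (simp add: ennreal_mult'[symmetric] hconst_def[symmetric] power_divide)
   qed
   finally show "ennreal (k * ro ^ n) <= (\<Sum>i. ennreal (pi powr (real n / 2) / Gamma (real n / 2 + 1) * (diameter (C i) / 2) powr real n))" .
  qed
  also have "... <= hausdorff_outer (real n) A" unfolding hausdorff_outer_def by (rule SUP_upper) (use ro in simp)
  finally show ?thesis unfolding A_def .
 qed
 have "ennreal (k / (2 + L) ^ n * ro ^ n) <= hausdorff_outer (real n) (frontier D \<inter> ball p ro)"
  if ro: "0 < ro" "ro < r" for ro
 proof -
  have "ro / (2 + L) <= ro / 1" using L ro by (intro divide_left_mono) auto
  then have "ro / (2 + L) < r" using ro by simp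
  moreover have "0 < ro / (2 + L)" using L ro by simp
  ultimately show ?thesis using main[of "ro / (2 + L)"] L by (simp add: power_divide)
 qed
 then show ?thesis unfolding n(3) n_def[symmetric] using chart_facts(2) k L
  by (intro exI[of _ "k / (2 + L) ^ n"] conjI exI[of _ r]) (auto intro!: divide_pos_pos)
qed

end

section \<open>Blow-up at the boundary\<close>

text \<open>Both sides of the Fubini computation are translation invariant and agree on the unit ball.\<close>

lemma lborel_isometry:
 fixes R :: "'a::euclidean_space => 'a"
 assumes lin: "linear R" and iso: "!!x. norm (R x) = norm x" and inv: "!!x. R (R x) = x"
 shows "distr lborel borel R = lborel"
proof (rule measure_eqI)
 have cR: "continuous_on UNIV R" using linear_continuous_on[of R] lin linear_conv_bounded_linear by blast
 have [measurable]: "R \<in> borel_measurable borel" using borel_measurable_continuous_onI[OF cR] .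
 have Rd: "R (x - y) = R x - R y" for x y using linear_diff[OF lin] .
 fix A assume "A \<in> sets (distr lborel borel R)"
 then have [measurable]: "A \<in> sets borel" by simp
 define f where "f = (indicator A :: 'a => ennreal)"
 define g where "g = (indicator (ball 0 1) :: 'a => ennreal)"
 have [measurable]: "f \<in> borel_measurable borel" "g \<in> borel_measurable borel"
  unfolding f_def g_def by (intro borel_measurable_indicator; simp)+
 define V where "V = (\<integral>\<^sup>+y. g y \<partial>lborel)"
 have V: "V ~= 0" "V ~= \<infinity>"
 proof -
  have "V = emeasure lborel (ball (0::'a) 1)" by (simp add: V_def g_def)
  then show "V ~= 0" "V ~= \<infinity>"
   using content_ball_pos[of 1 "0::'a"] emeasure_lborel_ball_finite[of "0::'a" 1] by (auto simp: measure_def)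
 qed
 have gR: "g (R x) = g x" for x by (simp add: g_def indicator_def iso)
 have sh: "(\<integral>\<^sup>+y. h (c - y) \<partial>lborel) = (\<integral>\<^sup>+y. h y \<partial>lborel)" if [measurable]: "h \<in> borel_measurable borel" for h :: "'a => ennreal" and c
  by (subst (2) lborel_reflect[of c, symmetric]) (simp add: nn_integral_distr)
 have "(\<integral>\<^sup>+x. f (R x) \<partial>lborel) * V = (\<integral>\<^sup>+x. f (R x) * V \<partial>lborel)" by (rule nn_integral_multc[symmetric]) simp
 also have "... = (\<integral>\<^sup>+x. (\<integral>\<^sup>+y. f (R x) * g (R x - y) \<partial>lborel) \<partial>lborel)"
 proof (rule nn_integral_cong)
  fix x
  show "f (R x) * V = (\<integral>\<^sup>+y. f (R x) * g (R x - y) \<partial>lborel)"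
   unfolding V_def using sh[of g "R x"] by (subst nn_integral_cmult) auto
 qed
 also have "... = (\<integral>\<^sup>+y. (\<integral>\<^sup>+x. f (R x) * g (R x - y) \<partial>lborel) \<partial>lborel)"
  by (rule lborel_pair.Fubini'[symmetric]) measurable
 also have "... = (\<integral>\<^sup>+y. (\<integral>\<^sup>+x. f (y - R x) * g (R x) \<partial>lborel) \<partial>lborel)"
 proof (rule nn_integral_cong)
  fix y
  have "(\<integral>\<^sup>+x. f (R x) * g (R x - y) \<partial>lborel) = (\<integral>\<^sup>+x. f (R (R y - x)) * g (R (R y - x) - y) \<partial>lborel)"
   using sh[of "%x. f (R x) * g (R x - y)" "R y"] by simp
  also have "... = (\<integral>\<^sup>+x. f (y - R x) * g (R x) \<partial>lborel)"
   by (rule nn_integral_cong) (simp add: Rd inv g_def indicator_def)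
  finally show "(\<integral>\<^sup>+x. f (R x) * g (R x - y) \<partial>lborel) = (\<integral>\<^sup>+x. f (y - R x) * g (R x) \<partial>lborel)" .
 qed
 also have "... = (\<integral>\<^sup>+x. (\<integral>\<^sup>+y. f (y - R x) * g (R x) \<partial>lborel) \<partial>lborel)"
  by (rule lborel_pair.Fubini') measurable
 also have "... = (\<integral>\<^sup>+x. (\<integral>\<^sup>+y. f y \<partial>lborel) * g (R x) \<partial>lborel)"
 proof (rule nn_integral_cong)
  fix x
  have "(\<integral>\<^sup>+y. f (y - R x) \<partial>lborel) = (\<integral>\<^sup>+y. f (- R x + y) \<partial>lborel)" by simp
  also have "... = (\<integral>\<^sup>+y. f y \<partial>lborel)"
   by (subst (2) lborel_distr_plus[of "- R x", symmetric]) (simp add: nn_integral_distr)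
  finally show "(\<integral>\<^sup>+y. f (y - R x) * g (R x) \<partial>lborel) = (\<integral>\<^sup>+y. f y \<partial>lborel) * g (R x)"
   by (subst nn_integral_multc) auto
 qed
 also have "... = (\<integral>\<^sup>+y. f y \<partial>lborel) * V" unfolding gR V_def by (rule nn_integral_cmult) simp
 finally have "(\<integral>\<^sup>+x. f (R x) \<partial>lborel) * V / V = (\<integral>\<^sup>+y. f y \<partial>lborel) * V / V" by simp
 then have "(\<integral>\<^sup>+x. f (R x) \<partial>lborel) = (\<integral>\<^sup>+y. f y \<partial>lborel)"
  using V by (simp add: ennreal_mult_divide_eq)
 moreover have "(\<integral>\<^sup>+x. f (R x) \<partial>lborel) = emeasure (distr lborel borel R) A"
 proof -
  have "(\<integral>\<^sup>+x. f (R x) \<partial>lborel) = (\<integral>\<^sup>+x. f x \<partial>distr lborel borel R)" by (simp add: nn_integral_distr)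
  then show ?thesis by (simp add: f_def)
 qed
 ultimately show "emeasure (distr lborel borel R) A = emeasure lborel A" by (simp add: f_def)
qed simp

text \<open>The reflection exchanging the unit vectors \<open>a\<close> and \<open>b\<close>; for
  \<open>a = b\<close> the quotient is 0 and the map is the identity.\<close>

definition refl_map :: "'a::euclidean_space => 'a => 'a => 'a" where
 "refl_map a b z = z - (2 * (z \<bullet> (a - b)) / ((a - b) \<bullet> (a - b))) *\<^sub>R (a - b)"

lemma refl_map:
 assumes "norm a = 1" "norm b = 1"
 shows "linear (refl_map a b)" "norm (refl_map a b z) = norm z" "refl_map a b (refl_map a b z) = z"
  "refl_map a b a = b" "refl_map a b z \<bullet> b = z \<bullet> a"
proof -
 define d where "d = a - b"
 have r: "refl_map a b z = z - (2 * (z \<bullet> d) / (d \<bullet> d)) *\<^sub>R d" for z by (simp add: refl_map_def d_def)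
 show lin: "linear (refl_map a b)" by (rule linearI) (simp_all add: r inner_add_left add_divide_distrib algebra_simps)
 have ip: "refl_map a b z \<bullet> refl_map a b w = z \<bullet> w" for z w
 proof (cases "d = 0")
  case False
  define k l where "k = 2 * (z \<bullet> d) / (d \<bullet> d)" "l = 2 * (w \<bullet> d) / (d \<bullet> d)"
  have dd: "l * (d \<bullet> d) = 2 * (w \<bullet> d)" "k * (w \<bullet> d) = l * (z \<bullet> d)"
   using False by (simp_all add: k_l_def)
  have "(z - k *\<^sub>R d) \<bullet> (w - l *\<^sub>R d) = z \<bullet> w - l * (z \<bullet> d) - k * (w \<bullet> d) + k * (l * (d \<bullet> d))"
   by (simp add: inner_diff_left inner_diff_right inner_commute[of d w] algebra_simps)
  also have "... = z \<bullet> w" unfolding dd using dd(2) by simp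
  finally show ?thesis unfolding r k_l_def .
 qed (simp add: r)
 show "norm (refl_map a b z) = norm z" by (simp add: norm_eq_sqrt_inner ip)
 show inv: "refl_map a b (refl_map a b z) = z" for z
 proof (cases "d = 0")
  case False
  then have dd: "d \<bullet> d ~= 0" by simp
  have "refl_map a b z \<bullet> d = - (z \<bullet> d)" unfolding r using dd by (simp add: inner_diff_left)
  then show ?thesis unfolding r[of "refl_map a b z"] by (simp add: r)
 qed (simp add: r)
 show ab: "refl_map a b a = b"
 proof (cases "d = 0")
  case False
  have aa: "a \<bullet> a = 1" "b \<bullet> b = 1" using assms by (simp_all add: norm_eq_1)
  have "2 * (a \<bullet> d) = d \<bullet> d" unfolding d_def by (simp add: inner_diff aa inner_commute)
  then show ?thesis unfolding r using False by (simp add: d_def)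
 qed (simp add: r, simp add: d_def)
 show "refl_map a b z \<bullet> b = z \<bullet> a" using ip[of z a] ab by simp
qed

text \<open>Radial, so that reflections preserve it, and squeezed between the indicators of the
  balls of radius 1 and 1 + de.\<close>

definition bump :: "real => 'a::euclidean_space => real" where
 "bump de z = smoothstep (((1 + de)^2 - (norm z)^2) * inverse ((1 + de)^2 - 1))"

definition bump' :: "real => real => real" where
 "bump' de s = - 2 * inverse ((1 + de)^2 - 1) * pd 1 smoothstep (((1 + de)^2 - s) * inverse ((1 + de)^2 - 1))"

lemma bump_props:
 assumes d: "de > 0"
 shows "test_fun UNIV (bump de :: 'a::euclidean_space => real)"
  "0 <= bump de z" "bump de z <= 1" "norm z <= 1 ==> bump de z = 1" "norm z >= 1 + de ==> bump de z = 0"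
  "grad_of (bump de) z = bump' de ((norm z)^2) *\<^sub>R (z :: 'a)"
proof -
 have pos: "(1 + de)^2 - 1 > 0" using d by (simp add: power2_eq_square algebra_simps add_pos_pos)
 have s1: "smooth_on UNIV (%z::'a. ((1 + de)^2 - (norm (z - 0))^2) * inverse ((1 + de)^2 - 1))"
  by (intro smooth_intros smooth_on_norm_sq open_UNIV)
 have "smooth_on UNIV (%z::'a. smoothstep (((1 + de)^2 - (norm (z - 0))^2) * inverse ((1 + de)^2 - 1)))"
  by (rule smooth_on_compose[OF open_UNIV smooth_smoothstep s1])
 then have sb: "smooth_on UNIV (bump de :: 'a => real)" by (simp add: bump_def[abs_def])
 show z0: "bump de z = 0" if "norm z >= 1 + de" for z :: 'a
 proof -
  have "(1 + de)^2 <= (norm z)^2" using that d by (intro power_mono) auto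
  then show ?thesis unfolding bump_def using pos by (intro smoothstep_le_0 mult_nonpos_nonneg) auto
 qed
 show "bump de z = 1" if "norm z <= 1"
 proof -
  have "(norm z)^2 <= 1" using power_mono[OF that, of 2] by simp
  then show ?thesis unfolding bump_def using pos by (intro smoothstep_ge_1) (simp add: field_simps)
 qed
 show "test_fun UNIV (bump de :: 'a => real)"
  by (rule test_funI[where K = "cball 0 (1 + de)"]) (use sb z0 in auto)
 show "0 <= bump de z" "bump de z <= 1" unfolding bump_def by (rule smoothstep_bounds)+
 have "pd i (bump de) z = bump' de ((norm z)^2) * (z \<bullet> i)" for i :: 'a
 proof -
  define A where "A z = ((1 + de)^2 - (norm z)^2) * inverse ((1 + de)^2 - 1)" for z :: 'a
  have dA: "(A has_derivative (%v. - 2 * (z \<bullet> v) * inverse ((1 + de)^2 - 1))) (at z)"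
   unfolding A_def power2_norm_eq_inner by (auto intro!: derivative_eq_intros simp: inner_commute algebra_simps)
  have "pd i (%z. smoothstep (A z)) z = pd 1 smoothstep (A z) * pd i A z"
   by (rule pd_comp[OF _ smooth_on_has_real_derivative[OF smooth_smoothstep]])
    (use dA in \<open>auto simp: differentiable_def\<close>)
  also have "pd i A z = - 2 * (z \<bullet> i) * inverse ((1 + de)^2 - 1)" by (rule pd_eqI[OF dA])
  finally show ?thesis unfolding bump_def[abs_def] bump'_def A_def[symmetric] by (simp add: A_def)
 qed
 then show "grad_of (bump de) z = bump' de ((norm z)^2) *\<^sub>R z" unfolding grad_of_pd
  by (simp only: scaleR_scaleR[symmetric] scaleR_sum_right[symmetric] euclidean_representation)
qed

lemma bump'_meas: "bump' de \<in> borel_measurable borel"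
proof -
 have "continuous_on UNIV (pd 1 smoothstep)" by (rule smooth_on_continuous[OF smooth_on_pd[OF smooth_smoothstep]])
 then have "continuous_on UNIV (%s. pd 1 smoothstep (((1 + de)^2 - s) * inverse ((1 + de)^2 - 1)))"
  by (rule continuous_on_compose2) (auto intro!: continuous_intros)
 then have "continuous_on UNIV (bump' de)" unfolding bump'_def[abs_def] by (rule continuous_on_mult_left)
 then show ?thesis by (rule borel_measurable_continuous_onI)
qed

text \<open>The blow-up limit of the weak Neumann condition at a point with gradient
  \<open>q\<close>. For nonzero \<open>q\<close> it is \<open>norm q\<close> times the integral of
  the bump over the hyperplane orthogonal to \<open>q\<close>.\<close>

definition flux :: "'a::euclidean_space itself => real => 'a => real" where
 "flux _ de q = - (LBINT z. indicator {z. z \<bullet> q > 0} z * (q \<bullet> grad_of (bump de) z))"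

text \<open>Reflecting one unit vector onto the other compares the two half-space integrals
  directly, because the bump is radial.\<close>

lemma flux_isotropic:
 fixes q :: "'a::euclidean_space"
 assumes d: "de > 0" and u: "norm u = 1" and q: "q ~= 0"
 shows "flux TYPE('a) de q = norm q * flux TYPE('a) de u"
proof -
 define n where "n = (1 / norm q) *\<^sub>R q"
 have n: "norm n = 1" "q = norm q *\<^sub>R n" using q by (auto simp: n_def)
 define f where "f s t = (if t > 0 then (t * bump' de (s^2)) else 0)" for s t :: real
 have fm: "(%z::'a. f (norm z) (z \<bullet> m)) \<in> borel_measurable borel" for m
 proof -
  have "(%z::'a. bump' de ((norm z)^2)) \<in> borel_measurable borel"
   by (rule measurable_compose[OF _ bump'_meas]) simp
  then show ?thesis unfolding f_def by measurable
 qed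
 have F: "flux TYPE('a) de m = - (LBINT z. f (norm z) (z \<bullet> m))" for m :: 'a unfolding flux_def bump_props(6)[OF d]
  by (rule arg_cong[of _ _ uminus], rule integral_cong[OF refl])
   (auto simp: f_def indicator_def inner_commute)
 have "flux TYPE('a) de q = norm q * flux TYPE('a) de n"
 proof -
  have "f (norm z) (z \<bullet> q) = norm q * f (norm z) (z \<bullet> n)" for z
   using q by (subst n(2)) (auto simp: f_def zero_less_mult_iff)
  then show ?thesis unfolding F by simp
 qed
 also have "flux TYPE('a) de n = flux TYPE('a) de u"
 proof -
  note R = refl_map[OF n(1) u]
  have m: "refl_map n u \<in> borel_measurable borel"
   using borel_measurable_continuous_onI[OF linear_continuous_on[of "refl_map n u"]] R(1) linear_conv_bounded_linear by blast
  have "(LBINT z. f (norm z) (z \<bullet> u)) = (\<integral>z. f (norm z) (z \<bullet> u) \<partial>distr lborel borel (refl_map n u))"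
   by (simp add: lborel_isometry[OF R(1-3)])
  also have "... = (LBINT z. f (norm (refl_map n u z)) (refl_map n u z \<bullet> u))"
   by (rule integral_distr) (use m fm in auto)
  also have "... = (LBINT z. f (norm z) (z \<bullet> n))" by (simp add: R(2,5))
  finally show ?thesis unfolding F by simp
 qed
 finally show ?thesis .
qed

lemma test_grad_Lipschitz:
 fixes W :: "'a::euclidean_space => real"
 assumes "test_fun D W"
 shows "\<exists>K\<ge>0. \<forall>x y. norm (grad_of W x - grad_of W y) <= K * norm (x - y)"
proof -
 have "\<forall>i. \<exists>K\<ge>0. \<forall>x y. \<bar>pd i W x - pd i W y\<bar> <= K * norm (x - y)"
  using test_Lipschitz[OF test_fun_pd[OF assms]] by blast
 then obtain K where K: "!!i. K i >= 0" "!!i x y. \<bar>pd i W x - pd i W y\<bar> <= K i * norm (x - y)" by metis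
 have "norm (grad_of W x - grad_of W y) <= (\<Sum>i\<in>Basis. K i) * norm (x - y)" for x y
 proof -
  have "grad_of W x - grad_of W y = (\<Sum>i\<in>Basis. (pd i W x - pd i W y) *\<^sub>R i)"
   unfolding grad_of_pd by (simp add: sum_subtractf scaleR_diff_left)
  also have "norm ... <= (\<Sum>i\<in>Basis. K i * norm (x - y))" by (rule sum_norm_le) (use K in simp)
  finally show ?thesis by (simp add: sum_distrib_right)
 qed
 moreover have "(\<Sum>i\<in>Basis. K i) >= 0" using K(1) by (intro sum_nonneg) auto
 ultimately show ?thesis by blast
qed

lemma test_Taylor_grad:
 assumes "test_fun D W"
 shows "\<exists>K\<ge>0. \<forall>x k. \<bar>W (x + k) - W x - grad_of W x \<bullet> k\<bar> <= K * (norm k)^2"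
 using test_Taylor[OF assms] pd_grad[OF test_differentiable[OF assms]] by metis

section \<open>Blow-up of the weak Neumann condition and constancy of the gradient norm\<close>

context
 fixes w :: "'a::euclidean_space set" and W :: "'a => real" and ka :: real
 assumes N: "DIM('a) >= 2" and lip: "lipschitz_domain w"
  and tW: "test_fun UNIV W" and Wpos: "!!x. x \<in> w ==> W x > 0" and W0: "!!x. x \<in> frontier w ==> W x = 0"
  and ka: "ka > 0"
  and con: "!!ps. test_fun UNIV ps ==> (LINT x|lebesgue_on w. ps x - grad_of W x \<bullet> grad_of ps x) = ka * bdry_integral w ps"
  and fin: "integrable surface_measure (indicator (frontier w) :: 'a => real)"
  and surf: "!!X. X \<in> sets borel ==> emeasure (surface_measure :: 'a measure) X = hausdorff_outer (real DIM('a) - 1) X"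
begin

lemma ow: "open w" and bw': "bounded w" and cw: "connected w" and new: "w ~= {}"
 using lip unfolding lipschitz_domain_def bounded_domain_def by auto

abbreviation (input) "q p \<equiv> grad_of W p"

text \<open>Taylor's formula makes \<open>W\<close> positive on a truncated cone about
  \<open>q p\<close> and negative on the opposite one. The negative cone misses \<open>w\<close>.
  The positive one contains no boundary point and is convex, so it lies in \<open>w\<close> as soon
  as it meets \<open>w\<close>; the interior cone of the Lipschitz chart provides a common
  point.\<close>

lemma wedge:
 assumes p: "p \<in> frontier w" and qp: "q p ~= 0" and eps: "ep > 0"
 shows "\<exists>ro>0. \<forall>z. norm z < ro --> (z \<bullet> q p > ep * norm (q p) * norm z --> p + z \<in> w) \<and>
  (z \<bullet> q p < - ep * norm (q p) * norm z --> p + z \<notin> w)"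
proof -
 obtain K where K: "K >= 0" "!!x k. \<bar>W (x + k) - W x - q x \<bullet> k\<bar> <= K * (norm k)^2"
  using test_Taylor_grad[OF tW] by blast
 have T: "\<bar>W (p + z) - q p \<bullet> z\<bar> <= K * (norm z)^2" for z using K(2)[of p z] W0[OF p] by simp
 obtain e r h L g where ch: "lip_chart w p e r h L g" using lip_chart_exists[OF lip p] by blast
 obtain c s0 where cs: "c > 0" "s0 > 0" "!!s z. 0 < s ==> s < s0 ==> norm z <= c * s ==> p - s *\<^sub>R e + z \<in> w"
  using chart_cone[OF ch ow] by blast
 define Q where "Q = norm (q p)"
 have Q: "Q > 0" using qp by (simp add: Q_def)
 \<comment> \<open>The aperture is shrunk so that a point built from the interior cone of the chart
   falls into the Taylor cone.\<close>
 define ep' where "ep' = min ep (c / (2 * (1 + c)))"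
 have e': "ep' > 0" "ep' <= ep" "ep' * (1 + c) < c"
 proof -
  have "ep' * (1 + c) <= c / (2 * (1 + c)) * (1 + c)" using cs(1) by (intro mult_right_mono) (auto simp: ep'_def)
  also have "... = c / 2" using cs(1) by (simp add: field_simps)
  finally show "ep' * (1 + c) < c" using cs(1) by simp
 qed (use eps cs in \<open>auto simp: ep'_def\<close>)
 define ro where "ro = ep' * Q / (K + 1)"
 have ro: "ro > 0" unfolding ro_def using e' Q K(1) by (intro divide_pos_pos mult_pos_pos) auto
 have Kro: "K * (norm z)^2 <= ep' * Q * norm z" if "norm z < ro" for z :: 'a
 proof -
  have "K * norm z <= (K + 1) * ro" using that K(1) by (intro mult_mono) auto
  also have "... = ep' * Q" unfolding ro_def using K(1) by simp
  finally show ?thesis using mult_right_mono[of "K * norm z" "ep' * Q" "norm z"] by (simp add: power2_eq_square mult.assoc)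
 qed
 have Wp: "W (p + z) > 0" if z: "norm z < ro" "z \<bullet> q p > ep' * Q * norm z" for z
  using Kro[OF z(1)] T[of z] z(2) by (simp add: inner_commute)
 have Wn: "p + z \<notin> w" if z: "norm z < ro" "z \<bullet> q p < - ep' * Q * norm z" for z
  using Wpos[of "p + z"] Kro[OF z(1)] T[of z] z(2) by (auto simp: inner_commute)
 define Kn where "Kn = {z. norm z < ro} \<inter> {z. ep' * Q * norm z - z \<bullet> q p < 0}"
 have convK: "convex Kn" unfolding Kn_def
 proof (intro convex_Int)
  show "convex {z::'a. norm z < ro}" using convex_ball[of "0::'a" ro] by (simp add: ball_def)
  show "convex {z. ep' * Q * norm z - z \<bullet> q p < 0}" unfolding convex_def
  proof (intro ballI allI impI, simp)
   fix x y :: 'a and u v :: real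
   assume x: "ep' * Q * norm x < x \<bullet> q p" and y: "ep' * Q * norm y < y \<bullet> q p" and u: "0 <= u" "0 <= v" "u + v = 1"
   have "norm (u *\<^sub>R x + v *\<^sub>R y) <= u * norm x + v * norm y"
    using norm_triangle_ineq[of "u *\<^sub>R x" "v *\<^sub>R y"] u by simp
   then have "ep' * Q * norm (u *\<^sub>R x + v *\<^sub>R y) <= ep' * Q * (u * norm x + v * norm y)"
    using e' Q by (intro mult_left_mono) auto
   also have "... = u * (ep' * Q * norm x) + v * (ep' * Q * norm y)" by (simp add: algebra_simps)
   also have "... < u * (x \<bullet> q p) + v * (y \<bullet> q p)"
   proof (cases "u = 0")
    case True
    then show ?thesis using u y by simp
   next
    case False
    then show ?thesis using u x y by (intro add_less_le_mono mult_strict_left_mono mult_left_mono) auto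
   qed
   finally show "ep' * Q * norm (u *\<^sub>R x + v *\<^sub>R y) < (u *\<^sub>R x + v *\<^sub>R y) \<bullet> q p" by (simp add: inner_add_left)
  qed
 qed
 have ne: "norm e = 1" using chart_facts(1)[OF ch ow] .
 \<comment> \<open>\<open>W\<close> vanishes at \<open>p\<close> and is positive along
   \<open>- e\<close>, so its derivative in this direction is nonnegative. It might be 0, hence the
   additional push \<open>z\<close> along \<open>q p\<close> in the choice of \<open>y\<close>
   below.\<close>
 have en: "0 <= (- e) \<bullet> q p"
 proof (rule field_le_epsilon)
  fix et :: real assume et: "et > 0"
  define s where "s = min (s0 / 2) (et / (K + 1))"
  have s: "s > 0" "s < s0" "s <= et / (K + 1)" using cs(2) et K(1) by (auto simp: s_def)
  then have "(K + 1) * s <= et" using K(1) by (simp add: pos_le_divide_eq mult.commute)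
  then have "K * s <= et" using s(1) by (simp add: algebra_simps)
  have "0 < W (p + - (s *\<^sub>R e))" using Wpos[OF cs(3)[OF s(1,2), of 0]] cs(1) s(1) by simp
  then have "0 < s * ((- e) \<bullet> q p) + s * (K * s)"
   using T[of "- (s *\<^sub>R e)"] ne by (simp add: inner_commute power2_eq_square mult_ac)
  then have "0 < s * ((- e) \<bullet> q p + K * s)" by (simp only: distrib_left)
  then show "0 <= (- e) \<bullet> q p + et" using s(1) \<open>K * s <= et\<close> by (simp add: zero_less_mult_iff)
 qed
 define s where "s = min (s0 / 2) (ro / (2 * (1 + c)))"
 have s: "s > 0" "s < s0" "s * (1 + c) < ro"
 proof -
  have "s * (1 + c) <= ro / (2 * (1 + c)) * (1 + c)" using cs(1) by (intro mult_right_mono) (auto simp: s_def)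
  also have "... = ro / 2" using cs(1) by (simp add: field_simps)
  finally show "s * (1 + c) < ro" using ro by simp
 qed (use cs ro in \<open>auto simp: s_def\<close>)
 define z y where "z = (c * s / Q) *\<^sub>R q p" "y = - (s *\<^sub>R e) + z"
 have nz: "norm z = c * s" unfolding z_y_def using Q cs s by (simp add: Q_def)
 have ny: "norm y <= s * (1 + c)"
  unfolding z_y_def(2) using norm_triangle_ineq[of "- (s *\<^sub>R e)" z] nz ne s by (simp add: algebra_simps)
 have "z \<bullet> q p = c * s * Q" using Q by (simp add: z_y_def Q_def dot_square_norm power2_eq_square)
 then have "y \<bullet> q p = s * ((- e) \<bullet> q p) + c * s * Q" unfolding z_y_def(2) inner_add_left by simp
 then have "c * s * Q <= y \<bullet> q p" using mult_nonneg_nonneg[OF less_imp_le[OF s(1)] en] by linarith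
 moreover have "ep' * Q * norm y <= ep' * Q * (s * (1 + c))" using ny e' Q by (intro mult_left_mono) auto
 moreover have "ep' * Q * (s * (1 + c)) < c * s * Q"
  using mult_strict_right_mono[OF e'(3), of "s * Q"] s(1) Q by (simp add: mult_ac)
 ultimately have "y \<in> Kn" unfolding Kn_def using ny s by auto
 moreover have "p + y \<in> w" using cs(3)[OF s(1,2), of z] nz by (simp add: z_y_def algebra_simps)
 ultimately have meet: "(+) p ` Kn \<inter> w ~= {}" by auto
 have "(+) p ` Kn \<inter> frontier w = {}" using Wp W0 unfolding Kn_def by force
 then have "(+) p ` Kn - w = {}"
  using connected_Int_frontier[of "(+) p ` Kn" w] meet convex_connected[OF convex_translation[OF convK]] by blast
 then have Kw: "p + z \<in> w" if "z \<in> Kn" for z using that by blast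
 show ?thesis
 proof (intro exI[of _ ro] conjI ro allI impI)
  fix z :: 'a assume z: "norm z < ro"
  have le: "ep' * Q * norm z <= ep * Q * norm z" using e' Q by (intro mult_right_mono) auto
  show "p + z \<in> w" if "z \<bullet> q p > ep * norm (q p) * norm z"
   by (rule Kw) (use z le that in \<open>simp add: Kn_def Q_def\<close>)
  show "p + z \<notin> w" if "z \<bullet> q p < - ep * norm (q p) * norm z"
   by (rule Wn[OF z]) (use le that in \<open>simp add: Q_def\<close>)
 qed
qed

definition blow :: "'a => real => real => 'a => real" where
 "blow p de r x = bump de (- (1 / r) *\<^sub>R p + (1 / r) *\<^sub>R x)"

lemma blow_test: "de > 0 ==> r > 0 ==> test_fun UNIV (blow p de r)"
proof (rule test_funI[where K = "cball p (r * (1 + de))"])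
 assume d: "de > 0" and r: "r > 0"
 show "smooth_on UNIV (blow p de r)" unfolding blow_def by (rule smooth_on_affine[OF test_smooth[OF bump_props(1)[OF d]]])
 fix x assume "x \<notin> cball p (r * (1 + de))"
 then have "norm (x - p) > r * (1 + de)" by (simp add: dist_norm norm_minus_commute)
 moreover have "norm (- (1 / r) *\<^sub>R p + (1 / r) *\<^sub>R x) = norm (x - p) / r"
 proof -
  have "- (1 / r) *\<^sub>R p + (1 / r) *\<^sub>R x = (1 / r) *\<^sub>R (x - p)" by (simp add: algebra_simps)
  then show ?thesis using r by simp
 qed
 ultimately show "blow p de r x = 0" unfolding blow_def using r by (intro bump_props(5)[OF d]) (simp add: pos_le_divide_eq mult.commute)
qed auto

lemma blow_at: "r > 0 ==> blow p de r (p + r *\<^sub>R z) = bump de z"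
 by (simp add: blow_def scaleR_add_right)

lemma grad_blow:
 assumes "de > 0" "r > 0"
 shows "grad_of (blow p de r) (p + r *\<^sub>R z) = (1 / r) *\<^sub>R grad_of (bump de) z"
proof -
 have "pd i (blow p de r) (p + r *\<^sub>R z) = (1 / r) * pd i (bump de) z" for i
 proof -
  have "pd i (%x. bump de (- (1 / r) *\<^sub>R p + (1 / r) *\<^sub>R x)) (p + r *\<^sub>R z)
   = (1 / r) * pd i (bump de) (- (1 / r) *\<^sub>R p + (1 / r) *\<^sub>R (p + r *\<^sub>R z))"
   by (rule pd_affine[OF test_differentiable[OF bump_props(1)[OF assms(1)]]])
  then show ?thesis using assms(2) by (simp add: blow_def[abs_def] scaleR_add_right)
 qed
 then show ?thesis unfolding grad_of_pd by (simp add: scaleR_sum_right)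
qed

text \<open>Of the volume factor r^N one power of \<open>r\<close> is used up by the gradient of the
  rescaled bump, which leaves the surface scaling r^(N-1).\<close>

lemma scaled_identity:
 assumes d: "de > 0" and r: "r > 0"
 shows "ka * bdry_integral w (blow p de r) / r ^ (DIM('a) - 1)
  = (LBINT z. indicator w (p + r *\<^sub>R z) * (r * bump de z - q (p + r *\<^sub>R z) \<bullet> grad_of (bump de) z))"
proof -
 have tb: "test_fun UNIV (blow p de r)" by (rule blow_test[OF d r])
 define F where "F x = indicator w x * (blow p de r x - q x \<bullet> grad_of (blow p de r) x)" for x
 have Fm: "F \<in> borel_measurable borel" unfolding F_def using ow
  by (intro borel_measurable_times borel_measurable_indicator borel_measurable_diff borel_measurable_inner
    borel_measurable_test[OF tb] grad_of_borel[OF tb] grad_of_borel[OF tW]) auto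
 have "ka * bdry_integral w (blow p de r) = (LINT x|lebesgue_on w. F x)" unfolding con[OF tb, symmetric]
  by (rule integral_cong[OF refl]) (simp add: F_def)
 also have "... = (LBINT x. F x)" by (rule lebesgue_on_integral_lborel[OF ow Fm]) (simp add: F_def)
 also have "... = r ^ DIM('a) * (LBINT z. F (p + r *\<^sub>R z))" by (rule lborel_integral_affine[OF Fm r])
 also have "... = r ^ (DIM('a) - 1) * (LBINT z. r * F (p + r *\<^sub>R z))"
  using power_minus_mult[of "DIM('a)" r] N by (simp add: mult_ac)
 also have "(%z. r * F (p + r *\<^sub>R z)) = (%z. indicator w (p + r *\<^sub>R z) * (r * bump de z - q (p + r *\<^sub>R z) \<bullet> grad_of (bump de) z))"
  unfolding F_def blow_at[OF r] grad_blow[OF d r] using r by (auto simp: indicator_def algebra_simps)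
 finally show ?thesis using r by simp
qed

lemma blow_limit:
 assumes d: "de > 0" and p: "p \<in> frontier w"
  and r: "!!n::nat. r n > 0" "r \<longlonglongrightarrow> 0"
 shows "(%n. ka * bdry_integral w (blow p de (r n)) / r n ^ (DIM('a) - 1)) \<longlonglongrightarrow> flux TYPE('a) de (q p)"
proof -
 note tb = bump_props(1)[OF d, where 'a = 'a]
 obtain M where M: "M >= 0" "!!x. norm (q x) <= M" using grad_of_bounded[OF tW] by blast
 obtain K where K: "K >= 0" "!!x y. norm (q x - q y) <= K * norm (x - y)" using test_grad_Lipschitz[OF tW] by blast
 obtain R where R: "!!n. r n <= R"
  using convergent_imp_Bseq[OF convergentI[OF r(2)]] unfolding Bseq_def by (metis abs_ge_self order_trans real_norm_def)
 define T where "T n z = indicator w (p + r n *\<^sub>R z) * (r n * bump de z - q (p + r n *\<^sub>R z) \<bullet> grad_of (bump de) z)" for n and z :: 'a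
 define T0 where "T0 z = - (indicator {z. z \<bullet> q p > 0} z * (q p \<bullet> grad_of (bump de) z))" for z :: 'a
 have qlim: "(%n. q (p + r n *\<^sub>R z)) \<longlonglongrightarrow> q p" for z
 proof (rule LIM_zero_cancel, rule Lim_null_comparison)
  show "\<forall>\<^sub>F n in sequentially. norm (q (p + r n *\<^sub>R z) - q p) <= K * (r n * norm z)"
   using K(2)[of "p + r _ *\<^sub>R z" p] r(1) by (intro always_eventually allI) (simp add: less_imp_le)
  show "(%n. K * (r n * norm z)) \<longlonglongrightarrow> 0"
   by (intro tendsto_mult_right_zero tendsto_mult_left_zero r(2))
 qed
 have [measurable]: "w \<in> sets borel" "bump de \<in> borel_measurable (borel :: 'a measure)" "q \<in> borel_measurable borel"
  "grad_of (bump de) \<in> borel_measurable (borel :: 'a measure)"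
  using ow borel_measurable_test[OF tb] grad_of_borel[OF tb] grad_of_borel[OF tW] by auto
 have lim: "(%n. integral\<^sup>L lborel (T n)) \<longlonglongrightarrow> integral\<^sup>L lborel T0"
 proof (rule integral_dominated_convergence[where w = "%z. R * bump de z + M * (\<Sum>i\<in>Basis. \<bar>pd i (bump de) z\<bar>)"])
  show "T0 \<in> borel_measurable lborel" "T n \<in> borel_measurable lborel" for n unfolding T0_def T_def by measurable
  show "integrable lborel (%z::'a. R * bump de z + M * (\<Sum>i\<in>Basis. \<bar>pd i (bump de) z\<bar>))"
   using test_integrable[OF tb] test_integrable[OF test_fun_pd[OF tb]] by simp
  show "AE z in lborel. norm (T n z) <= R * bump de z + M * (\<Sum>i\<in>Basis. \<bar>pd i (bump de) z\<bar>)" for n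
  proof (rule AE_I2)
   fix z :: 'a
   have "norm (grad_of (bump de) z) <= (\<Sum>i\<in>Basis. \<bar>pd i (bump de) z\<bar>)"
    unfolding grad_of_pd by (rule sum_norm_le) simp
   then have "\<bar>q (p + r n *\<^sub>R z) \<bullet> grad_of (bump de) z\<bar> <= M * (\<Sum>i\<in>Basis. \<bar>pd i (bump de) z\<bar>)"
    using M by (intro order_trans[OF Cauchy_Schwarz_ineq2] mult_mono) auto
   moreover have "0 <= r n * bump de z" "r n * bump de z <= R * bump de z"
    using r(1)[of n] R[of n] bump_props(2)[OF d, of z] by (auto intro: mult_right_mono)
   ultimately show "norm (T n z) <= R * bump de z + M * (\<Sum>i\<in>Basis. \<bar>pd i (bump de) z\<bar>)"
    by (auto simp: T_def indicator_def)
  qed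
  have hyp: "AE z in lborel. q p = 0 \<or> z \<bullet> q p ~= 0"
  proof (cases "q p = 0")
   case False
   then have "negligible {z. q p \<bullet> z = 0}" by (intro negligible_hyperplane) auto
   then have "AE z in lebesgue. z \<notin> {z. q p \<bullet> z = 0}" unfolding negligible_iff_null_sets by (rule AE_not_in)
   then have "AE z in lborel. z \<notin> {z. q p \<bullet> z = 0}" by (simp only: AE_completion_iff)
   then show ?thesis by eventually_elim (simp add: inner_commute)
  qed simp
  show "AE z in lborel. (%n. T n z) \<longlonglongrightarrow> T0 z" using hyp
  proof eventually_elim
   fix z assume z: "q p = 0 \<or> z \<bullet> q p ~= 0"
   have core: "(%n. r n * bump de z - q (p + r n *\<^sub>R z) \<bullet> grad_of (bump de) z) \<longlonglongrightarrow> 0 * bump de z - q p \<bullet> grad_of (bump de) z"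
    by (intro tendsto_intros r(2) qlim)
   show "(%n. T n z) \<longlonglongrightarrow> T0 z"
   proof (cases "q p = 0")
    case True
    have "(%n. T n z) \<longlonglongrightarrow> 0"
    proof (rule Lim_null_comparison)
     show "\<forall>\<^sub>F n in sequentially. norm (T n z) <= \<bar>r n * bump de z - q (p + r n *\<^sub>R z) \<bullet> grad_of (bump de) z\<bar>"
      by (intro always_eventually allI) (simp add: T_def indicator_def)
     show "(%n. \<bar>r n * bump de z - q (p + r n *\<^sub>R z) \<bullet> grad_of (bump de) z\<bar>) \<longlonglongrightarrow> 0"
      using tendsto_rabs[OF core] True by simp
    qed
    then show ?thesis using True by (simp add: T0_def)
   next
    case False
    then have zq: "z \<bullet> q p ~= 0" "z ~= 0" using z by auto
    define ep where "ep = \<bar>z \<bullet> q p\<bar> / (2 * norm (q p) * norm z)"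
    have eps: "ep > 0" using zq False by (simp add: ep_def)
    have ez: "ep * norm (q p) * norm z = \<bar>z \<bullet> q p\<bar> / 2" using zq False by (simp add: ep_def)
    obtain ro where rho: "ro > 0" "!!y. norm y < ro ==> y \<bullet> q p > ep * norm (q p) * norm y ==> p + y \<in> w"
     "!!y. norm y < ro ==> y \<bullet> q p < - ep * norm (q p) * norm y ==> p + y \<notin> w"
     using wedge[OF p False eps] by blast
    have "(%n. r n * norm z) \<longlonglongrightarrow> 0" by (rule tendsto_mult_left_zero[OF r(2)])
    then have ev: "\<forall>\<^sub>F n in sequentially. r n * norm z < ro" by (rule order_tendstoD) (rule rho(1))
    have ind: "\<forall>\<^sub>F n in sequentially. indicator w (p + r n *\<^sub>R z) = (indicator {z. z \<bullet> q p > 0} z :: real)"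
     using ev
    proof eventually_elim
     fix n assume n: "r n * norm z < ro"
     have nz: "norm (r n *\<^sub>R z) < ro" using n r(1)[of n] by simp
     have le: "ep * norm (q p) * norm (r n *\<^sub>R z) = r n * (\<bar>z \<bullet> q p\<bar> / 2)"
      using ez r(1)[of n] by (simp add: mult_ac)
     show "indicator w (p + r n *\<^sub>R z) = (indicator {z. z \<bullet> q p > 0} z :: real)"
     proof (cases "z \<bullet> q p > 0")
      case True
      have "p + r n *\<^sub>R z \<in> w" by (rule rho(2)[OF nz]) (unfold le, use True r(1)[of n] in simp)
      then show ?thesis using True by simp
     next
      case False
      then have "z \<bullet> q p < 0" using zq by simp
      have "p + r n *\<^sub>R z \<notin> w"
      proof (rule rho(3)[OF nz])
       have "r n * (z \<bullet> q p) < - (r n * (\<bar>z \<bullet> q p\<bar> / 2))" using \<open>z \<bullet> q p < 0\<close> r(1)[of n] by simp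
       then show "(r n *\<^sub>R z) \<bullet> q p < - ep * norm (q p) * norm (r n *\<^sub>R z)" using le by simp
      qed
      then show ?thesis using False by simp
     qed
    qed
    have "(%n. indicator {z. z \<bullet> q p > 0} z * (r n * bump de z - q (p + r n *\<^sub>R z) \<bullet> grad_of (bump de) z)) \<longlonglongrightarrow> T0 z"
     using tendsto_mult_left[OF core, of "indicator {z. z \<bullet> q p > 0} z"] by (simp add: T0_def)
    then show ?thesis by (rule tendsto_cong[THEN iffD1, rotated]) (use ind in eventually_elim, simp add: T_def)
   qed
  qed
 qed
 have "integral\<^sup>L lborel T0 = flux TYPE('a) de (q p)" unfolding T0_def flux_def by simp
 moreover have "integral\<^sup>L lborel (T n) = ka * bdry_integral w (blow p de (r n)) / r n ^ (DIM('a) - 1)" for n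
  unfolding T_def scaled_identity[OF d r(1)] ..
 ultimately show ?thesis using lim by simp
qed

text \<open>Project a boundary piece at \<open>p1\<close> onto its tangent hyperplane, reflect this
  onto the tangent hyperplane at \<open>p2\<close>, and lift to the boundary there along the normal.
  Near-flatness at \<open>p1\<close> means that the projection loses at most the factor 1 - ep, and
  the lift can only increase distances because it adds an orthogonal component.\<close>

lemma near_isometry:
 assumes p1: "p1 \<in> frontier w" "q p1 ~= 0" and p2: "p2 \<in> frontier w" "q p2 ~= 0" and eps: "0 < ep" "ep < 1"
 shows "\<exists>ro>0. \<forall>r. r < ro --> ennreal ((1 - ep) powr (real DIM('a) - 1)) *
  hausdorff_outer (real DIM('a) - 1) (frontier w \<inter> ball p1 r)
  <= hausdorff_outer (real DIM('a) - 1) (frontier w \<inter> ball p2 ((1 + ep) * r))"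
proof -
 obtain K where K: "K >= 0" "!!x k. \<bar>W (x + k) - W x - q x \<bullet> k\<bar> <= K * (norm k)^2"
  using test_Taylor_grad[OF tW] by blast
 obtain K2 where K2: "K2 >= 0" "!!x y. norm (q x - q y) <= K2 * norm (x - y)" using test_grad_Lipschitz[OF tW] by blast
 define Q1 Q2 where "Q1 = norm (q p1)" "Q2 = norm (q p2)"
 have Q: "Q1 > 0" "Q2 > 0" using p1 p2 by (auto simp: Q1_Q2_def)
 define n1 n2 where "n1 = (1 / Q1) *\<^sub>R q p1" "n2 = (1 / Q2) *\<^sub>R q p2"
 have n: "norm n1 = 1" "norm n2 = 1" "q p1 = Q1 *\<^sub>R n1" "q p2 = Q2 *\<^sub>R n2"
  using Q by (auto simp: n1_n2_def Q1_Q2_def)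
 then have nn: "n1 \<bullet> n1 = 1" "n2 \<bullet> n2 = 1" by (simp_all add: norm_eq_1)
 define R where "R = refl_map n1 n2"
 note R = refl_map[OF n(1,2), folded R_def]
 obtain ro2 where rho2: "ro2 > 0" "!!z. norm z < ro2 ==> z \<bullet> q p2 > ep / 2 * norm (q p2) * norm z ==> p2 + z \<in> w"
  "!!z. norm z < ro2 ==> z \<bullet> q p2 < - (ep / 2) * norm (q p2) * norm z ==> p2 + z \<notin> w"
  using wedge[OF p2, of "ep / 2"] eps by auto
 \<comment> \<open>The second bound keeps the Taylor error and the variation of the gradient on the
   ball, taken together, below \<open>ep * Q1\<close>.\<close>
 define ro where "ro = min (ro2 / 2) (ep * Q1 / (2 * K + K2 + 1))"
 have den: "2 * K + K2 + 1 > 0" using K K2 by simp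
 have ro: "ro > 0" "2 * ro <= ro2" "(2 * K + K2) * ro <= ep * Q1"
 proof -
  show pos: "ro > 0" unfolding ro_def using rho2(1) den eps Q by simp
  show "2 * ro <= ro2" unfolding ro_def by linarith
  have "ro <= ep * Q1 / (2 * K + K2 + 1)" unfolding ro_def by linarith
  then have "(2 * K + K2 + 1) * ro <= ep * Q1" using den by (simp add: pos_le_divide_eq mult.commute)
  moreover have "(2 * K + K2) * ro <= (2 * K + K2 + 1) * ro" using pos by (intro mult_right_mono) auto
  ultimately show "(2 * K + K2) * ro <= ep * Q1" by linarith
 qed
 define proj where "proj y = y - (y \<bullet> n1) *\<^sub>R n1" for y
 have proj_n: "proj y \<bullet> n1 = 0" for y by (simp add: proj_def inner_diff_left nn)
 have proj_diff: "proj (x - y) = proj x - proj y" for x y by (simp add: proj_def inner_diff_left algebra_simps)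
 have proj_le: "norm (proj y) <= norm y" for y
 proof -
  have "(norm y)^2 = (norm (proj y))^2 + (y \<bullet> n1)^2" unfolding power2_norm_eq_inner proj_def
   by (simp add: inner_diff_left inner_diff_right nn inner_commute power2_eq_square)
  then show ?thesis by (intro power2_le_imp_le[of "norm (proj y)" "norm y"]) (simp_all add: zero_le_power2)
 qed
 have Rn: "R (proj y) \<bullet> n2 = 0" for y using R(5) proj_n by simp
 have Rdiff: "R (x - y) = R x - R y" for x y by (rule linear_diff[OF R(1)])
 show ?thesis
 proof (intro exI[of _ ro] conjI ro(1) allI impI)
  fix r assume r: "r < ro"
  define A where "A = frontier w \<inter> ball p1 r"
  \<comment> \<open>Both points are zeros of \<open>W\<close>, so their difference is almost
    orthogonal to the gradient.\<close>
  have flat1: "\<bar>(x' - x) \<bullet> n1\<bar> <= ep * norm (x' - x)" if x: "x \<in> A" "x' \<in> A" for x x'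
  proof -
   have Wx: "W x = 0" "W x' = 0" using x W0 by (auto simp: A_def)
   define k where "k = x' - x"
   have d: "norm (x - p1) <= r" "norm (x' - p1) <= r" using x by (auto simp: A_def dist_norm norm_minus_commute)
   have "norm k <= norm (x' - p1) + norm (x - p1)" unfolding k_def using norm_triangle_ineq4[of "x' - p1" "x - p1"] by simp
   then have kr: "norm k <= 2 * r" using d by simp
   have r0: "0 <= r" using d(1) norm_ge_zero[of "x - p1"] by linarith
   have a: "\<bar>q x \<bullet> k\<bar> <= K * (norm k)^2" using K(2)[of x k] Wx by (simp add: k_def)
   have b: "\<bar>(q p1 - q x) \<bullet> k\<bar> <= K2 * r * norm k"
   proof -
    have "\<bar>(q p1 - q x) \<bullet> k\<bar> <= norm (q p1 - q x) * norm k" by (rule Cauchy_Schwarz_ineq2)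
    also have "norm (q p1 - q x) <= K2 * norm (p1 - x)" by (rule K2(2))
    also have "K2 * norm (p1 - x) <= K2 * r" using d(1) K2(1) by (intro mult_left_mono) (simp_all add: norm_minus_commute)
    finally show ?thesis by (simp add: mult_right_mono)
   qed
   have c: "K * (norm k)^2 <= 2 * K * r * norm k"
   proof -
    have "K * (norm k * norm k) <= K * (2 * r * norm k)" using kr K(1) by (intro mult_left_mono mult_right_mono) auto
    then show ?thesis by (simp add: power2_eq_square mult_ac)
   qed
   have "Q1 * \<bar>n1 \<bullet> k\<bar> = \<bar>q p1 \<bullet> k\<bar>" using Q by (simp add: n(3) abs_mult)
   also have "... <= \<bar>q x \<bullet> k\<bar> + \<bar>(q p1 - q x) \<bullet> k\<bar>" by (simp add: inner_diff_left)
   also have "... <= 2 * K * r * norm k + K2 * r * norm k" using a b c by linarith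
   also have "... = (2 * K + K2) * r * norm k" by (simp add: algebra_simps)
   also have "... <= (2 * K + K2) * ro * norm k" using r K(1) K2(1) by (intro mult_right_mono mult_left_mono) auto
   also have "... <= ep * Q1 * norm k" using ro(3) by (intro mult_right_mono) auto
   finally have "Q1 * \<bar>n1 \<bullet> k\<bar> <= Q1 * (ep * norm k)" by (simp add: mult_ac)
   then show ?thesis using Q(1) by (simp add: k_def inner_commute)
  qed
  have ex: "\<exists>s. \<bar>s\<bar> <= ep * norm (proj (x - p1)) \<and> p2 + R (proj (x - p1)) + s *\<^sub>R n2 \<in> frontier w" if x: "x \<in> A" for x
  proof (cases "proj (x - p1) = 0")
   case True
   then show ?thesis using p2(1) linear_0[OF R(1)] by (intro exI[of _ 0]) simp
  next
   case False
   define m where "m = norm (proj (x - p1))"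
   define z where "z = R (proj (x - p1))"
   have m: "m > 0" "m < ro" "norm z = m" using False x r proj_le[of "x - p1"] R(2)[of "proj (x - p1)"]
    by (auto simp: m_def z_def A_def dist_norm norm_minus_commute)
   have zs: "norm (z + s *\<^sub>R n2) <= (1 + ep) * m" "norm (z + s *\<^sub>R n2) < ro2" "(z + s *\<^sub>R n2) \<bullet> q p2 = s * Q2"
    if s: "\<bar>s\<bar> <= ep * m" for s
   proof -
    have "norm (z + s *\<^sub>R n2) <= m + \<bar>s\<bar>" using norm_triangle_ineq[of z "s *\<^sub>R n2"] n m by simp
    then show le: "norm (z + s *\<^sub>R n2) <= (1 + ep) * m" using s by (simp add: algebra_simps)
    have "(1 + ep) * m <= 2 * m" using eps m by (intro mult_right_mono) auto
    then show "norm (z + s *\<^sub>R n2) < ro2" using le m ro by linarith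
    show "(z + s *\<^sub>R n2) \<bullet> q p2 = s * Q2" unfolding n(4) z_def by (simp add: inner_add_left Rn nn)
   qed
   have em: "ep / 2 * Q2 * norm (z + s *\<^sub>R n2) < ep * m * Q2" if s: "\<bar>s\<bar> <= ep * m" for s
   proof -
    have "(1 + ep) * m < 2 * m" using eps m by (intro mult_strict_right_mono) auto
    then have "norm (z + s *\<^sub>R n2) < 2 * m" using zs(1)[OF s] by linarith
    then have "ep / 2 * Q2 * norm (z + s *\<^sub>R n2) < ep / 2 * Q2 * (2 * m)" using eps Q by (intro mult_strict_left_mono) auto
    then show ?thesis by (simp add: mult_ac)
   qed
   \<comment> \<open>The segment over the projected point has one end in \<open>w\<close> and one
     outside, so connectedness yields a boundary point on it.\<close>
   define L where "L = (%s. p2 + (z + s *\<^sub>R n2)) ` {- (ep * m)..ep * m}"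
  have em0: "ep * m > 0" using eps m by simp
  have "p2 + (z + (ep * m) *\<^sub>R n2) \<in> w"
   using rho2(2)[OF zs(2)] zs(3)[of "ep * m"] em[of "ep * m"] em0 by (simp add: Q1_Q2_def)
  moreover have "p2 + (z + (- (ep * m)) *\<^sub>R n2) \<notin> w"
  proof (rule rho2(3)[OF zs(2)])
   show "\<bar>- (ep * m)\<bar> <= ep * m" using em0 by simp
   then show "(z + (- (ep * m)) *\<^sub>R n2) \<bullet> q p2 < - (ep / 2) * norm (q p2) * norm (z + (- (ep * m)) *\<^sub>R n2)"
    using em[of "- (ep * m)"] zs(3)[of "- (ep * m)"] by (simp add: Q1_Q2_def)
  qed
  moreover have "p2 + (z + (ep * m) *\<^sub>R n2) \<in> L" "p2 + (z + (- (ep * m)) *\<^sub>R n2) \<in> L"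
   unfolding L_def using em0 by (intro imageI; simp)+
  ultimately have "L \<inter> w ~= {}" "L - w ~= {}" by blast+
  moreover have "connected L" unfolding L_def by (intro connected_continuous_image continuous_intros connected_Icc)
  ultimately have "L \<inter> frontier w ~= {}" by (intro connected_Int_frontier)
  then obtain s where "s \<in> {- (ep * m)..ep * m}" "p2 + (z + s *\<^sub>R n2) \<in> frontier w" unfolding L_def by blast
  then show ?thesis by (intro exI[of _ s]) (auto simp: m_def z_def add.assoc)
 qed
 then obtain S where S: "!!x. x \<in> A ==> \<bar>S x\<bar> <= ep * norm (proj (x - p1))"
   "!!x. x \<in> A ==> p2 + R (proj (x - p1)) + S x *\<^sub>R n2 \<in> frontier w" by metis
  define f where "f x = p2 + R (proj (x - p1)) + S x *\<^sub>R n2" for x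
  have "ennreal ((1 - ep) powr (real DIM('a) - 1)) * hausdorff_outer (real DIM('a) - 1) A <= hausdorff_outer (real DIM('a) - 1) (f ` A)"
  proof (rule hausdorff_outer_expanding)
   show "0 < 1 - ep" using eps by simp
   show "0 <= real DIM('a) - 1" using N by simp
   fix x y assume x: "x \<in> A" "y \<in> A"
   define k where "k = x - y"
   have "(1 - ep) * norm k <= norm (proj k)"
   proof -
    have "norm k <= norm (proj k) + norm ((k \<bullet> n1) *\<^sub>R n1)" using norm_triangle_ineq[of "proj k" "(k \<bullet> n1) *\<^sub>R n1"] by (simp add: proj_def)
    then have "norm k <= norm (proj k) + \<bar>k \<bullet> n1\<bar>" using n(1) by simp
    moreover have "\<bar>k \<bullet> n1\<bar> <= ep * norm k" using flat1[OF x(2,1)] by (simp only: k_def)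
    ultimately show ?thesis by (simp add: left_diff_distrib)
   qed
   also have "norm (proj k) = norm (R (proj k))" using R(2) by simp
   also have "... <= norm (f x - f y)"
   proof -
    have fe: "f x - f y = R (proj k) + (S x - S y) *\<^sub>R n2" by (simp add: f_def k_def proj_diff Rdiff algebra_simps)
    have "(norm (f x - f y))^2 = (norm (R (proj k)))^2 + (S x - S y)^2"
     unfolding fe power2_norm_eq_inner using Rn[of k]
     by (simp add: inner_add_left inner_add_right nn inner_commute power2_eq_square)
    then show ?thesis by (intro power2_le_imp_le[of "norm (R (proj k))"]) simp_all
   qed
   finally show "(1 - ep) * dist x y <= dist (f x) (f y)" by (simp add: dist_norm k_def)
  qed
  also have "... <= hausdorff_outer (real DIM('a) - 1) (frontier w \<inter> ball p2 ((1 + ep) * r))"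
  proof (rule hausdorff_outer_mono, rule image_subsetI, rule IntI)
   fix x assume x: "x \<in> A"
   show "f x \<in> frontier w" unfolding f_def by (rule S(2)[OF x])
   have "norm (f x - p2) <= norm (R (proj (x - p1))) + \<bar>S x\<bar>"
    unfolding f_def using norm_triangle_ineq[of "R (proj (x - p1))" "S x *\<^sub>R n2"] n(2) by (simp add: algebra_simps)
   also have "... <= (1 + ep) * norm (proj (x - p1))" using S(1)[OF x] R(2) by (simp add: algebra_simps)
   also have "... <= (1 + ep) * norm (x - p1)" using proj_le eps by (intro mult_left_mono) auto
   also have "... < (1 + ep) * r" using x eps by (intro mult_strict_left_mono) (auto simp: A_def dist_norm norm_minus_commute)
   finally show "f x \<in> ball p2 ((1 + ep) * r)" by (simp add: dist_norm norm_minus_commute)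
  qed
  finally show "ennreal ((1 - ep) powr (real DIM('a) - 1)) * hausdorff_outer (real DIM('a) - 1) (frontier w \<inter> ball p1 r)
   <= hausdorff_outer (real DIM('a) - 1) (frontier w \<inter> ball p2 ((1 + ep) * r))" by (simp add: A_def)
 qed
qed

definition mass :: "'a => real => real" where
 "mass p r = measure surface_measure (frontier w \<inter> ball p r)"

lemma frontier_ball_borel: "frontier w \<inter> ball p r \<in> sets borel" by (intro sets.Int borel_closed borel_open) auto

lemma frontier_ball_finite: "emeasure surface_measure (frontier w \<inter> ball p r) ~= \<infinity>"
proof -
 have fb: "frontier w \<in> sets (surface_measure :: 'a measure)" unfolding sets_surface_measure by (intro borel_closed) auto
 have "emeasure surface_measure (frontier w) < \<infinity>"
  using fin by (subst (asm) integrable_indicator_iff) (auto simp: surface_measure_def space_measure_of_conv)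
 moreover have "emeasure surface_measure (frontier w \<inter> ball p r) <= emeasure surface_measure (frontier w)"
  by (rule emeasure_mono) (use fb in auto)
 ultimately show ?thesis by (auto simp: top_unique)
qed

lemma mass_hausdorff: "ennreal (mass p r) = hausdorff_outer (real DIM('a) - 1) (frontier w \<inter> ball p r)"
 unfolding mass_def surf[OF frontier_ball_borel, symmetric]
 by (rule emeasure_eq_ennreal_measure[symmetric]) (use frontier_ball_finite in simp)

lemma mass_blow:
 assumes d: "de > 0" and r: "r > 0"
 shows "mass p r <= bdry_integral w (blow p de r)" "bdry_integral w (blow p de r) <= mass p ((1 + de) * r)"
proof -
 have sb: "sets (surface_measure :: 'a measure) = sets borel" by (rule sets_surface_measure)
 have int: "integrable surface_measure (indicator (frontier w \<inter> ball p s) :: 'a => real)" for s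
  by (rule integrable_real_indicator) (use sb frontier_ball_borel frontier_ball_finite[of p s] in \<open>auto simp: less_top\<close>)
 have mi: "mass p s = (LINT x|surface_measure. indicator (frontier w \<inter> ball p s) x)" for s
  unfolding mass_def using sb sets_eq_imp_space_eq[OF sb] by simp
 have bm: "blow p de r \<in> borel_measurable (surface_measure :: 'a measure)"
  using borel_measurable_test[OF blow_test[OF d r]] sb by (simp cong: measurable_cong_sets)
 have fm: "(indicator (frontier w) :: 'a => real) \<in> borel_measurable surface_measure"
  using fin by (rule borel_measurable_integrable)
 have b01: "0 <= blow p de r x" "blow p de r x <= 1" for x unfolding blow_def using bump_props(2,3)[OF d] by auto
 have i2: "integrable surface_measure (%x. indicator (frontier w) x * blow p de r x)"
  by (rule integrable_bound[OF fin borel_measurable_times[OF fm bm]])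
   (use b01 in \<open>auto simp: indicator_def\<close>)
 have nz: "- (1 / r) *\<^sub>R p + (1 / r) *\<^sub>R x = (1 / r) *\<^sub>R (x - p)" for x by (simp add: algebra_simps)
 show "mass p r <= bdry_integral w (blow p de r)" unfolding mi bdry_integral_def
 proof (rule integral_mono[OF int i2])
  fix x
  have "blow p de r x = 1" if "x \<in> ball p r"
   unfolding blow_def nz using that r by (intro bump_props(4)[OF d]) (simp add: dist_norm norm_minus_commute)
  then show "indicator (frontier w \<inter> ball p r) x <= indicator (frontier w) x * blow p de r x"
   using b01[of x] by (auto simp: indicator_def)
 qed
 show "bdry_integral w (blow p de r) <= mass p ((1 + de) * r)" unfolding mi bdry_integral_def
 proof (rule integral_mono[OF i2 int])
  fix x
  have "blow p de r x = 0" if "x \<notin> ball p ((1 + de) * r)"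
   unfolding blow_def nz using that r by (intro bump_props(5)[OF d]) (simp add: dist_norm norm_minus_commute pos_le_divide_eq)
  then show "indicator (frontier w) x * blow p de r x <= indicator (frontier w \<inter> ball p ((1 + de) * r)) x"
   using b01[of x] by (auto simp: indicator_def)
 qed
qed

text \<open>The covering lower bound keeps the scaled boundary integrals away from 0. Since the zero
  vector has zero flux, this forces a nonzero gradient on the boundary, as Hopf's lemma does for
  smooth domains.\<close>

lemma flux_pos:
 assumes d: "de > 0" and p: "p \<in> frontier w"
 shows "flux TYPE('a) de (q p) > 0"
proof -
 obtain e r h L g where ch: "lip_chart w p e r h L g" using lip_chart_exists[OF lip p] by blast
 obtain c ro0 where c: "c > 0" "ro0 > 0"
  "!!ro. 0 < ro ==> ro < ro0 ==> ennreal (c * ro ^ (DIM('a) - 1)) <= hausdorff_outer (real DIM('a) - 1) (frontier w \<inter> ball p ro)"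
  using chart_hausdorff_lower[OF ch ow N] by blast
 define r where "r n = ro0 / (real n + 2)" for n :: nat
 have r: "r n > 0" "r n < ro0" for n using c(2) mult_nonneg_nonneg[of ro0 "real n"] by (auto simp: r_def divide_less_eq algebra_simps add_pos_nonneg)
 have rl: "r \<longlonglongrightarrow> 0" unfolding r_def by real_asymp
 have "ka * c <= ka * bdry_integral w (blow p de (r n)) / r n ^ (DIM('a) - 1)" for n
 proof -
  have "ennreal (c * r n ^ (DIM('a) - 1)) <= ennreal (mass p (r n))" unfolding mass_hausdorff by (rule c(3)[OF r])
  then have "c * r n ^ (DIM('a) - 1) <= mass p (r n)" by (simp add: mass_def)
  also have "... <= bdry_integral w (blow p de (r n))" by (rule mass_blow(1)[OF d r(1)])
  finally have "ka * (c * r n ^ (DIM('a) - 1)) <= ka * bdry_integral w (blow p de (r n))" using ka by simp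
  then show ?thesis using r(1)[of n] by (simp add: pos_le_divide_eq mult.assoc)
 qed
 then have "ka * c <= flux TYPE('a) de (q p)" by (intro LIMSEQ_le_const[OF blow_limit[OF d p r(1) rl]]) auto
 then show ?thesis using mult_pos_pos[OF ka c(1)] by linarith
qed

lemma grad_nonzero: "p \<in> frontier w ==> q p ~= 0" using flux_pos[of 1 p] by (auto simp: flux_def)

text \<open>Both blow-up limits are multiples, by the two gradient norms, of the flux of one unit
  vector, while \<open>near_isometry\<close> compares the boundary masses at the two points up to
  factors tending to 1. Exchanging the points will give equality.\<close>

lemma grad_norm_le:
 assumes p1: "p1 \<in> frontier w" and p2: "p2 \<in> frontier w"
 shows "norm (q p1) <= norm (q p2)"
proof -
 define N1 where "N1 = DIM('a) - 1"
 have N1: "real DIM('a) - 1 = real N1" using N by (simp add: N1_def)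
 obtain u :: 'a where u: "norm u = 1" using SOME_Basis norm_Basis by blast
 have key: "(1 - ep) ^ N1 * norm (q p1) <= (1 + ep) ^ (2 * N1) * norm (q p2)" if e: "0 < ep" "ep < 1" for ep
 proof -
  obtain ro where rho: "ro > 0" "!!r. r < ro ==> ennreal ((1 - ep) powr (real DIM('a) - 1)) *
   hausdorff_outer (real DIM('a) - 1) (frontier w \<inter> ball p1 r)
   <= hausdorff_outer (real DIM('a) - 1) (frontier w \<inter> ball p2 ((1 + ep) * r))"
   using near_isometry[OF p1 grad_nonzero[OF p1] p2 grad_nonzero[OF p2] e] by blast
  define r where "r n = ro / 2 / (real n + 2)" for n :: nat
  have r: "r n > 0" "(1 + ep) * r n < ro" for n
  proof -
   show p: "r n > 0" using rho(1) by (auto simp: r_def)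
   have "(1 + ep) * r n <= 2 * r n" using e p by (intro mult_right_mono) auto
   also have "... < ro" using rho(1) mult_nonneg_nonneg[of ro "real n"] by (simp add: r_def divide_less_eq algebra_simps add_pos_nonneg)
   finally show "(1 + ep) * r n < ro" .
  qed
  have rl: "r \<longlonglongrightarrow> 0" unfolding r_def by real_asymp
  \<comment> \<open>One factor 1 + ep comes from the support of the bump at \<open>p1\<close>, the
    other from \<open>near_isometry\<close>.\<close>
  define r' where "r' n = (1 + ep)^2 * r n" for n
  have r': "r' n > 0" "r' \<longlonglongrightarrow> 0" for n unfolding r'_def using r e tendsto_mult_right_zero[OF rl] by auto
  have "(1 - ep) ^ N1 * (ka * bdry_integral w (blow p1 ep (r n)) / r n ^ N1)
   <= (1 + ep) ^ (2 * N1) * (ka * bdry_integral w (blow p2 ep (r' n)) / r' n ^ N1)" for n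
  proof -
   have "ennreal ((1 - ep) ^ N1 * mass p1 ((1 + ep) * r n)) <= ennreal (mass p2 ((1 + ep) * ((1 + ep) * r n)))"
   proof -
    have "ennreal ((1 - ep) ^ N1) * ennreal (mass p1 ((1 + ep) * r n)) <= ennreal (mass p2 ((1 + ep) * ((1 + ep) * r n)))"
     using rho(2)[OF r(2)[of n]] e unfolding mass_hausdorff N1 by (simp add: powr_realpow)
    moreover have "mass p1 ((1 + ep) * r n) >= 0" by (simp add: mass_def)
    ultimately show ?thesis using e by (simp add: ennreal_mult)
   qed
   then have "(1 - ep) ^ N1 * mass p1 ((1 + ep) * r n) <= mass p2 (r' n)"
    by (simp add: mass_def r'_def power2_eq_square mult.assoc)
   moreover have "(1 - ep) ^ N1 * bdry_integral w (blow p1 ep (r n)) <= (1 - ep) ^ N1 * mass p1 ((1 + ep) * r n)"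
    by (rule mult_left_mono[OF mass_blow(2)[OF e(1) r(1)]]) (use e in simp)
   moreover have "mass p2 (r' n) <= bdry_integral w (blow p2 ep (r' n))" by (rule mass_blow(1)[OF e(1) r'(1)])
   ultimately have "(1 - ep) ^ N1 * bdry_integral w (blow p1 ep (r n)) <= bdry_integral w (blow p2 ep (r' n))" by linarith
   then have "(ka / r n ^ N1) * ((1 - ep) ^ N1 * bdry_integral w (blow p1 ep (r n))) <= (ka / r n ^ N1) * bdry_integral w (blow p2 ep (r' n))"
    using ka r(1)[of n] by (intro mult_left_mono) auto
   moreover have "r' n ^ N1 = (1 + ep) ^ (2 * N1) * r n ^ N1" by (simp add: r'_def power_mult_distrib power_mult)
   moreover have "1 + ep ~= 0" using e by simp
   ultimately show ?thesis by (simp add: mult_ac)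
  qed
  then have "(1 - ep) ^ N1 * flux TYPE('a) ep (q p1) <= (1 + ep) ^ (2 * N1) * flux TYPE('a) ep (q p2)"
   by (intro LIMSEQ_le[OF tendsto_mult_left[OF blow_limit[OF e(1) p1 r(1) rl]] tendsto_mult_left[OF blow_limit[OF e(1) p2 r'(1) r'(2)]]])
    (auto simp: N1_def)
  moreover have "flux TYPE('a) ep (q p1) = norm (q p1) * flux TYPE('a) ep u" "flux TYPE('a) ep (q p2) = norm (q p2) * flux TYPE('a) ep u"
   by (rule flux_isotropic[OF e(1) u grad_nonzero], fact)+
  moreover have "flux TYPE('a) ep u > 0" using flux_pos[OF e(1) p1] calculation(2) by (simp add: zero_less_mult_iff)
  ultimately have "((1 - ep) ^ N1 * norm (q p1)) * flux TYPE('a) ep u <= ((1 + ep) ^ (2 * N1) * norm (q p2)) * flux TYPE('a) ep u"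
   by (simp add: mult.assoc)
  then show ?thesis using \<open>flux TYPE('a) ep u > 0\<close> by (simp only: mult_le_cancel_right_pos)
 qed
 have l1: "(%n::nat. (1 - 1 / (real n + 2)) ^ N1 * norm (q p1)) \<longlonglongrightarrow> (1 - 0) ^ N1 * norm (q p1)"
  by (intro tendsto_intros) real_asymp
 have l2: "(%n::nat. (1 + 1 / (real n + 2)) ^ (2 * N1) * norm (q p2)) \<longlonglongrightarrow> (1 + 0) ^ (2 * N1) * norm (q p2)"
  by (intro tendsto_intros) real_asymp
 have "(1 - 0) ^ N1 * norm (q p1) <= (1 + 0) ^ (2 * N1) * norm (q p2)"
  by (rule LIMSEQ_le[OF l1 l2], intro exI[of _ 0] allI impI, rule key) (auto simp: field_simps)
 then show ?thesis by simp
qed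

lemma grad_norm_frontier_const: "\<exists>be>0. \<forall>p\<in>frontier w. norm (grad_of W p) = be"
proof (cases "frontier w = {}")
 case False
 then obtain p where p: "p \<in> frontier w" by blast
 show ?thesis by (intro exI[of _ "norm (q p)"] conjI ballI)
   (use grad_nonzero[OF p] grad_norm_le p in \<open>auto intro!: antisym\<close>)
qed (auto intro: exI[of _ 1])

end

section \<open>Serrin's problem\<close>

lemma smooth_pd_add: "smooth_on UNIV f ==> smooth_on UNIV g ==> pd v (%x. f x + g x) = (%x. pd v f x + pd v g x)"
 by (rule ext, rule pd_add; rule smooth_on_differentiable, assumption, simp)

lemma smooth_pd_diff: "smooth_on UNIV f ==> smooth_on UNIV g ==> pd v (%x. f x - g x) = (%x. pd v f x - pd v g x)"
 by (rule ext, rule pd_diff; rule smooth_on_differentiable, assumption, simp)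

lemma smooth_pd_mult: "smooth_on UNIV f ==> smooth_on UNIV g ==> pd v (%x. f x * g x) = (%x. f x * pd v g x + pd v f x * g x)"
 by (rule ext, rule pd_mult; rule smooth_on_differentiable, assumption, simp)

lemma smooth_pd_sum: "(!!i. i \<in> I ==> smooth_on UNIV (f i)) ==> pd v (%x. \<Sum>i\<in>I. f i x) = (%x. \<Sum>i\<in>I. pd v (f i) x)"
 by (rule ext, rule pd_sum, rule smooth_on_differentiable[of UNIV]) auto

lemma pd_zero_imp_const:
 assumes D: "open D" "connected D" and f: "smooth_on D f" and z: "!!x i. x \<in> D ==> i \<in> Basis ==> pd i f x = 0"
 shows "\<exists>c. \<forall>x\<in>D. f x = c"
proof -
 have d: "(f has_derivative (%h. 0)) (at x)" if x: "x \<in> D" for x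
 proof -
  have "(%v. pd v f x) = (%v. 0)"
   using pd_grad[OF smooth_on_differentiable[OF f x]] z[OF x] by (simp add: grad_of_pd)
  then show ?thesis using pd_has_derivative[OF smooth_on_differentiable[OF f x]] by simp
 qed
 show ?thesis
 proof (cases "D = {}")
  case False
  then obtain x0 where x0: "x0 \<in> D" by blast
  have "f x = f x0" if "x \<in> D" for x by (rule has_derivative_zero_unique_connected[OF D(1,2) d that x0]) simp_all
  then show ?thesis by blast
 qed simp
qed

text \<open>A connected set that misses the boundary of \<open>D\<close> lies either inside or
  outside \<open>D\<close>. The open ball meets \<open>D\<close>; the complement of the closed ball
  is connected in dimension at least 2 and, being unbounded, cannot lie in \<open>D\<close>.\<close>

lemma ball_of_spherical_frontier:
 fixes D :: "'a::euclidean_space set"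
 assumes N: "DIM('a) >= 2" and D: "open D" "bounded D" and x: "x \<in> D" "(norm (x - c))^2 < m"
  and f: "!!p. p \<in> frontier D ==> (norm (p - c))^2 = m"
 shows "D = ball c (sqrt m)"
proof
 have fR: "norm (p - c) = sqrt m" if "p \<in> frontier D" for p by (simp flip: f[OF that])
 have "ball c (sqrt m) \<inter> frontier D = {}" using fR by (fastforce simp: dist_norm norm_minus_commute)
 moreover have "x \<in> ball c (sqrt m)" using x(2) by (simp add: dist_norm norm_minus_commute real_less_rsqrt)
 ultimately show "ball c (sqrt m) \<subseteq> D" using connected_Int_frontier[of "ball c (sqrt m)" D] x(1) connected_ball[of c "sqrt m"] by blast
 have "D \<subseteq> cball c (sqrt m)"
 proof (rule ccontr)
  assume "\<not> D \<subseteq> cball c (sqrt m)"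
  moreover have "connected (- cball c (sqrt m))" by (rule connected_complement_bounded_convex) (use N in auto)
  moreover have "- cball c (sqrt m) - D ~= {}"
  proof
   assume "- cball c (sqrt m) - D = {}"
   then have "UNIV \<subseteq> D \<union> cball c (sqrt m)" by blast
   then have "bounded (UNIV :: 'a set)" using D(2) bounded_subset by (metis bounded_Un bounded_cball)
   then show False by simp
  qed
  ultimately have "- cball c (sqrt m) \<inter> frontier D ~= {}" by (intro connected_Int_frontier) auto
  then show False using fR by (auto simp: dist_norm norm_minus_commute)
 qed
 then have "interior D \<subseteq> interior (cball c (sqrt m))" by (rule interior_mono)
 then show "D \<subseteq> ball c (sqrt m)" using D(1) by (simp add: interior_open)
qed

context
 fixes w :: "'a::euclidean_space set" and W :: "'a => real" and be :: real
 assumes ow: "open w" and bw: "bounded w" and cw: "connected w" and new: "w ~= {}"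
  and tW: "test_fun UNIV W" and lapW: "!!x. x \<in> w ==> lap_of W x = - 1"
  and W0: "!!x. x \<in> frontier w ==> W x = 0"
begin

lemma sW: "smooth_on UNIV W" by (rule test_smooth[OF tW])

text \<open>At an interior minimum all pure second derivatives are nonnegative, against the
  Laplacian being -1; so the minimum over the closure is attained on the boundary only.\<close>

lemma minimum_principle:
 assumes x: "x \<in> w" shows "W x > 0"
proof -
 have cc: "compact (closure w)" using bw by (simp add: compact_closure)
 have contW: "continuous_on (closure w) W" using smooth_on_continuous[OF sW] continuous_on_subset by blast
 obtain x0 where x0: "x0 \<in> closure w" "!!y. y \<in> closure w ==> W x0 <= W y"
  using continuous_attains_inf[OF cc _ contW] new closure_subset by blast
 have no_min: False if z: "z \<in> w" "!!y. y \<in> closure w ==> W z <= W y" for z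
 proof -
  obtain d where d: "d > 0" "ball z d \<subseteq> w" using ow z(1) open_contains_ball by blast
  have "pd i (pd i W) z >= 0" if i: "i \<in> Basis" for i
  proof (rule ccontr)
   assume neg: "\<not> pd i (pd i W) z >= 0"
   note der = pd_line[OF smooth_on_differentiable[OF _ UNIV_I]]
   have g0: "pd i W (z + 0 *\<^sub>R i) = 0"
   proof (rule DERIV_local_min[OF der[OF sW] d(1)], intro allI impI)
    fix y :: real assume "\<bar>0 - y\<bar> < d"
    then have "z + y *\<^sub>R i \<in> ball z d" using i by (simp add: dist_norm)
    then have "z + y *\<^sub>R i \<in> closure w" using d(2) closure_subset by blast
    then show "W (z + 0 *\<^sub>R i) <= W (z + y *\<^sub>R i)" using z(2)[of "z + y *\<^sub>R i"] by simp
   qed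
   obtain e where e: "e > 0" "!!h. 0 < h ==> h < e ==> pd i W (z + h *\<^sub>R i) < 0"
   proof -
    have "pd i (pd i W) (z + 0 *\<^sub>R i) < 0" using neg by simp
    from DERIV_neg_dec_right[OF der[OF smooth_on_pd[OF sW]] this] show ?thesis using g0 that by auto
   qed
   define h where "h = min (d / 2) (e / 2)"
   have h: "0 < h" "h < d" "h < e" using d(1) e(1) by (auto simp: h_def min_def)
   obtain xi where xi: "0 < xi" "xi < h" "W (z + h *\<^sub>R i) - W (z + 0 *\<^sub>R i) = (h - 0) * pd i W (z + xi *\<^sub>R i)"
    using MVT2[OF h(1) der[OF sW]] by blast
   have "(h - 0) * pd i W (z + xi *\<^sub>R i) < 0" using e(2)[of xi] xi h by (simp add: mult_pos_neg)
   moreover have "z + h *\<^sub>R i \<in> closure w" using d(2) h i closure_subset by (force simp: dist_norm)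
   ultimately show False using xi(3) z(2)[of "z + h *\<^sub>R i"] by simp
  qed
  then have "lap_of W z >= 0" unfolding lap_of_pd by (intro sum_nonneg) auto
  then show False using lapW[OF z(1)] by simp
 qed
 have "x0 \<in> frontier w" using x0 no_min by (metis DiffI frontier_def interior_open ow)
 then have "W x0 = 0" by (rule W0)
 moreover have "W x >= W x0" using x0(2) x closure_subset by blast
 moreover have "W x ~= W x0" using no_min[OF x] x0(2) by auto
 ultimately show ?thesis by simp
qed

text \<open>The cutoff is a function of \<open>W\<close>, so inside \<open>w\<close> its gradient is
  parallel to that of \<open>W\<close> and of order n on the layer where \<open>W\<close> is of
  order 1/n. The bound by \<open>C * W\<close> therefore keeps the error term bounded, and the
  layers shrink to the empty set.\<close>

lemma divergence_cutoff:
 fixes f :: "'a => 'a => real"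
 assumes sf: "!!i. i \<in> Basis ==> smooth_on UNIV (f i)"
  and bd: "!!x. x \<in> w ==> \<bar>\<Sum>i\<in>Basis. f i x * pd i W x\<bar> <= C * W x"
 shows "integrable lborel (%x. indicator w x * (\<Sum>i\<in>Basis. pd i (f i) x))"
  "(LBINT x. indicator w x * (\<Sum>i\<in>Basis. pd i (f i) x)) = 0"
proof -
 note Wpos = minimum_principle
 have cc: "compact (closure w)" using bw by (simp add: compact_closure)
 \<comment> \<open>The transition takes place for \<open>W\<close> between 1 / (n + 1) and 2 / (n +
   1); the indicator removes points outside \<open>w\<close>, where \<open>W\<close> may be
   positive.\<close>
 define te where "te n x = indicator w x * smoothstep ((real n + 1) * W x - 1)" for n :: nat and x
 define K where "K n = closure w \<inter> {x. W x >= 1 / (real n + 1)}" for n :: nat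
 have cW: "continuous_on UNIV W" by (rule smooth_on_continuous[OF sW])
 have cK: "compact (K n)" for n
  unfolding K_def using cc cW by (intro compact_Int_closed closed_Collect_le continuous_intros) auto
 have Kw: "K n \<subseteq> w" for n
 proof
  fix x assume x: "x \<in> K n"
  then have "W x ~= 0" by (auto simp: K_def)
  then show "x \<in> w" using x W0 by (auto simp: K_def frontier_def interior_open[OF ow])
 qed
 have z: "te n x = 0" if "x \<notin> K n" for n x
 proof (cases "x \<in> w")
  case True
  then have "W x < 1 / (real n + 1)" using that closure_subset by (auto simp: K_def)
  then have "(real n + 1) * W x < 1" by (simp add: pos_less_divide_eq mult.commute)
  then show ?thesis by (simp add: te_def smoothstep_le_0)
 qed (simp add: te_def)
 have tt: "test_fun w (te n)" for n
 proof (rule test_funI[OF _ cK Kw z])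
  have "smooth_on w (%x. smoothstep ((real n + 1) * W x - 1))"
   by (rule smooth_on_compose[OF ow smooth_smoothstep]) (intro smooth_intros ow smooth_on_mono[OF sW] subset_UNIV)
  then have "smooth_on w (te n)" by (rule smooth_on_cong[OF ow, rotated]) (simp add: te_def)
  moreover have "smooth_on (- K n) (te n)"
   by (rule smooth_on_cong[of _ "%x. 0"]) (use z[of _ n] cK compact_imp_closed[OF cK[of n]] in auto)
  ultimately have "smooth_on (w \<union> - K n) (te n)" by (rule smooth_on_Un)
  moreover have "w \<union> - K n = UNIV" using Kw[of n] by blast
  ultimately show "smooth_on UNIV (te n)" by simp
 qed
 obtain B where B: "B >= 0" "!!s::real. s \<in> {-1..1} ==> \<bar>pd 1 smoothstep s\<bar> <= B"
  using continuous_bounded[OF smooth_on_continuous[OF smooth_on_pd[OF smooth_smoothstep]] bounded_closed_interval] by blast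
 have dth: "\<bar>\<Sum>i\<in>Basis. f i x * pd i (te n) x\<bar> <= (if x \<in> w \<and> (real n + 1) * W x <= 2 then 2 * B * C else 0)" for n x
 proof (cases "x \<in> w")
  case False
  have "pd i (te n) x = 0" for i
  proof -
   have "pd i (te n) x = pd i (%x. 0) x"
    by (rule pd_cong[of "- K n"]) (use False Kw[of n] z[of _ n] compact_imp_closed[OF cK[of n]] in auto)
   then show ?thesis by simp
  qed
  then show ?thesis using False by simp
 next
  case True
  have p: "pd i (te n) x = pd 1 smoothstep ((real n + 1) * W x - 1) * ((real n + 1) * pd i W x)" for i
  proof -
   have d: "(%x. (real n + 1) * W x - 1) differentiable (at x)"
    using smooth_on_differentiable[OF sW, of x] by (auto intro!: derivative_intros)
   have "pd i (te n) x = pd i (%x. smoothstep ((real n + 1) * W x - 1)) x"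
    by (rule pd_cong[OF ow True]) (simp add: te_def)
   also have "... = pd 1 smoothstep ((real n + 1) * W x - 1) * pd i (%x. (real n + 1) * W x - 1) x"
    by (rule pd_comp[OF d smooth_on_has_real_derivative[OF smooth_smoothstep]])
   also have "pd i (%x. (real n + 1) * W x - 1) x = (real n + 1) * pd i W x"
    using smooth_on_differentiable[OF sW, of x] by (subst pd_diff) (auto intro!: derivative_intros simp: pd_cmult)
   finally show ?thesis .
  qed
  define D where "D = pd 1 smoothstep ((real n + 1) * W x - 1) * (real n + 1)"
  have "(\<Sum>i\<in>Basis. f i x * pd i (te n) x) = D * (\<Sum>i\<in>Basis. f i x * pd i W x)"
   unfolding p D_def sum_distrib_left by (rule sum.cong[OF refl]) (simp only: mult_ac)
  then have le: "\<bar>\<Sum>i\<in>Basis. f i x * pd i (te n) x\<bar> <= \<bar>D\<bar> * (C * W x)"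
   using bd[OF True] by (simp add: abs_mult mult_left_mono)
  have C0: "C >= 0"
  proof -
   have "0 <= C * W x" using bd[OF True] by linarith
   then show ?thesis using Wpos[OF True] by (simp add: zero_le_mult_iff)
  qed
  show ?thesis
  proof (cases "(real n + 1) * W x <= 2")
   case c2: True
   have "\<bar>D\<bar> * (C * W x) = \<bar>pd 1 smoothstep ((real n + 1) * W x - 1)\<bar> * (C * ((real n + 1) * W x))"
    by (simp add: D_def abs_mult)
   also have "... <= B * (C * 2)" using B(1) c2 C0 Wpos[OF True] by (intro mult_mono B(2)) auto
   finally show ?thesis using le True c2 by simp
  next
   case False
   have "pd 1 smoothstep ((real n + 1) * W x - 1) = pd 1 (%x. 1) ((real n + 1) * W x - 1)"
    by (rule pd_cong[of "{1<..}"]) (use False in \<open>auto simp: smoothstep_ge_1\<close>)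
   then show ?thesis using le False by (simp add: D_def)
  qed
 qed
 define v where "v x = (\<Sum>i\<in>Basis. pd i (f i) x)" for x
 have cv: "continuous_on UNIV v" unfolding v_def
  using smooth_on_continuous[OF smooth_on_pd[OF sf]] by (intro continuous_on_sum) auto
 obtain M where M: "M >= 0" "!!x. x \<in> w ==> \<bar>v x\<bar> <= M" using continuous_bounded[OF cv bw] by blast
 have iw: "integrable lborel (indicator w :: 'a => real)" by (intro bbs_integrable bbs_indicator borel_open ow bw)
 have iv: "integrable lborel (%x. indicator w x * v x)" by (intro bbs_integrable bbs_continuous_on borel_open ow bw cv)
 have mv: "v \<in> borel_measurable borel" by (rule borel_measurable_continuous_onI[OF cv])
 show "integrable lborel (%x. indicator w x * (\<Sum>i\<in>Basis. pd i (f i) x))" using iv by (simp only: v_def)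
 have ibp: "(LBINT x. v x * te n x) = - (LBINT x. (\<Sum>i\<in>Basis. f i x * pd i (te n) x))" for n
 proof -
  have i1: "integrable lborel (%x. pd i (f i) x * te n x)" if "i \<in> Basis" for i
   by (rule test_integrable[OF test_fun_mult[OF tt smooth_on_pd[OF sf[OF that]]]])
  have i2: "integrable lborel (%x. f i x * pd i (te n) x)" if "i \<in> Basis" for i
   by (rule test_integrable[OF test_fun_mult[OF test_fun_pd[OF tt] sf[OF that]]])
  have "(LBINT x. v x * te n x) = (\<Sum>i\<in>Basis. \<integral>x. pd i (f i) x * te n x \<partial>lborel)"
   unfolding v_def sum_distrib_right by (rule integral_sum) (rule i1)
  also have "... = (\<Sum>i\<in>Basis. - (LBINT x. f i x * pd i (te n) x))"
   by (rule sum.cong[OF refl]) (use integration_by_parts[OF tt sf] in simp)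
  also have "... = - (LBINT x. (\<Sum>i\<in>Basis. f i x * pd i (te n) x))"
   by (subst integral_sum) (use i2 in \<open>auto simp: sum_negf\<close>)
  finally show ?thesis .
 qed
 have big: "\<forall>\<^sub>F n in sequentially. (real n + 1) * W x > 2" if "x \<in> w" for x
 proof -
  have "filterlim (%n::nat. (real n + 1) * W x) at_top sequentially" using Wpos[OF that] by real_asymp
  then show ?thesis by (simp add: filterlim_at_top_dense)
 qed
 have l1: "(%n. \<integral>x. v x * te n x \<partial>lborel) \<longlonglongrightarrow> (LBINT x. indicator w x * v x)"
 proof (rule integral_dominated_convergence[where w = "%x. indicator w x * M"])
  show "(%x. indicator w x * v x) \<in> borel_measurable lborel" using iv by (rule borel_measurable_integrable)
  show "(%x. v x * te n x) \<in> borel_measurable lborel" for n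
   using borel_measurable_test[OF tt, of n] mv by simp
  show "integrable lborel (%x. indicator w x * M)" by (rule integrable_mult_left[OF iw])
  show "AE x in lborel. (%n. v x * te n x) \<longlonglongrightarrow> indicator w x * v x"
  proof (rule AE_I2)
   fix x
   show "(%n. v x * te n x) \<longlonglongrightarrow> indicator w x * v x"
   proof (cases "x \<in> w")
    case True
    show ?thesis
     by (rule tendsto_eventually, rule eventually_mono[OF big[OF True]]) (simp add: te_def True smoothstep_ge_1)
   qed (simp add: te_def)
  qed
  show "AE x in lborel. norm (v x * te n x) <= indicator w x * M" for n
  proof (rule AE_I2)
   fix x
   show "norm (v x * te n x) <= indicator w x * M"
   proof (cases "x \<in> w")
    case True
    have "\<bar>v x\<bar> * \<bar>te n x\<bar> <= M * 1"
     using M True smoothstep_bounds[of "(real n + 1) * W x - 1"] by (intro mult_mono) (auto simp: te_def)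
    then show ?thesis using True by (simp add: abs_mult)
   qed (simp add: te_def)
  qed
 qed
 have l2: "(%n. \<integral>x. (\<Sum>i\<in>Basis. f i x * pd i (te n) x) \<partial>lborel) \<longlonglongrightarrow> (\<integral>x. (0::real) \<partial>(lborel :: 'a measure))"
 proof (rule integral_dominated_convergence[where w = "%x. indicator w x * \<bar>2 * B * C\<bar>"])
  show "(%x. \<Sum>i\<in>Basis. f i x * pd i (te n) x) \<in> borel_measurable lborel" for n
   by (rule borel_measurable_sum) (use borel_measurable_test[OF test_fun_mult[OF test_fun_pd[OF tt] sf]] in simp)
  show "integrable lborel (%x. indicator w x * \<bar>2 * B * C\<bar>)" by (rule integrable_mult_left[OF iw])
  show "AE x in lborel. (%n. \<Sum>i\<in>Basis. f i x * pd i (te n) x) \<longlonglongrightarrow> 0"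
  proof (rule AE_I2)
   fix x
   show "(%n. \<Sum>i\<in>Basis. f i x * pd i (te n) x) \<longlonglongrightarrow> 0"
   proof (cases "x \<in> w")
    case True
    show ?thesis
     by (rule tendsto_eventually, rule eventually_mono[OF big[OF True]]) (use dth[of x] True in \<open>force split: if_splits\<close>)
   next
    case False
    then have "(\<Sum>i\<in>Basis. f i x * pd i (te n) x) = 0" for n using dth[of x n] by simp
    then show ?thesis by simp
   qed
  qed
  show "AE x in lborel. norm (\<Sum>i\<in>Basis. f i x * pd i (te n) x) <= indicator w x * \<bar>2 * B * C\<bar>" for n
  proof (rule AE_I2)
   fix x
   show "norm (\<Sum>i\<in>Basis. f i x * pd i (te n) x) <= indicator w x * \<bar>2 * B * C\<bar>"
    using dth[of x n] by (cases "x \<in> w") (auto split: if_splits)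
  qed
 qed simp
 have "(%n. \<integral>x. v x * te n x \<partial>lborel) \<longlonglongrightarrow> 0" unfolding ibp using tendsto_minus[OF l2] by simp
 then have "(LBINT x. indicator w x * v x) = 0" using l1 LIMSEQ_unique by blast
 then show "(LBINT x. indicator w x * (\<Sum>i\<in>Basis. pd i (f i) x)) = 0" by (simp add: v_def)
qed

section \<open>The P-function and Pohozaev's identity\<close>

definition "gsq x = (\<Sum>j\<in>Basis. pd j W x * pd j W x)"
definition "Pf x = gsq x + 2 / real DIM('a) * W x"
definition "xg x = (\<Sum>j\<in>Basis. (x \<bullet> j) * pd j W x)"

lemma smooth_pieces: "smooth_on UNIV gsq" "smooth_on UNIV Pf" "smooth_on UNIV xg"
proof -
 have a: "smooth_on UNIV (pd i W)" for i by (rule smooth_on_pd[OF sW])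
 show g: "smooth_on UNIV gsq" unfolding gsq_def[abs_def] by (intro smooth_intros open_UNIV a)
 show "smooth_on UNIV Pf" unfolding Pf_def[abs_def] by (intro smooth_intros open_UNIV g sW)
 show "smooth_on UNIV xg" unfolding xg_def[abs_def] by (intro smooth_intros open_UNIV a)
qed

lemma gsq_grad: "gsq x = (norm (grad_of W x))^2"
 unfolding gsq_def power2_norm_eq_inner euclidean_inner[of "grad_of W x" "grad_of W x"] by (simp add: grad_of_Basis)

lemma lap_sum: "x \<in> w ==> (\<Sum>i\<in>Basis. pd i (pd i W) x) = - 1" using lapW[of x] by (simp add: lap_of_pd)

lemma pd_gsq: "pd i gsq = (%x. \<Sum>j\<in>Basis. 2 * (pd j W x * pd i (pd j W) x))"
proof -
 have a: "smooth_on UNIV (pd i W)" for i by (rule smooth_on_pd[OF sW])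
 have "pd i gsq = (%x. \<Sum>j\<in>Basis. pd i (%x. pd j W x * pd j W x) x)"
  unfolding gsq_def[abs_def] by (rule smooth_pd_sum) (intro smooth_intros open_UNIV a)
 also have "... = (%x. \<Sum>j\<in>Basis. 2 * (pd j W x * pd i (pd j W) x))"
  unfolding smooth_pd_mult[OF a a] by (simp add: mult_ac)
 finally show ?thesis .
qed

lemma pd_xg: "i \<in> Basis ==> pd i xg x = (\<Sum>j\<in>Basis. (x \<bullet> j) * pd i (pd j W) x) + pd i W x"
proof -
 assume i: "i \<in> Basis"
 have a: "smooth_on UNIV (pd i W)" for i by (rule smooth_on_pd[OF sW])
 have "pd i xg = (%x. \<Sum>j\<in>Basis. pd i (%x. (x \<bullet> j) * pd j W x) x)"
  unfolding xg_def[abs_def] by (rule smooth_pd_sum) (intro smooth_intros open_UNIV a)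
 also have "... = (%x. \<Sum>j\<in>Basis. (x \<bullet> j) * pd i (pd j W) x + (i \<bullet> j) * pd j W x)"
  unfolding smooth_pd_mult[OF smooth_on_inner a] by simp
 also have "... = (%x. (\<Sum>j\<in>Basis. (x \<bullet> j) * pd i (pd j W) x) + pd i W x)"
  using i by (simp add: sum.distrib inner_Basis if_distrib[of "%c. c * _"] sum.delta cong: if_cong)
 finally show ?thesis by simp
qed

text \<open>Bochner's identity; shifting the Hessian by 1/n on the diagonal completes the square
  because its trace is -1.\<close>

lemma laplace_P:
 assumes x: "x \<in> w"
 shows "(\<Sum>i\<in>Basis. pd i (pd i Pf) x)
  = 2 * (\<Sum>i\<in>Basis. \<Sum>j\<in>Basis. (pd i (pd j W) x + (if i = j then 1 / real DIM('a) else 0))^2)"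
proof -
 define n where "n = real DIM('a)"
 have n: "n > 0" by (simp add: n_def)
 have a: "smooth_on UNIV (pd i W)" for i by (rule smooth_on_pd[OF sW])
 have "pd i (pd i Pf) x = (\<Sum>j\<in>Basis. 2 * (pd j W x * pd i (pd i (pd j W)) x + pd i (pd j W) x * pd i (pd j W) x)) + 2 / n * pd i (pd i W) x" for i
 proof -
  define c where "c = 2 / n"
  have "pd i Pf = (%x. pd i gsq x + c * pd i W x)" unfolding Pf_def[abs_def] n_def[symmetric] c_def[symmetric]
   by (subst smooth_pd_add) (simp_all add: smooth_pieces sW smooth_pd_mult smooth_on_mult)
  then have "pd i (pd i Pf) = pd i (%x. pd i gsq x + c * pd i W x)" by (rule arg_cong)
  also have "... = (%x. pd i (pd i gsq) x + pd i (%x. c * pd i W x) x)"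
   by (rule smooth_pd_add[OF smooth_on_pd[OF smooth_pieces(1)] smooth_on_mult[OF open_UNIV smooth_on_const a]])
  also have "pd i (%x. c * pd i W x) = (%x. c * pd i (pd i W) x)"
   using smooth_pd_mult[OF smooth_on_const[of UNIV c] a, of i i] by simp
  also have "pd i (pd i gsq) = (%x. \<Sum>j\<in>Basis. pd i (%x. 2 * (pd j W x * pd i (pd j W) x)) x)"
   unfolding pd_gsq by (rule smooth_pd_sum) (intro smooth_intros open_UNIV a smooth_on_pd)
  also have "(%x. \<Sum>j\<in>Basis. pd i (%x. 2 * (pd j W x * pd i (pd j W) x)) x)
   = (%x. \<Sum>j\<in>Basis. 2 * (pd j W x * pd i (pd i (pd j W)) x + pd i (pd j W) x * pd i (pd j W) x))"
  proof (rule ext, rule sum.cong[OF refl])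
   fix x and j :: 'a
   have s: "smooth_on UNIV (%x. pd j W x * pd i (pd j W) x)" by (intro smooth_intros open_UNIV a smooth_on_pd)
   show "pd i (%x. 2 * (pd j W x * pd i (pd j W) x)) x = 2 * (pd j W x * pd i (pd i (pd j W)) x + pd i (pd j W) x * pd i (pd j W) x)"
    unfolding smooth_pd_mult[OF smooth_on_const s] smooth_pd_mult[OF a smooth_on_pd[OF a]] by simp
  qed
  finally show ?thesis by (simp add: c_def)
 qed
 then have "(\<Sum>i\<in>Basis. pd i (pd i Pf) x) = (\<Sum>i\<in>Basis. (\<Sum>j\<in>Basis. 2 * (pd j W x * pd i (pd i (pd j W)) x + pd i (pd j W) x * pd i (pd j W) x)))
  + 2 / n * (\<Sum>i\<in>Basis. pd i (pd i W) x)" by (simp add: sum.distrib sum_distrib_left)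
 also have "... = 2 * (\<Sum>i\<in>Basis. \<Sum>j\<in>Basis. pd j W x * pd i (pd i (pd j W)) x)
  + 2 * (\<Sum>i\<in>Basis. \<Sum>j\<in>Basis. (pd i (pd j W) x)^2) - 2 / n"
  unfolding lap_sum[OF x] by (simp add: sum.distrib sum_distrib_left power2_eq_square)
 also have "(\<Sum>i\<in>Basis. \<Sum>j\<in>Basis. pd j W x * pd i (pd i (pd j W)) x) = (\<Sum>j\<in>Basis. pd j W x * lap_of (pd j W) x)"
  unfolding lap_of_pd sum_distrib_left by (rule sum.swap)
 also have "... = 0" using lap_pd[OF smooth_on_mono[OF sW subset_UNIV] ow lapW x] by simp
 also have "2 * 0 + 2 * (\<Sum>i\<in>Basis. \<Sum>j\<in>Basis. (pd i (pd j W) x)^2) - 2 / n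
  = 2 * (\<Sum>i\<in>Basis. \<Sum>j\<in>Basis. (pd i (pd j W) x + (if i = j then 1 / n else 0))^2)"
 proof -
  have "(pd i (pd j W) x + (if i = j then 1 / n else 0))^2
   = (pd i (pd j W) x)^2 + (if j = i then 2 / n * pd i (pd i W) x + 1 / n^2 else 0)" for i j
   by (simp add: power2_sum power_divide)
  then have "(\<Sum>i\<in>Basis. \<Sum>j\<in>Basis. (pd i (pd j W) x + (if i = j then 1 / n else 0))^2)
   = (\<Sum>i\<in>Basis. \<Sum>j\<in>Basis. (pd i (pd j W) x)^2) + (\<Sum>i\<in>Basis. 2 / n * pd i (pd i W) x + 1 / n^2)"
   by (simp add: sum.distrib sum.delta)
  also have "(\<Sum>i\<in>(Basis::'a set). 2 / n * pd i (pd i W) x + 1 / n^2) = 2 / n * (\<Sum>i\<in>Basis. pd i (pd i W) x) + n * (1 / n^2)"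
   by (simp add: sum.distrib sum_distrib_left n_def)
  also have "... = - 1 / n" unfolding lap_sum[OF x] using n by (simp add: power2_eq_square)
  finally show ?thesis by simp
 qed
 finally show ?thesis unfolding n_def .
qed

text \<open>The vector field combines the \<open>P\<close>-function identity with the Pohozaev field so that the
 boundary terms vanish and the divergence collapses to \<open>W\<close> times the Laplacian of \<open>P\<close>.\<close>

definition "Xf i x = W x * pd i Pf x - (Pf x - be^2) * pd i W x
 - 2 / real DIM('a) * (xg x * pd i W x - (1 / 2) * ((gsq x + be^2) * (x \<bullet> i)) + W x * (x \<bullet> i)
   + (real DIM('a) - 1) * (W x * pd i W x))"

lemma smooth_Xf: "smooth_on UNIV (Xf i)"
 unfolding Xf_def[abs_def] by (intro smooth_intros open_UNIV smooth_pieces smooth_on_pd sW)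

lemma divergence_Xf:
 assumes x: "x \<in> w"
 shows "(\<Sum>i\<in>Basis. pd i (Xf i) x) = W x * (\<Sum>i\<in>Basis. pd i (pd i Pf) x)"
proof -
 define n where "n = real DIM('a)"
 have n: "n > 0" by (simp add: n_def)
 \<comment> \<open>The second derivatives in the Pohozaev field and in half the gradient of
   \<open>gsq\<close> both produce \<open>S\<close>, by symmetry of the Hessian, and so
   cancel.\<close>
 define S where "S = (\<Sum>i\<in>Basis. \<Sum>j\<in>Basis. (x \<bullet> j) * pd i (pd j W) x * pd i W x)"
 have "(\<Sum>i\<in>Basis. pd i (Xf i) x) = W x * (\<Sum>i\<in>Basis. pd i (pd i Pf) x) - (Pf x - be^2) * (\<Sum>i\<in>Basis. pd i (pd i W) x)
  - 2 / n * (xg x * (\<Sum>i\<in>Basis. pd i (pd i W) x) + (\<Sum>i\<in>Basis. pd i xg x * pd i W x)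
   - 1 / 2 * (n * (gsq x + be^2) + (\<Sum>i\<in>Basis. pd i gsq x * (x \<bullet> i)))
   + (n * W x + (\<Sum>i\<in>Basis. pd i W x * (x \<bullet> i)))
   + (n - 1) * (W x * (\<Sum>i\<in>Basis. pd i (pd i W) x) + (\<Sum>i\<in>Basis. pd i W x * pd i W x)))"
 proof -
  define c h m where "c = 2 / n" "h = (1 / 2 :: real)" "m = n - 1"
  have "pd i (Xf i) x = W x * pd i (pd i Pf) x - (Pf x - be^2) * pd i (pd i W) x
  - c * (xg x * pd i (pd i W) x + pd i xg x * pd i W x - h * ((gsq x + be^2) + pd i gsq x * (x \<bullet> i))
   + (W x + pd i W x * (x \<bullet> i)) + m * (W x * pd i (pd i W) x + pd i W x * pd i W x))" if i: "i \<in> Basis" for i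
   unfolding Xf_def[abs_def] n_def[symmetric] c_h_m_def[symmetric]
   using i by (simp add: smooth_pd_add smooth_pd_diff smooth_pd_mult smooth_pieces sW smooth_on_pd smooth_on_add smooth_on_mult smooth_on_diff)
  then show ?thesis unfolding n_def[symmetric] c_h_m_def[symmetric]
   by (simp add: sum.distrib sum_subtractf sum_distrib_left[symmetric] n_def[symmetric])
 qed
 also have "(\<Sum>i\<in>Basis. pd i xg x * pd i W x) = S + gsq x"
  by (simp add: pd_xg distrib_right sum.distrib S_def gsq_def sum_distrib_right)
 also have "(\<Sum>i\<in>Basis. pd i gsq x * (x \<bullet> i)) = 2 * S"
 proof -
  have "(\<Sum>i\<in>Basis. pd i gsq x * (x \<bullet> i)) = 2 * (\<Sum>i\<in>Basis. \<Sum>j\<in>Basis. (x \<bullet> i) * pd i (pd j W) x * pd j W x)"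
   unfolding pd_gsq by (simp add: sum_distrib_left sum_distrib_right mult_ac)
  also have "(\<Sum>i\<in>Basis. \<Sum>j\<in>Basis. (x \<bullet> i) * pd i (pd j W) x * pd j W x) = (\<Sum>j\<in>Basis. \<Sum>i\<in>Basis. (x \<bullet> i) * pd i (pd j W) x * pd j W x)"
   by (rule sum.swap)
  also have "... = S" unfolding S_def
   by (intro sum.cong refl) (simp add: smooth_second_difference[OF sW open_UNIV UNIV_I, symmetric])
  finally show ?thesis .
 qed
 also have "(\<Sum>i\<in>Basis. pd i W x * (x \<bullet> i)) = xg x" by (simp add: xg_def mult.commute)
 also have "(\<Sum>i\<in>Basis. pd i W x * pd i W x) = gsq x" by (simp add: gsq_def)
 finally have "(\<Sum>i\<in>Basis. pd i (Xf i) x) = W x * (\<Sum>i\<in>Basis. pd i (pd i Pf) x) + (Pf x - be^2)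
  - 2 / n * (n * gsq x - n * (gsq x + be^2) / 2 + W x)"
 proof -
  have "xg x * - 1 + (S + gsq x) - 1 / 2 * (n * (gsq x + be^2) + 2 * S) + (n * W x + xg x) + (n - 1) * (W x * - 1 + gsq x)
   = n * gsq x - n * (gsq x + be^2) / 2 + W x" by (simp add: field_simps)
  moreover assume "(\<Sum>i\<in>Basis. pd i (Xf i) x) = W x * (\<Sum>i\<in>Basis. pd i (pd i Pf) x) - (Pf x - be^2) * (\<Sum>i\<in>Basis. pd i (pd i W) x)
   - 2 / n * (xg x * (\<Sum>i\<in>Basis. pd i (pd i W) x) + (S + gsq x) - 1 / 2 * (n * (gsq x + be^2) + 2 * S)
   + (n * W x + xg x) + (n - 1) * (W x * (\<Sum>i\<in>Basis. pd i (pd i W) x) + gsq x))"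
  ultimately show ?thesis unfolding lap_sum[OF x] by simp
 qed
 also have "2 / n * (n * gsq x - n * (gsq x + be^2) / 2 + W x) = gsq x - be^2 + 2 / n * W x"
  using n by (simp add: field_simps)
 moreover have "Pf x = gsq x + 2 / n * W x" by (simp add: Pf_def n_def)
 ultimately show ?thesis by simp
qed

context
 assumes be: "be > 0" and gbe: "!!p. p \<in> frontier w ==> norm (grad_of W p) = be"
begin

text \<open>A ball inside \<open>w\<close> that touches the boundary at \<open>p\<close> makes every
  direction of the open half-space towards its centre an inward one, along which \<open>W\<close>
  becomes positive. A vector with nonnegative product against a whole half-space is a nonnegative
  multiple of the normal of that half-space.\<close>

lemma inner_normal:
 assumes p: "p \<in> frontier w" and x: "ball x (norm (x - p)) \<subseteq> w" "x ~= p"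
 shows "grad_of W p \<bullet> (x - p) = be * norm (x - p)"
proof -
 obtain K where K: "K >= 0" "!!x k. \<bar>W (x + k) - W x - grad_of W x \<bullet> k\<bar> <= K * (norm k)^2"
  using test_Taylor_grad[OF tW] by blast
 define v g where "v = x - p" "g = grad_of W p"
 have v: "norm v > 0" "v \<bullet> v = (norm v)^2" using x(2) by (auto simp: v_g_def power2_norm_eq_inner)
 have half: "g \<bullet> e >= 0" if e: "e \<bullet> v > 0" for e
 proof -
  have l: "((%t. t * (norm e)^2) \<longlongrightarrow> 0) (at_right 0)" by (auto intro!: tendsto_eq_intros)
  have "\<forall>\<^sub>F t in at_right 0. 0 <= g \<bullet> e + K * (t * (norm e)^2)"
   using order_tendstoD(2)[OF l e] eventually_at_right_less[of 0]
  proof eventually_elim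
   fix t :: real assume t: "t * (norm e)^2 < e \<bullet> v" "0 < t"
   have "(norm (t *\<^sub>R e - v))^2 = t * (t * (norm e)^2) - 2 * (t * (e \<bullet> v)) + (norm v)^2"
    unfolding power2_norm_eq_inner by (simp add: inner_diff_left inner_diff_right inner_commute)
   moreover have "t * (t * (norm e)^2) <= t * (e \<bullet> v)" "t * (e \<bullet> v) > 0" using t e by simp_all
   ultimately have "(norm (t *\<^sub>R e - v))^2 < (norm v)^2" by linarith
   then have "norm (t *\<^sub>R e - v) < norm v" by (rule power_less_imp_less_base) simp
   moreover have "norm (x - (p + t *\<^sub>R e)) = norm (t *\<^sub>R e - v)"
    using norm_minus_commute[of "t *\<^sub>R e" v] by (simp add: v_g_def algebra_simps)
   ultimately have "p + t *\<^sub>R e \<in> ball x (norm (x - p))" unfolding mem_ball dist_norm by (simp only: v_g_def(1))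
   then have "W (p + t *\<^sub>R e) > 0" using x(1) minimum_principle by blast
   then have "0 < g \<bullet> (t *\<^sub>R e) + K * (norm (t *\<^sub>R e))^2" using K(2)[of p "t *\<^sub>R e"] W0[OF p] by (simp add: v_g_def)
   also have "... = t * (g \<bullet> e + K * (t * (norm e)^2))" by (simp add: power_mult_distrib power2_eq_square algebra_simps)
   finally show "0 <= g \<bullet> e + K * (t * (norm e)^2)" using t(2) by (simp add: zero_less_mult_iff)
  qed
  from tendsto_lowerbound[OF tendsto_add[OF tendsto_const tendsto_mult_right_zero[OF l]] this] show ?thesis by simp
 qed
 define h where "h = g - ((g \<bullet> v) / (v \<bullet> v)) *\<^sub>R v"
 have hv: "h \<bullet> v = 0" using v by (simp add: h_def inner_diff_left)
 have gh: "g \<bullet> h = h \<bullet> h"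
 proof -
  have "g = h + ((g \<bullet> v) / (v \<bullet> v)) *\<^sub>R v" by (simp add: h_def)
  then have "g \<bullet> h = (h + ((g \<bullet> v) / (v \<bullet> v)) *\<^sub>R v) \<bullet> h" by (rule arg_cong)
  then show ?thesis using hv by (simp add: inner_add_left inner_commute[of v h])
 qed
 have "h \<bullet> h <= 0"
 proof (rule field_le_epsilon)
  fix ep :: real assume e: "ep > 0"
  \<comment> \<open>The direction \<open>- h\<close> lies on the edge of the half-space, so it is
    tilted by a small multiple of \<open>v\<close>.\<close>
  define s where "s = ep / (\<bar>g \<bullet> v\<bar> + 1)"
  have s: "s > 0" unfolding s_def using e by (intro divide_pos_pos) auto
  have "(s *\<^sub>R v - h) \<bullet> v > 0" using s v hv by (simp add: inner_diff_left)
  then have "g \<bullet> (s *\<^sub>R v - h) >= 0" by (rule half)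
  then have "h \<bullet> h <= s * (g \<bullet> v)" using gh by (simp add: inner_diff_right)
  also have "... <= s * (\<bar>g \<bullet> v\<bar> + 1)" using s by (intro mult_left_mono) auto
  also have "... = ep" by (simp add: s_def add_nonneg_eq_0_iff)
  finally show "h \<bullet> h <= 0 + ep" by simp
 qed
 then have "h = 0" using inner_ge_zero[of h] by (simp add: antisym)
 then have gv: "g = ((g \<bullet> v) / (v \<bullet> v)) *\<^sub>R v" by (simp add: h_def)
 have g0: "g \<bullet> v >= 0" using half[of v] v by simp
 have "norm g = (g \<bullet> v) / (v \<bullet> v) * norm v" by (subst gv) (use g0 v in simp)
 then have "be = (g \<bullet> v) / norm v" using gbe[OF p] v by (simp add: v_g_def power2_eq_square)
 then show ?thesis using v by (simp add: v_g_def)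
qed

text \<open>Near the boundary both sides are compared with the distance \<open>d\<close> to a
  nearest boundary point: \<open>gsq\<close> is Lipschitz and equals be^2 there, while
  \<open>inner_normal\<close> makes \<open>W\<close> at least be / 2 times \<open>d\<close>.
  Elsewhere \<open>W\<close> is bounded below by compactness.\<close>

lemma gradient_gap: "\<exists>C. \<forall>x\<in>w. \<bar>gsq x - be^2\<bar> <= C * W x"
proof -
 obtain K where K: "K >= 0" "!!x k. \<bar>W (x + k) - W x - grad_of W x \<bullet> k\<bar> <= K * (norm k)^2"
  using test_Taylor_grad[OF tW] by blast
 have tg: "test_fun UNIV gsq" unfolding gsq_def[abs_def]
  by (rule test_fun_sum) (rule test_fun_mult[OF test_fun_pd[OF tW] smooth_on_pd[OF sW]])
 obtain L where L: "L >= 0" "!!x y. \<bar>gsq x - gsq y\<bar> <= L * norm (x - y)" using test_Lipschitz[OF tg] by blast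
 obtain B where B: "!!x. \<bar>gsq x\<bar> <= B" using test_bounded[OF tg] by blast
 have cc: "compact (closure w)" using bw by (simp add: compact_closure)
 have cf: "compact (frontier w)" using bw by (rule compact_frontier_bounded)
 have nf: "frontier w ~= {}" using frontier_not_empty[OF new] bw not_bounded_UNIV by metis
 define de where "de = be / (2 * (K + 1))"
 have de: "de > 0" "K * de <= be / 2" using be K(1) by (auto simp: de_def field_simps)
 define S where "S = closure w \<inter> (\<Inter>q\<in>frontier w. {x. dist x q >= de})"
 have cS: "compact S" unfolding S_def by (intro compact_Int_closed cc closed_INT ballI closed_Collect_le continuous_intros)
 have Sw: "S \<subseteq> w"
 proof
  fix x assume x: "x \<in> S"
  then have "x \<notin> frontier w" using de(1) by (auto simp: S_def)
  then show "x \<in> w" using x by (auto simp: S_def frontier_def interior_open[OF ow])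
 qed
 obtain m where m: "m > 0" "!!x. x \<in> S ==> m <= W x"
 proof (cases "S = {}")
  case False
  obtain x0 where "x0 \<in> S" "!!y. y \<in> S ==> W x0 <= W y"
   using continuous_attains_inf[OF cS False continuous_on_subset[OF smooth_on_continuous[OF sW]]] by blast
  then show ?thesis using that[of "W x0"] Sw minimum_principle by blast
 qed (use that[of 1] in auto)
 have B0: "B >= 0" using B[of 0] by linarith
 define C where "C = 2 * L / be + (B + be^2) / m"
 show ?thesis
 proof (intro exI[of _ C] ballI)
  fix x assume x: "x \<in> w"
  have Wx: "W x > 0" by (rule minimum_principle[OF x])
  have C1: "2 * L / be * W x >= 0" "(B + be^2) / m * W x >= 0" using L(1) be m B0 Wx by auto
  show "\<bar>gsq x - be^2\<bar> <= C * W x"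
  proof (cases "x \<in> S")
   case True
   have "\<bar>gsq x - be^2\<bar> <= B + be^2" using B[of x] zero_le_power2[of be] by linarith
   also have "... = (B + be^2) / m * m" using m by simp
   also have "... <= (B + be^2) / m * W x" using m(2)[OF True] m(1) B0 by (intro mult_left_mono) auto
   finally show ?thesis using C1 by (simp add: C_def distrib_right)
  next
   case False
   obtain p where p: "p \<in> frontier w" "!!q. q \<in> frontier w ==> dist x p <= dist x q"
    using distance_attains_inf[OF compact_imp_closed[OF cf] nf, of x] by blast
   define d where "d = norm (x - p)"
   have d: "d > 0" using p(1) x by (auto simp: d_def frontier_def interior_open[OF ow])
   have dde: "d < de"
   proof -
    obtain q where "q \<in> frontier w" "dist x q < de" using False x closure_subset by (fastforce simp: S_def)
    then show ?thesis using p(2)[of q] by (simp add: d_def dist_norm)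
   qed
   have "ball x d \<inter> frontier w = {}" using p(2) by (fastforce simp: d_def dist_norm)
   then have bw: "ball x d \<subseteq> w"
    using connected_Int_frontier[of "ball x d" w] centre_in_ball[of x d] x d connected_ball[of x d] by blast
   have "grad_of W p \<bullet> (x - p) = be * d" unfolding d_def by (rule inner_normal[OF p(1)]) (use bw d in \<open>auto simp: d_def\<close>)
   then have "W x >= be * d - K * d^2" using K(2)[of p "x - p"] W0[OF p(1)] by (simp add: d_def)
   moreover have "K * d^2 <= be / 2 * d"
   proof -
    have "K * d <= K * de" using dde K(1) by (intro mult_left_mono) auto
    then have "K * d <= be / 2" using de(2) by linarith
    then show ?thesis using d mult_right_mono[of "K * d" "be / 2" d] by (simp add: power2_eq_square mult.assoc)
   qed
   ultimately have Wd: "be / 2 * d <= W x" by (simp add: field_simps)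
   have "\<bar>gsq x - be^2\<bar> = \<bar>gsq x - gsq p\<bar>" using gbe[OF p(1)] by (simp add: gsq_grad)
   also have "... <= L * d" unfolding d_def by (rule L(2))
   also have "... = 2 * L / be * (be / 2 * d)" using be by simp
   also have "... <= 2 * L / be * W x" using Wd L(1) be by (intro mult_left_mono) auto
   finally show ?thesis using C1 by (simp add: C_def distrib_right)
  qed
 qed
qed

text \<open>The product of \<open>Xf\<close> with the gradient of \<open>W\<close> is
  \<open>W * Y - (gsq - be^2) * Z\<close>, so \<open>gradient_gap\<close> supplies the bound that
  \<open>divergence_cutoff\<close> asks for. The nonnegative function \<open>W\<close> times the
  Laplacian of \<open>Pf\<close> then has integral 0, which kills the sum of squares.\<close>

lemma hessian_W:
 assumes x: "x \<in> w" and i: "i \<in> Basis" and j: "j \<in> Basis"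
 shows "pd i (pd j W) x = (if i = j then - 1 / real DIM('a) else 0)"
proof -
 define n where "n = real DIM('a)"
 define c where "c = 2 / n"
 note bounded_by = continuous_bounded[OF smooth_on_continuous bw]
 define Y Z where "Y x = (\<Sum>i\<in>Basis. pd i Pf x * pd i W x) - c * gsq x - c * xg x - c * (n - 1) * gsq x"
  and "Z x = gsq x + c / 2 * xg x" for x
 have sY: "smooth_on UNIV Y" "smooth_on UNIV Z" unfolding Y_def[abs_def] Z_def[abs_def]
  by (intro smooth_intros open_UNIV smooth_pieces smooth_on_pd sW)+
 obtain MY where MY: "MY >= 0" "!!x. x \<in> w ==> \<bar>Y x\<bar> <= MY" using bounded_by[OF sY(1)] by blast
 obtain MZ where MZ: "MZ >= 0" "!!x. x \<in> w ==> \<bar>Z x\<bar> <= MZ" using bounded_by[OF sY(2)] by blast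
 obtain C where C: "!!x. x \<in> w ==> \<bar>gsq x - be^2\<bar> <= C * W x" using gradient_gap by blast
 have bd: "\<bar>\<Sum>i\<in>Basis. Xf i x * pd i W x\<bar> <= (MY + C * MZ) * W x" if x: "x \<in> w" for x
 proof -
  have "Xf i x * pd i W x = W x * (pd i Pf x * pd i W x) - (Pf x - be^2) * (pd i W x * pd i W x)
   - c * (xg x * (pd i W x * pd i W x) - (1 / 2) * ((gsq x + be^2) * ((x \<bullet> i) * pd i W x)) + W x * ((x \<bullet> i) * pd i W x)
   + (n - 1) * (W x * (pd i W x * pd i W x)))" for i
   unfolding Xf_def n_def[symmetric] c_def[symmetric] by (simp add: algebra_simps)
  then have "(\<Sum>i\<in>Basis. Xf i x * pd i W x) = W x * (\<Sum>i\<in>Basis. pd i Pf x * pd i W x) - (Pf x - be^2) * gsq x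
   - c * (xg x * gsq x - (1 / 2) * ((gsq x + be^2) * xg x) + W x * xg x + (n - 1) * (W x * gsq x))"
   unfolding gsq_def xg_def by (simp only: sum.distrib sum_subtractf sum_distrib_left[symmetric])
  also have "... = W x * Y x - (gsq x - be^2) * Z x"
  proof -
   have P: "Pf x = gsq x + c * W x" by (simp add: Pf_def c_def n_def)
   show ?thesis unfolding Y_def Z_def P by (simp add: field_simps)
  qed
  also have "\<bar>...\<bar> <= \<bar>W x\<bar> * \<bar>Y x\<bar> + \<bar>gsq x - be^2\<bar> * \<bar>Z x\<bar>"
   using abs_triangle_ineq4[of "W x * Y x" "(gsq x - be^2) * Z x"] by (simp add: abs_mult)
  also have "... <= W x * MY + C * W x * MZ"
   using MY(2)[OF x] MZ(2)[OF x] C[OF x] minimum_principle[OF x] by (intro add_mono mult_mono) auto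
  finally show ?thesis by (simp add: algebra_simps)
 qed
 have div: "integrable lborel (%x. indicator w x * (\<Sum>i\<in>Basis. pd i (Xf i) x))"
  "(LBINT x. indicator w x * (\<Sum>i\<in>Basis. pd i (Xf i) x)) = 0" by (rule divergence_cutoff[OF smooth_Xf bd]; assumption)+
 define lapP where "lapP x = (\<Sum>i\<in>Basis. pd i (pd i Pf) x)" for x
 have eq: "indicator w x * (\<Sum>i\<in>Basis. pd i (Xf i) x) = indicator w x * (W x * lapP x)" for x
  using divergence_Xf[of x] by (simp add: indicator_def lapP_def)
 have lapP0: "lapP x >= 0" if "x \<in> w" for x
  unfolding lapP_def laplace_P[OF that] by (intro mult_nonneg_nonneg sum_nonneg) auto
 have "AE x in lborel. indicator w x * (W x * lapP x) = 0" using div unfolding eq by (subst (asm) integral_nonneg_eq_0_iff_AE)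
   (use lapP0 minimum_principle in \<open>auto simp: indicator_def less_imp_le\<close>)
 then have "AE x in lborel. x \<in> w --> W x * lapP x = 0" by eventually_elim (auto simp: indicator_def)
 moreover have "continuous_on w (%x. W x * lapP x)"
 proof -
  have "smooth_on UNIV (%x. W x * lapP x)" unfolding lapP_def
   by (intro smooth_intros open_UNIV smooth_on_pd smooth_pieces sW)
  then show ?thesis using smooth_on_continuous continuous_on_subset by blast
 qed
 ultimately have "W x * lapP x = 0" using AE_eq_continuous[OF ow _ continuous_on_const[of w 0]] x by blast
 then have "lapP x = 0" using minimum_principle[OF x] by simp
 then have z: "(\<Sum>i\<in>Basis. \<Sum>j\<in>Basis. (pd i (pd j W) x + (if i = j then 1 / real DIM('a) else 0))^2) = 0"
  unfolding lapP_def laplace_P[OF x] by simp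
 have "(\<Sum>j\<in>Basis. (pd i (pd j W) x + (if i = j then 1 / real DIM('a) else 0))^2) = 0"
  using z i by (subst (asm) sum_nonneg_eq_0_iff) (auto intro: sum_nonneg)
 then have "(pd i (pd j W) x + (if i = j then 1 / real DIM('a) else 0))^2 = 0"
  using j by (subst (asm) sum_nonneg_eq_0_iff) auto
 then show ?thesis by (auto split: if_splits)
qed

theorem serrin_ball:
 assumes N: "DIM('a) >= 2"
 shows "\<exists>c r A. 0 < r \<and> w = ball c r \<and> (\<forall>x\<in>w. W x = A - (norm (x - c))^2 / (2 * real DIM('a)))"
proof -
 define n where "n = real DIM('a)"
 have n: "n > 0" by (simp add: n_def)
 have a: "smooth_on UNIV (pd i W)" for i by (rule smooth_on_pd[OF sW])
 have "\<exists>c. \<forall>x\<in>w. pd j W x + (1 / n) * (x \<bullet> j) = c" if j: "j \<in> Basis" for j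
 proof (rule pd_zero_imp_const[OF ow cw])
  show "smooth_on w (%x. pd j W x + (1 / n) * (x \<bullet> j))"
   by (intro smooth_intros ow smooth_on_mono[OF a subset_UNIV])
  fix x i :: 'a assume x: "x \<in> w" and i: "i \<in> Basis"
  have "pd i (%x. pd j W x + (1 / n) * (x \<bullet> j)) x = pd i (pd j W) x + (1 / n) * (i \<bullet> j)"
   unfolding smooth_pd_add[OF a smooth_on_mult[OF open_UNIV smooth_on_const smooth_on_inner]]
    smooth_pd_mult[OF smooth_on_const smooth_on_inner] by simp
  then show "pd i (%x. pd j W x + (1 / n) * (x \<bullet> j)) x = 0"
   using hessian_W[OF x i j] i j by (simp add: inner_Basis n_def)
 qed
 then obtain cc where cc: "!!j x. j \<in> Basis ==> x \<in> w ==> pd j W x + (1 / n) * (x \<bullet> j) = cc j" by metis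
 \<comment> \<open>The zero of the affine field with components
   \<open>cc j - (x \<bullet> j) / n\<close>, which the gradient of \<open>W\<close> has turned out
   to be.\<close>
 define c where "c = (\<Sum>j\<in>Basis. (n * cc j) *\<^sub>R j)"
 have cj: "c \<bullet> j = n * cc j" if "j \<in> Basis" for j
  unfolding c_def using that by (simp add: inner_sum_left inner_Basis if_distrib sum.delta cong: if_cong)
 have "\<exists>A. \<forall>x\<in>w. W x + (1 / (2 * n)) * (norm (x - c))^2 = A"
 proof (rule pd_zero_imp_const[OF ow cw])
  show "smooth_on w (%x. W x + (1 / (2 * n)) * (norm (x - c))^2)"
   by (intro smooth_intros smooth_on_norm_sq ow smooth_on_mono[OF sW subset_UNIV])
  fix x i :: 'a assume x: "x \<in> w" and i: "i \<in> Basis"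
  have pn: "pd i (%x. (norm (x - c))^2) x = 2 * ((x - c) \<bullet> i)" unfolding power2_norm_eq_inner
   by (rule pd_eqI) (auto intro!: derivative_eq_intros simp: inner_commute)
  have "pd i (%x. W x + (1 / (2 * n)) * (norm (x - c))^2) x = pd i W x + 1 / (2 * n) * (2 * ((x - c) \<bullet> i))"
   unfolding smooth_pd_add[OF sW smooth_on_mult[OF open_UNIV smooth_on_const smooth_on_norm_sq]]
    smooth_pd_mult[OF smooth_on_const smooth_on_norm_sq] pn by simp
  also have "... = pd i W x + (1 / n) * (x \<bullet> i) - cc i" using n cj[OF i] by (simp add: inner_diff_left field_simps)
  finally show "pd i (%x. W x + (1 / (2 * n)) * (norm (x - c))^2) x = 0" using cc[OF i x] by simp
 qed
 then obtain A where A: "!!x. x \<in> w ==> W x = A - (norm (x - c))^2 / (2 * n)"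
  by (auto simp: algebra_simps)
 have Af: "(norm (p - c))^2 = 2 * n * A" if p: "p \<in> frontier w" for p
 proof -
  have "W p = A - (norm (p - c))^2 / (2 * n)"
  proof (rule continuous_constant_on_closure[where S = w and f = "%x. W x - (A - (norm (x - c))^2 / (2 * n))" and a = 0 and x = p, simplified])
   show "continuous_on (closure w) (%x. W x - (A - (norm (x - c))^2 / (2 * n)))"
    using n by (intro continuous_intros continuous_on_subset[OF smooth_on_continuous[OF sW]]) auto
  qed (use A p in \<open>auto simp: frontier_def\<close>)
  then show ?thesis using W0[OF p] n by (simp add: field_simps)
 qed
 obtain x0 where x0: "x0 \<in> w" using new by blast
 have "(norm (x0 - c))^2 < 2 * n * A" using minimum_principle[OF x0] A[OF x0] n by (simp add: field_simps)
 moreover from this have "0 < sqrt (2 * n * A)" using zero_le_power2[of "norm (x0 - c)"] by (simp only: real_sqrt_gt_0_iff)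
 ultimately show ?thesis using ball_of_spherical_frontier[OF N ow bw x0 _ Af] A n_def by blast
qed

end

end

section \<open>Boundary values at regular points\<close>

text \<open>Shifting by \<open>n\<close> copies of \<open>z\<close> carries \<open>g\<close> off its
  own support, so the squared difference integrates to twice the squared norm of \<open>g\<close>;
  telescoping into \<open>n\<close> single steps costs n^2 by Cauchy-Schwarz. Choosing
  \<open>n\<close> with n |z| between 2R and 4R makes the constant independent of
  \<open>z\<close>.\<close>

lemma discrete_Poincare:
 fixes g :: "'a::euclidean_space => real"
 assumes g: "bbs g" "!!x. norm x > R ==> g x = 0" and R: "R > 0" and z: "z ~= 0" "norm z <= R"
 shows "(norm z)^2 * (LBINT x. (g x)^2) <= 8 * R^2 * (LBINT x. (g x - g (z + x))^2)" (is "_ <= _ * ?S")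
proof -
 have nz: "norm z > 0" using z by simp
 define n where "n = nat \<lceil>2 * R / norm z\<rceil> + 1"
 have "2 * R / norm z >= 0" using R nz by simp
 then have n: "2 * R / norm z < real n" "real n <= 2 * R / norm z + 2" unfolding n_def by linarith+
 have big: "2 * R < real n * norm z" using n(1) nz by (simp add: pos_divide_less_eq)
 have nle: "(real n * norm z)^2 <= (4 * R)^2"
  using mult_right_mono[OF n(2), of "norm z"] z nz by (intro power_mono) (auto simp: distrib_right)
 have gi: "integrable lborel (%x. (g (c + x) - g (d + x))^2)" for c d by (intro bbs_integrable bbs_intros g)
 have i2: "integrable lborel (%x. (g x)^2)" by (intro bbs_integrable bbs_intros g)
 have z0: "g x = 0 \<or> g (real n *\<^sub>R z + x) = 0" for x
 proof (rule ccontr)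
  assume "\<not> ?thesis"
  then have "norm x <= R" "norm (real n *\<^sub>R z + x) <= R" using g(2) not_less by blast+
  then show False using big norm_triangle_ineq4[of "real n *\<^sub>R z + x" x] by simp
 qed
 have "2 * (LBINT x. (g x)^2) = (LBINT x. (g x)^2 + (g (real n *\<^sub>R z + x))^2)"
  using i2 integrable_shift[OF i2, of "real n *\<^sub>R z"] lborel_integral_shift[of "%x. (g x)^2" "real n *\<^sub>R z"] by simp
 also have "... = (LBINT x. (g (0 + x) - g (real n *\<^sub>R z + x))^2)"
 proof (rule integral_cong[OF refl])
  show "(g x)^2 + (g (real n *\<^sub>R z + x))^2 = (g (0 + x) - g (real n *\<^sub>R z + x))^2" for x using z0[of x] by auto
 qed
 also have "... <= (LBINT x. (\<Sum>k<n. (g (real k *\<^sub>R z + x) - g (real (Suc k) *\<^sub>R z + x))^2) * real n)"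
 proof (rule integral_mono[OF gi])
  show "(g (0 + x) - g (real n *\<^sub>R z + x))^2 <= (\<Sum>k<n. (g (real k *\<^sub>R z + x) - g (real (Suc k) *\<^sub>R z + x))^2) * real n" for x
   using sum_squared_le_sum_of_squares[of "%k. g (real k *\<^sub>R z + x) - g (real (Suc k) *\<^sub>R z + x)" "{..<n}"]
    sum_lessThan_telescope'[of "%k. g (real k *\<^sub>R z + x)" n] by simp
 qed (intro integrable_mult_left integrable_sum gi)
 also have "... = (\<Sum>k<n. LBINT x. (g (real k *\<^sub>R z + x) - g (real (Suc k) *\<^sub>R z + x))^2) * real n"
  using gi by (simp add: integral_sum)
 also have "... = real n * real n * ?S"
  using lborel_integral_shift[of "%x. (g x - g (z + x))^2" "real _ *\<^sub>R z"] by (simp add: scaleR_left_distrib add.assoc)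
 finally have "(norm z)^2 * (2 * (LBINT x. (g x)^2)) <= (norm z)^2 * (real n * real n * ?S)" by (rule mult_left_mono) simp
 also have "... = (real n * norm z)^2 * ?S" by (simp add: power_mult_distrib power2_eq_square)
 also have "... <= (4 * R)^2 * ?S" by (rule mult_right_mono[OF nle]) simp
 finally show ?thesis by (simp add: power_mult_distrib)
qed

text \<open>A Caccioppoli inequality for functions that only satisfy the sub-mean-value property,
 with difference quotients in place of gradients.\<close>

lemma subharmonic_energy:
 fixes w ph :: "'a::euclidean_space => real"
 assumes D: "open D" "D \<subseteq> cball 0 R" "R > 0"
  and w: "w \<in> borel_measurable borel" "!!x. 0 <= w x" "!!x. w x <= M" "!!x. x \<notin> D ==> w x = 0"
  and t: "test_fun UNIV ph" and s0: "s0 > 0"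
  and sub: "!!x s. w x * (1 - ph x) ~= 0 ==> 0 < s ==> s <= s0 ==>
   (LBINT z. indicator (cball (0::'a) s) z) * w x <= (LBINT z. indicator (cball 0 s) z * w (z + x))"
 shows "(LBINT x. (w x - w x * ph x)^2) <= 16 * R^2 * M^2 * (LBINT x. indicator D x * (norm (grad_of ph x))^2)"
proof -
 define g P where "g x = w x - w x * ph x" and "P x = g x - g x * ph x" for x
 define E vol where "E = (LBINT x. indicator D x * (norm (grad_of ph x))^2)" and "vol = (LBINT x. indicator D x :: real)"
 define S where "S z = (LBINT x. (g x - g (z + x))^2)" for z
 define a where "a z = (LBINT x. P x * w (z + x))" for z
 define A where "A = (LBINT x. w x * P x)"
 obtain K where K: "K >= 0" "!!x k. \<bar>ph (x + k) - ph x - grad_of ph x \<bullet> k\<bar> <= K * (norm k)^2"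
  using test_Taylor_grad[OF t] by blast
 have M0: "M >= 0" using w(2)[of 0] w(3)[of 0] by linarith
 have bD: "bounded D" using D(2) bounded_subset[OF bounded_cball] by blast
 have wM: "\<bar>w x\<bar> <= M" for x using w(2,3)[of x] by simp
 have bw: "bbs w" by (rule bbsI[OF w(1) wM bD w(4)])
 have bg: "bbs g" unfolding g_def by (intro bbs_intros bw bbs_test[OF t])
 have bP: "bbs P" unfolding P_def by (intro bbs_intros bg bbs_test[OF t])
 have bI: "bbs (indicator D)" by (rule bbs_indicator) (use D(1) bD in auto)
 have bE: "bbs (%x. indicator D x * (norm (grad_of ph x))^2)" unfolding grad_of_pd
  by (intro bbs_mult_continuous[OF bI] continuous_intros smooth_on_continuous smooth_on_pd test_smooth[OF t])
 have Pw: "P x = w x * (1 - ph x)^2" for x by (simp add: P_def g_def power2_eq_square algebra_simps)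
 have P0: "P x >= 0" for x using w(2)[of x] by (simp add: Pw)
 have Sle: "S z <= M^2 * (2 * (norm z)^2 * E + 2 * K^2 * (norm z) ^ 4 * vol) + (2 * A - a z - a (- z))" for z
 proof -
  define F where "F x = w x * w (z + x) * (ph x - ph (z + x))^2" for x
  define F' where "F' x = M^2 * (2 * (norm z)^2 * (indicator D x * (norm (grad_of ph x))^2) + 2 * K^2 * (norm z) ^ 4 * indicator D x)" for x
  have Fb: "F x <= F' x" for x
  proof (cases "x \<in> D")
   case True
   have "\<bar>ph x - ph (z + x)\<bar> <= norm z * norm (grad_of ph x) + K * (norm z)^2"
    using K(2)[of x z] Cauchy_Schwarz_ineq2[of "grad_of ph x" z] by (simp add: add.commute mult.commute)
   then have "(ph x - ph (z + x))^2 <= (norm z * norm (grad_of ph x) + K * (norm z)^2)^2"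
    using power_mono[OF _ abs_ge_zero, of "ph x - ph (z + x)" _ 2] by simp
   also have "... <= 2 * (norm z * norm (grad_of ph x))^2 + 2 * (K * (norm z)^2)^2"
    using sum_squares_bound[of "norm z * norm (grad_of ph x)" "K * (norm z)^2"] by (simp add: power2_sum)
   finally have le: "(ph x - ph (z + x))^2 <= 2 * (norm z)^2 * (norm (grad_of ph x))^2 + 2 * K^2 * (norm z) ^ 4"
    by (simp add: power_mult_distrib mult.assoc flip: power_mult)
   have "w x * w (z + x) <= M * M" using w(2,3) M0 by (intro mult_mono) auto
   then have "F x <= M * M * (2 * (norm z)^2 * (norm (grad_of ph x))^2 + 2 * K^2 * (norm z) ^ 4)"
    unfolding F_def by (rule mult_mono[OF _ le]) (use M0 in auto)
   then show ?thesis using True by (simp add: F'_def power2_eq_square)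
  qed (simp add: F_def F'_def w(4))
  note i = bbs_integrable[OF bE] bbs_integrable[OF bI] bbs_integrable[OF bbs_mult[OF bw bP]] bbs_integrable[OF bbs_shift[OF bbs_mult[OF bw bP], of z]]
   bbs_integrable[OF bbs_mult[OF bP bbs_shift[OF bw, of z]]] bbs_integrable[OF bbs_mult[OF bw bbs_shift[OF bP, of z]]]
  have iF: "integrable lborel F" unfolding F_def by (intro bbs_integrable bbs_intros bw bbs_test[OF t])
  \<comment> \<open>A discrete product rule. The first term is the one Caccioppoli's inequality
    keeps, with the difference of \<open>ph\<close>; the bracket integrates to minus the pairing of
    \<open>P\<close> with the second difference of \<open>w\<close> in direction
    \<open>z\<close>.\<close>
  have "(g x - g (z + x))^2 = F x + (w x * P x + w (z + x) * P (z + x) - P x * w (z + x) - w x * P (z + x))" for x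
   unfolding Pw g_def F_def by (simp add: power2_eq_square algebra_simps)
  then have "S z = (LBINT x. F x) + (A + (LBINT x. w (z + x) * P (z + x)) - a z - (LBINT x. w x * P (z + x)))"
   unfolding S_def A_def a_def using iF i(3-6) by simp
  also have "(LBINT x. w (z + x) * P (z + x)) = A" unfolding A_def by (rule lborel_integral_shift)
  also have "(LBINT x. w x * P (z + x)) = a (- z)"
   using lborel_integral_shift[of "%x. P x * w (- z + x)" z] by (simp add: a_def mult.commute)
  also have "(LBINT x. F x) <= (LBINT x. F' x)"
   by (rule integral_mono[OF iF _ Fb]) (use i(1,2) in \<open>simp add: F'_def\<close>)
  also have "... = M^2 * (2 * (norm z)^2 * E + 2 * K^2 * (norm z) ^ 4 * vol)" using i(1,2) by (simp add: F'_def E_def vol_def)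
  finally show ?thesis by simp
 qed
 have vol0: "vol >= 0" unfolding vol_def by simp
 have main: "(LBINT x. (g x)^2) <= 8 * R^2 * M^2 * (2 * E + 2 * K^2 * s^2 * vol)" (is "?G <= ?C") if s: "0 < s" "s <= s0" "s <= R" for s
 proof -
  define io where "io = (indicator (cball 0 s) :: 'a => real)"
  have bi: "bbs io" unfolding io_def by (rule bbs_indicator) auto
  note ii = bbs_integrable[OF bi]
  define J where "J = (LBINT z. io z * (norm z)^2)"
  have iJ: "integrable lborel (%z. io z * (norm z)^2)"
   by (intro bbs_integrable bbs_mult_continuous[OF bi] continuous_intros)
  have "J ~= 0"
  proof
   assume "J = 0"
   then have "AE z in lborel. io z * (norm z)^2 = 0"
    unfolding J_def by (subst (asm) integral_nonneg_eq_0_iff_AE[OF iJ]) (auto simp: io_def)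
   then have "AE z in (lborel :: 'a measure). z \<in> ball 0 s --> (norm z)^2 = 0" by (rule eventually_mono) (auto simp: io_def)
   moreover obtain v :: 'a where v: "norm v = s / 2" using vector_choose_size[of "s / 2"] s by auto
   ultimately have "(norm v)^2 = 0" using s(1)
    by (intro AE_eq_continuous[OF open_ball[of 0 s], where f = "%z. (norm z)^2" and g = "%z. 0"]) (auto intro!: continuous_intros)
   then show False using v s by simp
  qed
  then have J0: "J > 0" unfolding J_def less_le by (simp add: io_def)
  note sw = integral_swap_kernel[OF ii bbs_integrable[OF bP], of "%z x. w (z + x)" M, folded a_def]
  have ia: "integrable lborel (%z. io z * a z)" by (rule sw(1)) (use w(1) wM in measurable)
  have refl: "io z * a (- z) = io (0 - z) * a (0 - z)" for z by (simp add: io_def indicator_def)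
  have rm: "(%z. 0 - z) \<in> measurable lborel (borel :: 'a measure)" by simp
  have ia0: "(%z. io z * a z) \<in> borel_measurable borel" using borel_measurable_integrable[OF ia] by simp
  have ia': "integrable lborel (%z. io z * a (- z))"
   using ia integrable_distr_eq[OF rm ia0] unfolding refl lborel_reflect by simp
  have ie: "(LBINT z. io z * a (- z)) = (LBINT z. io z * a z)"
   using integral_distr[OF rm ia0] unfolding refl lborel_reflect by simp
  \<comment> \<open>Averaged over the ball, the second-difference term has the favourable sign:
    \<open>P\<close> is nonnegative, and the sub-mean-value property holds wherever \<open>P\<close>
    is nonzero.\<close>
  have mean: "(LBINT z. io z) * A <= (LBINT z. io z * a z)"
  proof -
   have "(LBINT z. io z) * A = (LBINT x. (LBINT z. io z) * (w x * P x))" by (simp add: A_def)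
   also have "... <= (LBINT x. P x * (LBINT z. io z * w (z + x)))"
   proof (rule integral_mono)
    show "integrable lborel (%x. (LBINT z. io z) * (w x * P x))" by (rule bbs_integrable[OF bbs_cmult[OF bbs_mult[OF bw bP]]])
    show "integrable lborel (%x. P x * (LBINT z. io z * w (z + x)))"
     by (rule integral_swap_kernel(1)[OF bbs_integrable[OF bP] ii, of _ M]) (use w(1) wM in measurable)
    show "(LBINT z. io z) * (w x * P x) <= P x * (LBINT z. io z * w (z + x))" for x
     using mult_left_mono[OF sub[OF _ s(1,2), of x] P0[of x]] by (cases "P x = 0") (auto simp: Pw io_def mult_ac)
   qed
   also have "... = (LBINT z. io z * a z)" by (rule sw(2)[symmetric]) (use w(1) wM in measurable)
   finally show ?thesis .
  qed
  have pw: "io z * (norm z)^2 * ?G <= io z * (norm z)^2 * ?C + 8 * R^2 * (io z * (2 * A) - io z * a z - io z * a (- z))" if z: "z ~= 0" for z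
  proof (cases "norm z <= s")
   case True
   have "(norm z)^2 * ?G <= 8 * R^2 * S z" unfolding S_def
   proof (rule discrete_Poincare[OF bg _ D(3) z])
    show "g x = 0" if "R < norm x" for x using w(4)[of x] subsetD[OF D(2), of x] that by (auto simp: g_def)
   qed (use True s in simp)
   also have "... <= 8 * R^2 * (M^2 * ((norm z)^2 * (2 * E + 2 * K^2 * s^2 * vol)) + (2 * A - a z - a (- z)))"
   proof (intro mult_left_mono order_trans[OF Sle] add_right_mono)
    have "(norm z) ^ 4 <= (norm z)^2 * s^2"
     using mult_left_mono[OF power_mono[OF True norm_ge_zero, of 2] zero_le_power2[of "norm z"]] by (simp flip: power_add)
    then have "2 * K^2 * vol * (norm z) ^ 4 <= 2 * K^2 * vol * ((norm z)^2 * s^2)" using vol0 by (intro mult_left_mono) auto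
    then show "2 * (norm z)^2 * E + 2 * K^2 * (norm z) ^ 4 * vol <= (norm z)^2 * (2 * E + 2 * K^2 * s^2 * vol)"
     by (simp add: algebra_simps)
   qed auto
   finally show ?thesis using True by (simp add: io_def algebra_simps)
  qed (simp add: io_def)
  have "(LBINT z. io z * (norm z)^2 * ?G) <= (LBINT z. io z * (norm z)^2 * ?C + 8 * R^2 * (io z * (2 * A) - io z * a z - io z * a (- z)))"
  proof (rule integral_mono_AE)
   show "AE z in lborel. io z * (norm z)^2 * ?G <= io z * (norm z)^2 * ?C + 8 * R^2 * (io z * (2 * A) - io z * a z - io z * a (- z))"
    using AE_lborel_singleton[of "0::'a"] by eventually_elim (rule pw)
  qed (use iJ ii ia ia' in \<open>auto intro!: integrable_mult_left integrable_mult_right integrable_add integrable_diff\<close>)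
  also have "... = J * ?C + 8 * R^2 * (2 * ((LBINT z. io z) * A - (LBINT z. io z * a z)))"
   using iJ ii ia ia' by (simp add: J_def ie)
  also have "... <= J * ?C" using mean by (simp add: mult_le_0_iff)
  finally show ?thesis using J0 by (simp add: J_def[symmetric])
 qed
 \<comment> \<open>Letting the radius tend to 0 removes the Taylor error of \<open>ph\<close>, whose
   constant \<open>K\<close> is not controlled by the energy.\<close>
 have "(LBINT x. (g x)^2) <= 8 * R^2 * M^2 * (2 * E + 2 * K^2 * 0^2 * vol)"
 proof (rule tendsto_lowerbound)
  show "((%s. 8 * R^2 * M^2 * (2 * E + 2 * K^2 * s^2 * vol)) \<longlongrightarrow> 8 * R^2 * M^2 * (2 * E + 2 * K^2 * 0^2 * vol)) (at_right 0)"
   by (intro tendsto_intros)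
  show "\<forall>\<^sub>F s in at_right 0. (LBINT x. (g x)^2) <= 8 * R^2 * M^2 * (2 * E + 2 * K^2 * s^2 * vol)"
   unfolding eventually_at_right_field by (intro exI[of _ "min s0 R"]) (use s0 D(3) main in auto)
 qed simp
 then show ?thesis by (simp add: g_def E_def)
qed

text \<open>Hypothesis \<open>appr\<close> is membership of \<open>q\<close> in H^1_0, stated with
  classical gradients since \<open>q\<close> is smooth. If \<open>q p\<close> were nonzero, every
  \<open>V\<close> in the upper class for the data \<open>f\<close> would be at least
  \<open>1 - de\<close> on \<open>D\<close>, although \<open>f p = 0\<close>.\<close>

lemma regular_boundary_zero:
 fixes D :: "'a::euclidean_space set" and q :: "'a => real"
 assumes D: "open D" "bounded D" and reg: "regular_boundary_point D p" and sq: "smooth_on UNIV q"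
  and appr: "!!e. e > 0 ==> \<exists>ps. test_fun D ps \<and>
   (LBINT x. indicator D x * ((ps x - q x)^2 + (norm (grad_of ps x - grad_of q x))^2)) < e"
 shows "q p = 0"
proof (rule ccontr)
 assume qp: "q p ~= 0"
 have Db: "D \<in> sets borel" using D(1) by simp
 have "open {x. q x ~= 0}" by (intro open_Collect_neq smooth_on_continuous[OF sq] continuous_on_const)
 then obtain r0 where r0: "r0 > 0" "ball p r0 \<subseteq> {x. q x ~= 0}" using qp open_contains_ball by blast
 define r where "r = r0 / 2"
 have r: "r > 0" "cball p r \<subseteq> ball p r0" using r0(1) by (auto simp: r_def)
 obtain et Wn where et: "test_fun (ball p r0) et" "open Wn" "cball p r \<subseteq> Wn" "!!x. x \<in> Wn ==> et x = 1"
  using exists_cutoff[OF compact_cball open_ball r(2)] by blast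
 \<comment> \<open>Only 1/q near \<open>p\<close> is wanted; the cutoff \<open>et\<close> is 1
   around \<open>cball p r\<close>, and beyond that ball \<open>f\<close> is already 1.\<close>
 define te where "te x = inverse (q x) * et x" for x
 have tte: "test_fun UNIV te" unfolding te_def by (rule test_mono[OF test_mult_local[OF et(1) open_ball]])
   (use r0 smooth_on_mono[OF sq] in \<open>auto intro!: smooth_on_inverse\<close>)
 obtain R where R: "R > 0" "D \<subseteq> cball 0 R"
  using bounded_subset_ballD[OF D(2), of 0] ball_subset_cball by (metis subset_trans)
 obtain B where B: "!!x. \<bar>te x\<bar> <= B" using test_bounded[OF tte] by blast
 obtain G where G: "G >= 0" "!!x. norm (grad_of te x) <= G" using grad_of_bounded[OF tte] by blast
 define f where "f y = min 1 (dist y p / r)" for y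
 have low: "1 - de <= V x" if V: "V \<in> perron_upper_class D f" and de: "0 < de" "de < 1" and x: "x \<in> D" for V de x
 proof -
  have Vs: "superharmonic_on D V" and Vb: "bdd_below (V ` D)"
   and Vf: "!!y e. y \<in> frontier D ==> e > 0 ==> \<exists>d>0. \<forall>x\<in>D \<inter> ball y d. f y - e <= V x"
   using V unfolding perron_upper_class_def by auto
  \<comment> \<open>The amount by which \<open>V\<close> falls short of \<open>1 - de\<close>.
    Superharmonicity of \<open>V\<close> gives it the sub-mean-value property at points where it is
    positive; the aim is to show that it vanishes.\<close>
  define w where "w x = (if x \<in> D then max 0 (1 - de - V x) else 0)" for x
  obtain b where b: "!!x. x \<in> D ==> b <= V x" using Vb unfolding bdd_below_def by auto
  define M where "M = 1 + \<bar>b\<bar>"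
  have w0: "w x >= 0" and wM: "w x <= M" and wD: "x \<notin> D ==> w x = 0" for x
   using b[of x] de by (auto simp: w_def M_def)
  have wm: "w \<in> borel_measurable borel"
  proof (rule borel_measurableI_less)
   fix y :: real
   have "open {x \<in> D. V x > c}" for c unfolding open_contains_ball
   proof
    fix x assume x: "x \<in> {x \<in> D. V x > c}"
    then have "V x - c > 0" by simp
    then obtain d where d: "d > 0" "!!y. y \<in> D \<inter> ball x d ==> V x - (V x - c) < V y"
     using Vs x unfolding superharmonic_on_def by blast
    obtain d' where "d' > 0" "ball x d' \<subseteq> D" using x D(1) open_contains_ball by blast
    then show "\<exists>e>0. ball x e \<subseteq> {x \<in> D. V x > c}" using d by (intro exI[of _ "min d d'"]) (auto simp: subset_iff)
   qed
   then have "- D \<union> {x \<in> D. V x > 1 - de - y} \<in> sets borel" using D(1) by (intro sets.Un) auto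
   moreover have "{x \<in> space borel. w x < y} = (if y <= 0 then {} else - D \<union> {x \<in> D. V x > 1 - de - y})"
    by (auto simp: w_def not_less split: if_splits)
   ultimately show "{x \<in> space borel. w x < y} \<in> sets borel" by simp
  qed
  have "\<bar>w x\<bar> <= M" for x using w0[of x] wM[of x] by linarith
  then have bw: "bbs w" by (rule bbsI[OF wm _ D(2) wD])
  have shift: "(LBINT z. indicator (cball (0::'a) s) z * u (z + x)) = (LBINT z. indicator (cball x s) z * u z)" for s x and u :: "'a => real"
  proof -
   have "indicator (cball (0::'a) s) z * u (z + x) = indicator (cball x s) (x + z) * u (x + z)" for z
    by (simp add: indicator_def dist_norm add.commute)
   then show ?thesis using lborel_integral_shift[of "%z. indicator (cball x s) z * u z" x] by simp
  qed
  have sub: "(LBINT z. indicator (cball (0::'a) s) z) * w x <= (LBINT z. indicator (cball 0 s) z * w (z + x))"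
   if x: "w x ~= 0" and s: "s > 0" "cball x s \<subseteq> D" for x s
  proof -
   let ?L = "lebesgue_on (cball x s)"
   note fm = Lebesgue_Measure.finite_measure_lebesgue_on[OF lmeasurable_cball, of x s]
   have VI: "integrable ?L V" "(LINT y|?L. V y) <= measure lebesgue (cball x s) * V x"
    using Vs s unfolding superharmonic_on_def by blast+
   define m where "m = measure lebesgue (cball x s)"
   have mL: "measure ?L (space ?L) = m" unfolding m_def by (simp add: measure_restrict_space)
   have "(LBINT z. indicator (cball (0::'a) s) z) * w x = (1 - de) * m - m * V x"
    using shift[of s "%_. 1" x] x by (auto simp: m_def w_def algebra_simps split: if_splits)
   also have "... <= (1 - de) * m - (LINT y|?L. V y)" using VI(2) by (simp add: m_def)
   also have "... = (LINT y|?L. (1 - de) - V y)"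
    using VI(1) finite_measure.integrable_const[OF fm, of "1 - de"] mL by (simp add: mult.commute)
   also have "... <= (LINT y|?L. w y)"
   proof (rule integral_mono)
    show "integrable ?L (%y. (1 - de) - V y)" using VI(1) finite_measure.integrable_const[OF fm] by (intro integrable_diff)
    show "integrable ?L w"
     using bbs_integrable[OF bbs_mult[OF bbs_indicator[OF _ bounded_cball] bw]] by (simp add: lebesgue_on_borel(1)[OF _ wm])
    show "1 - de - V y <= w y" if "y \<in> space ?L" for y using that s(2) by (auto simp: w_def)
   qed
   finally show ?thesis unfolding shift by (simp add: lebesgue_on_borel(2)[OF _ wm])
  qed
  define k where "k = (32 * R^2 * M^2 + 2 * M^2) * (3 * B^2 + 2 * G^2)"
  have k0: "k >= 0" by (simp add: k_def)
  have w2: "(LBINT x. (w x)^2) <= k * e" if e: "e > 0" for e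
  proof -
   obtain ps where ps: "test_fun D ps"
    "(LBINT x. indicator D x * ((ps x - q x)^2 + (norm (grad_of ps x - grad_of q x))^2)) < e" using appr[OF e] by blast
   note sps = test_smooth[OF ps(1)]
   define u where "u x = q x - ps x" for x
   have su: "smooth_on UNIV u" unfolding u_def by (intro smooth_intros open_UNIV sq sps)
   \<comment> \<open>\<open>u = q - ps\<close> has energy below \<open>e\<close> and equals
     \<open>q\<close> off the support of \<open>ps\<close>. Hence \<open>ph\<close> is 1 near
     \<open>p\<close> off that support, while its energy is of order \<open>e\<close>.\<close>
   define ph where "ph x = u x * te x" for x
   have tph: "test_fun UNIV ph" unfolding ph_def by (rule test_fun_mult[OF tte su])
   have gu: "grad_of u x = grad_of q x - grad_of ps x" for x
    unfolding grad_of_pd u_def smooth_pd_diff[OF sq sps] by (simp add: scaleR_diff_left sum_subtractf)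
   define H where "H v x = indicator D x * ((v x)^2 + (norm (grad_of v x))^2)" for v and x :: 'a
   have bH: "bbs (H v)" if "smooth_on UNIV v" for v unfolding H_def grad_of_pd
    by (intro bbs_continuous_on Db D(2) continuous_intros smooth_on_continuous smooth_on_pd that)
   have "(LBINT x. H u x) < e"
    using ps(2) unfolding H_def gu by (simp add: u_def power2_commute[of "q _"] norm_minus_commute[of "grad_of q _"])
   moreover have "H ph x <= (3 * B^2 + 2 * G^2) * H u x" for x
   proof -
    have "grad_of ph x = u x *\<^sub>R grad_of te x + te x *\<^sub>R grad_of u x" unfolding ph_def
     by (intro grad_of_mult smooth_on_differentiable[OF su] test_differentiable[OF tte]) simp
    then have "norm (grad_of ph x) <= \<bar>u x\<bar> * norm (grad_of te x) + \<bar>te x\<bar> * norm (grad_of u x)"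
     using norm_triangle_ineq[of "u x *\<^sub>R grad_of te x" "te x *\<^sub>R grad_of u x"] by simp
    also have "... <= G * \<bar>u x\<bar> + B * norm (grad_of u x)"
     using mult_left_mono[OF G(2)[of x] abs_ge_zero[of "u x"]] mult_right_mono[OF B[of x] norm_ge_zero[of "grad_of u x"]] by (simp add: mult.commute)
    finally have "(norm (grad_of ph x))^2 <= (G * \<bar>u x\<bar> + B * norm (grad_of u x))^2" by (intro power_mono) auto
    also have "... <= 2 * G^2 * (u x)^2 + 2 * B^2 * (norm (grad_of u x))^2"
     using sum_squares_bound[of "G * \<bar>u x\<bar>" "B * norm (grad_of u x)"] by (simp add: power2_sum power_mult_distrib)
    finally have 1: "(norm (grad_of ph x))^2 <= 2 * G^2 * (u x)^2 + 2 * B^2 * (norm (grad_of u x))^2" .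
    have "(te x)^2 <= B^2" using power_mono[OF B[of x] abs_ge_zero, of 2] by simp
    then have "(ph x)^2 <= B^2 * (u x)^2" unfolding ph_def power_mult_distrib by (simp add: mult.commute mult_right_mono)
    moreover have "0 <= 2 * B^2 * (u x)^2 + B^2 * (norm (grad_of u x))^2 + 2 * G^2 * (norm (grad_of u x))^2" by simp
    ultimately have "(ph x)^2 + (norm (grad_of ph x))^2 <= (3 * B^2 + 2 * G^2) * ((u x)^2 + (norm (grad_of u x))^2)"
     using 1 unfolding distrib_left distrib_right by linarith
    then show ?thesis by (simp add: H_def indicator_def)
   qed
   then have "(LBINT x. H ph x) <= (LBINT x. (3 * B^2 + 2 * G^2) * H u x)"
    by (intro integral_mono bbs_integrable bbs_cmult bH su test_smooth[OF tph])
   ultimately have He: "(LBINT x. H ph x) <= (3 * B^2 + 2 * G^2) * e"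
    using mult_left_mono[of "LBINT x. H u x" e "3 * B^2 + 2 * G^2"] by simp
   define T where "T = {x. w x * (1 - ph x) ~= 0}"
   have TD: "T \<subseteq> D" using wD by (auto simp: T_def)
   \<comment> \<open>Near the boundary \<open>w * (1 - ph)\<close> vanishes for one of two reasons:
     around \<open>cball p r\<close> because \<open>ph\<close> is 1 off the support of
     \<open>ps\<close>, elsewhere because \<open>f\<close> is 1 and so \<open>V\<close> is at least
     \<open>1 - de\<close>. Compactness then gives a uniform radius \<open>s0\<close> for the mean
     values.\<close>
   have "closure T \<subseteq> D"
   proof (rule subsetI, rule ccontr)
    fix y assume y: "y \<in> closure T" and yD: "y \<notin> D"
    have yf: "y \<in> frontier D" using y yD closure_mono[OF TD] D(1) by (auto simp: frontier_def interior_open)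
    show False
    proof (cases "y \<in> cball p r")
     case True
     have oO: "open (Wn - tsupp ps)" using et(2) by (intro open_Diff) auto
     have "y \<in> Wn - tsupp ps" using True et(3) yD ps(1) by (auto simp: test_fun_iff)
     then have "(Wn - tsupp ps) \<inter> T ~= {}" using y open_Int_closure_eq_empty[OF oO, of T] by blast
     then obtain z where z: "z \<in> Wn" "z \<notin> tsupp ps" "z \<in> T" by blast
     have "et z = 1" using z(1) et(4) by simp
     moreover then have "z \<in> ball p r0" using test_zero_outside[OF et(1), of z] by fastforce
     then have "q z ~= 0" using r0(2) by blast
     ultimately have "ph z = 1" using not_in_tsupp[OF z(2)] by (simp add: ph_def u_def te_def)
     then show False using z(3) by (simp add: T_def)
    next
     case False
     then have "f y = 1" using r(1) by (simp add: f_def dist_commute min_def field_simps)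
     then obtain d where d: "d > 0" "!!x. x \<in> D \<inter> ball y d ==> 1 - de <= V x" using Vf[OF yf de(1)] by auto
     obtain z where z: "z \<in> T" "z \<in> ball y d" using y d(1) closure_approachable[of y T] by (auto simp: dist_commute)
     have "V z >= 1 - de" using d(2) z TD by blast
     then show False using z(1) by (auto simp: T_def w_def split: if_splits)
    qed
   qed
   then obtain s0 where s0: "s0 > 0" "(\<Union>x\<in>closure T. cball x s0) \<subseteq> D"
    using compact_subset_open_imp_cball_epsilon_subset[OF _ D(1), of "closure T"] bounded_subset[OF D(2) TD] by (auto simp: compact_closure)
   have en: "(LBINT x. (w x - w x * ph x)^2) <= 16 * R^2 * M^2 * (LBINT x. indicator D x * (norm (grad_of ph x))^2)"
   proof (rule subharmonic_energy[OF D(1) R(2,1) wm w0 wM wD tph s0(1)])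
    fix x s assume x: "w x * (1 - ph x) ~= 0" and s: "0 < s" "s <= s0"
    have "x \<in> closure T" using x closure_subset[of T] by (auto simp: T_def)
    then have "cball x s \<subseteq> D" using s0(2) s(2) by (force simp: subset_iff)
    then show "(LBINT z. indicator (cball (0::'a) s) z) * w x <= (LBINT z. indicator (cball 0 s) z * w (z + x))"
     using sub[of x s] x s(1) by auto
   qed
   note cph = smooth_on_continuous[OF test_smooth[OF tph]]
   have bg: "bbs (%x. indicator D x * (norm (grad_of ph x))^2)" unfolding grad_of_pd
    by (intro bbs_continuous_on Db D(2) continuous_intros smooth_on_continuous smooth_on_pd test_smooth[OF tph])
   have bf: "bbs (%x. indicator D x * (ph x)^2)" by (intro bbs_continuous_on Db D(2) continuous_intros cph)
   have bh: "bbs (%x. (w x - w x * ph x)^2)" by (intro bbs_intros bw bbs_test[OF tph])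
   have "(LBINT x. (w x)^2) <= (LBINT x. 2 * (w x - w x * ph x)^2 + 2 * M^2 * (indicator D x * (ph x)^2))"
   proof (rule integral_mono)
    show "integrable lborel (%x. 2 * (w x - w x * ph x)^2 + 2 * M^2 * (indicator D x * (ph x)^2))"
     by (intro bbs_integrable bbs_add bbs_cmult bh bf)
    show "(w x)^2 <= 2 * (w x - w x * ph x)^2 + 2 * M^2 * (indicator D x * (ph x)^2)" for x
    proof (cases "x \<in> D")
     case True
     have "(w x)^2 <= 2 * (w x - w x * ph x)^2 + 2 * ((w x)^2 * (ph x)^2)"
      using zero_le_power2[of "w x - 2 * (w x * ph x)"] by (simp add: power2_eq_square algebra_simps)
     also have "(w x)^2 * (ph x)^2 <= M^2 * (ph x)^2" using power_mono[OF wM w0, of x 2] by (intro mult_right_mono) auto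
     finally show ?thesis using True by simp
    qed (simp add: wD)
   qed (intro bbs_integrable bbs_power2 bw)
   also have "... = 2 * (LBINT x. (w x - w x * ph x)^2) + 2 * M^2 * (LBINT x. indicator D x * (ph x)^2)"
    using bbs_integrable[OF bh] bbs_integrable[OF bf] by simp
   also have "... <= 32 * R^2 * M^2 * (LBINT x. indicator D x * (norm (grad_of ph x))^2) + 2 * M^2 * (LBINT x. indicator D x * (ph x)^2)"
    using en by linarith
   also have "... <= (32 * R^2 * M^2 + 2 * M^2) * (LBINT x. H ph x)"
   proof -
    have "(LBINT x. H ph x) = (LBINT x. indicator D x * (ph x)^2) + (LBINT x. indicator D x * (norm (grad_of ph x))^2)"
     unfolding H_def distrib_left using bbs_integrable[OF bg] bbs_integrable[OF bf] by simp
    moreover have "(LBINT x. indicator D x * (ph x)^2) >= 0" "(LBINT x. indicator D x * (norm (grad_of ph x))^2) >= 0" by simp_all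
    ultimately show ?thesis by (simp add: algebra_simps)
   qed
   also have "... <= k * e" using mult_left_mono[OF He, of "32 * R^2 * M^2 + 2 * M^2"] by (simp add: k_def mult.assoc)
   finally show ?thesis .
  qed
  have "(LBINT x. (w x)^2) <= 0 + ep" if "ep > 0" for ep
  proof -
   have "(LBINT x. (w x)^2) <= k * (ep / (k + 1))" using w2[of "ep / (k + 1)"] that k0 by simp
   also have "... <= ep" using that k0 by (simp add: field_simps)
   finally show ?thesis by simp
  qed
  then have "(LBINT x. (w x)^2) <= 0" by (rule field_le_epsilon)
  moreover have "(LBINT x. (w x)^2) >= 0" by simp
  ultimately have "(LBINT x. (w x)^2) = 0" by (rule antisym)
  then have "AE x in lborel. (w x)^2 = 0" using integral_nonneg_eq_0_iff_AE[OF bbs_integrable[OF bbs_power2[OF bw]]] by simp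
  then have wAE: "AE x in lborel. w x = 0" by (rule eventually_mono) simp
  \<comment> \<open>From almost everywhere to everywhere: at a point with \<open>w x > 0\<close> the
    sub-mean-value inequality would have right side 0.\<close>
  show "1 - de <= V x"
  proof (rule ccontr)
   assume "\<not> 1 - de <= V x"
   then have wx: "w x > 0" using x by (simp add: w_def)
   obtain s where s: "s > 0" "cball x s \<subseteq> D" using x D(1) open_contains_cball by blast
   have "(LBINT z. indicator (cball (0::'a) s) z) * w x <= (LBINT z. indicator (cball x s) z * w z)"
    using sub[OF _ s] wx unfolding shift by simp
   also have "... = 0" by (rule integral_eq_zero_AE) (use wAE in \<open>rule eventually_mono, simp\<close>)
   finally have "measure lborel (cball (0::'a) s) <= 0" using wx by (simp add: mult_le_0_iff)
   then show False using content_cball_pos[OF s(1), of "0::'a"] by linarith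
  qed
 qed
 have sup1: "superharmonic_on D (%x. 1)" unfolding superharmonic_on_def
 proof (intro conjI ballI allI impI)
  fix x :: 'a and r :: real
  show "integrable (lebesgue_on (cball x r)) (%x. 1 :: real)"
   by (rule finite_measure.integrable_const[OF Lebesgue_Measure.finite_measure_lebesgue_on]) simp
  show "(LINT y|lebesgue_on (cball x r). 1) <= measure lebesgue (cball x r) * 1" by (simp add: measure_restrict_space)
 qed (auto intro: exI[of _ 1])
 have one: "(%x. 1) \<in> perron_upper_class D f"
  unfolding perron_upper_class_def using sup1 by (auto simp: f_def intro!: exI[of _ 1])
 have perron: "perron_solution D f x >= 1 / 2" if "x \<in> D" for x
  unfolding perron_solution_def by (rule cInf_greatest) (use one low[of _ "1 / 2" x] that in auto)
 have "p \<in> frontier D" using reg by (simp add: regular_boundary_point_def)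
 then have "p islimpt D" using D(1) by (auto simp: frontier_def interior_open closure_def)
 then have nb: "at p within D ~= bot" by (simp add: trivial_limit_within)
 have "continuous_on (frontier D) f" unfolding f_def using r(1) by (intro continuous_intros) auto
 then have "(perron_solution D f \<longlongrightarrow> f p) (at p within D)" using reg unfolding regular_boundary_point_def by blast
 then have "1 / 2 <= f p" by (rule tendsto_lowerbound) (use perron nb in \<open>auto simp: eventually_at_filter\<close>)
 then show False by (simp add: f_def)
qed

section \<open>The torsion function\<close>

lemma sqi_continuous:
 fixes f :: "'a::euclidean_space => 'b::euclidean_space"
 assumes D: "open D" "bounded D" and f: "continuous_on UNIV f"
 shows "sqi (lebesgue_on D) f"
proof -
 have c: "continuous_on UNIV (%x. (norm (f x))^2)" by (intro continuous_intros f)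
 have "integrable (lebesgue_on D) (%x. (norm (f x))^2)"
  unfolding lebesgue_on_borel(1)[OF borel_open[OF D(1)] borel_measurable_continuous_onI[OF c]]
  by (rule bbs_integrable[OF bbs_continuous_on[OF borel_open[OF D(1)] D(2) c]])
 then show ?thesis unfolding sqi_def using measurable_lebesgue_onI[OF borel_measurable_continuous_onI[OF f]] by blast
qed

lemma smooth_grad_continuous: "smooth_on UNIV f ==> continuous_on UNIV (grad_of f)"
 unfolding grad_of_pd[abs_def] by (intro continuous_intros smooth_on_continuous smooth_on_pd) auto

lemma weak_grad_eq_grad:
 assumes D: "open D" "bounded D" and wg: "weak_grad D v Ga" and s: "sqi (lebesgue_on D) v" "sqi (lebesgue_on D) Ga"
  and f: "smooth_on UNIV f" and eq: "AE x in lebesgue_on D. v x = f x"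
 shows "AE x in lebesgue_on D. Ga x = grad_of f x"
proof (rule weak_grad_unique[OF D s(2) sqi_continuous[OF D smooth_grad_continuous[OF f]] wg weak_gradI])
 fix ph i assume t: "test_fun D ph" and i: "i \<in> (Basis :: 'a set)"
 note m = measurable_lebesgue_onI[OF borel_measurable_test[OF test_fun_pd[OF t]]]
  and f' = measurable_lebesgue_onI[OF borel_measurable_continuous_onI[OF smooth_on_continuous[OF f]]]
 have "(LINT x|lebesgue_on D. v x * pd i ph x) = (LINT x|lebesgue_on D. f x * pd i ph x)"
  by (rule integral_cong_AE[OF borel_measurable_times[OF sqi_meas[OF s(1)] m] borel_measurable_times[OF f' m]])
   (use eq in \<open>auto elim!: eventually_mono\<close>)
 then show "(LINT x|lebesgue_on D. v x * pd i ph x) = - (LINT x|lebesgue_on D. (grad_of f x \<bullet> i) * ph x)"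
  using weak_gradD[OF smooth_weak_grad[OF D(1) f] t i] by simp
qed

lemma pd_norm_sq: "pd i (%x. (norm (x - c))^2) = (%x. 2 * ((x - c) \<bullet> i))"
 unfolding power2_norm_eq_inner by (rule ext, rule pd_eqI) (auto intro!: derivative_eq_intros simp: inner_commute)

lemma lap_norm_sq: "lap_of (%x::'a::euclidean_space. k * (norm (x - c))^2) x = 2 * k * real DIM('a)"
proof -
 have "pd i (%x. k * (norm (x - c))^2) = (%x. (2 * k) * (x \<bullet> i - c \<bullet> i))" for i
  unfolding smooth_pd_mult[OF smooth_on_const smooth_on_norm_sq] pd_norm_sq by (simp add: inner_diff_left mult_ac)
 moreover have "pd i (%x. (2 * k) * (x \<bullet> i - c \<bullet> i)) x = 2 * k" if "i \<in> Basis" for i x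
  by (rule trans[OF pd_eqI[where D = "%v. 2 * k * (v \<bullet> i)"]]) (use that in \<open>auto intro!: derivative_eq_intros\<close>)
 ultimately show ?thesis unfolding lap_of_pd by (simp add: mult.commute)
qed

lemma smooth_paraboloid: "smooth_on S (%x::'a::euclidean_space. k * (norm (x - c))^2)"
 by (rule smooth_on_mono[OF smooth_on_mult[OF open_UNIV smooth_on_const smooth_on_norm_sq] subset_UNIV])

text \<open>Adding a paraboloid of Laplacian 1 turns the weak solution into a weakly harmonic
  function, to which Weyl's lemma applies. The Borel representative \<open>v0\<close> is introduced
  because that lemma works with \<open>lborel\<close>, whereas \<open>v\<close> is only Lebesgue
  measurable.\<close>

lemma torsion_smooth:
 fixes D :: "'a::euclidean_space set"
 assumes D: "open D" "bounded D" and v: "sqi (lebesgue_on D) v" and Ga: "sqi (lebesgue_on D) Ga" and wg: "weak_grad D v Ga"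
  and eq: "!!ph. test_fun D ph ==> (LINT x|lebesgue_on D. Ga x \<bullet> grad_of ph x) = (LINT x|lebesgue_on D. ph x)"
 shows "\<exists>u. smooth_on D u \<and> (\<forall>x\<in>D. lap_of u x = - 1) \<and> (AE x in lebesgue_on D. v x = u x)"
proof -
 define k where "k = 1 / (2 * real DIM('a))"
 have fin: "finite_measure (lebesgue_on D)" by (rule finite_measure_lebesgue_on[OF D])
 have vi: "integrable (lebesgue_on D) v" by (rule sqi_integrable[OF fin v])
 have vL: "integrable lebesgue (%x. indicator D x *\<^sub>R v x)" using vi D(1) by (subst (asm) integrable_restrict_space) auto
 then obtain g where g: "g \<in> borel_measurable lborel" "AE x in lborel. indicator D x *\<^sub>R v x = g x"
  using completion_ex_borel_measurable_real[of "%x. indicator D x *\<^sub>R v x" lborel] by blast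
 define v0 where "v0 x = g x * indicator D x" for x
 have iDm: "(indicator D :: 'a => real) \<in> borel_measurable borel" using D(1) by simp
 have v0m: "v0 \<in> borel_measurable borel" unfolding v0_def using g(1) iDm by simp
 have v0AE: "AE x in lborel. indicator D x *\<^sub>R v x = v0 x"
  using g(2) by (rule eventually_mono) (auto simp: v0_def indicator_def)
 have v0D: "AE x in lebesgue_on D. v x = v0 x"
  unfolding AE_lebesgue_on_lborel[OF D(1)] using v0AE by (rule eventually_mono) (auto simp: indicator_def)
 have v0L: "integrable lborel v0"
 proof -
  have "AE x in lebesgue. indicator D x *\<^sub>R v x = v0 x" using v0AE by (rule AE_completion)
  then have "integrable lebesgue v0"
   using vL by (subst (asm) integrable_cong_AE[where g = v0]) (use v0m borel_measurable_integrable[OF vL] in \<open>auto simp: measurable_completion\<close>)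
  then show ?thesis using v0m by (simp add: integrable_completion)
 qed
 define p where "p = (%x::'a. k * (norm (x - 0))^2)"
 have sp: "smooth_on UNIV p" unfolding p_def by (rule smooth_paraboloid)
 have lp: "lap_of p x = 1" for x unfolding p_def lap_norm_sq by (simp add: k_def)
 define h where "h x = v0 x + p x * indicator D x" for x
 have ip: "integrable lborel (%x. p x * indicator D x)"
  using bbs_integrable[OF bbs_continuous_on[OF borel_open[OF D(1)] D(2) smooth_on_continuous[OF sp]]] by (simp add: mult.commute)
 have wh: "weakly_harmonic D h" unfolding weakly_harmonic_def
 proof (intro allI impI)
  fix ph assume t: "test_fun D ph"
  have tl: "test_fun D (lap_of ph)" by (rule test_fun_lap[OF t])
  obtain K where K: "!!x. \<bar>lap_of ph x\<bar> <= K" using test_bounded[OF tl] by blast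
  have lm: "lap_of ph \<in> borel_measurable borel" by (rule borel_measurable_test[OF tl])
  have "(LBINT x. h x * lap_of ph x) = (LBINT x. v0 x * lap_of ph x) + (LBINT x. (p x * indicator D x) * lap_of ph x)"
   unfolding h_def distrib_right
   by (rule integral_add; rule integrable_mult_bounded[OF _ _ K]) (use v0L ip lm in auto)
  also have "(LBINT x. (p x * indicator D x) * lap_of ph x) = (LBINT x. p x * lap_of ph x)"
   using test_zero_outside[OF tl] by (intro integral_cong) (auto simp: indicator_def)
  also have "... = (LBINT x. ph x)" unfolding lap_weak[OF t sp] lp by simp
  also have "(LBINT x. v0 x * lap_of ph x) = (LINT x|lebesgue_on D. v0 x * lap_of ph x)"
   by (rule lebesgue_on_integral_lborel[OF D(1) borel_measurable_times[OF v0m lm], symmetric]) (simp add: v0_def)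
  also have "... = (LINT x|lebesgue_on D. v x * lap_of ph x)"
  proof (rule integral_cong_AE)
   show "AE x in lebesgue_on D. v0 x * lap_of ph x = v x * lap_of ph x" using v0D by (rule eventually_mono) simp
  qed (use measurable_lebesgue_onI[OF v0m] measurable_lebesgue_onI[OF lm] sqi_meas[OF v] in \<open>auto intro: borel_measurable_times\<close>)
  also have "... = - (LINT x|lebesgue_on D. Ga x \<bullet> grad_of ph x)" by (rule weak_grad_lap[OF D v Ga wg t])
  also have "(LINT x|lebesgue_on D. Ga x \<bullet> grad_of ph x) = (LINT x|lebesgue_on D. ph x)" by (rule eq[OF t])
  also have "... = (LBINT x. ph x)"
   by (rule lebesgue_on_integral_lborel[OF D(1) borel_measurable_test[OF t]]) (rule test_zero_outside[OF t])
  finally show "(LBINT x. h x * lap_of ph x) = 0" by simp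
 qed
 have ih: "integrable lborel h" unfolding h_def using v0L ip by simp
 have hz: "h y = 0" if "y \<notin> D" for y using that by (simp add: h_def v0_def)
 have "\<exists>V. smooth_on D V \<and> (\<forall>x\<in>D. lap_of V x = 0) \<and> (AE x in lborel. x \<in> D --> V x = h x)"
 proof (rule Weyl[OF D ih D(2) hz wh])
  fix V assume "smooth_on D V" "!!x. x \<in> D ==> lap_of V x = 0" "AE x in lborel. x \<in> D --> V x = h x"
  then show ?thesis by (intro exI[of _ V] conjI ballI)
 qed
 then obtain V where V: "smooth_on D V" "!!x. x \<in> D ==> lap_of V x = 0" "AE x in lborel. x \<in> D --> V x = h x"
  by blast
 define u where "u x = V x - p x" for x
 have sp': "smooth_on D p" by (rule smooth_on_mono[OF sp subset_UNIV])
 have "smooth_on D u" unfolding u_def by (rule smooth_on_diff[OF D(1) V(1) sp'])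
 moreover have "lap_of u x = - 1" if "x \<in> D" for x
  unfolding u_def using lap_diff[OF D(1) that V(1) sp'] V(2)[OF that] lp by simp
 moreover have "AE x in lebesgue_on D. v x = u x" unfolding AE_lebesgue_on_lborel[OF D(1)] using v0AE V(3)
  by eventually_elim (auto simp: u_def h_def)
 ultimately show ?thesis by blast
qed

section \<open>The overdetermined heat problem\<close>

context
 fixes om :: "'a::euclidean_space set"
 assumes dom: "lipschitz_domain om" and N: "DIM('a) >= 2"
  and fin: "integrable surface_measure (indicator (frontier om) :: 'a => real)"
  and pos: "(LINT x|surface_measure. indicator (frontier om) x) ~= (0 :: real)"
begin

lemma surface_test_integrable:
 "test_fun UNIV f ==> integrable surface_measure (%x. indicator (frontier om) x * f x)"
 using test_bounded[of UNIV f] surface_bounded_integrable[OF fin borel_measurable_test] by blast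

text \<open>If the boundary had measure 0 its integral would be 0; so \<open>pos\<close> provides
  the nonzero value that \<open>emeasure_surface\<close> asks for.\<close>

lemma surface_formula:
 assumes "X \<in> sets borel"
 shows "emeasure (surface_measure :: 'a measure) X = hausdorff_outer (real DIM('a) - 1) X"
proof (rule emeasure_surface[OF _ assms])
 show "emeasure (surface_measure :: 'a measure) (frontier om) ~= 0"
 proof
  assume "emeasure (surface_measure :: 'a measure) (frontier om) = 0"
  then have "AE x in surface_measure. indicator (frontier om) x = (0 :: real)"
   by (intro AE_I[of _ _ "frontier om"]) (auto simp: sets_surface_measure indicator_def)
  then have "(LINT x|surface_measure. indicator (frontier om) x) = (0 :: real)" by (rule integral_eq_zero_AE)
  then show False using pos by simp
 qed
qed

text \<open>Every surface ball centred on a Lipschitz boundary has positive measure.\<close>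

lemma zero_on_frontier:
 assumes t: "test_fun UNIV f" and z: "bdry_integral om (%x. f x * f x) = 0" and p: "p \<in> frontier om"
 shows "f p = 0"
proof (rule ccontr)
 assume ne: "f p ~= 0"
 have sB: "sets (surface_measure :: 'a measure) = sets borel" by (rule sets_surface_measure)
 have ow: "open om" using dom by (simp add: lipschitz_domain_def bounded_domain_def)
 have t2: "test_fun UNIV (%x. f x * f x)" by (rule test_fun_mult[OF t test_smooth[OF t]])
 have "AE x in surface_measure. indicator (frontier om) x * (f x * f x) = 0" using z unfolding bdry_integral_def
  by (subst (asm) integral_nonneg_eq_0_iff_AE[OF surface_test_integrable[OF t2]]) auto
 then have ae: "AE x in surface_measure. x \<notin> frontier om \<inter> {x. f x ~= 0}"
  by (rule eventually_mono) auto
 have cf: "continuous_on UNIV f" by (rule test_continuous[OF t])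
 have oE: "open {x. f x ~= 0}" by (intro open_Collect_neq cf continuous_on_const)
 then have mE: "frontier om \<inter> {x. f x ~= 0} \<in> sets borel" by (intro sets.Int borel_closed borel_open) auto
 have e0: "emeasure (surface_measure :: 'a measure) (frontier om \<inter> {x. f x ~= 0}) = 0"
  using AE_iff_null_sets[THEN iffD2, OF _ ae] mE sB by (intro null_setsD1) simp
 obtain r where r: "r > 0" "ball p r \<subseteq> {x. f x ~= 0}" using oE ne open_contains_ball by blast
 obtain e r' h L g where ch: "lip_chart om p e r' h L g" using lip_chart_exists[OF dom p] by blast
 obtain c ro0 where c: "c > 0" "ro0 > 0"
  "!!ro. 0 < ro ==> ro < ro0 ==> ennreal (c * ro ^ (DIM('a) - 1)) <= hausdorff_outer (real DIM('a) - 1) (frontier om \<inter> ball p ro)"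
  using chart_hausdorff_lower[OF ch ow N] by blast
 define ro where "ro = min r (ro0 / 2)"
 have ro: "0 < ro" "ro < ro0" "ro <= r" using r(1) c(2) by (auto simp: ro_def)
 have "ennreal (c * ro ^ (DIM('a) - 1)) <= hausdorff_outer (real DIM('a) - 1) (frontier om \<inter> ball p ro)" by (rule c(3)[OF ro(1,2)])
 also have "... <= hausdorff_outer (real DIM('a) - 1) (frontier om \<inter> {x. f x ~= 0})"
  by (rule hausdorff_outer_mono) (use r(2) ro(3) subset_ball[of ro r p] in blast)
 also have "... = 0" using e0 unfolding surface_formula[OF mE] .
 finally show False using c(1) ro(1) by (simp add: ennreal_eq_0_iff[symmetric] mult_le_0_iff)
qed

end

theorem mainTheorem3:
  fixes \<Omega> \<omega> :: "'a::euclidean_space set"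
    and lam :: "nat \<Rightarrow> real" and phi :: "nat \<Rightarrow> 'a \<Rightarrow> real"
    and U :: "real \<Rightarrow> 'a \<Rightarrow> real"
    and t \<tau> a b :: "nat \<Rightarrow> real"
  assumes "DIM('a) \<ge> 2"
    and "bounded_domain \<Omega>"
    and "\<forall>x\<in>frontier \<Omega>. regular_boundary_point \<Omega> x"
    and "dirichlet_eigenbasis \<Omega> lam phi"
    and "heat_solution \<Omega> lam phi U"
    and "lipschitz_domain \<omega>" and "\<omega> \<noteq> {}" and "closure \<omega> \<subseteq> \<Omega>"
    and "\<forall>n. t n > 0" and "\<forall>n. \<tau> n > 0"
    and "\<forall>n. trace_const \<omega> (U (\<tau> n)) (a n)"
    and "\<forall>n. conormal_const \<omega> (U (t n)) (b n)"
    and "(\<exists>ts>0. ts islimpt range t) \<or> \<not> bdd_above (range t)"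
    and "(\<exists>ts>0. ts islimpt range \<tau>) \<or> \<not> bdd_above (range \<tau>)"
  shows "\<exists>c r R. \<omega> = ball c r \<and> \<Omega> = ball c R"
proof -
 note basis = assms(4) and heat = assms(5) and lip = assms(6)
 have O: "open \<Omega>" "bounded \<Omega>" "connected \<Omega>" using assms(2) by (auto simp: bounded_domain_def)
 have w: "open \<omega>" "bounded \<omega>" "connected \<omega>" "\<omega> ~= {}" using lip by (auto simp: lipschitz_domain_def bounded_domain_def)
 have wO: "\<omega> \<subseteq> \<Omega>" using assms(8) closure_subset by blast
 have "\<forall>k. \<exists>G. H01 \<Omega> (phi k) G \<and> (\<forall>v Gv. H01 \<Omega> v Gv -->
   (LINT x|lebesgue_on \<Omega>. G x \<bullet> Gv x) = lam k * (LINT x|lebesgue_on \<Omega>. phi k x * v x))"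
  using basis by (simp add: dirichlet_eigenbasis_def dirichlet_eigenpair_def)
 then obtain G where G: "!!k. H01 \<Omega> (phi k) (G k)"
  and weq: "!!k v Gv. H01 \<Omega> v Gv ==> (LINT x|lebesgue_on \<Omega>. G k x \<bullet> Gv x) = lam k * (LINT x|lebesgue_on \<Omega>. phi k x * v x)"
  by metis
 interpret M: dirichlet_modes \<Omega> lam phi G by unfold_locales (fact O(1,2) basis G weq)+
 obtain v Ga where tor: "M.torsion v Ga" using M.torsion_exists by blast
 interpret M: heat_modes \<Omega> lam phi G \<omega> U v Ga by unfold_locales (fact w(1) wO heat tor)+
 have H: "H01 \<Omega> v Ga" and tor': "!!ph. test_fun \<Omega> ph ==> (LINT x|lebesgue_on \<Omega>. Ga x \<bullet> grad_of ph x) = (LINT x|lebesgue_on \<Omega>. ph x)"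
  using tor unfolding M.torsion_def by blast+
 note vs = H01_D[OF H]
 obtain u where u: "smooth_on \<Omega> u" "!!x. x \<in> \<Omega> ==> lap_of u x = - 1" "AE x in lebesgue_on \<Omega>. v x = u x"
  using torsion_smooth[OF O(1,2) vs tor'] by blast
 \<comment> \<open>\<open>ze\<close> stands for the constant 1 on \<open>\<omega>\<close> as a test
   function: its boundary integral is the surface area and its conormal expression is minus the
   volume.\<close>
 obtain ze Wn where z: "test_fun \<Omega> ze" "open Wn" "closure \<omega> \<subseteq> Wn" "!!x. x \<in> Wn ==> ze x = 1"
  using exists_cutoff[OF _ O(1) assms(8)] w(2) by (auto simp: compact_closure)
 have tz: "test_fun UNIV ze" by (rule test_mono[OF z(1)]) simp
 have z1: "ze x = 1" if "x \<in> closure \<omega>" for x using z(3,4) that by blast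
 have gz: "grad_of ze x = 0" if "x \<in> \<omega>" for x
 proof -
  have "pd i ze x = pd i (%x. 1) x" for i by (rule pd_cong[OF w(1) that]) (use z1 closure_subset in blast)
  then show ?thesis unfolding grad_of_pd by simp
 qed
 define F where "F = frontier \<omega>"
 have z1F: "ze x = 1" if "x \<in> F" for x using that z1 by (simp add: F_def frontier_def)
 define sg0 where "sg0 = bdry_integral \<omega> ze"
 have sg0: "sg0 = (LINT x|surface_measure. indicator F x)" unfolding sg0_def bdry_integral_def F_def[symmetric]
  by (rule integral_cong[OF refl]) (use z1F in \<open>auto simp: indicator_def\<close>)
 define vol where "vol = measure lebesgue \<omega>"
 have lw: "\<omega> \<in> lmeasurable" using w(1,2) by (simp add: lmeasurable_open)
 have vol: "vol > 0"
 proof -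
  have "\<not> negligible \<omega>" using w(1,4) open_not_negligible by blast
  then have "vol ~= 0" unfolding vol_def using lw negligible_iff_measure by blast
  then show ?thesis by (simp add: vol_def less_le)
 qed
 have Lz: "(LINT x|lebesgue_on \<omega>. Ga x \<bullet> grad_of ze x - ze x) = - vol"
 proof -
  have "(LINT x|lebesgue_on \<omega>. Ga x \<bullet> grad_of ze x - ze x) = (LINT x|lebesgue_on \<omega>. - 1)"
   by (rule integral_cong[OF refl]) (use gz z1 closure_subset in \<open>auto simp: subset_iff\<close>)
  then show ?thesis using w(1) by (simp add: vol_def measure_restrict_space)
 qed
 have con1: "(LINT x|lebesgue_on \<omega>. Ga x \<bullet> grad_of ps x - ps x) = 0"
  if "test_fun UNIV ps" "!!n. b n * bdry_integral \<omega> ps = 0" for ps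
  by (rule M.conormal_torsion[where t = t and b = b]) (use assms(9,12,13) that in auto)
 \<comment> \<open>If the boundary integral of \<open>ze\<close> were 0, as a true value or by
   default, \<open>ze\<close> itself would be admissible in \<open>con1\<close> and the volume would
   be 0.\<close>
 have sg0_ne: "sg0 ~= 0"
 proof
  assume "sg0 = 0"
  then have "(LINT x|lebesgue_on \<omega>. Ga x \<bullet> grad_of ze x - ze x) = 0"
   by (intro con1[OF tz]) (simp add: sg0_def)
  then show False using Lz vol by simp
 qed
 have fin: "integrable surface_measure (indicator F :: 'a => real)"
  using sg0_ne not_integrable_integral_eq unfolding sg0 by blast
 note fin' = fin[unfolded F_def] and pos' = sg0_ne[unfolded sg0 F_def]
 note sti = surface_test_integrable[OF lip assms(1) fin' pos']
 \<comment> \<open>\<open>- ka\<close> will be the constant weak normal derivative of the torsion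
   function; testing with \<open>ze\<close> forces this value.\<close>
 define ka where "ka = vol / sg0"
 have "sg0 >= 0" unfolding sg0 by (rule integral_nonneg) simp
 then have ka: "ka > 0" using sg0_ne vol by (simp add: ka_def)
 have b_add: "bdry_integral \<omega> (%x. f x - c * g x) = bdry_integral \<omega> f - c * bdry_integral \<omega> g"
  if "test_fun UNIV f" "test_fun UNIV g" for f g :: "'a => real" and c
 proof -
  have "indicator (frontier \<omega>) x * (f x - c * g x) = indicator (frontier \<omega>) x * f x - c * (indicator (frontier \<omega>) x * g x)" for x
   by (simp add: algebra_simps)
  then show ?thesis unfolding bdry_integral_def using sti[OF that(1)] sti[OF that(2)] by simp
 qed
 have sGw: "sqi (lebesgue_on \<omega>) Ga" by (rule sqi_subset(1)[OF w(1) O(1) wO vs(2)])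
 have ci: "integrable (lebesgue_on \<omega>) (%x. Ga x \<bullet> grad_of ps x - ps x)" if "test_fun UNIV ps" for ps
  using sqi_inner[OF sGw test_sqi(2)[OF w(1,2) that]] sqi_integrable[OF finite_measure_lebesgue_on[OF w(1,2)] test_sqi(1)[OF w(1,2) that]]
  by simp
 have g_add: "grad_of (%x. f x - c * g x) x = grad_of f x - c *\<^sub>R grad_of g x" if "test_fun UNIV f" "test_fun UNIV g" for f g :: "'a => real" and c x
 proof -
  note d = test_differentiable[OF that(1)] test_differentiable[OF that(2)]
  have "pd i (%x. f x - c * g x) x = pd i f x - c * pd i g x" for i
   using pd_diff[OF d(1), of "%x. c * g x"] pd_cmult[OF d(2)] d(2) by simp
  then show ?thesis unfolding grad_of_pd by (simp add: scaleR_diff_left sum_subtractf scaleR_sum_right)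
 qed
 have t_add: "test_fun UNIV (%x. f x - c * g x)" if "test_fun UNIV f" "test_fun UNIV g" for f g :: "'a => real" and c
  by (rule test_fun_diff[OF that(1) test_fun_cmult[OF that(2)]])
 \<comment> \<open>Subtracting a multiple of \<open>ze\<close> gives zero boundary mean, so
   \<open>con1\<close> applies, and linearity recovers a general \<open>ps\<close>.\<close>
 have con: "(LINT x|lebesgue_on \<omega>. Ga x \<bullet> grad_of ps x - ps x) = - ka * bdry_integral \<omega> ps" if p: "test_fun UNIV ps" for ps
 proof -
  define c where "c = bdry_integral \<omega> ps / sg0"
  have "(LINT x|lebesgue_on \<omega>. Ga x \<bullet> grad_of (%x. ps x - c * ze x) x - (ps x - c * ze x)) = 0"
  proof (rule con1[OF t_add[OF p tz]])
   have "bdry_integral \<omega> (%x. ps x - c * ze x) = 0"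
    unfolding b_add[OF p tz] sg0_def[symmetric] using sg0_ne by (simp add: c_def)
   then show "b n * bdry_integral \<omega> (%x. ps x - c * ze x) = 0" for n by simp
  qed
  moreover have "Ga x \<bullet> grad_of (%x. ps x - c * ze x) x - (ps x - c * ze x)
   = (Ga x \<bullet> grad_of ps x - ps x) - c * (Ga x \<bullet> grad_of ze x - ze x)" for x
   unfolding g_add[OF p tz] by (simp add: inner_diff_right algebra_simps)
  ultimately have "(LINT x|lebesgue_on \<omega>. Ga x \<bullet> grad_of ps x - ps x) - c * (LINT x|lebesgue_on \<omega>. Ga x \<bullet> grad_of ze x - ze x) = 0"
   using ci[OF p] ci[OF tz] by simp
  then show ?thesis unfolding Lz by (simp add: c_def ka_def mult.commute)
 qed
 \<comment> \<open>A test function that agrees with the torsion function on \<open>\<omega>\<close>;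
   the cutoff removes the behaviour near the boundary of \<open>\<Omega>\<close>.\<close>
 define vz where "vz x = u x * ze x" for x
 have tvz: "test_fun UNIV vz" unfolding vz_def by (rule test_mono[OF test_mult_local[OF z(1) O(1) u(1)]]) simp
 have vz_w: "vz x = u x" if "x \<in> \<omega>" for x using z1 that closure_subset by (auto simp: vz_def)
 have AEv: "AE x in lebesgue_on \<omega>. v x = vz x"
  using u(3) unfolding AE_lebesgue_on_lborel[OF O(1)] AE_lebesgue_on_lborel[OF w(1)]
  by (rule eventually_mono) (use vz_w wO in auto)
 have vw: "sqi (lebesgue_on \<omega>) v" by (rule sqi_subset(1)[OF w(1) O(1) wO vs(1)])
 have AEG: "AE x in lebesgue_on \<omega>. Ga x = grad_of vz x"
  by (rule weak_grad_eq_grad[OF w(1,2) weak_grad_subset[OF w(1) O(1) wO vs(3)] vw sGw test_smooth[OF tvz] AEv])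
 have key: "bdry_integral \<omega> (%x. vz x * te x) = 0" if th: "test_fun UNIV te" "bdry_integral \<omega> te = 0" for te
 proof -
  have tp: "test_fun UNIV (%x. vz x * te x)" by (rule test_fun_mult[OF th(1) test_smooth[OF tvz]])
  have "(LINT x|lebesgue_on \<omega>. v x * (Ga x \<bullet> grad_of te x - te x) + Ga x \<bullet> (te x *\<^sub>R Ga x)) = 0"
   by (rule M.trace_torsion[where t = \<tau> and a = a, OF _ _ _ th fin' con]) (use assms(10,11,14) in auto)
  moreover have "(LINT x|lebesgue_on \<omega>. v x * (Ga x \<bullet> grad_of te x - te x) + Ga x \<bullet> (te x *\<^sub>R Ga x))
   = (LINT x|lebesgue_on \<omega>. Ga x \<bullet> grad_of (%x. vz x * te x) x - vz x * te x)"
  proof (rule integral_cong_AE)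
   have m: "Ga \<in> borel_measurable (lebesgue_on \<omega>)" "v \<in> borel_measurable (lebesgue_on \<omega>)" "grad_of te \<in> borel_measurable (lebesgue_on \<omega>)"
    "te \<in> borel_measurable (lebesgue_on \<omega>)"
    using sqi_meas[OF sGw] sqi_meas[OF vw] measurable_lebesgue_onI[OF grad_of_borel[OF th(1)]] measurable_lebesgue_onI[OF borel_measurable_test[OF th(1)]] .
   then show "(%x. v x * (Ga x \<bullet> grad_of te x - te x) + Ga x \<bullet> (te x *\<^sub>R Ga x)) \<in> borel_measurable (lebesgue_on \<omega>)"
    by (intro borel_measurable_add borel_measurable_times borel_measurable_diff borel_measurable_inner borel_measurable_scaleR)
   show "(%x. Ga x \<bullet> grad_of (%x. vz x * te x) x - vz x * te x) \<in> borel_measurable (lebesgue_on \<omega>)"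
    by (rule borel_measurable_integrable[OF ci[OF tp]])
   show "AE x in lebesgue_on \<omega>. v x * (Ga x \<bullet> grad_of te x - te x) + Ga x \<bullet> (te x *\<^sub>R Ga x)
    = Ga x \<bullet> grad_of (%x. vz x * te x) x - vz x * te x" using AEv AEG
   proof eventually_elim
    fix x assume "v x = vz x" "Ga x = grad_of vz x"
    then show "v x * (Ga x \<bullet> grad_of te x - te x) + Ga x \<bullet> (te x *\<^sub>R Ga x) = Ga x \<bullet> grad_of (%x. vz x * te x) x - vz x * te x"
     unfolding grad_of_mult[OF test_differentiable[OF tvz] test_differentiable[OF th(1)]]
     by (simp add: inner_add_right algebra_simps)
   qed
  qed
  ultimately have "ka * bdry_integral \<omega> (%x. vz x * te x) = 0" using con[OF tp] by simp
  then show ?thesis using ka by simp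
 qed
 \<comment> \<open>The boundary mean of \<open>vz\<close>. Subtracting it gives \<open>W\<close>
   zero boundary mean, so \<open>W\<close> may serve as its own test function in \<open>key\<close>,
   and the boundary integral of W^2 vanishes.\<close>
 define al where "al = bdry_integral \<omega> vz / sg0"
 define W where "W x = vz x - al * ze x" for x
 have tW: "test_fun UNIV W" unfolding W_def by (rule t_add[OF tvz tz])
 have bW: "bdry_integral \<omega> W = 0"
  unfolding W_def b_add[OF tvz tz] using sg0_ne by (simp add: al_def sg0_def)
 have W0: "W p = 0" if p: "p \<in> frontier \<omega>" for p
 proof (rule zero_on_frontier[OF lip assms(1) fin' pos' tW _ p])
  have "bdry_integral \<omega> (%x. W x * W x) = bdry_integral \<omega> (%x. vz x * W x - al * W x)"
   unfolding bdry_integral_def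
   by (rule integral_cong[OF refl]) (use z1F in \<open>auto simp: indicator_def F_def W_def algebra_simps\<close>)
  also have "... = bdry_integral \<omega> (%x. vz x * W x) - al * bdry_integral \<omega> W"
   by (rule b_add[OF test_fun_mult[OF tW test_smooth[OF tvz]] tW])
  also have "... = 0" using key[OF tW bW] bW by simp
  finally show "bdry_integral \<omega> (%x. W x * W x) = 0" .
 qed
 have Ww: "W x = u x - al" if "x \<in> \<omega>" for x using vz_w[OF that] z1 closure_subset that by (auto simp: W_def)
 have lapW: "lap_of W x = - 1" if x: "x \<in> \<omega>" for x
 proof -
  have "lap_of W x = lap_of (%x. u x - al) x" by (rule lap_cong[OF w(1) x Ww])
  also have "... = lap_of u x"
   using lap_diff[OF w(1) x smooth_on_mono[OF u(1) wO] smooth_on_const, of al] by (simp add: lap_of_pd)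
  finally show ?thesis using u(2) x wO by auto
 qed
 have gW: "grad_of W x = grad_of vz x" if "x \<in> \<omega>" for x unfolding W_def g_add[OF tvz tz] gz[OF that] by simp
 have conW: "(LINT x|lebesgue_on \<omega>. ps x - grad_of W x \<bullet> grad_of ps x) = ka * bdry_integral \<omega> ps" if p: "test_fun UNIV ps" for ps
 proof -
  have i: "integrable (lebesgue_on \<omega>) (%x. grad_of W x \<bullet> grad_of ps x)" "integrable (lebesgue_on \<omega>) ps"
   by (rule sqi_inner[OF test_sqi(2)[OF w(1,2) tW] test_sqi(2)[OF w(1,2) p]])
    (rule sqi_integrable[OF finite_measure_lebesgue_on[OF w(1,2)] test_sqi(1)[OF w(1,2) p]])
  have "(LINT x|lebesgue_on \<omega>. Ga x \<bullet> grad_of ps x - ps x) = (LINT x|lebesgue_on \<omega>. grad_of W x \<bullet> grad_of ps x - ps x)"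
  proof (rule integral_cong_AE[OF borel_measurable_integrable[OF ci[OF p]]])
   show "(%x. grad_of W x \<bullet> grad_of ps x - ps x) \<in> borel_measurable (lebesgue_on \<omega>)"
    using i by (intro borel_measurable_integrable integrable_diff)
   show "AE x in lebesgue_on \<omega>. Ga x \<bullet> grad_of ps x - ps x = grad_of W x \<bullet> grad_of ps x - ps x"
    using AEG AE_space by eventually_elim (simp add: gW)
  qed
  then show ?thesis using con[OF p] i by simp
 qed
 note mp = minimum_principle[OF w tW lapW W0]
 obtain be where be: "be > 0" "!!p. p \<in> frontier \<omega> ==> norm (grad_of W p) = be"
  using grad_norm_frontier_const[OF assms(1) lip tW mp W0 ka conW fin' surface_formula[OF lip assms(1) fin' pos']] by blast
 obtain c r A where ball: "0 < r" "\<omega> = ball c r" and WA: "!!x. x \<in> \<omega> ==> W x = A - (norm (x - c))^2 / (2 * real DIM('a))"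
  using serrin_ball[OF w tW lapW W0 be assms(1)] by blast
 \<comment> \<open>On \<open>\<omega>\<close> the torsion function is \<open>W + al\<close>, which
   fixes the constant term.\<close>
 define q where "q x = (A + al) - 1 / (2 * real DIM('a)) * (norm (x - c))^2" for x
 have sq: "smooth_on UNIV q" unfolding q_def by (rule smooth_on_diff[OF open_UNIV smooth_on_const smooth_paraboloid])
 have sqO: "smooth_on \<Omega> q" by (rule smooth_on_mono[OF sq subset_UNIV])
 have lq: "lap_of q x = - 1" for x
  unfolding q_def lap_diff[OF open_UNIV UNIV_I smooth_on_const smooth_paraboloid] lap_norm_sq by (simp add: lap_of_pd)
 have uq: "u x = q x" if "x \<in> \<Omega>" for x
 proof -
  have "u x - q x = 0"
  proof (rule unique_continuation[OF O(1,3) smooth_on_diff[OF O(1) u(1) sqO] _ w(1,4) wO _ that])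
   show "u x - q x = 0" if "x \<in> \<omega>" for x using WA[OF that] Ww[OF that] by (simp add: q_def)
   show "lap_of (%x. u x - q x) x = 0" if "x \<in> \<Omega>" for x
    unfolding lap_diff[OF O(1) that u(1) sqO] u(2)[OF that] lq by simp
  qed
  then show ?thesis by simp
 qed
 have AEq: "AE x in lebesgue_on \<Omega>. v x = q x"
  using u(3) unfolding AE_lebesgue_on_lborel[OF O(1)] by (rule eventually_mono) (use uq in auto)
 have AEgq: "AE x in lebesgue_on \<Omega>. Ga x = grad_of q x" by (rule weak_grad_eq_grad[OF O(1,2) vs(3,1,2) sq AEq])
 have q0: "q p = 0" if p: "p \<in> frontier \<Omega>" for p
 proof (rule regular_boundary_zero[OF O(1,2) assms(3)[rule_format, OF p] sq])
  fix e :: real assume e: "e > 0"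
  obtain ps where ps: "!!m::nat. test_fun \<Omega> (ps m)"
   "(%m. \<integral>x. (ps m x - v x)^2 + (norm (grad_of (ps m) x - Ga x))^2 \<partial>lebesgue_on \<Omega>) \<longlonglongrightarrow> 0"
   using H unfolding H01_def by blast
  have m: "q \<in> borel_measurable borel" "grad_of q \<in> borel_measurable borel"
   by (intro borel_measurable_continuous_onI smooth_on_continuous[OF sq] smooth_grad_continuous[OF sq])+
  have m': "ps m \<in> borel_measurable borel" "grad_of (ps m) \<in> borel_measurable borel" for m
   by (rule borel_measurable_test[OF ps(1)], rule grad_of_borel[OF ps(1)])
  have E1: "(LINT x|lebesgue_on \<Omega>. (ps m x - v x)^2 + (norm (grad_of (ps m) x - Ga x))^2)
   = (LINT x|lebesgue_on \<Omega>. (ps m x - q x)^2 + (norm (grad_of (ps m) x - grad_of q x))^2)" for m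
  proof (rule integral_cong_AE)
   show "AE x in lebesgue_on \<Omega>. (ps m x - v x)^2 + (norm (grad_of (ps m) x - Ga x))^2 = (ps m x - q x)^2 + (norm (grad_of (ps m) x - grad_of q x))^2"
    using AEq AEgq by eventually_elim simp
  qed (use m[THEN measurable_lebesgue_onI] m'[THEN measurable_lebesgue_onI] sqi_meas[OF vs(1)] sqi_meas[OF vs(2)] in measurable)
  have E2: "(LINT x|lebesgue_on \<Omega>. (ps m x - q x)^2 + (norm (grad_of (ps m) x - grad_of q x))^2)
   = (LBINT x. indicator \<Omega> x * ((ps m x - q x)^2 + (norm (grad_of (ps m) x - grad_of q x))^2))" for m
   by (rule lebesgue_on_borel(2)) (use O(1) m m' in measurable)
  show "\<exists>ps. test_fun \<Omega> ps \<and> (LBINT x. indicator \<Omega> x * ((ps x - q x)^2 + (norm (grad_of ps x - grad_of q x))^2)) < e"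
   using eventually_happens'[OF sequentially_bot order_tendstoD(2)[OF ps(2)[unfolded E1 E2] e]] ps(1) by blast
 qed
 have c: "c \<in> \<Omega>" using ball wO by (auto simp: subset_iff)
 have fr: "(norm (p - c))^2 = 2 * real DIM('a) * (A + al)" if "p \<in> frontier \<Omega>" for p
  using q0[OF that] by (simp add: q_def field_simps)
 obtain p where p: "p \<in> frontier \<Omega>" using frontier_not_empty[of \<Omega>] c O(2) not_bounded_UNIV by blast
 then have "p ~= c" using c by (auto simp: frontier_def interior_open[OF O(1)])
 then have "(norm (c - c))^2 < 2 * real DIM('a) * (A + al)" using fr[OF p, symmetric] by simp
 from ball_of_spherical_frontier[OF assms(1) O(1,2) c this fr]
 have "\<Omega> = ball c (sqrt (2 * real DIM('a) * (A + al)))" .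
 then show ?thesis using ball(2) by blast
qed

end
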